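(* Let $\mathcal{D}$ be a probability distribution of $(z,y)\in\mathbb{R}^n\times\mathbb{R}$, let $\lambda>0$, let $\Phi:\mathbb{R}^n\times\mathbb{R}^d\to\mathbb{R}$, $(z,x)\mapsto\Phi(z,x)$, be continuous, and let $G:\mathcal{P}_2(\mathbb{R}^d)\to\mathbb{R}$ be the (real-valued) function $$G(\mu)=\mathbf{E}_{(z,y)\sim\mathcal{D}}\,\ell\Big(y,\int\Phi(z,x)\,d\mu(x)\Big)+\frac\lambda2\int\|x\|^2d\mu(x).$$ Assume that $\ell$ is the square loss $\ell(y,y')=\frac12|y-y'|^2$ or the logistic loss $\ell(y,y')=\log(1+\exp(-yy'))$, that $|\Phi|$ is bounded by $K>0$, and that $\Phi$ is smooth in $x$, uniformly in $z$ (i.e. $x\mapsto\nabla_x\Phi(z,x)$ exists and is Lipschitz continuous with a constant independent of $z$). Then: 1. $G$ admits a first-variation at every $\mu\in\mathcal{P}_2(\mathbb{R}^d)$, given for $x\in\mathbb{R}^d$ by $$V[\mu](x)=\mathbf{E}_{(z,y)\sim\mathcal{D}}\,\ell'\Big(y,\int\Phi(z,x')\,d\mu(x')\Big)\Phi(z,x)+\frac\lambda2\|x\|^2,$$ where $\ell'$ is the derivative of $\ell$ with respect to its second argument; moreover $V[\mu]\in C^1(\mathbb{R}^d)$ and there exists $L>0$ such that $\|\nabla V[\mu](x)-\nabla V[\nu](y)\|\le L(\|x-y\|+W_2(\mu,\nu))$ for all $\mu,\nu\in\mathcal{P}_2(\mathbb{R}^d)$ and all $x,y\in\mathbb{R}^d$.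 2. $G$ is convex for the linear structure, i.e. $G(\alpha\mu+(1-\alpha)\nu)\le\alpha G(\mu)+(1-\alpha)G(\nu)$ for all $\mu,\nu\in\mathcal{P}_2(\mathbb{R}^d)$ and $\alpha\in[0,1]$, and for every $\tau>0$, $F_\tau=G+\tau H$ admits a minimizer over $\mathcal{P}_2^a(\mathbb{R}^d)$. 3. For every $\tau>0$, there exists $\rho_\tau>0$ such that for all $\mu\in\mathcal{P}_2(\mathbb{R}^d)$, $e^{-V[\mu]/\tau}\in L^1(\mathbb{R}^d)$ and the probability measure $\nu\propto e^{-V[\mu]/\tau}$ satisfies $\mathrm{LSI}(\rho_\tau)$, in each of the following cases: - $\ell$ is the logistic loss; then this holds with $\rho_\tau\ge\frac\lambda\tau e^{-2K/\tau}$; - $\ell$ is the square loss and $|\mathbf{E}[y|z]|\le K'$ almost surely for a constant $K'$; then this holds with $\rho_\tau\ge\frac\lambda\tau e^{-2K(K+K')/\tau}$.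
   Context: $\mathcal{P}_2(\mathbb{R}^d)$ (resp. $\mathcal{P}_2^a(\mathbb{R}^d)$) is the set of probability measures (resp. absolutely continuous probability measures) on $\mathbb{R}^d$ with finite second moment. $W_2$ is the 2-Wasserstein distance, $W_2(\mu,\nu)^2=\min_{\gamma\in\Pi(\mu,\nu)}\int\|y-x\|^2d\gamma(x,y)$, with $\Pi(\mu,\nu)$ the set of probability measures on $\mathbb{R}^d\times\mathbb{R}^d$ with marginals $\mu$ and $\nu$. $\|\cdot\|$ is the Euclidean norm. $H(\mu)=\int\log(\frac{d\mu}{dx})\,d\mu$ is the entropy. First-variation: $G$ admits a first-variation at $\mu\in\mathcal{P}_2(\mathbb{R}^d)$ if there is a continuous function $V[\mu]:\mathbb{R}^d\to\mathbb{R}$ such that for all $\nu\in\mathcal{P}_2(\mathbb{R}^d)$, $\lim_{\epsilon\downarrow0}\frac1\epsilon\big(G((1-\epsilon)\mu+\epsilon\nu)-G(\mu)\big)=\int V[\mu]\,d(\nu-\mu)$. It is unique up to an additive constant. Log-Sobolev inequality: $\nu\in\mathcal{P}_2^a(\mathbb{R}^d)$ satisfies $\mathrm{LSI}(\rho)$, $\rho>0$, if for all $\mu\in\mathcal{P}_2^a(\mathbb{R}^d)$ absolutely continuous w.r.t. $\nu$, $H(\mu|\nu)\le\frac1{2\rho}I(\mu|\nu)$, where $H(\mu|\nu)=\int\log(\frac{d\mu}{d\nu})d\mu$ and $I(\mu|\nu)=\int\|\nabla\log\frac{d\mu}{d\nu}\|^2d\mu$.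
   Formalization: For the logistic loss, item 1 is stated under the additional assumption E[y²] < ∞ and item 3 under |y| ≤ 1 almost surely (both hold for labels in {-1,1}); for arbitrary real labels these claims fail. *)

theory Defs
  imports "HOL-Probability.Probability"
begin

definition P2 :: "'a::euclidean_space measure set" where
  "P2 = {\<mu>. prob_space \<mu> \<and> sets \<mu> = sets borel \<and> integrable \<mu> (\<lambda>x. (norm x)\<^sup>2)}"

definition P2a :: "'a::euclidean_space measure set" where
  "P2a = {\<mu> \<in> P2. absolutely_continuous lborel \<mu>}"

text \<open>The set of couplings, and the Wasserstein distance. The infimum is taken in
  \<^typ>\<open>ennreal\<close>; it is finite on \<^const>\<open>P2\<close>.\<close>

definition couplings :: "'a::euclidean_space measure \<Rightarrow> 'a measure \<Rightarrow> ('a \<times> 'a) measure set" where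
  "couplings \<mu> \<nu> = {\<gamma>. prob_space \<gamma> \<and> sets \<gamma> = sets borel \<and>
     distr \<gamma> borel fst = \<mu> \<and> distr \<gamma> borel snd = \<nu>}"

definition W2 :: "'a::euclidean_space measure \<Rightarrow> 'a measure \<Rightarrow> real" where
  "W2 \<mu> \<nu> = sqrt (enn2real (INF \<gamma> \<in> couplings \<mu> \<nu>.
     \<integral>\<^sup>+ p. ennreal ((norm (snd p - fst p))\<^sup>2) \<partial>\<gamma>))"

text \<open>The measure \<open>a \<mu> + b \<nu>\<close> (intended for \<open>a, b \<ge> 0\<close>).\<close>

definition lin_comb ::
  "real \<Rightarrow> 'a::euclidean_space measure \<Rightarrow> real \<Rightarrow> 'a measure \<Rightarrow> 'a measure" where
  "lin_comb a \<mu> b \<nu> = measure_of UNIV (sets borel)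
     (\<lambda>A. ennreal a * emeasure \<mu> A + ennreal b * emeasure \<nu> A)"

definition first_variation_at ::
  "('a::euclidean_space measure \<Rightarrow> real) \<Rightarrow> 'a measure \<Rightarrow> ('a \<Rightarrow> real) \<Rightarrow> bool" where
  "first_variation_at G \<mu> V \<longleftrightarrow> continuous_on UNIV V \<and>
     (\<forall>\<nu>\<in>P2. integrable \<mu> V \<and> integrable \<nu> V \<and>
       ((\<lambda>\<epsilon>. (G (lin_comb (1 - \<epsilon>) \<mu> \<epsilon> \<nu>) - G \<mu>) / \<epsilon>)
          \<longlongrightarrow> (\<integral>x. V x \<partial>\<nu>) - (\<integral>x. V x \<partial>\<mu>)) (at_right 0))"

text \<open>The Bochner integral of a non-integrable function is 0. Entropies may be infinite, so they
  are defined with the extended integral of a function whose positive or negative part is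
  integrable. The entropy on \<^const>\<open>P2a\<close> and the relative entropy are always in this situation,
  with integrable negative part.\<close>

definition ext_integral :: "'a measure \<Rightarrow> ('a \<Rightarrow> real) \<Rightarrow> ereal" where
  "ext_integral M f =
     enn2ereal (\<integral>\<^sup>+ x. ennreal (f x) \<partial>M) - enn2ereal (\<integral>\<^sup>+ x. ennreal (- f x) \<partial>M)"

definition relative_entropy :: "'a measure \<Rightarrow> 'a measure \<Rightarrow> ereal" where
  "relative_entropy \<mu> \<nu> = ext_integral \<mu> (\<lambda>x. ln (enn2real (RN_deriv \<nu> \<mu> x)))"

definition entropy_functional :: "'a::euclidean_space measure \<Rightarrow> ereal" where
  "entropy_functional \<mu> = relative_entropy \<mu> lborel"

text \<open>Weak (distributional) gradient of a locally integrable function, tested against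
  compactly supported \<open>C\<^sup>1\<close> functions.\<close>

definition weak_gradient :: "('a::euclidean_space \<Rightarrow> real) \<Rightarrow> ('a \<Rightarrow> 'a) \<Rightarrow> bool" where
  "weak_gradient f g \<longleftrightarrow>
     (\<forall>C. compact C \<longrightarrow> set_integrable lborel C f \<and> set_integrable lborel C g) \<and>
     (\<forall>\<phi> \<psi>. (\<forall>x. GDERIV \<phi> x :> \<psi> x) \<and> continuous_on UNIV \<psi> \<and> compact (closure {x. \<phi> x \<noteq> 0}) \<longrightarrow>
        (\<integral>x. f x *\<^sub>R \<psi> x \<partial>lborel) = - (\<integral>x. \<phi> x *\<^sub>R g x \<partial>lborel))"

text \<open>Relative Fisher information \<open>\<integral> \<parallel>\<nabla> log f\<parallel>\<^sup>2 d\<mu>\<close> with \<open>f = d\<mu>/d\<nu>\<close>. As usual, \<open>f\<close> is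
  required to be weakly differentiable, \<open>\<nabla> log f\<close> means \<open>\<nabla>f / f\<close> (and \<open>f > 0\<close> holds
  \<open>\<mu>\<close>-almost everywhere), and the value is \<open>\<infinity>\<close> when \<open>f\<close> is not weakly differentiable:
  the infimum ranges over the versions \<open>f\<close> of the density that have a weak gradient \<open>g\<close>, hence
  over the empty set in that case. If \<open>\<nu>\<close> has a positive Lebesgue density,
  then \<open>f\<close> and \<open>g\<close> are unique almost everywhere and the infimum is over at most one value.\<close>

definition relative_fisher :: "'a::euclidean_space measure \<Rightarrow> 'a measure \<Rightarrow> ennreal" where
  "relative_fisher \<mu> \<nu> =
     Inf {\<integral>\<^sup>+ x. ennreal ((norm (g x /\<^sub>R f x))\<^sup>2) \<partial>\<mu> | f g.
       f \<in> borel_measurable borel \<and> (\<forall>x. 0 \<le> f x) \<and> \<mu> = density \<nu> (\<lambda>x. ennreal (f x)) \<and>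
       weak_gradient f g}"

definition LSI :: "real \<Rightarrow> 'a::euclidean_space measure \<Rightarrow> bool" where
  "LSI \<rho> \<nu> \<longleftrightarrow> \<rho> > 0 \<and> \<nu> \<in> P2a \<and>
     (\<forall>\<mu>\<in>P2a. absolutely_continuous \<nu> \<mu> \<longrightarrow>
        relative_entropy \<mu> \<nu> \<le> ereal (1 / (2 * \<rho>)) * enn2ereal (relative_fisher \<mu> \<nu>))"

definition square_loss :: "real \<Rightarrow> real \<Rightarrow> real" where
  "square_loss y y' = 1/2 * \<bar>y - y'\<bar>\<^sup>2"

definition logistic_loss :: "real \<Rightarrow> real \<Rightarrow> real" where
  "logistic_loss y y' = ln (1 + exp (- y * y'))"

definition risk ::
  "('z \<times> real) measure \<Rightarrow> (real \<Rightarrow> real \<Rightarrow> real) \<Rightarrow> real \<Rightarrow> ('z \<Rightarrow> 'a::euclidean_space \<Rightarrow> real)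
    \<Rightarrow> 'a measure \<Rightarrow> real" where
  "risk D loss lam \<Phi> \<mu> =
     (\<integral>(z, y). loss y (\<integral>x. \<Phi> z x \<partial>\<mu>) \<partial>D) + lam / 2 * (\<integral>x. (norm x)\<^sup>2 \<partial>\<mu>)"

definition potential ::
  "('z \<times> real) measure \<Rightarrow> (real \<Rightarrow> real \<Rightarrow> real) \<Rightarrow> real \<Rightarrow> ('z \<Rightarrow> 'a::euclidean_space \<Rightarrow> real)
    \<Rightarrow> 'a measure \<Rightarrow> 'a \<Rightarrow> real" where
  "potential D loss lam \<Phi> \<mu> x =
     (\<integral>(z, y). deriv (loss y) (\<integral>x'. \<Phi> z x' \<partial>\<mu>) * \<Phi> z x \<partial>D) + lam / 2 * (norm x)\<^sup>2"

definition free_energy ::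
  "real \<Rightarrow> ('a::euclidean_space measure \<Rightarrow> real) \<Rightarrow> 'a measure \<Rightarrow> ereal" where
  "free_energy \<tau> G \<mu> = ereal (G \<mu>) + ereal \<tau> * entropy_functional \<mu>"

text \<open>The probability measure proportional to \<open>e\<^bsup>-U\<^esup>\<close>, for integrable \<open>e\<^bsup>-U\<^esup>\<close>.\<close>

definition gibbs :: "('a::euclidean_space \<Rightarrow> real) \<Rightarrow> 'a measure" where
  "gibbs U = density lborel (\<lambda>x. ennreal (exp (- U x) / (\<integral>x'. exp (- U x') \<partial>lborel)))"

text \<open>A version of the conditional expectation \<open>E[y|z]\<close> for \<open>(z, y) \<sim> D\<close>, as a function on the
  whole space that is measurable with respect to the sigma-algebra generated by \<open>z\<close>.\<close>

definition cond_exp_label :: "('z::euclidean_space \<times> real) measure \<Rightarrow> 'z \<times> real \<Rightarrow> real" where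
  "cond_exp_label D = real_cond_exp D (vimage_algebra (space D) fst borel) snd"

end

theory Submission
  imports Defs
begin

text \<open>
The deepest claim is the logarithmic Sobolev inequality. The first variation at \<open>\<mu>\<close> is
\<open>lam/2 * |x|\<^sup>2\<close> plus a function bounded by \<open>k\<close>, where \<open>k\<close> does not depend on \<open>\<mu>\<close>. So the Gibbs
measure has a density with respect to the centred Gaussian measure of variance \<open>s = \<tau>/lam\<close> in each
direction, and this density varies by a factor of at most \<open>exp (2k/\<tau>)\<close>. The entropy of \<open>f\<close> relative
to a measure is the smallest value over \<open>t > 0\<close> of the integral of the nonnegative function
\<open>f ln f - f ln t - f + t\<close>, so replacing the measure by a comparable one costs only the ratio of the
bounds (Holley and Stroock; \<open>LSI_gibbs_bounded_perturbation\<close>). It remains to prove the sharp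
inequality for Gaussian measures, \<open>gaussian_log_sobolev\<close>.

For smooth \<open>F\<close> (\<open>log_sobolev_tame\<close>) a Gaussian variable of variance \<open>s\<close> is written as a sum of \<open>n\<close>
independent ones of variance \<open>h = s/n\<close>. The entropy of \<open>F\<close> is the sum of the mean entropies of the
heat evolutions of \<open>F\<close> over the single increments. Over a short increment the evolved function is
almost affine, and its entropy is at most \<open>h/2 * |\<nabla>F|\<^sup>2/F\<close> up to an error of order \<open>h powr (3/2)\<close>. By
convexity of \<open>|p|\<^sup>2/m\<close> the heat flow does not increase the mean of \<open>|\<nabla>F|\<^sup>2/F\<close>, so the sum is at most
\<open>s/2\<close> times this mean, with a total error of order \<open>sqrt h\<close>. No derivative in time occurs.

A density \<open>f\<close> that is only weakly differentiable is truncated and mollified by the heat semigroup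
itself. The smooth inequality for variance \<open>s - \<delta>\<close> and the function evolved for time \<open>\<delta>\<close> has a
right-hand side that is bounded by the one for \<open>f\<close> and variance \<open>s\<close>, again by convexity, and the
left-hand side is lower semicontinuous as \<open>\<delta>\<close> tends to 0. The convention \<open>|\<nabla>f|\<^sup>2/f = 0\<close> on
\<open>{f = 0}\<close> is harmless because a weak gradient can be replaced by 0 there (\<open>weak_gradient_zero_set\<close>).

The statements on the first variation come from one estimate: for both losses the derivative in the
second argument is Lipschitz with constant \<open>1 + y\<^sup>2\<close>, so that all Taylor remainders are quadratic with
an integrable factor. The dependence on \<open>\<mu>\<close> is controlled by \<open>W2\<close> because predictions are integrals
of a function that is Lipschitz in \<open>x\<close>, which can be compared along any coupling.

A minimiser exists by uniform convexity, without compactness of measures. In terms of the density \<open>f\<close>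
with respect to the same Gaussian measure \<open>\<gamma>\<close>, the quadratic penalty is absorbed and the free energy
becomes, up to a constant, the expected loss plus \<open>\<tau> \<integral> (f ln f - f + 1) d\<gamma>\<close>. The first term is convex
and the second is uniformly convex for the Hellinger distance, so a minimising sequence is Cauchy in
\<open>L\<^sup>1\<close> (\<open>ref_energy_midpoint\<close>), and Fatou's lemma applies to both terms (\<open>ref_energy_minimizer\<close>).
\<close>

section \<open>Differentiating integrals of functions with Lipschitz gradient\<close>

lemma norm_integral_le_integral:
  fixes f :: "'z \<Rightarrow> 'b::{banach, second_countable_topology}"
  assumes "integrable M g" "\<And>z. z \<in> space M \<Longrightarrow> norm (f z) \<le> g z"
  shows "norm (\<integral>z. f z \<partial>M) \<le> (\<integral>z. g z \<partial>M)"
proof -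
  have "norm (\<integral>z. f z \<partial>M) \<le> (\<integral>z. norm (f z) \<partial>M)" by (rule integral_norm_bound)
  also have "\<dots> \<le> (\<integral>z. g z \<partial>M)"
    by (rule integral_mono') (use assms order_trans[OF norm_ge_zero] in auto)
  finally show ?thesis .
qed

text \<open>The mean value theorem along the segment. The constant \<open>L\<close> instead of the optimal \<open>L/2\<close> makes the
proof immediate, and only the order of the remainder matters below.\<close>

lemma gradient_taylor_bound:
  fixes F :: "'a::euclidean_space \<Rightarrow> real"
  assumes F: "\<And>x. GDERIV F x :> G x" and G: "L-lipschitz_on UNIV G"
  shows "\<bar>F (x + v) - F x - v \<bullet> G x\<bar> \<le> L * (norm v)\<^sup>2"
proof -
  have der: "((\<lambda>t. F (x + t *\<^sub>R v)) has_real_derivative v \<bullet> G (x + t *\<^sub>R v)) (at t)" for t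
  proof -
    have "((\<lambda>t. F (x + t *\<^sub>R v)) has_derivative (\<lambda>h. (h *\<^sub>R v) \<bullet> G (x + t *\<^sub>R v))) (at t)"
      by (rule has_derivative_compose[of "\<lambda>t. x + t *\<^sub>R v" _ _ _ F, OF _ F[unfolded gderiv_def]])
         (auto intro!: derivative_eq_intros)
    then show ?thesis
      unfolding has_field_derivative_def by (simp add: mult_commute_abs)
  qed
  obtain t :: real where t: "0 < t" "t < 1" "F (x + 1 *\<^sub>R v) - F (x + 0 *\<^sub>R v) = (1 - 0) * (v \<bullet> G (x + t *\<^sub>R v))"
    using MVT2[of 0 1 "\<lambda>t. F (x + t *\<^sub>R v)" "\<lambda>t. v \<bullet> G (x + t *\<^sub>R v)"] der by auto
  have "\<bar>F (x + v) - F x - v \<bullet> G x\<bar> = \<bar>v \<bullet> (G (x + t *\<^sub>R v) - G x)\<bar>"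
    using t by (simp add: inner_diff_right)
  also have "\<dots> \<le> norm v * norm (G (x + t *\<^sub>R v) - G x)" by (rule Cauchy_Schwarz_ineq2)
  also have "\<dots> \<le> norm v * (L * norm (t *\<^sub>R v))"
    using lipschitz_onD[OF G, of "x + t *\<^sub>R v" x] by (intro mult_left_mono) (auto simp: dist_norm)
  also have "\<dots> = t * (L * (norm v)\<^sup>2)" using t by (simp add: power2_eq_square)
  also have "\<dots> \<le> 1 * (L * (norm v)\<^sup>2)"
    using t lipschitz_on_nonneg[OF G] by (intro mult_right_mono) auto
  finally show ?thesis by simp
qed

lemma GDERIV_if_quadratic_remainder:
  fixes F :: "'a::euclidean_space \<Rightarrow> real"
  assumes "\<And>v. \<bar>F (x + v) - F x - v \<bullet> g\<bar> \<le> C * (norm v)\<^sup>2"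
  shows "GDERIV F x :> g"
  unfolding gderiv_def
proof (rule has_derivativeI_sandwich[of 1])
  show "bounded_linear (\<lambda>h. h \<bullet> g)" by (rule bounded_linear_inner_left)
  show "((\<lambda>y. C * norm (y - x)) \<longlongrightarrow> 0) (at x)"
    by (auto intro!: tendsto_eq_intros)
  fix y assume "y \<noteq> x"
  then show "norm (F y - F x - (y - x) \<bullet> g) / norm (y - x) \<le> C * norm (y - x)"
    using assms[of "y - x"] by (simp add: divide_simps power2_eq_square mult.assoc)
qed auto

text \<open>A quadratic remainder with an integrable factor survives integration, so differentiation under
the integral sign needs no dominated convergence of difference quotients. This is used for the heat
semigroup, for Gaussian mollification and for the potential.\<close>

lemma GDERIV_integral_quadratic:
  fixes F :: "'z \<Rightarrow> 'a::euclidean_space \<Rightarrow> real"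
  assumes "\<And>z v. \<bar>F z (x + v) - F z x - v \<bullet> g z\<bar> \<le> c z * (norm v)\<^sup>2"
    and "integrable M c" "integrable M g" "\<And>x. integrable M (\<lambda>z. F z x)"
  shows "GDERIV (\<lambda>x. \<integral>z. F z x \<partial>M) x :> (\<integral>z. g z \<partial>M)"
proof (rule GDERIV_if_quadratic_remainder[where C = "\<integral>z. c z \<partial>M"])
  fix v
  have "\<bar>(\<integral>z. F z (x + v) \<partial>M) - (\<integral>z. F z x \<partial>M) - v \<bullet> (\<integral>z. g z \<partial>M)\<bar>
      = norm (\<integral>z. F z (x + v) - F z x - v \<bullet> g z \<partial>M)"
    using assms by simp
  also have "\<dots> \<le> (\<integral>z. c z * (norm v)\<^sup>2 \<partial>M)"
    by (rule norm_integral_le_integral)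
       (use assms in \<open>auto intro!: Bochner_Integration.integrable_diff integrable_inner_right\<close>)
  finally show "\<bar>(\<integral>z. F z (x + v) \<partial>M) - (\<integral>z. F z x \<partial>M) - v \<bullet> (\<integral>z. g z \<partial>M)\<bar>
      \<le> (\<integral>z. c z \<partial>M) * (norm v)\<^sup>2" using assms by simp
qed

section \<open>Gaussian measures\<close>

definition gauss :: "real \<Rightarrow> 'a::euclidean_space \<Rightarrow> real" where
  "gauss s x = (\<Prod>b\<in>Basis. normal_density 0 (sqrt s) (x \<bullet> b))"

definition gaussian :: "real \<Rightarrow> 'a::euclidean_space measure" where
  "gaussian s = density lborel (\<lambda>x. ennreal (gauss s x))"

text \<open>Time is normalised such that time and variance coincide, that is, \<open>heat s\<close> is the semigroup with
generator \<open>1/2\<close> times the Laplacian.\<close>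

definition heat :: "real \<Rightarrow> ('a::euclidean_space \<Rightarrow> 'b::euclidean_space) \<Rightarrow> 'a \<Rightarrow> 'b" where
  "heat s f x = (\<integral>y. f (x + y) \<partial>gaussian s)"

lemma gauss_measurable [measurable]: "gauss s \<in> borel_measurable borel"
  unfolding gauss_def[abs_def] by measurable

lemma gauss_nonneg [simp]: "0 \<le> gauss s x"
  by (auto simp: gauss_def intro!: prod_nonneg)

lemma gauss_pos: "0 < s \<Longrightarrow> 0 < gauss s x"
  by (auto simp: gauss_def intro!: prod_pos normal_density_pos)

lemma gauss_eq:
  fixes x :: "'a::euclidean_space"
  assumes "0 < s"
  shows "gauss s x = (1 / sqrt (2 * pi * s)) ^ DIM('a) * exp (- (norm x)\<^sup>2 / (2 * s))"
proof -
  have "gauss s x = (\<Prod>b\<in>(Basis::'a set). (1 / sqrt (2 * pi * s)) * exp (- (x \<bullet> b)\<^sup>2 / (2 * s)))"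
    using assms by (simp add: gauss_def normal_density_def)
  also have "\<dots> = (1 / sqrt (2 * pi * s)) ^ DIM('a) * exp (\<Sum>b\<in>Basis. - (x \<bullet> b)\<^sup>2 / (2 * s))"
    by (simp only: prod.distrib exp_sum[OF finite_Basis] prod_constant)
  also have "(\<Sum>b\<in>Basis. - (x \<bullet> b)\<^sup>2 / (2 * s)) = - (norm x)\<^sup>2 / (2 * s)"
    unfolding power2_norm_eq_inner euclidean_inner[of x x]
    by (simp add: sum_divide_distrib sum_negf power2_eq_square)
  finally show ?thesis .
qed

lemma gauss_minus [simp]: "gauss s (- x) = gauss s x"
  by (auto simp: gauss_def normal_density_def)

lemma sets_gaussian [simp, measurable_cong]: "sets (gaussian s) = sets borel"
  and space_gaussian [simp]: "space (gaussian s) = UNIV"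
  by (simp_all add: gaussian_def)

lemma prob_space_gaussian:
  assumes "0 < s" shows "prob_space (gaussian s :: 'a::euclidean_space measure)"
proof
  have "emeasure (gaussian s) (space (gaussian s) :: 'a set) = (\<integral>\<^sup>+x. (\<Prod>b\<in>Basis. ennreal (normal_density 0 (sqrt s) (x \<bullet> b))) \<partial>(lborel :: 'a measure))"
    by (simp add: gaussian_def emeasure_density gauss_def prod_ennreal)
  also have "\<dots> = (\<Prod>b\<in>(Basis::'a set). (\<integral>\<^sup>+x. ennreal (normal_density 0 (sqrt s) x) \<partial>lborel))"
    by (rule nn_integral_lborel_prod) auto
  also have "(\<integral>\<^sup>+x. ennreal (normal_density 0 (sqrt s) x) \<partial>lborel) = 1"
    using prob_space.emeasure_space_1[OF prob_space_normal_density[of "sqrt s" 0]] assms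
    by (simp add: emeasure_density)
  finally show "emeasure (gaussian s) (space (gaussian s) :: 'a set) = 1" by simp
qed

lemma nn_integral_gaussian:
  "f \<in> borel_measurable borel \<Longrightarrow> (\<integral>\<^sup>+x. f x \<partial>gaussian s) = (\<integral>\<^sup>+x. ennreal (gauss s x) * f x \<partial>lborel)"
  unfolding gaussian_def by (subst nn_integral_density) auto

lemma integral_gaussian:
  fixes f :: "'a::euclidean_space \<Rightarrow> 'b::euclidean_space"
  shows "f \<in> borel_measurable borel \<Longrightarrow> (\<integral>x. f x \<partial>gaussian s) = (\<integral>x. gauss s x *\<^sub>R f x \<partial>lborel)"
  unfolding gaussian_def by (subst integral_density) auto

lemma integrable_gaussian:
  fixes f :: "'a::euclidean_space \<Rightarrow> 'b::euclidean_space"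
  shows "f \<in> borel_measurable borel \<Longrightarrow> integrable (gaussian s) f \<longleftrightarrow> integrable lborel (\<lambda>x. gauss s x *\<^sub>R f x)"
  unfolding gaussian_def by (subst integrable_density) auto

lemma AE_gaussian_iff:
  assumes "0 < s" shows "(AE x in gaussian s. P x) \<longleftrightarrow> (AE x in lborel. P x)"
  using gauss_pos[OF assms] unfolding gaussian_def by (subst AE_density) auto

text \<open>Both densities are products over the coordinates, which reduces the claim to dimension one.\<close>

lemma gauss_convolution:
  fixes u :: "'a::euclidean_space"
  assumes "0 < s" "0 < t"
  shows "(\<integral>\<^sup>+y. ennreal (gauss s (u - y)) * ennreal (gauss t y) \<partial>lborel) = ennreal (gauss (s + t) u)"
proof -
  have "(\<integral>\<^sup>+y. ennreal (gauss s (u - y)) * ennreal (gauss t y) \<partial>lborel)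
     = (\<integral>\<^sup>+y. (\<Prod>b\<in>Basis. ennreal (normal_density 0 (sqrt s) (u \<bullet> b - y \<bullet> b) * normal_density 0 (sqrt t) (y \<bullet> b))) \<partial>lborel)"
    by (simp add: gauss_def prod_ennreal ennreal_mult'[symmetric] prod_nonneg prod.distrib[symmetric] inner_diff_left)
  also have "\<dots> = (\<Prod>b\<in>(Basis::'a set). (\<integral>\<^sup>+y. ennreal (normal_density 0 (sqrt s) (u \<bullet> b - y) * normal_density 0 (sqrt t) y) \<partial>lborel))"
    by (rule nn_integral_lborel_prod) auto
  also have "\<dots> = (\<Prod>b\<in>(Basis::'a set). ennreal (normal_density 0 (sqrt (s + t)) (u \<bullet> b)))"
    using conv_normal_density_zero_mean[of "sqrt s" "sqrt t"] assms by (simp add: fun_eq_iff)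
  finally show ?thesis by (simp add: gauss_def prod_ennreal)
qed

lemma nn_integral_lborel_translate:
  fixes f :: "'a::euclidean_space \<Rightarrow> ennreal"
  assumes [measurable]: "f \<in> borel_measurable borel"
  shows "(\<integral>\<^sup>+x. f (c + x) \<partial>lborel) = (\<integral>\<^sup>+x. f x \<partial>lborel)"
  by (subst (2) lborel_distr_plus[symmetric, of c], subst nn_integral_distr) auto

lemma integral_lborel_translate:
  fixes f :: "'a::euclidean_space \<Rightarrow> 'b::euclidean_space"
  assumes [measurable]: "f \<in> borel_measurable borel"
  shows "(\<integral>x. f (c + x) \<partial>lborel) = (\<integral>x. f x \<partial>lborel)"
  by (subst (2) lborel_distr_plus[symmetric, of c], subst integral_distr) auto

lemma integrable_lborel_translate:
  fixes f :: "'a::euclidean_space \<Rightarrow> 'b::euclidean_space"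
  assumes [measurable]: "integrable lborel f"
  shows "integrable lborel (\<lambda>x. f (c + x))"
  using assms by (subst (asm) lborel_distr_plus[symmetric, of c], subst (asm) integrable_distr_eq) auto

lemma gaussian_convolution:
  assumes "0 < s" "0 < t"
  shows "gaussian (s + t) = distr (gaussian s \<Otimes>\<^sub>M gaussian t) borel (\<lambda>(x, y). x + y :: 'a::euclidean_space)"
proof (rule measure_eqI)
  fix A :: "'a set" assume "A \<in> sets (gaussian (s + t))"
  then have [measurable]: "A \<in> sets borel" by simp
  interpret S: prob_space "gaussian s :: 'a measure" by (rule prob_space_gaussian) fact
  interpret T: prob_space "gaussian t :: 'a measure" by (rule prob_space_gaussian) fact
  interpret ST: pair_sigma_finite "gaussian s :: 'a measure" "gaussian t :: 'a measure" ..
  have shift: "(\<integral>\<^sup>+x. ennreal (gauss s x) * indicator A (x + y) \<partial>lborel)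
      = (\<integral>\<^sup>+x. ennreal (gauss s (x - y)) * indicator A x \<partial>lborel)" for y
    using nn_integral_lborel_translate[of "\<lambda>x. ennreal (gauss s (x - y)) * indicator A x" y]
    by (simp add: add.commute)
  have "emeasure (distr (gaussian s \<Otimes>\<^sub>M gaussian t) borel (\<lambda>(x, y). x + y)) A
     = (\<integral>\<^sup>+p. indicator A (fst p + snd p) \<partial>(gaussian s \<Otimes>\<^sub>M gaussian t))"
    by (subst nn_integral_indicator[symmetric], simp, subst nn_integral_distr) (auto simp: split_beta)
  also have "\<dots> = (\<integral>\<^sup>+y. \<integral>\<^sup>+x. indicator A (x + y) \<partial>gaussian s \<partial>gaussian t)"
    by (subst ST.nn_integral_snd[symmetric]) (auto simp: split_beta)
  also have "\<dots> = (\<integral>\<^sup>+y. ennreal (gauss t y) * (\<integral>\<^sup>+x. ennreal (gauss s x) * indicator A (x + y) \<partial>lborel) \<partial>lborel)"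
    by (simp add: nn_integral_gaussian)
  also have "\<dots> = (\<integral>\<^sup>+y. ennreal (gauss t y) * (\<integral>\<^sup>+x. ennreal (gauss s (x - y)) * indicator A x \<partial>lborel) \<partial>lborel)"
    by (simp only: shift)
  also have "\<dots> = (\<integral>\<^sup>+y. (\<integral>\<^sup>+x. ennreal (gauss t y) * (ennreal (gauss s (x - y)) * indicator A x) \<partial>lborel) \<partial>lborel)"
    by (subst nn_integral_cmult) auto
  also have "\<dots> = (\<integral>\<^sup>+x. (\<integral>\<^sup>+y. ennreal (gauss t y) * (ennreal (gauss s (x - y)) * indicator A x) \<partial>lborel) \<partial>lborel)"
    by (rule lborel_pair.Fubini') measurable
  also have "\<dots> = (\<integral>\<^sup>+x. (\<integral>\<^sup>+y. ennreal (gauss s (x - y)) * ennreal (gauss t y) \<partial>lborel) * indicator A x \<partial>lborel)"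
    by (subst nn_integral_multc[symmetric]) (auto simp: ac_simps)
  also have "\<dots> = emeasure (gaussian (s + t)) A"
    by (simp add: gauss_convolution assms gaussian_def emeasure_density)
  finally show "emeasure (gaussian (s + t)) A = emeasure (distr (gaussian s \<Otimes>\<^sub>M gaussian t) borel (\<lambda>(x, y). x + y)) A" ..
qed simp

lemma gaussian_scale:
  assumes "0 < s"
  shows "gaussian s = distr (gaussian 1) borel (\<lambda>y. sqrt s *\<^sub>R y :: 'a::euclidean_space)"
proof -
  let ?T = "\<lambda>y. 0 + sqrt s *\<^sub>R y :: 'a"
  have "gaussian s = density (density (distr lborel borel ?T) (\<lambda>_. \<bar>sqrt s\<bar> ^ DIM('a))) (\<lambda>x. ennreal (gauss s x))"
    unfolding gaussian_def using lborel_affine[of "sqrt s" "0::'a"] assms by simp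
  also have "\<dots> = distr (density lborel (\<lambda>y. ennreal (\<bar>sqrt s\<bar> ^ DIM('a)) * ennreal (gauss s (?T y)))) borel ?T"
    by (subst density_density_eq, simp, simp, subst density_distr) (auto simp: comp_def ennreal_power)
  also have "(\<lambda>y. ennreal (\<bar>sqrt s\<bar> ^ DIM('a)) * ennreal (gauss s (?T y))) = (\<lambda>y. ennreal (gauss 1 y))"
    using assms by (auto simp: fun_eq_iff gauss_eq ennreal_mult'[symmetric] power_mult_distrib power_divide
        real_sqrt_mult field_simps)
  finally show ?thesis by (simp add: gaussian_def)
qed

text \<open>Completing the square in the exponent is a translation by \<open>a\<close>.\<close>

lemma gaussian_exp_inner:
  fixes a :: "'a::euclidean_space"
  shows "(\<integral>\<^sup>+y. ennreal (exp (a \<bullet> y)) \<partial>gaussian 1) = ennreal (exp ((norm a)\<^sup>2 / 2))"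
proof -
  interpret prob_space "gaussian 1 :: 'a measure" by (rule prob_space_gaussian) simp
  have eq: "gauss 1 (a + y) * exp (a \<bullet> (a + y)) = exp ((norm a)\<^sup>2 / 2) * gauss 1 y" for y :: 'a
  proof -
    have "(norm (a + y))\<^sup>2 = (norm a)\<^sup>2 + 2 * (a \<bullet> y) + (norm y)\<^sup>2"
      by (simp add: power2_norm_eq_inner inner_simps inner_commute)
    then have e: "- (norm (a + y))\<^sup>2 / (2 * 1) + a \<bullet> (a + y) = (norm a)\<^sup>2 / 2 + - (norm y)\<^sup>2 / (2 * 1)"
      by (simp add: inner_simps power2_norm_eq_inner field_simps)
    have "exp (- (norm (a + y))\<^sup>2 / (2 * 1)) * exp (a \<bullet> (a + y)) = exp ((norm a)\<^sup>2 / 2) * exp (- (norm y)\<^sup>2 / (2 * 1))"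
      unfolding exp_add[symmetric] e ..
    then show ?thesis unfolding gauss_eq[OF zero_less_one] by simp
  qed
  have "(\<integral>\<^sup>+y. ennreal (exp (a \<bullet> y)) \<partial>gaussian 1) = (\<integral>\<^sup>+y. ennreal (gauss 1 y * exp (a \<bullet> y)) \<partial>lborel)"
    by (simp add: nn_integral_gaussian ennreal_mult')
  also have "\<dots> = (\<integral>\<^sup>+y. ennreal (gauss 1 (a + y) * exp (a \<bullet> (a + y))) \<partial>lborel)"
    by (subst nn_integral_lborel_translate) auto
  also have "\<dots> = (\<integral>\<^sup>+y. ennreal (exp ((norm a)\<^sup>2 / 2)) * ennreal (gauss 1 y) \<partial>(lborel :: 'a measure))"
    by (simp add: eq ennreal_mult')
  also have "\<dots> = ennreal (exp ((norm a)\<^sup>2 / 2)) * emeasure (gaussian 1) (space (gaussian 1) :: 'a set)"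
    by (simp add: nn_integral_cmult gaussian_def emeasure_density)
  finally show ?thesis using emeasure_space_1 by simp
qed

section \<open>Moments of Gaussian measures\<close>

lemma exp_minus_exp_ge:
  fixes v :: real assumes "0 \<le> v" shows "2 * v \<le> exp v - exp (- v)"
proof -
  define A where "A = 1 + v + v\<^sup>2 / 2"
  have A: "1 \<le> A" "A \<le> exp v" using assms exp_lower_Taylor_quadratic[of v] by (auto simp: A_def)
  have "2 * v * A \<le> A * A - 1"
    unfolding A_def using assms by (simp add: field_simps power2_eq_square)
  then have "2 * v \<le> A - 1 / A" using A by (simp add: field_simps)
  moreover have "1 / exp v \<le> 1 / A" using A by (intro divide_left_mono) auto
  ultimately show ?thesis using A by (simp add: exp_minus inverse_eq_divide)
qed

lemma square_le_exp_plus_exp_minus: "(u::real)\<^sup>2 + 2 \<le> exp u + exp (- u)"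
proof -
  define v where "v = \<bar>u\<bar> / 2"
  have "(2 * v)\<^sup>2 \<le> (exp v - exp (- v))\<^sup>2"
    by (rule power_mono[OF exp_minus_exp_ge]) (auto simp: v_def)
  also have "\<dots> = exp (2 * v) + exp (- (2 * v)) - 2"
    by (simp add: power2_eq_square algebra_simps exp_add[symmetric])
  also have "\<dots> = exp u + exp (- u) - 2" by (auto simp: v_def abs_if)
  finally show ?thesis by (simp add: v_def power2_eq_square abs_mult[symmetric])
qed

text \<open>The product with the Gaussian density is a multiple of another Gaussian density.\<close>

lemma integrable_gaussian_exp_square:
  assumes "0 < s" "c < 1 / (2 * s)"
  shows "integrable (gaussian s) (\<lambda>x::'a::euclidean_space. exp (c * (norm x)\<^sup>2))"
proof -
  define r where "r = 1 / (1 / s - 2 * c)"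
  have r: "0 < r" "1 / (2 * s) - c = 1 / (2 * r)" using assms by (auto simp: r_def field_simps)
  interpret prob_space "gaussian r :: 'a measure" by (rule prob_space_gaussian) fact
  define k where "k = (1 / sqrt (2 * pi * s)) ^ DIM('a) / (1 / sqrt (2 * pi * r)) ^ DIM('a)"
  have "gauss s x *\<^sub>R exp (c * (norm x)\<^sup>2) = k * gauss r x" for x :: 'a
  proof -
    have e: "- (norm x)\<^sup>2 / (2 * s) + c * (norm x)\<^sup>2 = - (norm x)\<^sup>2 / (2 * r)"
      using arg_cong[OF r(2), of "\<lambda>u. - (norm x)\<^sup>2 * u"] by (simp add: algebra_simps)
    have "exp (- (norm x)\<^sup>2 / (2 * s)) * exp (c * (norm x)\<^sup>2) = exp (- (norm x)\<^sup>2 / (2 * r))"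
      unfolding exp_add[symmetric] e ..
    then show ?thesis using assms r by (simp add: gauss_eq k_def)
  qed
  moreover have "integrable (gaussian r) (\<lambda>_::'a. 1::real)" by simp
  then have "integrable lborel (gauss r :: 'a \<Rightarrow> real)"
    by (subst (asm) integrable_gaussian) auto
  ultimately show ?thesis by (subst integrable_gaussian) auto
qed

lemma integrable_gaussian_poly:
  "integrable (gaussian 1) (\<lambda>y::'a::euclidean_space. (1 + norm y) ^ k)"
proof (rule Bochner_Integration.integrable_bound)
  show "integrable (gaussian 1) (\<lambda>y::'a. exp (real k ^ 2) * exp (1/4 * (norm y)\<^sup>2))"
    by (intro integrable_mult_right integrable_gaussian_exp_square) auto
  show "AE y::'a in gaussian 1. norm ((1 + norm y) ^ k) \<le> norm (exp (real k ^ 2) * exp (1/4 * (norm y)\<^sup>2))"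
  proof (rule AE_I2)
    fix y :: 'a
    have "(1 + norm y) ^ k \<le> exp (norm y) ^ k"
      by (intro power_mono exp_ge_add_one_self) auto
    also have "\<dots> = exp (real k * norm y)" by (simp add: exp_of_nat_mult)
    also have "\<dots> \<le> exp (real k ^ 2 + 1/4 * (norm y)\<^sup>2)"
      using zero_le_power2[of "real k - norm y / 2"] by (simp add: power2_diff power_divide)
    finally show "norm ((1 + norm y) ^ k) \<le> norm (exp (real k ^ 2) * exp (1/4 * (norm y)\<^sup>2))"
      by (simp add: exp_add)
  qed
qed simp

lemma integrable_gaussian_poly_bound:
  fixes f :: "'a::euclidean_space \<Rightarrow> 'b::euclidean_space"
  assumes "f \<in> borel_measurable borel" "\<And>y. norm (f y) \<le> c * (1 + norm y) ^ k"
  shows "integrable (gaussian 1) f"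
proof (rule Bochner_Integration.integrable_bound)
  show "integrable (gaussian 1) (\<lambda>y::'a. c * (1 + norm y) ^ k)"
    by (intro integrable_mult_right integrable_gaussian_poly)
  show "AE y in gaussian 1. norm (f y) \<le> norm (c * (1 + norm y) ^ k)"
    using assms(2) by (intro AE_I2) (simp add: order_trans[OF _ abs_ge_self])
qed (use assms in simp)

lemma integrable_gaussian_id: "integrable (gaussian 1) (\<lambda>y::'a::euclidean_space. y)"
  by (rule integrable_gaussian_poly_bound[where c = 1 and k = 1]) auto

lemma integrable_gaussian_norm: "integrable (gaussian 1) (\<lambda>y::'a::euclidean_space. norm y)"
  by (rule integrable_gaussian_poly_bound[where c = 1 and k = 1]) auto

lemma integrable_gaussian_norm2: "integrable (gaussian 1) (\<lambda>y::'a::euclidean_space. (norm y)\<^sup>2)"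
proof (rule integrable_gaussian_poly_bound[where c = 1 and k = 2])
  fix y :: 'a show "norm ((norm y)\<^sup>2) \<le> 1 * (1 + norm y)\<^sup>2"
    by (auto intro: power_mono)
qed simp

lemma integrable_gaussian_inner2: "integrable (gaussian 1) (\<lambda>y::'a::euclidean_space. (p \<bullet> y)\<^sup>2)"
proof (rule integrable_gaussian_poly_bound[where c = "(norm p)\<^sup>2" and k = 2])
  fix y :: 'a
  have "norm ((p \<bullet> y)\<^sup>2) = \<bar>p \<bullet> y\<bar>\<^sup>2" by simp
  also have "\<dots> \<le> (norm p * norm y)\<^sup>2" by (intro power_mono Cauchy_Schwarz_ineq2) auto
  also have "\<dots> \<le> (norm p)\<^sup>2 * (1 + norm y)\<^sup>2"
    unfolding power_mult_distrib by (intro mult_left_mono power_mono) auto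
  finally show "norm ((p \<bullet> y)\<^sup>2) \<le> (norm p)\<^sup>2 * (1 + norm y)\<^sup>2" .
qed simp

lemma gaussian_mean_zero: "(\<integral>y. y \<partial>gaussian 1) = (0::'a::euclidean_space)"
proof -
  have "distr (lborel :: 'a measure) borel uminus = lborel"
    using lborel_affine[of "-1" "0::'a"] by (simp add: density_1)
  then have "(\<integral>y. gauss 1 y *\<^sub>R y \<partial>(lborel :: 'a measure)) = (\<integral>y. gauss 1 y *\<^sub>R y \<partial>(distr lborel borel uminus :: 'a measure))"
    by simp
  also have "\<dots> = - (\<integral>y. gauss 1 y *\<^sub>R y \<partial>(lborel :: 'a measure))"
    by (subst integral_distr) auto
  finally have "(\<integral>y. gauss 1 y *\<^sub>R y \<partial>(lborel :: 'a measure)) = 0"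
    by (metis add.right_inverse scaleR_2 scaleR_eq_0_iff zero_neq_numeral)
  then show ?thesis by (subst integral_gaussian) auto
qed

text \<open>Integrate \<open>u\<^sup>2 + 2 \<le> exp u + exp (- u)\<close> for \<open>u = t * (p \<bullet> y)\<close>, insert the exponential moments of
\<open>gaussian_exp_inner\<close>, divide by \<open>t\<^sup>2\<close> and let \<open>t\<close> tend to 0.\<close>

lemma gaussian_variance_le: "(\<integral>y. (p \<bullet> y)\<^sup>2 \<partial>gaussian 1) \<le> (norm (p::'a::euclidean_space))\<^sup>2"
proof (rule field_le_epsilon)
  fix e :: real assume e: "0 < e"
  define q where "q = (norm p)\<^sup>2"
  have "0 \<le> q" by (simp add: q_def)
  \<comment> \<open>\<open>w\<close> is the small parameter \<open>t\<^sup>2\<close>; it is chosen such that \<open>w * q \<le> 1\<close> and \<open>w * q\<^sup>2 \<le> e\<close>.\<close>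
  define w where "w = min (1 / (1 + q)) (e / (1 + q\<^sup>2))"
  have w: "0 < w" "w \<le> 1 / (1 + q)" "w \<le> e / (1 + q\<^sup>2)"
    using e \<open>0 \<le> q\<close> by (auto simp: w_def add_pos_nonneg)
  define t where "t = sqrt w"
  have t2: "t\<^sup>2 = w" using w by (simp add: t_def)
  interpret prob_space "gaussian 1 :: 'a measure" by (rule prob_space_gaussian) simp
  have wq: "w * q \<le> 1" "w * q\<^sup>2 \<le> e"
  proof -
    have "w * q \<le> 1 / (1 + q) * q" using w \<open>0 \<le> q\<close> by (intro mult_right_mono) auto
    also have "\<dots> \<le> 1" using \<open>0 \<le> q\<close> by simp
    finally show "w * q \<le> 1" .
    have "w * q\<^sup>2 \<le> e / (1 + q\<^sup>2) * q\<^sup>2" using w by (intro mult_right_mono) auto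
    also have "\<dots> \<le> e" using e add_pos_nonneg[OF zero_less_one zero_le_power2[of q]] by (simp add: field_simps)
    finally show "w * q\<^sup>2 \<le> e" .
  qed
  have "ennreal (w * (\<integral>y. (p \<bullet> y)\<^sup>2 \<partial>gaussian 1) + 2) = ennreal (\<integral>y. w * (p \<bullet> y)\<^sup>2 + 2 \<partial>gaussian 1)"
    by (subst Bochner_Integration.integral_add) (auto intro!: integrable_gaussian_inner2 simp: prob_space[unfolded space_gaussian])
  also have "\<dots> = (\<integral>\<^sup>+y. ennreal (w * (p \<bullet> y)\<^sup>2 + 2) \<partial>gaussian 1)"
    using w by (intro nn_integral_eq_integral[symmetric])
       (auto intro!: integrable_gaussian_inner2 AE_I2 add_nonneg_nonneg)
  also have "\<dots> \<le> (\<integral>\<^sup>+y. ennreal (exp ((t *\<^sub>R p) \<bullet> y)) + ennreal (exp ((- t *\<^sub>R p) \<bullet> y)) \<partial>gaussian 1)"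
  proof (rule nn_integral_mono)
    fix y
    show "ennreal (w * (p \<bullet> y)\<^sup>2 + 2) \<le> ennreal (exp ((t *\<^sub>R p) \<bullet> y)) + ennreal (exp ((- t *\<^sub>R p) \<bullet> y))"
      using square_le_exp_plus_exp_minus[of "t * (p \<bullet> y)"]
      by (simp add: ennreal_plus[symmetric] power_mult_distrib t2 del: ennreal_plus)
  qed
  also have "\<dots> = (\<integral>\<^sup>+y. ennreal (exp ((t *\<^sub>R p) \<bullet> y)) \<partial>gaussian 1) + (\<integral>\<^sup>+y. ennreal (exp ((- t *\<^sub>R p) \<bullet> y)) \<partial>gaussian 1)"
    by (rule nn_integral_add) auto
  also have "\<dots> = ennreal (2 * exp (w * q / 2))"
    unfolding gaussian_exp_inner by (simp add: ennreal_plus[symmetric] power_mult_distrib t2 q_def del: ennreal_plus)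
  finally have "w * (\<integral>y. (p \<bullet> y)\<^sup>2 \<partial>gaussian 1) + 2 \<le> 2 * exp (w * q / 2)"
    by (simp add: ennreal_le_iff)
  also have "\<dots> \<le> 2 * (1 + w * q / 2 + (w * q / 2)\<^sup>2)"
    using exp_bound[of "w * q / 2"] wq w \<open>0 \<le> q\<close> by simp
  finally have "w * (\<integral>y. (p \<bullet> y)\<^sup>2 \<partial>gaussian 1) \<le> w * (q + w * q\<^sup>2 / 2)"
    by (simp add: power2_eq_square field_simps)
  then have "(\<integral>y. (p \<bullet> y)\<^sup>2 \<partial>gaussian 1) \<le> q + w * q\<^sup>2 / 2" using w by simp
  then show "(\<integral>y. (p \<bullet> y)\<^sup>2 \<partial>gaussian 1) \<le> (norm p)\<^sup>2 + e" using wq e by (simp add: q_def)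
qed

section \<open>The heat semigroup on smooth functions\<close>

definition bounded_borel :: "('a::euclidean_space \<Rightarrow> 'b::euclidean_space) \<Rightarrow> bool" where
  "bounded_borel f \<longleftrightarrow> f \<in> borel_measurable borel \<and> (\<exists>B. \<forall>x. norm (f x) \<le> B)"

lemma bounded_borelI:
  "f \<in> borel_measurable borel \<Longrightarrow> (\<And>x. norm (f x) \<le> B) \<Longrightarrow> bounded_borel f"
  by (auto simp: bounded_borel_def)

lemma bounded_borel_measurable: "bounded_borel f \<Longrightarrow> f \<in> borel_measurable borel"
  by (simp add: bounded_borel_def)

lemma integrable_bounded_borel:
  assumes "bounded_borel f" "prob_space M" "sets M = sets borel"
  shows "integrable M (\<lambda>y. f (x + y))"
proof -
  interpret prob_space M by fact
  note [measurable_cong] = assms(3)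
  have [measurable]: "f \<in> borel_measurable borel" using assms(1) by (rule bounded_borel_measurable)
  obtain B where "\<And>x. norm (f x) \<le> B" using assms by (auto simp: bounded_borel_def)
  then show ?thesis by (intro integrable_const_bound[where B = B]) auto
qed

lemmas integrable_heat = integrable_bounded_borel[OF _ prob_space_gaussian sets_gaussian]

lemma heat_bounded_borel:
  fixes f :: "'a::euclidean_space \<Rightarrow> 'b::euclidean_space"
  assumes "0 < s" "bounded_borel f" shows "bounded_borel (heat s f)"
proof -
  interpret prob_space "gaussian s :: 'a measure" by (rule prob_space_gaussian) fact
  have [measurable]: "f \<in> borel_measurable borel" using assms(2) by (rule bounded_borel_measurable)
  obtain B where B: "\<And>x. norm (f x) \<le> B" using assms by (auto simp: bounded_borel_def)
  have "norm (heat s f x) \<le> B" for x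
  proof -
    have "norm (heat s f x) \<le> (\<integral>y. B \<partial>(gaussian s :: 'a measure))"
      unfolding heat_def by (rule norm_integral_le_integral) (auto simp: B)
    then show ?thesis by (simp add: prob_space[unfolded space_gaussian])
  qed
  moreover have "heat s f \<in> borel_measurable borel"
    unfolding heat_def[abs_def] by measurable
  ultimately show ?thesis by (auto intro: bounded_borelI)
qed

lemma heat_semigroup:
  fixes f :: "'a::euclidean_space \<Rightarrow> 'b::euclidean_space"
  assumes "0 < s" "0 < t" "bounded_borel f"
  shows "heat s (heat t f) x = heat (s + t) f x"
proof -
  interpret S: prob_space "gaussian s :: 'a measure" by (rule prob_space_gaussian) fact
  interpret T: prob_space "gaussian t :: 'a measure" by (rule prob_space_gaussian) fact
  interpret ST: pair_prob_space "gaussian s :: 'a measure" "gaussian t :: 'a measure" ..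
  have [measurable]: "f \<in> borel_measurable borel" using assms(3) by (rule bounded_borel_measurable)
  obtain B where B: "\<And>x. norm (f x) \<le> B" using assms by (auto simp: bounded_borel_def)
  have "integrable (gaussian s \<Otimes>\<^sub>M gaussian t) (\<lambda>p. f (x + (fst p + snd p)))"
    by (rule ST.integrable_const_bound[where B = B]) (use B in auto)
  then have "(\<integral>y. (\<integral>z. f (x + (y + z)) \<partial>gaussian t) \<partial>gaussian s) = (\<integral>p. f (x + (fst p + snd p)) \<partial>(gaussian s \<Otimes>\<^sub>M gaussian t))"
    using ST.integral_fst'[of "\<lambda>p. f (x + (fst p + snd p))"] by simp
  also have "\<dots> = heat (s + t) f x"
    unfolding heat_def gaussian_convolution[OF assms(1,2)]
    by (subst integral_distr) (auto simp: split_beta)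
  finally show ?thesis by (simp add: heat_def add.assoc)
qed

lemma heat_scale:
  fixes f :: "'a::euclidean_space \<Rightarrow> 'b::euclidean_space"
  assumes "0 < s" "f \<in> borel_measurable borel"
  shows "heat s f x = (\<integral>y. f (x + sqrt s *\<^sub>R y) \<partial>gaussian 1)"
  unfolding heat_def gaussian_scale[OF assms(1)] using assms(2) by (subst integral_distr) auto

text \<open>The class of functions with gradient \<open>G\<close> in which the smooth inequality is proved. The heat
semigroup preserves it with the same constants (\<open>tame_heat\<close>), which makes the error of a time step
uniform along the flow. One constant \<open>B\<close> bounds both the function and its gradient.\<close>

definition tame :: "real \<Rightarrow> real \<Rightarrow> real \<Rightarrow> ('a::euclidean_space \<Rightarrow> real) \<Rightarrow> ('a \<Rightarrow> 'a) \<Rightarrow> bool" where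
  "tame \<epsilon> B L F G \<longleftrightarrow> (\<forall>x. GDERIV F x :> G x) \<and> L-lipschitz_on UNIV G \<and>
     (\<forall>x. norm (G x) \<le> B \<and> \<epsilon> \<le> F x \<and> F x \<le> B) \<and> 0 < \<epsilon>"

lemma GDERIV_continuous_on:
  "(\<And>x. GDERIV F x :> G x) \<Longrightarrow> continuous_on UNIV F"
  unfolding gderiv_def by (intro continuous_at_imp_continuous_on ballI) (blast intro: has_derivative_continuous)

lemma tame_bounded_borel:
  assumes "tame \<epsilon> B L F G"
  shows "bounded_borel F" "bounded_borel G"
    "bounded_borel (\<lambda>x. F x * ln (F x))" "bounded_borel (\<lambda>x. (norm (G x))\<^sup>2 / F x)"
proof -
  have t: "\<And>x. GDERIV F x :> G x" "L-lipschitz_on UNIV G" "\<And>x. norm (G x) \<le> B" "\<And>x. \<epsilon> \<le> F x" "\<And>x. F x \<le> B" "0 < \<epsilon>"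
    using assms by (auto simp: tame_def)
  have [measurable]: "F \<in> borel_measurable borel"
    using GDERIV_continuous_on[OF t(1)] by (rule borel_measurable_continuous_onI)
  have [measurable]: "G \<in> borel_measurable borel"
    using lipschitz_on_continuous_on[OF t(2)] by (rule borel_measurable_continuous_onI)
  have pos: "0 < F x" for x using t(4)[of x] t(6) by simp
  show "bounded_borel F" by (rule bounded_borelI[where B = B]) (use t pos[THEN less_imp_le] in auto)
  show "bounded_borel G" by (rule bounded_borelI[where B = B]) (use t in auto)
  show "bounded_borel (\<lambda>x. F x * ln (F x))"
  proof (rule bounded_borelI[where B = "B * (\<bar>ln \<epsilon>\<bar> + \<bar>ln B\<bar>)"])
    fix x
    have "ln \<epsilon> \<le> ln (F x)" "ln (F x) \<le> ln B"
      using t(4)[of x] t(5)[of x] t(6) pos[of x] by (auto intro: ln_mono)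
    then have "\<bar>ln (F x)\<bar> \<le> \<bar>ln \<epsilon>\<bar> + \<bar>ln B\<bar>" by linarith
    then show "norm (F x * ln (F x)) \<le> B * (\<bar>ln \<epsilon>\<bar> + \<bar>ln B\<bar>)"
      using pos[of x] t(5)[of x] by (auto simp: abs_mult intro!: mult_mono)
  qed simp
  show "bounded_borel (\<lambda>x. (norm (G x))\<^sup>2 / F x)"
  proof (rule bounded_borelI[where B = "B\<^sup>2 / \<epsilon>"])
    fix x show "norm ((norm (G x))\<^sup>2 / F x) \<le> B\<^sup>2 / \<epsilon>"
      using pos[of x] t(3)[of x] t(4)[of x] t(6) by (auto intro!: frac_le power_mono)
  qed simp
qed

lemma tame_heat:
  assumes "tame \<epsilon> B L F (G :: 'a::euclidean_space \<Rightarrow> 'a)" "0 < s"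
  shows "tame \<epsilon> B L (heat s F) (heat s G)"
proof -
  interpret prob_space "gaussian s :: 'a measure" by (rule prob_space_gaussian) fact
  have t: "\<And>x. GDERIV F x :> G x" "L-lipschitz_on UNIV G" "\<And>x. norm (G x) \<le> B" "\<And>x. \<epsilon> \<le> F x" "\<And>x. F x \<le> B" "0 < \<epsilon>"
    using assms by (auto simp: tame_def)
  note b = tame_bounded_borel(1,2)[OF assms(1)]
  note [simp] = b[THEN integrable_heat, OF \<open>0 < s\<close>]
  have "GDERIV (heat s F) x :> heat s G x" for x
    unfolding heat_def
  proof (rule GDERIV_integral_quadratic[where c = "\<lambda>_. L"])
    fix z v
    show "\<bar>F (x + v + z) - F (x + z) - v \<bullet> G (x + z)\<bar> \<le> L * (norm v)\<^sup>2"
      using gradient_taylor_bound[OF t(1,2), of "x + z" v] by (simp add: ac_simps)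
  qed auto
  moreover have "L-lipschitz_on UNIV (heat s G)"
  proof (rule lipschitz_onI)
    fix x y
    have "dist (heat s G x) (heat s G y) = norm (\<integral>z. G (x + z) - G (y + z) \<partial>gaussian s)"
      by (simp add: heat_def dist_norm)
    also have "\<dots> \<le> (\<integral>z. L * dist x y \<partial>(gaussian s :: 'a measure))"
    proof (rule norm_integral_le_integral)
      fix z show "norm (G (x + z) - G (y + z)) \<le> L * dist x y"
        using lipschitz_onD[OF t(2), of "x + z" "y + z"] by (simp add: dist_norm)
    qed auto
    finally show "dist (heat s G x) (heat s G y) \<le> L * dist x y"
      by (simp add: prob_space[unfolded space_gaussian])
  qed (rule lipschitz_on_nonneg[OF t(2)])
  moreover have "norm (heat s G x) \<le> B" for x
    unfolding heat_def using norm_integral_le_integral[of "gaussian s" "\<lambda>_. B" "\<lambda>y. G (x + y)"] t(3)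
    by (simp add: prob_space[unfolded space_gaussian])
  moreover have "\<epsilon> \<le> heat s F x" "heat s F x \<le> B" for x
    using integral_mono[of "gaussian s" "\<lambda>_. \<epsilon>" "\<lambda>y. F (x + y)"] integral_mono[of "gaussian s" "\<lambda>y. F (x + y)" "\<lambda>_. B"] t
    by (auto simp: heat_def prob_space[unfolded space_gaussian])
  ultimately show ?thesis using t(6) by (auto simp: tame_def)
qed

section \<open>Logarithmic Sobolev inequality for smooth functions\<close>

text \<open>The derivative of the difference of both sides is \<open>v ^ 3 / (1 + v)\<close>, which has the sign of \<open>v\<close>.\<close>

lemma ln_cubic_bound:
  fixes u :: real assumes "-1 < u"
  shows "ln (1 + u) \<le> u - u\<^sup>2 / 2 + u ^ 3 / 3"
proof -
  define g where "g u = u - u\<^sup>2 / 2 + u ^ 3 / 3 - ln (1 + u)" for u :: real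
  have der: "(g has_real_derivative v ^ 3 / (1 + v)) (at v)" if "-1 < v" for v
  proof -
    have "(g has_real_derivative 1 - v + v\<^sup>2 - 1 / (1 + v)) (at v)"
      unfolding g_def[abs_def] using that by (auto intro!: derivative_eq_intros simp: power2_eq_square)
    moreover have "1 - v + v\<^sup>2 - 1 / (1 + v) = v ^ 3 / (1 + v)"
      using that by (simp add: field_simps power2_eq_square power3_eq_cube)
    ultimately show ?thesis by simp
  qed
  have "g 0 \<le> g u"
  proof (cases "0 \<le> u")
    case True
    show ?thesis
    proof (rule DERIV_nonneg_imp_nondecreasing[OF True])
      fix x assume x: "0 \<le> x" "x \<le> u"
      then have "0 \<le> x ^ 3 / (1 + x)" by simp
      then show "\<exists>y. (g has_real_derivative y) (at x) \<and> 0 \<le> y" using der[of x] x by auto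
    qed
  next
    case False
    have "u \<le> 0" using False by simp
    then show ?thesis
    proof (rule DERIV_nonpos_imp_nonincreasing)
      fix x assume x: "u \<le> x" "x \<le> 0"
      have "x ^ 3 = x * (x * x)" by (simp add: power3_eq_cube)
      also have "\<dots> \<le> 0" using x by (intro mult_nonpos_nonneg) (auto simp: mult_nonpos_nonpos)
      finally have "x ^ 3 / (1 + x) \<le> 0"
        using x assms by (intro divide_nonpos_nonneg) auto
      then show "\<exists>y. (g has_real_derivative y) (at x) \<and> y \<le> 0" using der[of x] x assms by auto
    qed
  qed
  then show ?thesis by (simp add: g_def)
qed

text \<open>The Bregman divergence of \<open>t ln t\<close> at \<open>m\<close>. It is nonnegative, so that its integral always makes
sense, and if \<open>m\<close> is the mean of \<open>t\<close> then this integral is the entropy. The convention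
\<open>0 * ln 0 = 0\<close> gives the right value at \<open>t = 0\<close>.\<close>

definition entropy_gap :: "real \<Rightarrow> real \<Rightarrow> real" where
  "entropy_gap t m = t * ln t - t * ln m - t + m"

text \<open>The factor \<open>1 / (2 * m)\<close> of the quadratic term is the exact second-order coefficient, and this is
what makes the constant in the logarithmic Sobolev inequality sharp.\<close>

lemma entropy_gap_le_quadratic:
  fixes v m :: real
  assumes "0 < v" "0 < m"
  shows "entropy_gap v m \<le> (v - m)\<^sup>2 / (2 * m) + \<bar>v - m\<bar> ^ 3 / (2 * m\<^sup>2)"
proof -
  define u where "u = (v - m) / m"
  have u: "-1 < u" "v = m * (1 + u)" using assms by (auto simp: u_def field_simps)
  have "(1 + u) * ln (1 + u) - u \<le> u\<^sup>2 / 2 + \<bar>u\<bar> ^ 3 / 2"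
  proof (cases "0 \<le> u")
    case True
    have "(1 + u) * ln (1 + u) - u \<le> u\<^sup>2 / 2 + \<bar>u\<bar> ^ 3 / 2"
    proof -
      define g where "g u = u\<^sup>2 / 2 + u - (1 + u) * ln (1 + u)" for u :: real
      have "g 0 \<le> g u"
      proof (rule DERIV_nonneg_imp_nondecreasing[OF True])
        fix x :: real assume "0 \<le> x"
        then have "(g has_real_derivative x - ln (1 + x)) (at x)"
          unfolding g_def[abs_def] by (auto intro!: derivative_eq_intros)
        moreover have "0 \<le> x - ln (1 + x)" using ln_add_one_self_le_self[OF \<open>0 \<le> x\<close>] by simp
        ultimately show "\<exists>y. (g has_real_derivative y) (at x) \<and> 0 \<le> y" by blast
      qed
      moreover have "0 \<le> \<bar>u\<bar> ^ 3" by simp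
      moreover have "g 0 = 0" by (simp add: g_def)
      moreover have "g u = u\<^sup>2 / 2 + u - (1 + u) * ln (1 + u)" by (simp add: g_def)
      ultimately show ?thesis by linarith
    qed
    then show ?thesis .
  next
    case False
    have "(1 + u) * ln (1 + u) - u \<le> (1 + u) * (u - u\<^sup>2 / 2 + u ^ 3 / 3) - u"
      using u ln_cubic_bound[OF u(1)] by (simp add: mult_left_mono)
    also have "\<dots> = u\<^sup>2 / 2 + (\<bar>u\<bar> ^ 3 / 6 + u\<^sup>2 * u\<^sup>2 / 3)"
      using False by (simp add: abs_of_neg field_simps power2_eq_square power3_eq_cube)
    also have "u\<^sup>2 * u\<^sup>2 \<le> \<bar>u\<bar> ^ 3"
    proof -
      have "u\<^sup>2 * u\<^sup>2 = \<bar>u\<bar> ^ 3 * \<bar>u\<bar>" by (simp add: power2_eq_square power3_eq_cube)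
      also have "\<dots> \<le> \<bar>u\<bar> ^ 3 * 1" using False u by (intro mult_left_mono) auto
      finally show ?thesis by simp
    qed
    finally show ?thesis by simp
  qed
  then have "m * ((1 + u) * ln (1 + u) - u) \<le> m * (u\<^sup>2 / 2 + \<bar>u\<bar> ^ 3 / 2)"
    using assms by simp
  moreover have "entropy_gap v m = m * ((1 + u) * ln (1 + u) - u)"
  proof -
    have "ln v = ln m + ln (1 + u)" unfolding u(2) using assms u by (intro ln_mult_pos) auto
    then have "v * ln v - v * ln m - v + m = v * ln (1 + u) - v + m" by (simp add: algebra_simps)
    then show ?thesis unfolding entropy_gap_def by (simp add: u(2) algebra_simps)
  qed
  moreover have "m * (u\<^sup>2 / 2 + \<bar>u\<bar> ^ 3 / 2) = (v - m)\<^sup>2 / (2 * m) + \<bar>v - m\<bar> ^ 3 / (2 * m\<^sup>2)"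
    using assms by (simp add: u_def field_simps power2_eq_square power3_eq_cube)
  ultimately show ?thesis by simp
qed

text \<open>The function \<open>(p, m) \<mapsto> |p|\<^sup>2 / m\<close> is convex and homogeneous of degree one, hence it lies above its
tangent \<open>2 * (p \<bullet> g) / m - |p|\<^sup>2 * f / m\<^sup>2\<close>, taken at the means \<open>p\<close> and \<open>m\<close>. This inequality is
integrated.\<close>

lemma norm_square_div_integral_le:
  fixes G :: "'z \<Rightarrow> 'a::euclidean_space"
  assumes G: "integrable M G" and F: "integrable M F" and Q: "integrable M (\<lambda>z. (norm (G z))\<^sup>2 / F z)"
    and pos: "\<And>z. 0 < F z" and m: "0 < (\<integral>z. F z \<partial>M)"
  shows "(norm (\<integral>z. G z \<partial>M))\<^sup>2 / (\<integral>z. F z \<partial>M) \<le> (\<integral>z. (norm (G z))\<^sup>2 / F z \<partial>M)"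
proof -
  define p m where "p = (\<integral>z. G z \<partial>M)" and "m = (\<integral>z. F z \<partial>M)"
  have m: "0 < m" using assms by (simp add: m_def)
  have "(norm p)\<^sup>2 / m = 2 / m * (p \<bullet> p) - (norm p)\<^sup>2 / m\<^sup>2 * m"
    unfolding power2_norm_eq_inner using m by (simp add: power2_eq_square)
  also have "\<dots> = (\<integral>z. 2 / m * (p \<bullet> G z) - (norm p)\<^sup>2 / m\<^sup>2 * F z \<partial>M)"
    using G F by (subst Bochner_Integration.integral_diff) (auto simp: p_def m_def)
  also have "\<dots> \<le> (\<integral>z. (norm (G z))\<^sup>2 / F z \<partial>M)"
  proof (rule integral_mono)
    fix z
    define g f where "g = G z" and "f = F z"
    have f: "0 < f" using pos by (simp add: f_def)
    have "0 \<le> (norm (m *\<^sub>R g - f *\<^sub>R p))\<^sup>2" by simp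
    also have "\<dots> = m\<^sup>2 * (norm g)\<^sup>2 - 2 * m * f * (p \<bullet> g) + f\<^sup>2 * (norm p)\<^sup>2"
      unfolding power2_norm_eq_inner by (simp add: inner_simps inner_commute power2_eq_square algebra_simps)
    finally have "0 \<le> (m\<^sup>2 * (norm g)\<^sup>2 - 2 * m * f * (p \<bullet> g) + f\<^sup>2 * (norm p)\<^sup>2) / (m\<^sup>2 * f)"
      using m f by simp
    also have "\<dots> = (norm g)\<^sup>2 / f - 2 / m * (p \<bullet> g) + (norm p)\<^sup>2 / m\<^sup>2 * f"
      using m f by (simp add: field_simps power2_eq_square)
    finally show "2 / m * (p \<bullet> G z) - (norm p)\<^sup>2 / m\<^sup>2 * F z \<le> (norm (G z))\<^sup>2 / F z"
      unfolding g_def f_def by linarith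
  qed (use G F Q in auto)
  finally show ?thesis by (simp add: p_def m_def)
qed

lemma heat_jensen_fisher:
  assumes "tame \<epsilon> B L F (G :: 'a::euclidean_space \<Rightarrow> 'a)" "0 < s"
  shows "(norm (heat s G x))\<^sup>2 / heat s F x \<le> heat s (\<lambda>x. (norm (G x))\<^sup>2 / F x) x"
proof -
  note b = tame_bounded_borel[OF assms(1), THEN integrable_heat, OF \<open>0 < s\<close>]
  have "0 < heat s F x" "\<And>x. 0 < F x"
    using tame_heat[OF assms] assms(1) by (auto simp: tame_def intro: less_le_trans)
  then show ?thesis
    unfolding heat_def using b by (intro norm_square_div_integral_le) auto
qed

text \<open>Seen from its own mean \<open>m = heat h F x\<close>, the variable \<open>F (x + sqrt h * y)\<close> with standard Gaussian \<open>y\<close>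
is \<open>sqrt h * (p \<bullet> y)\<close> with \<open>p = heat h G x\<close>, up to an error of order \<open>h\<close>. Hence its entropy is
\<open>h * |p|\<^sup>2 / (2 * m)\<close> up to an error of order \<open>h powr (3/2)\<close>. Expanding around \<open>m\<close> and \<open>p\<close> instead of
\<open>F x\<close> and \<open>G x\<close> gives the main term the form to which \<open>heat_jensen_fisher\<close> applies.\<close>

lemma heat_entropy_one_step:
  "\<exists>C\<ge>0. \<forall>F G h x. tame \<epsilon> B L F (G :: 'a::euclidean_space \<Rightarrow> 'a) \<longrightarrow> 0 < h \<longrightarrow> h \<le> 1 \<longrightarrow>
    heat h (\<lambda>x. F x * ln (F x)) x - heat h F x * ln (heat h F x)
      \<le> h / 2 * ((norm (heat h G x))\<^sup>2 / heat h F x) + h * sqrt h * C"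
proof -
  let ?N = "gaussian 1 :: 'a measure"
  interpret prob_space ?N by (rule prob_space_gaussian) simp
  have one: "(\<integral>y. c \<partial>?N) = c" for c :: real by (simp add: prob_space[unfolded space_gaussian])
  define K1 where "K1 = (\<integral>y. norm y \<partial>?N)"
  define K2 where "K2 = (\<integral>y. (norm y)\<^sup>2 \<partial>?N)"
  have K: "0 \<le> K1" "0 \<le> K2" by (simp_all add: K1_def K2_def)
  \<comment> \<open>Absolute values, because \<open>C\<close> has to be chosen before \<open>tame\<close> provides the signs of the constants.\<close>
  define c where "c = \<bar>B\<bar> + \<bar>L\<bar> * (1 + K1 + K2)"
  have c: "0 \<le> c" using K by (simp add: c_def)
  define e where "e = \<bar>\<epsilon>\<bar>"
  define w where "w = c\<^sup>2 / (2 * e) + c ^ 3 / (2 * e\<^sup>2)"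
  have w: "0 \<le> w" using c by (simp add: w_def e_def)
  define C where "C = w * (\<integral>y. (1 + norm y) ^ 6 \<partial>?N)"
  have int6: "integrable ?N (\<lambda>y. (1 + norm y) ^ 6)" by (rule integrable_gaussian_poly)
  show ?thesis
  proof (intro exI[of _ C] conjI allI impI)
    show "0 \<le> C" using w by (simp add: C_def)
    fix F and G :: "'a \<Rightarrow> 'a" and h x
    assume tame: "tame \<epsilon> B L F G" and h: "0 < h" "h \<le> (1::real)"
    have t: "\<And>x. GDERIV F x :> G x" "L-lipschitz_on UNIV G" "\<And>x. norm (G x) \<le> B" "\<And>x. \<epsilon> \<le> F x" "\<And>x. F x \<le> B" "0 < \<epsilon>"
      using tame by (auto simp: tame_def)
    have L: "0 \<le> L" by (rule lipschitz_on_nonneg[OF t(2)])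
    have B: "0 \<le> B" using t(3)[of 0] norm_ge_zero[of "G 0"] by linarith
    have e: "e = \<epsilon>" using t(6) by (simp add: e_def)
    note bb = tame_bounded_borel[OF tame]
    note [measurable] = bb(1,2)[THEN bounded_borel_measurable]
    have sc: "integrable ?N (\<lambda>y. f (x + sqrt h *\<^sub>R y))" if bf: "bounded_borel f" for f :: "'a \<Rightarrow> 'b::euclidean_space"
    proof -
      have [measurable]: "f \<in> borel_measurable borel" using bf by (rule bounded_borel_measurable)
      obtain B where "\<And>x. norm (f x) \<le> B" using bf by (auto simp: bounded_borel_def)
      then show ?thesis by (intro integrable_const_bound[where B = B]) auto
    qed
    define m where "m = heat h F x"
    define p where "p = heat h G x"
    have th: "tame \<epsilon> B L (heat h F) (heat h G)" by (rule tame_heat[OF tame h(1)])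
    then have m: "\<epsilon> \<le> m" "0 < m" and p: "norm p \<le> B" by (auto simp: tame_def m_def p_def intro: less_le_trans)
    have m_eq: "m = (\<integral>y. F (x + sqrt h *\<^sub>R y) \<partial>?N)" unfolding m_def by (rule heat_scale) (use h in auto)
    have p_eq: "p = (\<integral>y. G (x + sqrt h *\<^sub>R y) \<partial>?N)" unfolding p_def by (rule heat_scale) (use h in auto)
    have r0: "\<bar>F (x + sqrt h *\<^sub>R y) - F x - sqrt h * (y \<bullet> G x)\<bar> \<le> L * h * (norm y)\<^sup>2" for y
      using gradient_taylor_bound[OF t(1,2), of x "sqrt h *\<^sub>R y"] h by (simp add: power_mult_distrib)
    have mean: "(\<integral>y. y \<bullet> G x \<partial>?N) = 0"
    proof -
      have "(\<integral>y. y \<bullet> G x \<partial>?N) = (\<integral>y. y \<partial>?N) \<bullet> G x"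
        by (rule integral_inner_left) (rule integrable_gaussian_id)
      then show ?thesis unfolding gaussian_mean_zero by simp
    qed
    have "\<bar>m - F x\<bar> = norm (\<integral>y. F (x + sqrt h *\<^sub>R y) - F x - sqrt h * (y \<bullet> G x) \<partial>?N)"
      using integrable_gaussian_id sc[OF bb(1)] mean
      by (subst Bochner_Integration.integral_diff) (auto simp: m_eq one prob_space[unfolded space_gaussian])
    also have "\<dots> \<le> (\<integral>y. L * h * (norm y)\<^sup>2 \<partial>?N)"
      by (rule norm_integral_le_integral) (use r0 integrable_gaussian_norm2 in auto)
    finally have m_F: "\<bar>m - F x\<bar> \<le> L * h * K2" by (simp add: K2_def)
    have "norm (p - G x) = norm (\<integral>y. G (x + sqrt h *\<^sub>R y) - G x \<partial>?N)"
      using sc[OF bb(2)] by (subst Bochner_Integration.integral_diff) (auto simp: p_eq prob_space[unfolded space_gaussian])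
    also have "\<dots> \<le> (\<integral>y. L * sqrt h * norm y \<partial>?N)"
    proof (rule norm_integral_le_integral)
      fix y show "norm (G (x + sqrt h *\<^sub>R y) - G x) \<le> L * sqrt h * norm y"
        using lipschitz_onD[OF t(2), of "x + sqrt h *\<^sub>R y" x] h by (simp add: dist_norm mult.assoc)
    qed (use integrable_gaussian_norm in auto)
    finally have p_G: "norm (p - G x) \<le> L * sqrt h * K1" by (simp add: K1_def)
    define v where "v y = F (x + sqrt h *\<^sub>R y)" for y
    have v: "\<epsilon> \<le> v y" "0 < v y" for y using t(4)[of "x + sqrt h *\<^sub>R y"] t(6) by (auto simp: v_def)
    \<comment> \<open>All powers of \<open>norm y\<close> in the error are bounded by the single integrable function \<open>(1 + norm y) ^ 6\<close>.\<close>
    have ptw: "v y * ln (v y) - v y * ln m - v y + m \<le> h / (2 * m) * (p \<bullet> y)\<^sup>2 + h * sqrt h * w * (1 + norm y) ^ 6" for y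
    proof -
      define T where "T = (1 + norm y)\<^sup>2"
      have T: "1 \<le> T" "norm y \<le> T" "(norm y)\<^sup>2 \<le> T"
        unfolding T_def by (auto simp: power2_eq_square algebra_simps)
      define R where "R = L * (1 + K1 + K2) * T"
      have R0: "0 \<le> R" unfolding R_def using L K T by auto
      \<comment> \<open>The deviation from the affine approximation.\<close>
      define r where "r = v y - m - sqrt h * (p \<bullet> y)"
      have cs: "\<bar>p \<bullet> y\<bar> \<le> B * T"
        by (rule order_trans[OF Cauchy_Schwarz_ineq2]) (use p T B in \<open>intro mult_mono, auto\<close>)
      have "r = (v y - F x - sqrt h * (y \<bullet> G x)) - (m - F x) - sqrt h * ((p - G x) \<bullet> y)"
        by (simp add: r_def inner_diff_left inner_commute algebra_simps)
      also have "\<bar>\<dots>\<bar> \<le> L * h * (norm y)\<^sup>2 + L * h * K2 + sqrt h * (L * sqrt h * K1 * norm y)"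
      proof -
        have "\<bar>(p - G x) \<bullet> y\<bar> \<le> L * sqrt h * K1 * norm y"
          by (rule order_trans[OF Cauchy_Schwarz_ineq2]) (intro mult_right_mono p_G norm_ge_zero)
        then have "\<bar>sqrt h * ((p - G x) \<bullet> y)\<bar> \<le> sqrt h * (L * sqrt h * K1 * norm y)"
          using h by (simp add: abs_mult mult_left_mono)
        then show ?thesis using r0[of y] m_F unfolding v_def by linarith
      qed
      also have "\<dots> = h * (L * ((norm y)\<^sup>2 + K2 * 1 + K1 * norm y))"
        using h by (simp add: algebra_simps)
      also have "\<dots> \<le> h * (L * (T + K2 * T + K1 * T))"
        using h L K T by (intro mult_left_mono add_mono) auto
      also have "\<dots> = h * R" by (simp add: R_def algebra_simps)
      finally have r: "\<bar>r\<bar> \<le> h * R" .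
      have hh: "h \<le> sqrt h" "h * h \<le> h * sqrt h"
      proof -
        have "sqrt h * sqrt h \<le> sqrt h * 1" using h by (intro mult_left_mono) auto
        then show "h \<le> sqrt h" using h by simp
        then show "h * h \<le> h * sqrt h" using h by (intro mult_left_mono) auto
      qed
      have S: "B * T + R = c * T" using B L by (simp add: c_def R_def algebra_simps)
      have vm: "v y - m = sqrt h * (p \<bullet> y) + r" by (simp add: r_def)
      have "\<bar>v y - m\<bar> \<le> sqrt h * (B * T) + sqrt h * R"
      proof -
        have "\<bar>sqrt h * (p \<bullet> y)\<bar> \<le> sqrt h * (B * T)" using cs h by (simp add: abs_mult mult_left_mono)
        moreover have "\<bar>r\<bar> \<le> sqrt h * R" using r mult_right_mono[OF hh(1) R0] by linarith
        ultimately show ?thesis unfolding vm by linarith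
      qed
      then have "\<bar>v y - m\<bar> ^ 3 \<le> (sqrt h * (c * T)) ^ 3"
        unfolding distrib_left[symmetric] S by (intro power_mono) simp_all
      also have "\<dots> = h * sqrt h * c ^ 3 * T ^ 3"
        using h by (simp add: power_mult_distrib power3_eq_cube)
      finally have cube: "\<bar>v y - m\<bar> ^ 3 \<le> h * sqrt h * c ^ 3 * T ^ 3" .
      have "(v y - m)\<^sup>2 = h * (p \<bullet> y)\<^sup>2 + (2 * sqrt h * (p \<bullet> y) * r + r * r)"
        unfolding vm power2_sum power_mult_distrib using h by (simp add: power2_eq_square[of r])
      also have "2 * sqrt h * (p \<bullet> y) * r + r * r \<le> h * sqrt h * (2 * (B * T) * R) + h * sqrt h * (R * R)"
      proof (rule add_mono)
        have "2 * sqrt h * (p \<bullet> y) * r \<le> 2 * sqrt h * (\<bar>p \<bullet> y\<bar> * \<bar>r\<bar>)"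
          using h by (simp add: abs_mult[symmetric] mult.assoc mult_left_mono)
        also have "\<dots> \<le> 2 * sqrt h * ((B * T) * (h * R))"
          using cs r h B T by (intro mult_left_mono mult_mono) auto
        finally show "2 * sqrt h * (p \<bullet> y) * r \<le> h * sqrt h * (2 * (B * T) * R)" by (simp add: ac_simps)
        have "r * r = \<bar>r\<bar> * \<bar>r\<bar>" by simp
        also have "\<dots> \<le> (h * R) * (h * R)" using r h R0 by (intro mult_mono) auto
        also have "\<dots> = (h * h) * (R * R)" by simp
        also have "\<dots> \<le> (h * sqrt h) * (R * R)" using hh R0 by (intro mult_right_mono) auto
        finally show "r * r \<le> h * sqrt h * (R * R)" .
      qed
      also have "h * sqrt h * (2 * (B * T) * R) + h * sqrt h * (R * R) \<le> h * sqrt h * (c\<^sup>2 * T ^ 3)"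
      proof -
        have "2 * (B * T) * R + R * R \<le> (B * T + R)\<^sup>2" unfolding power2_sum by (simp add: power2_eq_square[of R])
        also have "\<dots> = c\<^sup>2 * T\<^sup>2" by (simp add: S power_mult_distrib)
        also have "\<dots> \<le> c\<^sup>2 * T ^ 3" using T by (intro mult_left_mono power_increasing) auto
        finally show ?thesis using h by (simp add: distrib_left[symmetric] mult_left_mono)
      qed
      finally have square: "(v y - m)\<^sup>2 \<le> h * (p \<bullet> y)\<^sup>2 + h * sqrt h * (c\<^sup>2 * T ^ 3)" by simp
      have "v y * ln (v y) - v y * ln m - v y + m \<le> (v y - m)\<^sup>2 / (2 * m) + \<bar>v y - m\<bar> ^ 3 / (2 * m\<^sup>2)"
        by (rule entropy_gap_le_quadratic[unfolded entropy_gap_def]) fact+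
      also have "\<dots> \<le> (h * (p \<bullet> y)\<^sup>2 + h * sqrt h * (c\<^sup>2 * T ^ 3)) / (2 * m) + (h * sqrt h * c ^ 3 * T ^ 3) / (2 * m\<^sup>2)"
        using square cube m by (intro add_mono divide_right_mono) auto
      also have "\<dots> = h / (2 * m) * (p \<bullet> y)\<^sup>2 + ((h * sqrt h * (c\<^sup>2 * T ^ 3)) / (2 * m) + (h * sqrt h * c ^ 3 * T ^ 3) / (2 * m\<^sup>2))"
        by (simp add: add_divide_distrib)
      also have "(h * sqrt h * (c\<^sup>2 * T ^ 3)) / (2 * m) + (h * sqrt h * c ^ 3 * T ^ 3) / (2 * m\<^sup>2)
          \<le> (h * sqrt h * (c\<^sup>2 * T ^ 3)) / (2 * \<epsilon>) + (h * sqrt h * c ^ 3 * T ^ 3) / (2 * \<epsilon>\<^sup>2)"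
        using m t(6) h c T by (intro add_mono divide_left_mono) (auto intro!: power_mono mult_nonneg_nonneg)
      also have "\<dots> = h * sqrt h * w * T ^ 3" by (simp add: w_def e field_simps)
      also have "T ^ 3 = (1 + norm y) ^ 6" by (simp add: T_def power_mult[symmetric])
      finally show ?thesis by simp
    qed
    have iv: "integrable ?N v" "integrable ?N (\<lambda>y. v y * ln (v y))"
      unfolding v_def using sc[OF bb(1)] sc[OF bb(3)] by auto
    have "heat h (\<lambda>x. F x * ln (F x)) x - m * ln m = (\<integral>y. v y * ln (v y) - v y * ln m - v y + m \<partial>?N)"
    proof -
      have "heat h (\<lambda>x. F x * ln (F x)) x = (\<integral>y. v y * ln (v y) \<partial>?N)"
        unfolding v_def by (rule heat_scale) (use h in auto)
      moreover have "m = (\<integral>y. v y \<partial>?N)" by (simp add: m_eq v_def)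
      ultimately show ?thesis using iv by (simp add: prob_space[unfolded space_gaussian])
    qed
    also have "\<dots> \<le> (\<integral>y. h / (2 * m) * (p \<bullet> y)\<^sup>2 + h * sqrt h * w * (1 + norm y) ^ 6 \<partial>?N)"
      using iv int6 by (intro integral_mono ptw Bochner_Integration.integrable_add integrable_mult_right
          Bochner_Integration.integrable_diff integrable_gaussian_inner2) auto
    also have "\<dots> = h / (2 * m) * (\<integral>y. (p \<bullet> y)\<^sup>2 \<partial>?N) + h * sqrt h * C"
      using int6 by (simp add: integrable_gaussian_inner2 C_def)
    also have "\<dots> \<le> h / (2 * m) * (norm p)\<^sup>2 + h * sqrt h * C"
      using h m by (intro add_mono mult_left_mono gaussian_variance_le) auto
    finally show "heat h (\<lambda>x. F x * ln (F x)) x - heat h F x * ln (heat h F x)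
      \<le> h / 2 * ((norm (heat h G x))\<^sup>2 / heat h F x) + h * sqrt h * C"
      by (simp add: m_def p_def)
  qed
qed

text \<open>With \<open>h = T / n\<close>, induction on the number of steps gives the inequality at time \<open>k * h\<close> with an error
\<open>k * h * sqrt h * C\<close>: the heat semigroup is applied to the inequality at time \<open>k * h\<close>, and the entropy of
one more step is added. At time \<open>T\<close> the total error \<open>T * C * sqrt (T / n)\<close> vanishes as \<open>n\<close> grows.\<close>

theorem log_sobolev_tame:
  assumes tame: "tame \<epsilon> B L F (G :: 'a::euclidean_space \<Rightarrow> 'a)" and T: "0 < T"
  shows "heat T (\<lambda>x. F x * ln (F x)) x - heat T F x * ln (heat T F x)
    \<le> T / 2 * heat T (\<lambda>x. (norm (G x))\<^sup>2 / F x) x"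
proof -
  obtain C where C: "0 \<le> C" "\<And>F G h x. tame \<epsilon> B L F (G :: 'a \<Rightarrow> 'a) \<Longrightarrow> 0 < h \<Longrightarrow> h \<le> 1 \<Longrightarrow>
    heat h (\<lambda>x. F x * ln (F x)) x - heat h F x * ln (heat h F x)
      \<le> h / 2 * ((norm (heat h G x))\<^sup>2 / heat h F x) + h * sqrt h * C"
    using heat_entropy_one_step[of \<epsilon> B L, where ?'a = 'a] by blast
  define Psi where "Psi x = F x * ln (F x)" for x
  define Q where "Q x = (norm (G x))\<^sup>2 / F x" for x
  note bb = tame_bounded_borel[OF tame, folded Psi_def Q_def]
  have steps: "heat (real (Suc k) * h) Psi x - heat (real (Suc k) * h) F x * ln (heat (real (Suc k) * h) F x)
      \<le> real (Suc k) * h / 2 * heat (real (Suc k) * h) Q x + real (Suc k) * (h * sqrt h * C)"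
    if h: "0 < h" "h \<le> 1" for h k x
  proof (induction k arbitrary: x)
    case 0
    have "h / 2 * ((norm (heat h G x))\<^sup>2 / heat h F x) \<le> h / 2 * heat h Q x"
      using heat_jensen_fisher[OF tame h(1)] h unfolding Q_def by (intro mult_left_mono) auto
    then have "heat h Psi x - heat h F x * ln (heat h F x) \<le> h / 2 * heat h Q x + h * sqrt h * C"
      using C(2)[OF tame h, of x, folded Psi_def] by linarith
    then show ?case by simp
  next
    case (Suc k)
    define a where "a = real (Suc k) * h"
    have a: "0 < a" "real (Suc (Suc k)) * h = h + a" using h by (auto simp: a_def algebra_simps add_pos_nonneg)
    have ha: "0 < h + a" using a(1) h by simp
    define Fa where "Fa = heat a F"
    define Ga where "Ga = heat a G"
    have tame_a: "tame \<epsilon> B L Fa Ga" unfolding Fa_def Ga_def by (rule tame_heat) (use tame a in auto)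
    note ba = tame_bounded_borel[OF tame_a]
    have semi: "heat h Fa x = heat (h + a) F x" "heat h Ga x = heat (h + a) G x"
      "heat h (heat a Psi) x = heat (h + a) Psi x" "heat h (heat a Q) x = heat (h + a) Q x"
      unfolding Fa_def Ga_def using h a bb by (auto intro!: heat_semigroup)
    interpret prob_space "gaussian h :: 'a measure" by (rule prob_space_gaussian) fact
    note [simp] = ba(3)[THEN integrable_heat, OF \<open>0 < h\<close>]
      heat_bounded_borel[OF a(1) bb(3), THEN integrable_heat, OF \<open>0 < h\<close>]
      heat_bounded_borel[OF a(1) bb(4), THEN integrable_heat, OF \<open>0 < h\<close>]
    define D where "D = real (Suc k) * (h * sqrt h * C)"
    have "heat (h + a) Psi x = (\<integral>y. heat a Psi (x + y) \<partial>gaussian h)"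
      unfolding semi(3)[symmetric] by (simp add: heat_def[of h])
    also have "\<dots> \<le> (\<integral>y. Fa (x + y) * ln (Fa (x + y)) + a / 2 * heat a Q (x + y) + D \<partial>gaussian h)"
    proof (rule integral_mono)
      fix y show "heat a Psi (x + y) \<le> Fa (x + y) * ln (Fa (x + y)) + a / 2 * heat a Q (x + y) + D"
        using Suc.IH[of "x + y"] unfolding a_def[symmetric] D_def Fa_def by simp
    qed auto
    also have "\<dots> = heat h (\<lambda>x. Fa x * ln (Fa x)) x + a / 2 * heat (h + a) Q x + D"
      unfolding semi(4)[symmetric] by (simp add: heat_def[of h] prob_space[unfolded space_gaussian])
    also have "heat h (\<lambda>x. Fa x * ln (Fa x)) x \<le> heat h Fa x * ln (heat h Fa x)
        + h / 2 * ((norm (heat h Ga x))\<^sup>2 / heat h Fa x) + h * sqrt h * C"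
      using C(2)[OF tame_a h, of x] by simp
    also have "(norm (heat h Ga x))\<^sup>2 / heat h Fa x \<le> heat (h + a) Q x"
      unfolding semi Q_def by (rule heat_jensen_fisher[OF tame ha])
    finally have "heat (h + a) Psi x \<le> heat (h + a) F x * ln (heat (h + a) F x) + h / 2 * heat (h + a) Q x + h * sqrt h * C
        + a / 2 * heat (h + a) Q x + D"
      using h unfolding semi by simp
    then show ?case unfolding a(2) D_def by (simp add: field_simps)
  qed
  have bound: "heat T Psi x - heat T F x * ln (heat T F x) \<le> T / 2 * heat T Q x + T * C * sqrt (T / real (Suc k))"
    if "T \<le> real (Suc k)" for k
  proof -
    have "0 < T / real (Suc k)" "T / real (Suc k) \<le> 1" "real (Suc k) * (T / real (Suc k)) = T"
      using T that by (auto simp: field_simps)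
    note steps[OF this(1,2), of k x, unfolded this(3)]
    moreover have "real (Suc k) * (T / real (Suc k) * sqrt (T / real (Suc k)) * C) = T * C * sqrt (T / real (Suc k))"
      by (simp add: field_simps)
    ultimately show ?thesis by (simp only:)
  qed
  have "(\<lambda>k. T / 2 * heat T Q x + T * C * sqrt (T / real (Suc k))) \<longlonglongrightarrow> T / 2 * heat T Q x + T * C * sqrt 0"
    by (intro tendsto_intros LIMSEQ_Suc lim_const_over_n)
  then have "heat T Psi x - heat T F x * ln (heat T F x) \<le> T / 2 * heat T Q x + T * C * sqrt 0"
  proof (rule tendsto_lowerbound)
    obtain k0 where "T \<le> real k0" using real_arch_simple by blast
    then show "\<forall>\<^sub>F k in sequentially. heat T Psi x - heat T F x * ln (heat T F x) \<le> T / 2 * heat T Q x + T * C * sqrt (T / real (Suc k))"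
      unfolding eventually_sequentially by (intro exI[of _ k0] allI impI bound) auto
  qed simp
  then show ?thesis by (simp add: Psi_def[abs_def] Q_def[abs_def])
qed

section \<open>Mollification by the heat semigroup in \<open>L\<^sup>1\<close>\<close>

lemma integrable_cball_const: "integrable lborel (\<lambda>x::'a::euclidean_space. indicator (cball 0 r) x * (c::real))"
  using emeasure_bounded_finite[of "cball (0::'a) r"]
  by (intro integrable_mult_left integrable_real_indicator) auto

text \<open>Truncate \<open>f\<close> in its argument and in its value, take continuous functions that converge almost
everywhere to the truncation, and force the same truncation on them by a retraction onto a ball and a
cutoff, so that dominated convergence applies.\<close>

lemma integrable_approx_continuous:
  fixes f :: "'a::euclidean_space \<Rightarrow> 'b::euclidean_space"
  assumes f: "integrable lborel f" and e: "0 < e"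
  obtains h R where "continuous_on UNIV h" "\<And>x. norm x > R \<Longrightarrow> h x = 0" "integrable lborel h"
    "(\<integral>x. norm (f x - h x) \<partial>lborel) < e"
proof -
  have [measurable]: "f \<in> borel_measurable borel" using f by auto
  define fk where "fk k x = (if norm x \<le> real k \<and> norm (f x) \<le> real k then f x else 0)" for k x
  have [measurable]: "fk k \<in> borel_measurable borel" for k unfolding fk_def[abs_def] by measurable
  have "(\<lambda>k. \<integral>x. norm (f x - fk k x) \<partial>lborel) \<longlonglongrightarrow> (\<integral>x. 0 \<partial>(lborel :: 'a measure))"
  proof (rule integral_dominated_convergence[where w = "\<lambda>x. norm (f x)"])
    show "AE x in lborel. (\<lambda>k. norm (f x - fk k x)) \<longlonglongrightarrow> 0"
    proof (rule AE_I2)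
      fix x
      obtain k0 where "norm x + norm (f x) \<le> real k0" using real_arch_simple by blast
      then have "\<forall>k\<ge>k0. norm (f x - fk k x) = 0"
      proof (intro allI impI)
        fix k assume "norm x + norm (f x) \<le> real k0" "k0 \<le> k"
        then have "norm x + norm (f x) \<le> real k" using of_nat_mono[of k0 k, where 'a = real] by linarith
        then have "norm x \<le> real k" "norm (f x) \<le> real k"
          using norm_ge_zero[of x] norm_ge_zero[of "f x"] by linarith+
        then show "norm (f x - fk k x) = 0" by (simp add: fk_def)
      qed
      then show "(\<lambda>k. norm (f x - fk k x)) \<longlonglongrightarrow> 0"
        by (intro tendsto_eventually) (auto simp: eventually_sequentially)
    qed
    show "AE x in lborel. norm (norm (f x - fk k x)) \<le> norm (f x)" for k
      by (auto simp: fk_def)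
  qed (use f in auto)
  then have "\<forall>\<^sub>F k in sequentially. (\<integral>x. norm (f x - fk k x) \<partial>lborel) < e / 2"
    using e by (intro order_tendstoD) auto
  then obtain k0 where k0: "\<And>k. k \<ge> k0 \<Longrightarrow> (\<integral>x. norm (f x - fk k x) \<partial>lborel) < e / 2"
    by (auto simp: eventually_sequentially)
  define k where "k = Suc k0"
  have k: "(\<integral>x. norm (f x - fk k x) \<partial>lborel) < e / 2" "0 < real k"
    using k0[of k] by (auto simp: k_def)
  have fk_int: "integrable lborel (fk k)"
    by (rule Bochner_Integration.integrable_bound[OF f]) (auto simp: fk_def)
  have "fk k measurable_on UNIV"
    by (rule lebesgue_measurable_imp_measurable_on) (auto intro: measurable_completion)
  then obtain N g where N: "negligible N" and g: "\<And>n. continuous_on UNIV (g n)"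
    and lim: "\<And>x. x \<notin> N \<Longrightarrow> (\<lambda>n. g n x) \<longlonglongrightarrow> fk k x"
    unfolding measurable_on_def by auto
  \<comment> \<open>The radial retraction onto the ball of radius \<open>k\<close>.\<close>
  define \<rho> where "\<rho> z = (real k / max (real k) (norm z)) *\<^sub>R z" for z :: 'b
  have \<rho>: "norm (\<rho> z) \<le> real k" for z
    using k(2) by (auto simp: \<rho>_def max_def field_simps)
  have \<rho>_id: "\<rho> z = z" if "norm z \<le> real k" for z using that k(2) by (simp add: \<rho>_def)
  have \<rho>_cont: "continuous_on UNIV \<rho>"
    unfolding \<rho>_def[abs_def] using k(2) by (intro continuous_intros) (auto simp: max_def)
  define ct where "ct x = max 0 (min 1 (real k + 1 - norm x))" for x :: 'a
  have ct_cont: "continuous_on UNIV ct" unfolding ct_def[abs_def] by (intro continuous_intros)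
  define h where "h n x = ct x *\<^sub>R \<rho> (g n x)" for n x
  have h_cont: "continuous_on UNIV (h n)" for n
    unfolding h_def[abs_def]
    by (intro continuous_on_scaleR ct_cont continuous_on_compose2[OF \<rho>_cont g]) auto
  then have [measurable]: "h n \<in> borel_measurable borel" for n by (rule borel_measurable_continuous_onI)
  have h_out: "h n x = 0" if "norm x > real k + 1" for n x using that by (simp add: h_def ct_def)
  define w where "w x = indicator (cball 0 (real k + 1)) x *\<^sub>R real k" for x :: 'a
  have w_int: "integrable lborel w" unfolding w_def
    using integrable_cball_const[of "real k + 1" "real k"] by simp
  have h_w: "norm (h n x) \<le> w x" for n x
  proof (cases "norm x > real k + 1")
    case False
    have "norm (h n x) = ct x * norm (\<rho> (g n x))" by (simp add: h_def ct_def)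
    also have "\<dots> \<le> 1 * real k" using \<rho> by (intro mult_mono) (auto simp: ct_def)
    finally show ?thesis using False by (simp add: w_def)
  qed (simp add: h_out w_def)
  have h_int: "integrable lborel (h n)" for n
    by (rule Bochner_Integration.integrable_bound[OF w_int])
       (use h_w in \<open>auto intro: order_trans[OF _ abs_ge_self]\<close>)
  have "(\<lambda>n. \<integral>x. norm (fk k x - h n x) \<partial>lborel) \<longlonglongrightarrow> (\<integral>x. 0 \<partial>(lborel :: 'a measure))"
  proof (rule integral_dominated_convergence[where w = "\<lambda>x. norm (fk k x) + w x"])
    have "AE x in lebesgue. x \<notin> N" using N unfolding negligible_iff_null_sets by (rule AE_not_in)
    then have "AE x in lborel. x \<notin> N" by (simp add: AE_completion_iff)
    then show "AE x in lborel. (\<lambda>n. norm (fk k x - h n x)) \<longlonglongrightarrow> 0"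
    proof eventually_elim
      case (elim x)
      have "(\<lambda>n. \<rho> (g n x)) \<longlonglongrightarrow> \<rho> (fk k x)"
        using lim[OF elim] \<rho>_cont by (intro continuous_on_tendsto_compose[OF \<rho>_cont]) auto
      then have "(\<lambda>n. norm (fk k x - h n x)) \<longlonglongrightarrow> norm (fk k x - ct x *\<^sub>R \<rho> (fk k x))"
        unfolding h_def by (intro tendsto_intros)
      moreover have "ct x *\<^sub>R \<rho> (fk k x) = fk k x"
      proof (cases "norm x \<le> real k")
        case True
        then have "ct x = 1" by (simp add: ct_def)
        then show ?thesis using \<rho>_id[of "fk k x"] by (simp add: fk_def)
      qed (simp add: fk_def \<rho>_def)
      ultimately show ?case by simp
    qed
    show "AE x in lborel. norm (norm (fk k x - h n x)) \<le> norm (fk k x) + w x" for n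
    proof (rule AE_I2)
      fix x
      have "norm (fk k x - h n x) \<le> norm (fk k x) + norm (h n x)" by (rule norm_triangle_ineq4)
      then show "norm (norm (fk k x - h n x)) \<le> norm (fk k x) + w x" using h_w[of n x] by simp
    qed
  qed (use fk_int w_int in auto)
  then have "\<forall>\<^sub>F n in sequentially. (\<integral>x. norm (fk k x - h n x) \<partial>lborel) < e / 2"
    using e by (intro order_tendstoD) auto
  then obtain n where n: "(\<integral>x. norm (fk k x - h n x) \<partial>lborel) < e / 2"
    by (auto simp: eventually_sequentially)
  have "(\<integral>x. norm (f x - h n x) \<partial>lborel) \<le> (\<integral>x. norm (f x - fk k x) + norm (fk k x - h n x) \<partial>lborel)"
  proof (rule integral_mono)
    fix x
    show "norm (f x - h n x) \<le> norm (f x - fk k x) + norm (fk k x - h n x)"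
      using norm_triangle_ineq[of "f x - fk k x" "fk k x - h n x"] by simp
  qed (use f fk_int h_int in auto)
  also have "\<dots> < e" using f fk_int h_int k n by simp
  finally show ?thesis using that[of "h n"] h_cont h_out h_int by blast
qed

lemma gauss_le: "0 < s \<Longrightarrow> gauss s (x :: 'a::euclidean_space) \<le> (1 / sqrt (2 * pi * s)) ^ DIM('a)"
  by (simp add: gauss_eq mult_left_le)

lemma integrable_heat_L1:
  fixes f :: "'a::euclidean_space \<Rightarrow> 'b::euclidean_space"
  assumes "integrable lborel f" "0 < s"
  shows "integrable (gaussian s) (\<lambda>y. f (x + y))"
proof -
  have [measurable]: "f \<in> borel_measurable borel" using assms by auto
  show ?thesis
  proof (subst integrable_gaussian, simp, rule Bochner_Integration.integrable_bound)
    show "integrable lborel (\<lambda>y. (1 / sqrt (2 * pi * s)) ^ DIM('a) *\<^sub>R f (x + y))"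
      using integrable_lborel_translate[OF assms(1)] by simp
    show "AE y in lborel. norm (gauss s y *\<^sub>R f (x + y)) \<le> norm ((1 / sqrt (2 * pi * s)) ^ DIM('a) *\<^sub>R f (x + y))"
      using gauss_le[OF assms(2), where 'a = 'a] assms(2) by (intro AE_I2) (simp add: mult_right_mono)
  qed simp
qed

lemma heat_eq_convolution:
  fixes f :: "'a::euclidean_space \<Rightarrow> 'b::euclidean_space"
  assumes [measurable]: "f \<in> borel_measurable borel"
  shows "heat s f x = (\<integral>u. gauss s (u - x) *\<^sub>R f u \<partial>lborel)"
  unfolding heat_def
  using integral_lborel_translate[of "\<lambda>u. gauss s (u - x) *\<^sub>R f u" x] by (simp add: integral_gaussian)

lemma heat_measurable [measurable]:
  fixes f :: "'a::euclidean_space \<Rightarrow> 'b::euclidean_space"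
  assumes [measurable]: "f \<in> borel_measurable borel" and "0 < s"
  shows "heat s f \<in> borel_measurable borel"
proof -
  interpret prob_space "gaussian s :: 'a measure" by (rule prob_space_gaussian) fact
  show ?thesis unfolding heat_def[abs_def] by measurable
qed

lemma norm_integral_le_nn_integral:
  fixes f :: "'z \<Rightarrow> 'b::euclidean_space"
  shows "ennreal (norm (\<integral>z. f z \<partial>M)) \<le> (\<integral>\<^sup>+z. norm (f z) \<partial>M)"
  by (cases "integrable M f") (auto simp: integral_norm_bound_ennreal not_integrable_integral_eq)

lemma nn_integral_norm_heat_le:
  fixes f :: "'a::euclidean_space \<Rightarrow> 'b::euclidean_space"
  assumes [measurable]: "f \<in> borel_measurable borel" and s: "0 < s"
  shows "(\<integral>\<^sup>+x. norm (heat s f x) \<partial>lborel) \<le> (\<integral>\<^sup>+x. norm (f x) \<partial>lborel)"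
proof -
  interpret G: prob_space "gaussian s :: 'a measure" by (rule prob_space_gaussian) fact
  interpret P: pair_sigma_finite "gaussian s :: 'a measure" "lborel :: 'a measure" ..
  have "(\<integral>\<^sup>+x. norm (heat s f x) \<partial>lborel) \<le> (\<integral>\<^sup>+x. (\<integral>\<^sup>+y. norm (f (x + y)) \<partial>gaussian s) \<partial>lborel)"
    unfolding heat_def by (intro nn_integral_mono norm_integral_le_nn_integral)
  also have "\<dots> = (\<integral>\<^sup>+y. (\<integral>\<^sup>+x. norm (f (x + y)) \<partial>lborel) \<partial>gaussian s)"
    by (rule P.Fubini') measurable
  also have "\<dots> = (\<integral>\<^sup>+y. (\<integral>\<^sup>+x. norm (f x) \<partial>lborel) \<partial>(gaussian s :: 'a measure))"
    using nn_integral_lborel_translate[of "\<lambda>x. ennreal (norm (f x))"] by (simp add: add.commute)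
  also have "\<dots> = (\<integral>\<^sup>+x. norm (f x) \<partial>lborel)" by (simp add: G.emeasure_space_1[unfolded space_gaussian])
  finally show ?thesis .
qed

lemma heat_L1:
  fixes f :: "'a::euclidean_space \<Rightarrow> 'b::euclidean_space"
  assumes f: "integrable lborel f" and s: "0 < s"
  shows "integrable lborel (heat s f)" "(\<integral>x. norm (heat s f x) \<partial>lborel) \<le> (\<integral>x. norm (f x) \<partial>lborel)"
proof -
  have [measurable]: "f \<in> borel_measurable borel" using f by auto
  note le = nn_integral_norm_heat_le[OF this s]
  have fin: "(\<integral>\<^sup>+x. norm (f x) \<partial>lborel) = ennreal (\<integral>x. norm (f x) \<partial>lborel)"
    using f by (intro nn_integral_eq_integral) auto
  show i: "integrable lborel (heat s f)"
    by (rule integrableI_bounded) (use s le fin in \<open>auto intro: le_less_trans\<close>)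
  have "ennreal (\<integral>x. norm (heat s f x) \<partial>lborel) = (\<integral>\<^sup>+x. norm (heat s f x) \<partial>lborel)"
    using i by (intro nn_integral_eq_integral[symmetric]) auto
  then have "ennreal (\<integral>x. norm (heat s f x) \<partial>lborel) \<le> ennreal (\<integral>x. norm (f x) \<partial>lborel)"
    using le unfolding fin by simp
  then show "(\<integral>x. norm (heat s f x) \<partial>lborel) \<le> (\<integral>x. norm (f x) \<partial>lborel)"
    by (subst (asm) ennreal_le_iff) auto
qed

text \<open>The left-hand side is at most the Gaussian mean of the \<open>L\<^sup>1\<close> modulus of continuity
\<open>\<omega> (sqrt (\<delta> n) * y)\<close>. This modulus is bounded and tends to 0 at 0.\<close>

lemma heat_tendsto_L1_continuous:
  fixes h :: "'a::euclidean_space \<Rightarrow> 'b::euclidean_space"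
  assumes h: "continuous_on UNIV h" "\<And>x. norm x > R \<Longrightarrow> h x = 0" "integrable lborel h"
    and \<delta>: "\<delta> \<longlonglongrightarrow> 0" "\<And>n. 0 < \<delta> n"
  shows "(\<lambda>n. \<integral>x. norm (heat (\<delta> n) h x - h x) \<partial>lborel) \<longlonglongrightarrow> 0"
proof -
  let ?N = "gaussian 1 :: 'a measure"
  interpret G: prob_space ?N by (rule prob_space_gaussian) simp
  interpret P: pair_sigma_finite ?N "lborel :: 'a measure" ..
  have [measurable]: "h \<in> borel_measurable borel" using h by auto
  have "compact (cball 0 R :: 'a set)" by simp
  then have "bounded (h ` cball 0 R)" by (intro compact_imp_bounded compact_continuous_image continuous_on_subset[OF h(1)]) auto
  then obtain M0 where M0: "\<And>x. x \<in> cball 0 R \<Longrightarrow> norm (h x) \<le> M0" unfolding bounded_iff by blast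
  define M where "M = max 0 M0"
  have M: "norm (h x) \<le> M" for x
    using M0[of x] h(2)[of x] by (cases "norm x \<le> R") (auto simp: M_def)
  define \<omega> where "\<omega> v = (\<integral>x. norm (h (x + v) - h x) \<partial>lborel)" for v
  have trans: "integrable lborel (\<lambda>x. h (x + v))" for v
    using integrable_lborel_translate[OF h(3), of v] by (simp add: add.commute)
  have om_int: "integrable lborel (\<lambda>x. norm (h (x + v) - h x))" for v using trans h(3) by auto
  have om_bound: "\<omega> v \<le> 2 * (\<integral>x. norm (h x) \<partial>lborel)" for v
  proof -
    have "\<omega> v \<le> (\<integral>x. norm (h (x + v)) + norm (h x) \<partial>lborel)"
      unfolding \<omega>_def using trans h(3) by (intro integral_mono norm_triangle_ineq4) auto
    also have "\<dots> = 2 * (\<integral>x. norm (h x) \<partial>lborel)"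
    proof -
      have "(\<integral>x. norm (h (x + v)) \<partial>lborel) = (\<integral>x. norm (h x) \<partial>lborel)"
        using integral_lborel_translate[of "\<lambda>x. norm (h x)" v] by (simp add: add.commute)
      then show ?thesis using trans h(3) by simp
    qed
    finally show ?thesis .
  qed
  have om_nonneg: "0 \<le> \<omega> v" for v by (simp add: \<omega>_def)
  have [measurable]: "\<omega> \<in> borel_measurable borel" unfolding \<omega>_def[abs_def] by measurable
  have om_lim: "(\<lambda>n. \<omega> (v n)) \<longlonglongrightarrow> 0" if v: "v \<longlonglongrightarrow> 0" for v
  proof -
    have "\<forall>\<^sub>F n in sequentially. norm (v n) < 1" using tendsto_norm[OF v] by (intro order_tendstoD) auto
    then obtain n0 where n0: "\<And>n. n \<ge> n0 \<Longrightarrow> norm (v n) < 1" by (auto simp: eventually_sequentially)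
    have "(\<lambda>n. \<omega> (v (n + n0))) \<longlonglongrightarrow> (\<integral>x. 0 \<partial>(lborel :: 'a measure))"
      unfolding \<omega>_def
    proof (rule integral_dominated_convergence[where w = "\<lambda>x. indicator (cball 0 (R + 1)) x * (2 * M)"])
      show "integrable lborel (\<lambda>x::'a. indicator (cball 0 (R + 1)) x * (2 * M))"
        by (rule integrable_cball_const)
      show "AE x in lborel. (\<lambda>n. norm (h (x + v (n + n0)) - h x)) \<longlonglongrightarrow> 0"
      proof (rule AE_I2)
        fix x
        have "(\<lambda>n. x + v (n + n0)) \<longlonglongrightarrow> x + 0" by (intro tendsto_intros LIMSEQ_ignore_initial_segment v)
        then have "(\<lambda>n. h (x + v (n + n0))) \<longlonglongrightarrow> h x"
          using continuous_on_tendsto_compose[OF h(1), of "\<lambda>n. x + v (n + n0)" x] by simp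
        then show "(\<lambda>n. norm (h (x + v (n + n0)) - h x)) \<longlonglongrightarrow> 0"
          by (simp add: tendsto_norm_zero_iff LIM_zero_iff)
      qed
      fix n
      show "AE x in lborel. norm (norm (h (x + v (n + n0)) - h x)) \<le> indicator (cball 0 (R + 1)) x * (2 * M)"
      proof (rule AE_I2)
        fix x
        have vn: "norm (v (n + n0)) < 1" by (rule n0) simp
        show "norm (norm (h (x + v (n + n0)) - h x)) \<le> indicator (cball 0 (R + 1)) x * (2 * M)"
        proof (cases "norm x \<le> R + 1")
          case True
          then show ?thesis using norm_triangle_ineq4[of "h (x + v (n + n0))" "h x"] M[of x] M[of "x + v (n + n0)"] by simp
        next
          case False
          then have "norm (x + v (n + n0)) > R" using vn norm_diff_triangle_ineq[of x "v (n+n0)" 0 "v (n + n0)"]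
            norm_triangle_ineq2[of x "- v (n + n0)"] by simp
          then show ?thesis using False h(2) by simp
        qed
      qed
    qed auto
    then show ?thesis by (simp add: LIMSEQ_offset)
  qed
  have bound: "(\<integral>x. norm (heat (\<delta> n) h x - h x) \<partial>lborel) \<le> (\<integral>y. \<omega> (sqrt (\<delta> n) *\<^sub>R y) \<partial>?N)" for n
  proof -
    note d = \<delta>(2)[of n]
    have fin: "(\<integral>\<^sup>+y. ennreal (\<omega> (sqrt (\<delta> n) *\<^sub>R y)) \<partial>?N) = ennreal (\<integral>y. \<omega> (sqrt (\<delta> n) *\<^sub>R y) \<partial>?N)"
      using om_bound om_nonneg
      by (intro nn_integral_eq_integral G.integrable_const_bound[where B = "2 * (\<integral>x. norm (h x) \<partial>lborel)"]) auto
    have diff: "heat (\<delta> n) h x - h x = (\<integral>y. h (x + sqrt (\<delta> n) *\<^sub>R y) - h x \<partial>?N)" for x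
      using d M by (subst Bochner_Integration.integral_diff)
        (auto simp: heat_scale G.prob_space[unfolded space_gaussian] intro!: G.integrable_const_bound[where B = M])
    have "(\<integral>\<^sup>+x. norm (heat (\<delta> n) h x - h x) \<partial>lborel) \<le> (\<integral>\<^sup>+x. (\<integral>\<^sup>+y. norm (h (x + sqrt (\<delta> n) *\<^sub>R y) - h x) \<partial>?N) \<partial>lborel)"
      unfolding diff by (intro nn_integral_mono norm_integral_le_nn_integral)
    also have "\<dots> = (\<integral>\<^sup>+y. (\<integral>\<^sup>+x. norm (h (x + sqrt (\<delta> n) *\<^sub>R y) - h x) \<partial>lborel) \<partial>?N)"
      by (rule P.Fubini') measurable
    also have "\<dots> = (\<integral>\<^sup>+y. ennreal (\<omega> (sqrt (\<delta> n) *\<^sub>R y)) \<partial>?N)"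
      unfolding \<omega>_def by (intro nn_integral_cong nn_integral_eq_integral om_int) auto
    finally have "(\<integral>\<^sup>+x. norm (heat (\<delta> n) h x - h x) \<partial>lborel) \<le> ennreal (\<integral>y. \<omega> (sqrt (\<delta> n) *\<^sub>R y) \<partial>?N)"
      unfolding fin .
    moreover have "(\<integral>\<^sup>+x. norm (heat (\<delta> n) h x - h x) \<partial>lborel) = ennreal (\<integral>x. norm (heat (\<delta> n) h x - h x) \<partial>lborel)"
      using heat_L1(1)[OF h(3) d] h(3) by (intro nn_integral_eq_integral) auto
    ultimately show ?thesis using om_nonneg by (simp add: ennreal_le_iff)
  qed
  have "(\<lambda>n. \<integral>y. \<omega> (sqrt (\<delta> n) *\<^sub>R y) \<partial>?N) \<longlonglongrightarrow> (\<integral>y. 0 \<partial>?N)"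
  proof (rule integral_dominated_convergence[where w = "\<lambda>_. 2 * (\<integral>x. norm (h x) \<partial>lborel)"])
    show "AE y in ?N. (\<lambda>n. \<omega> (sqrt (\<delta> n) *\<^sub>R y)) \<longlonglongrightarrow> 0"
    proof (rule AE_I2)
      fix y :: 'a
      have "(\<lambda>n. sqrt (\<delta> n) *\<^sub>R y) \<longlonglongrightarrow> sqrt 0 *\<^sub>R y" by (intro tendsto_intros \<delta>)
      then show "(\<lambda>n. \<omega> (sqrt (\<delta> n) *\<^sub>R y)) \<longlonglongrightarrow> 0" by (intro om_lim) simp
    qed
    show "AE y in ?N. norm (\<omega> (sqrt (\<delta> n) *\<^sub>R y)) \<le> 2 * (\<integral>x. norm (h x) \<partial>lborel)" for n
      using om_bound om_nonneg by auto
  qed auto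
  then have "(\<lambda>n. \<integral>y. \<omega> (sqrt (\<delta> n) *\<^sub>R y) \<partial>?N) \<longlonglongrightarrow> 0" by simp
  then show ?thesis
    by (rule tendsto_sandwich[OF _ _ tendsto_const, rotated 2]) (use bound in auto)
qed

text \<open>Density of continuous functions of compact support, since the heat semigroup is a contraction in
\<open>L\<^sup>1\<close>.\<close>

lemma heat_tendsto_L1:
  fixes f :: "'a::euclidean_space \<Rightarrow> 'b::euclidean_space"
  assumes f: "integrable lborel f" and \<delta>: "\<delta> \<longlonglongrightarrow> 0" "\<And>n. 0 < \<delta> n"
  shows "(\<lambda>n. \<integral>x. norm (heat (\<delta> n) f x - f x) \<partial>lborel) \<longlonglongrightarrow> 0"
proof (rule LIMSEQ_I)
  fix e :: real assume "0 < e"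
  then have e: "0 < e / 3" by simp
  obtain h R where h: "continuous_on UNIV h" "\<And>x. norm x > R \<Longrightarrow> h x = 0" "integrable lborel h"
    "(\<integral>x. norm (f x - h x) \<partial>lborel) < e / 3"
    using integrable_approx_continuous[OF f e] by blast
  have "\<forall>\<^sub>F n in sequentially. (\<integral>x. norm (heat (\<delta> n) h x - h x) \<partial>lborel) < e / 3"
    using heat_tendsto_L1_continuous[OF h(1-3) \<delta>] e by (intro order_tendstoD) auto
  then obtain n0 where n0: "\<And>n. n \<ge> n0 \<Longrightarrow> (\<integral>x. norm (heat (\<delta> n) h x - h x) \<partial>lborel) < e / 3"
    by (auto simp: eventually_sequentially)
  show "\<exists>n0. \<forall>n\<ge>n0. norm ((\<integral>x. norm (heat (\<delta> n) f x - f x) \<partial>lborel) - 0) < e"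
  proof (intro exI[of _ n0] allI impI)
    fix n assume n: "n \<ge> n0"
    note d = \<delta>(2)[of n]
    have fh: "integrable lborel (\<lambda>x. f x - h x)" using f h by auto
    note i = heat_L1(1)[OF f d] heat_L1(1)[OF h(3) d] heat_L1(1)[OF fh d] f h(3) fh
    have diff: "heat (\<delta> n) f x - f x = heat (\<delta> n) (\<lambda>x. f x - h x) x + (heat (\<delta> n) h x - h x) + (h x - f x)" for x
      unfolding heat_def using integrable_heat_L1[OF f d] integrable_heat_L1[OF h(3) d] by simp
    have "(\<integral>x. norm (heat (\<delta> n) f x - f x) \<partial>lborel)
      \<le> (\<integral>x. norm (heat (\<delta> n) (\<lambda>x. f x - h x) x) + norm (heat (\<delta> n) h x - h x) + norm (f x - h x) \<partial>lborel)"
    proof (rule integral_mono)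
      fix x
      show "norm (heat (\<delta> n) f x - f x) \<le> norm (heat (\<delta> n) (\<lambda>x. f x - h x) x) + norm (heat (\<delta> n) h x - h x) + norm (f x - h x)"
        unfolding diff norm_minus_commute[of "f x" "h x"]
        by (intro order_trans[OF norm_triangle_ineq] add_right_mono norm_triangle_ineq)
    qed (use i in auto)
    also have "\<dots> = (\<integral>x. norm (heat (\<delta> n) (\<lambda>x. f x - h x) x) \<partial>lborel) + (\<integral>x. norm (heat (\<delta> n) h x - h x) \<partial>lborel) + (\<integral>x. norm (f x - h x) \<partial>lborel)"
      using i by simp
    also have "\<dots> < e / 3 + e / 3 + e / 3"
      using heat_L1(2)[OF fh d] n0[OF n] h(4) by linarith
    finally show "norm ((\<integral>x. norm (heat (\<delta> n) f x - f x) \<partial>lborel) - 0) < e" by simp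
  qed
qed

section \<open>Integration by parts and the Gaussian kernel\<close>

text \<open>By translation invariance all difference quotients of \<open>u\<close> have integral 0, and they converge
boundedly to the directional derivatives.\<close>

lemma integral_gradient_eq_0:
  fixes u :: "'a::euclidean_space \<Rightarrow> real"
  assumes u: "\<And>x. GDERIV u x :> U x" and U: "continuous_on UNIV U" and R: "\<And>x. norm x > R \<Longrightarrow> u x = 0"
  shows "(\<integral>x. U x \<partial>lborel) = 0" "integrable lborel U"
proof -
  have u_cont: "continuous_on UNIV u" by (rule GDERIV_continuous_on[OF u])
  have [measurable]: "u \<in> borel_measurable borel" "U \<in> borel_measurable borel"
    using u_cont U by (auto intro: borel_measurable_continuous_onI)
  have U0: "U x = 0" if "norm x > R" for x
  proof -
    have "open {x. R < norm (x::'a)}" by (intro open_Collect_less continuous_intros)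
    then have "\<forall>\<^sub>F y in nhds x. norm y > R" using eventually_nhds_in_open[of _ x] that by fastforce
    then have "\<forall>\<^sub>F y in nhds x. u y = 0" by eventually_elim (rule R)
    then have "(u has_derivative (\<lambda>_. 0)) (at x)"
      using has_derivative_transform_eventually[of "\<lambda>_. 0" "\<lambda>_. 0" x UNIV u] that
      by (auto simp: eventually_at_filter eventually_nhds R elim: eventually_mono)
    then have "(\<lambda>h. h \<bullet> U x) = (\<lambda>_. 0)"
      using u[of x] unfolding gderiv_def by (rule has_derivative_unique[rotated])
    then have "U x \<bullet> U x = 0" by metis
    then show ?thesis by simp
  qed
  have "bounded (U ` cball 0 R)"
    by (intro compact_imp_bounded compact_continuous_image continuous_on_subset[OF U]) auto
  then obtain M0 where M0: "\<And>x. x \<in> cball 0 R \<Longrightarrow> norm (U x) \<le> M0" unfolding bounded_iff by blast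
  define M where "M = max 0 M0"
  have M: "norm (U x) \<le> M" for x
    using M0[of x] U0[of x] by (cases "norm x \<le> R") (auto simp: M_def)
  have ind: "integrable lborel (\<lambda>x::'a. indicator (cball 0 r) x * c)" for r and c :: real
    by (rule integrable_cball_const)
  show U_int: "integrable lborel U"
  proof (rule Bochner_Integration.integrable_bound[OF ind[of R M]])
    show "AE x in lborel. norm (U x) \<le> norm (indicator (cball 0 R) x * M)"
      using M U0 by (intro AE_I2) (auto simp: indicator_def intro: order_trans[OF _ abs_ge_self])
  qed simp
  have u_int: "integrable lborel u"
  proof -
    have "bounded (u ` cball 0 R)"
      by (intro compact_imp_bounded compact_continuous_image continuous_on_subset[OF u_cont]) auto
    then obtain K where K: "\<And>x. x \<in> cball 0 R \<Longrightarrow> norm (u x) \<le> K" unfolding bounded_iff by blast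
    show ?thesis
    proof (rule Bochner_Integration.integrable_bound[OF ind[of R K]])
      show "AE x in lborel. norm (u x) \<le> norm (indicator (cball 0 R) x * K)"
        using K R by (intro AE_I2) (force simp: indicator_def)
    qed simp
  qed
  have lip: "\<bar>u (x + v) - u x\<bar> \<le> M * norm v" for x v
  proof -
    have "norm (u (x + v) - u x) \<le> M * norm (x + v - x)"
    proof (rule differentiable_bound[where f' = "\<lambda>x h. h \<bullet> U x" and S = UNIV])
      fix x :: 'a
      show "(u has_derivative (\<lambda>h. h \<bullet> U x)) (at x within UNIV)" using u[of x] by (simp add: gderiv_def)
      show "onorm (\<lambda>h. h \<bullet> U x) \<le> M"
      proof (rule onorm_le)
        fix h show "norm (h \<bullet> U x) \<le> M * norm h"
          using Cauchy_Schwarz_ineq2[of h "U x"] mult_left_mono[OF M[of x], of "norm h"] by (simp add: mult.commute)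
      qed
    qed auto
    then show ?thesis by simp
  qed
  have "(\<integral>x. b \<bullet> U x \<partial>lborel) = 0" if "norm b = 1" for b
  proof -
    define q where "q n x = real (Suc n) * (u (x + (1 / real (Suc n)) *\<^sub>R b) - u x)" for n x
    have [measurable]: "q n \<in> borel_measurable borel" for n unfolding q_def by measurable
    have "(\<lambda>n. \<integral>x. q n x \<partial>lborel) \<longlonglongrightarrow> (\<integral>x. b \<bullet> U x \<partial>lborel)"
    proof (rule integral_dominated_convergence[where w = "\<lambda>x. indicator (cball 0 (R + 1)) x * M"])
      show "AE x in lborel. (\<lambda>n. q n x) \<longlonglongrightarrow> b \<bullet> U x"
      proof (rule AE_I2)
        fix x
        have "((\<lambda>t. u (x + t *\<^sub>R b)) has_derivative (\<lambda>h. (h *\<^sub>R b) \<bullet> U (x + 0 *\<^sub>R b))) (at 0)"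
          by (rule has_derivative_compose[of "\<lambda>t. x + t *\<^sub>R b" _ _ _ u, OF _ u[unfolded gderiv_def]])
             (auto intro!: derivative_eq_intros)
        then have "((\<lambda>t. u (x + t *\<^sub>R b)) has_real_derivative (b \<bullet> U x)) (at 0)"
          unfolding has_field_derivative_def by (simp add: mult_commute_abs)
        then have lim: "((\<lambda>h. (u (x + h *\<^sub>R b) - u x) / h) \<longlongrightarrow> b \<bullet> U x) (at 0)"
          by (simp add: DERIV_def)
        have "filterlim (\<lambda>n. 1 / real (Suc n)) (at 0) sequentially"
          unfolding filterlim_at using LIMSEQ_Suc[OF lim_const_over_n[of 1]] by (simp add: eventually_sequentially)
        from filterlim_compose[OF lim this] show "(\<lambda>n. q n x) \<longlonglongrightarrow> b \<bullet> U x"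
          by (simp add: q_def mult.commute divide_simps)
      qed
      show "AE x in lborel. norm (q n x) \<le> indicator (cball 0 (R + 1)) x * M" for n
      proof (rule AE_I2)
        fix x
        let ?v = "(1 / real (Suc n)) *\<^sub>R b"
        have v: "norm ?v \<le> 1" using that by simp
        show "norm (q n x) \<le> indicator (cball 0 (R + 1)) x * M"
        proof (cases "norm x \<le> R + 1")
          case True
          have "norm (q n x) = real (Suc n) * \<bar>u (x + ?v) - u x\<bar>"
            by (simp add: q_def abs_mult)
          also have "\<dots> \<le> real (Suc n) * (M * norm ?v)" by (intro mult_left_mono lip) auto
          also have "\<dots> = M" using that by simp
          finally show ?thesis using True by simp
        next
          case False
          then have "norm (x + ?v) > R" using v norm_diff_ineq[of x ?v] by linarith
          then show ?thesis using False R by (simp add: q_def)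
        qed
      qed
    qed (use ind[of "R + 1" M] in auto)
    moreover have "(\<integral>x. q n x \<partial>lborel) = 0" for n
    proof -
      have "integrable lborel (\<lambda>x. u (x + v))" "(\<integral>x. u (x + v) \<partial>lborel) = (\<integral>x. u x \<partial>lborel)" for v
        using integrable_lborel_translate[OF u_int, of v] integral_lborel_translate[of u v] by (auto simp: add.commute)
      then show ?thesis using u_int by (simp add: q_def)
    qed
    ultimately show ?thesis using LIMSEQ_unique[OF _ tendsto_const[of 0]] by auto
  qed
  then have "b \<bullet> (\<integral>x. U x \<partial>lborel) = b \<bullet> 0" if "b \<in> Basis" for b
    using that integral_inner_right[of b lborel U] U_int by simp
  then show "(\<integral>x. U x \<partial>lborel) = 0" by (metis euclidean_eqI inner_commute)
qed

definition gauss_grad :: "real \<Rightarrow> 'a::euclidean_space \<Rightarrow> 'a" where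
  "gauss_grad s v = - (gauss s v / s) *\<^sub>R v"

lemma GDERIV_norm_square: "GDERIV (\<lambda>x. (norm x)\<^sup>2) (x::'a::euclidean_space) :> 2 *\<^sub>R x"
  unfolding gderiv_def power2_norm_eq_inner
  by (auto intro!: derivative_eq_intros simp: inner_commute)

lemma GDERIV_gauss:
  assumes "0 < s" shows "GDERIV (gauss s) (v::'a::euclidean_space) :> gauss_grad s v"
proof -
  let ?c = "(1 / sqrt (2 * pi * s)) ^ DIM('a)"
  have "GDERIV (\<lambda>v::'a. ?c * exp (- (norm v)\<^sup>2 / (2 * s))) v :> (?c * (exp (- (norm v)\<^sup>2 / (2 * s)) * (- 1 / (2 * s)))) *\<^sub>R (2 *\<^sub>R v)"
    by (rule GDERIV_DERIV_compose[of "\<lambda>v. (norm v)\<^sup>2" v _ "\<lambda>q. ?c * exp (- q / (2 * s))", OF GDERIV_norm_square])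
       (use assms in \<open>auto intro!: derivative_eq_intros\<close>)
  then show ?thesis using assms unfolding gauss_grad_def by (simp add: gauss_eq[OF assms, abs_def])
qed

text \<open>The Hessian is bounded because \<open>exp (- r) * (1 + 2 * r)\<close> is bounded, where \<open>r = |v|\<^sup>2 / (2 * s)\<close>.\<close>

lemma gauss_grad_lipschitz:
  assumes s: "0 < s"
  shows "\<exists>L. L-lipschitz_on UNIV (gauss_grad s :: 'a::euclidean_space \<Rightarrow> 'a)"
proof -
  let ?c = "(1 / sqrt (2 * pi * s)) ^ DIM('a)"
  define D where "D v h = - (1 / s) *\<^sub>R (gauss s v *\<^sub>R h + (h \<bullet> gauss_grad s v) *\<^sub>R v)" for v h :: 'a
  have "((3 * ?c) / s)-lipschitz_on UNIV (gauss_grad s :: 'a \<Rightarrow> 'a)"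
  proof (rule bounded_derivative_imp_lipschitz)
    fix v :: 'a
    have "((\<lambda>v. gauss s v *\<^sub>R v) has_derivative (\<lambda>h. gauss s v *\<^sub>R h + (h \<bullet> gauss_grad s v) *\<^sub>R v)) (at v)"
      using has_derivative_scaleR[OF GDERIV_gauss[OF s, of v, unfolded gderiv_def] has_derivative_ident] by simp
    from has_derivative_scaleR_right[OF this, of "- (1 / s)"]
    show "(gauss_grad s has_derivative D v) (at v within UNIV)"
      unfolding D_def[abs_def] gauss_grad_def[abs_def] by (simp add: gauss_grad_def)
    show "onorm (D v) \<le> 3 * ?c / s"
    proof (rule onorm_le)
      fix h
      define r where "r = (norm v)\<^sup>2 / (2 * s)"
      have r: "0 \<le> r" using s by (simp add: r_def)
      have "norm (gauss s v *\<^sub>R h + (h \<bullet> gauss_grad s v) *\<^sub>R v) \<le> gauss s v * norm h + \<bar>h \<bullet> gauss_grad s v\<bar> * norm v"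
        by (rule order_trans[OF norm_triangle_ineq]) simp
      also have "\<bar>h \<bullet> gauss_grad s v\<bar> \<le> norm h * (gauss s v / s * norm v)"
        using Cauchy_Schwarz_ineq2[of h "gauss_grad s v"] s by (simp add: gauss_grad_def)
      also have "gauss s v * norm h + norm h * (gauss s v / s * norm v) * norm v = gauss s v * (1 + 2 * r) * norm h"
        using s by (simp add: r_def field_simps power2_eq_square)
      also have "gauss s v * (1 + 2 * r) = ?c * (exp (- r) * (1 + 2 * r))"
        using s by (simp add: gauss_eq r_def)
      also have "\<dots> \<le> ?c * 3"
      proof (intro mult_left_mono)
        have "exp (- r) * (1 + 2 * r) \<le> exp (- r) * (3 * exp r)"
        proof (rule mult_left_mono)
          show "1 + 2 * r \<le> 3 * exp r" using exp_ge_add_one_self[of r] r by linarith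
        qed simp
        also have "\<dots> = 3" by (simp add: exp_minus)
        finally show "exp (- r) * (1 + 2 * r) \<le> 3" .
      qed (use s in simp)
      finally have "norm (gauss s v *\<^sub>R h + (h \<bullet> gauss_grad s v) *\<^sub>R v) \<le> ?c * 3 * norm h"
        by (simp add: mult_right_mono)
      then show "norm (D v h) \<le> 3 * ?c / s * norm h"
        using s by (simp add: D_def divide_simps mult.commute)
    qed
  qed (use s in auto)
  then show ?thesis by blast
qed

lemma gauss_grad_bounded:
  assumes s: "0 < s"
  shows "\<exists>C\<ge>0. \<forall>v::'a::euclidean_space. norm (gauss_grad s v) \<le> C"
proof (intro exI conjI allI)
  let ?c = "(1 / sqrt (2 * pi * s)) ^ DIM('a)"
  show "0 \<le> ?c * (1 + 2 * s) / s" using s by simp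
  fix v :: 'a
  define r where "r = (norm v)\<^sup>2 / (2 * s)"
  have r: "0 \<le> r" using s by (simp add: r_def)
  have "norm v \<le> 1 + (norm v)\<^sup>2"
  proof -
    have "2 * norm v \<le> (norm v)\<^sup>2 + 1" using zero_le_power2[of "norm v - 1"] by (simp add: power2_diff)
    then show ?thesis using norm_ge_zero[of v] by linarith
  qed
  also have "\<dots> = 1 + 2 * s * r" using s by (simp add: r_def)
  also have "\<dots> \<le> exp r + 2 * s * exp r"
    using exp_ge_add_one_self[of r] r s by (intro add_mono mult_left_mono) linarith+
  finally have "exp (- r) * norm v \<le> exp (- r) * (exp r * (1 + 2 * s))"
    by (intro mult_left_mono) (auto simp: algebra_simps)
  also have "\<dots> = 1 + 2 * s" by (simp add: exp_minus)
  finally have "?c * (exp (- r) * norm v) / s \<le> ?c * (1 + 2 * s) / s"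
    using s by (intro divide_right_mono mult_left_mono) auto
  moreover have "norm (gauss_grad s v) = ?c * (exp (- r) * norm v) / s"
    using s by (simp add: gauss_grad_def gauss_eq r_def)
  ultimately show "norm (gauss_grad s v) \<le> ?c * (1 + 2 * s) / s" by simp
qed

section \<open>Weak gradients: truncation, mollification, zero set\<close>

text \<open>The square makes the cutoff continuously differentiable and gives
\<open>|\<nabla>\<eta>|\<^sup>2 \<le> 16 * \<eta> / R\<^sup>2\<close> (\<open>cutoff_grad_le\<close>), which is what keeps the Fisher information
\<open>|\<nabla>(\<eta> f)|\<^sup>2 / (\<eta> f)\<close> of a truncated density bounded where \<open>\<eta>\<close> is small.\<close>

definition cutoff :: "real \<Rightarrow> 'a::euclidean_space \<Rightarrow> real" where
  "cutoff R x = (max 0 (1 - (norm x)\<^sup>2 / R\<^sup>2))\<^sup>2"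

definition cutoff_grad :: "real \<Rightarrow> 'a::euclidean_space \<Rightarrow> 'a" where
  "cutoff_grad R x = - (4 / R\<^sup>2 * max 0 (1 - (norm x)\<^sup>2 / R\<^sup>2)) *\<^sub>R x"

lemma DERIV_max_0_square: "((\<lambda>t::real. (max 0 t)\<^sup>2) has_real_derivative 2 * max 0 t) (at t)"
  unfolding gderiv_deriv[symmetric]
proof (rule GDERIV_if_quadratic_remainder[where C = 1])
  fix v :: real
  have "(max 0 (t + v))\<^sup>2 - (max 0 t)\<^sup>2 - v * (2 * max 0 t) \<le> v\<^sup>2"
    "- v\<^sup>2 \<le> (max 0 (t + v))\<^sup>2 - (max 0 t)\<^sup>2 - v * (2 * max 0 t)"
  proof -
    consider "0 \<le> t" "0 \<le> t + v" | "t \<le> 0" "0 \<le> t + v" | "0 \<le> t" "t + v \<le> 0" | "t \<le> 0" "t + v \<le> 0"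
      by linarith
    then have "(max 0 (t + v))\<^sup>2 - (max 0 t)\<^sup>2 - v * (2 * max 0 t) \<le> v\<^sup>2 \<and> 
      - v\<^sup>2 \<le> (max 0 (t + v))\<^sup>2 - (max 0 t)\<^sup>2 - v * (2 * max 0 t)"
    proof cases
      case 1
      then show ?thesis by (simp add: power2_eq_square algebra_simps)
    next
      case 2
      have "(t + v)\<^sup>2 \<le> v\<^sup>2" using 2 by (intro power_mono) auto
      then show ?thesis using 2 by (auto simp: max_def intro: order_trans[of _ 0])
    next
      case 3
      have sq: "max 0 (t + v) = 0" "max 0 t = t" using 3 by auto
      have "0 \<le> (t + v)\<^sup>2" by simp
      then have 1: "0 \<le> t\<^sup>2 + 2 * t * v + v\<^sup>2" by (simp add: power2_sum)
      have "0 \<le> t * (- (t + v))" using 3 by (intro mult_nonneg_nonneg) auto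
      then have 2: "t * v \<le> - t\<^sup>2" by (simp add: algebra_simps power2_eq_square)
      have 3: "0 \<le> t\<^sup>2" "0 \<le> v\<^sup>2" "v * (2 * t) = 2 * (t * v)" "0\<^sup>2 = (0::real)" by auto
      show ?thesis unfolding sq 3 using 1 2 3(1,2) by linarith
    next
      case 4
      then show ?thesis by (simp add: max_def)
    qed
    then show "(max 0 (t + v))\<^sup>2 - (max 0 t)\<^sup>2 - v * (2 * max 0 t) \<le> v\<^sup>2"
      "- v\<^sup>2 \<le> (max 0 (t + v))\<^sup>2 - (max 0 t)\<^sup>2 - v * (2 * max 0 t)" by auto
  qed
  then show "\<bar>(max 0 (t + v))\<^sup>2 - (max 0 t)\<^sup>2 - v \<bullet> (2 * max 0 t)\<bar> \<le> 1 * (norm v)\<^sup>2"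
    by (simp add: abs_le_iff)
qed

lemma GDERIV_cutoff: "GDERIV (cutoff R) (x::'a::euclidean_space) :> cutoff_grad R x"
proof -
  let ?q = "\<lambda>x::'a. 1 - (norm x)\<^sup>2 / R\<^sup>2"
  have q: "GDERIV ?q x :> (- (1 / R\<^sup>2)) *\<^sub>R (2 *\<^sub>R x)"
  proof (rule GDERIV_DERIV_compose[of "\<lambda>x. (norm x)\<^sup>2" x _ "\<lambda>t. 1 - t / R\<^sup>2", OF GDERIV_norm_square])
    have "((\<lambda>t. 1 - t / R\<^sup>2) has_real_derivative 0 - 1 / R\<^sup>2) (at ((norm x)\<^sup>2))"
      by (intro DERIV_diff DERIV_const DERIV_cdivide DERIV_ident)
    then show "((\<lambda>t. 1 - t / R\<^sup>2) has_real_derivative - (1 / R\<^sup>2)) (at ((norm x)\<^sup>2))" by simp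
  qed
  have "GDERIV (\<lambda>x. (max 0 (?q x))\<^sup>2) x :> (2 * max 0 (?q x)) *\<^sub>R ((- (1 / R\<^sup>2)) *\<^sub>R (2 *\<^sub>R x))"
    by (rule GDERIV_DERIV_compose[of ?q x _ "\<lambda>t. (max 0 t)\<^sup>2", OF q DERIV_max_0_square])
  then show ?thesis
    unfolding cutoff_def[abs_def] cutoff_grad_def by (simp add: mult.commute)
qed

lemma cutoff_grad_continuous: "continuous_on UNIV (cutoff_grad R)"
  unfolding cutoff_grad_def[abs_def] divide_inverse by (intro continuous_intros)

lemma cutoff_measurable [measurable]: "cutoff R \<in> borel_measurable borel" "cutoff_grad R \<in> borel_measurable borel"
  using GDERIV_continuous_on[OF GDERIV_cutoff] cutoff_grad_continuous by (auto intro: borel_measurable_continuous_onI)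

lemma cutoff_bounds: "0 \<le> cutoff R x" "cutoff R x \<le> 1"
proof -
  show "0 \<le> cutoff R x" by (simp add: cutoff_def)
  have "(max 0 (1 - (norm x)\<^sup>2 / R\<^sup>2))\<^sup>2 \<le> 1\<^sup>2" by (intro power_mono) auto
  then show "cutoff R x \<le> 1" by (simp add: cutoff_def)
qed

lemma cutoff_outside:
  assumes "0 < R" "norm x > R" shows "cutoff R x = 0" "cutoff_grad R x = 0"
proof -
  have "R\<^sup>2 \<le> (norm x)\<^sup>2" using assms by (intro power_mono) auto
  then have "max 0 (1 - (norm x)\<^sup>2 / R\<^sup>2) = 0" using assms by (simp add: max_def field_simps)
  then show "cutoff R x = 0" "cutoff_grad R x = 0" by (simp_all add: cutoff_def cutoff_grad_def)
qed

lemma cutoff_grad_le: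
  assumes "0 < R" shows "(norm (cutoff_grad R x))\<^sup>2 \<le> 16 / R\<^sup>2 * cutoff R x"
proof (cases "norm x \<le> R")
  case True
  define m where "m = max 0 (1 - (norm x)\<^sup>2 / R\<^sup>2)"
  have "(norm (cutoff_grad R x))\<^sup>2 = 16 / (R\<^sup>2 * R\<^sup>2) * m\<^sup>2 * (norm x)\<^sup>2"
    unfolding cutoff_grad_def m_def[symmetric] by (simp add: power_mult_distrib power_divide flip: power_add)
  also have "\<dots> \<le> 16 / (R\<^sup>2 * R\<^sup>2) * m\<^sup>2 * R\<^sup>2"
    using True by (intro mult_left_mono power_mono) auto
  also have "\<dots> = 16 / R\<^sup>2 * m\<^sup>2" using assms by (simp add: field_simps)
  also have "m\<^sup>2 = cutoff R x" by (simp add: cutoff_def m_def)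
  finally show ?thesis .
qed (use assms in \<open>simp add: cutoff_outside\<close>)

lemma cutoff_tendsto: "(\<lambda>n. cutoff (real (Suc n)) x) \<longlonglongrightarrow> 1"
proof -
  have "filterlim (\<lambda>n. (real (Suc n))\<^sup>2) at_infinity sequentially"
    by (intro filterlim_at_top_imp_at_infinity filterlim_pow_at_top filterlim_compose[OF filterlim_real_sequentially filterlim_Suc]) auto
  then have "(\<lambda>n. (norm x)\<^sup>2 / (real (Suc n))\<^sup>2) \<longlonglongrightarrow> 0"
    by (rule tendsto_divide_0[OF tendsto_const])
  then have "(\<lambda>n. (max 0 (1 - (norm x)\<^sup>2 / (real (Suc n))\<^sup>2))\<^sup>2) \<longlonglongrightarrow> (max 0 (1 - 0))\<^sup>2"
    by (intro tendsto_intros)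
  then show ?thesis by (simp add: cutoff_def)
qed

lemma bounded_of_compact_support:
  fixes \<phi> :: "'a::euclidean_space \<Rightarrow> 'b::euclidean_space"
  assumes "continuous_on UNIV \<phi>" "\<And>x. norm x > R \<Longrightarrow> \<phi> x = 0"
  obtains C where "0 \<le> C" "\<And>x. norm (\<phi> x) \<le> C"
proof -
  have "bounded (\<phi> ` cball 0 R)"
    by (intro compact_imp_bounded compact_continuous_image continuous_on_subset[OF assms(1)]) auto
  then obtain M0 where M0: "\<And>x. x \<in> cball 0 R \<Longrightarrow> norm (\<phi> x) \<le> M0" unfolding bounded_iff by blast
  have "norm (\<phi> x) \<le> max 0 M0" for x
    using M0[of x] assms(2)[of x] by (cases "norm x \<le> R") auto
  then show ?thesis using that[of "max 0 M0"] by simp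
qed

lemma integrable_if_dominated_on_cball:
  fixes f :: "'a::euclidean_space \<Rightarrow> 'b::euclidean_space" and k :: "'a \<Rightarrow> 'c::euclidean_space"
  assumes "set_integrable lborel (cball 0 R) f" "k \<in> borel_measurable borel"
    "\<And>x. norm (k x) \<le> C * norm (f x)" "\<And>x. norm x > R \<Longrightarrow> k x = 0"
  shows "integrable lborel k"
proof (rule Bochner_Integration.integrable_bound)
  show "integrable lborel (\<lambda>x. C * norm (indicator (cball 0 R) x *\<^sub>R f x))"
    using assms(1) unfolding set_integrable_def by (intro integrable_mult_right integrable_norm)
  show "AE x in lborel. norm (k x) \<le> norm (C * norm (indicator (cball 0 R) x *\<^sub>R f x))"
    using assms(3,4) by (intro AE_I2) (auto simp: indicator_def intro: order_trans[OF _ abs_ge_self])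
qed (use assms in simp)

lemma weak_gradient_measurable:
  assumes "weak_gradient f (g :: 'a::euclidean_space \<Rightarrow> 'a)" shows "g \<in> borel_measurable borel"
proof (rule borel_measurable_LIMSEQ_metric[where f = "\<lambda>n x. indicator (cball 0 (real n)) x *\<^sub>R g x"])
  fix n
  have "set_integrable lborel (cball 0 (real n)) g" using assms unfolding weak_gradient_def by auto
  then show "(\<lambda>x. indicator (cball 0 (real n)) x *\<^sub>R g x) \<in> borel_measurable borel"
    unfolding set_integrable_def by auto
next
  fix x :: 'a
  obtain n0 where "norm x \<le> real n0" using real_arch_simple by blast
  then have "\<And>n. n \<ge> n0 \<Longrightarrow> indicator (cball 0 (real n)) x *\<^sub>R g x = g x"
    by (auto simp: indicator_def dest: of_nat_mono[where 'a = real])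
  then show "(\<lambda>n. indicator (cball 0 (real n)) x *\<^sub>R g x) \<longlonglongrightarrow> g x"
    by (intro tendsto_eventually) (auto simp: eventually_sequentially)
qed

lemma weak_gradientD:
  assumes "weak_gradient f g" "\<And>x. GDERIV \<phi> x :> \<psi> x" "continuous_on UNIV \<psi>" "compact (closure {x. \<phi> x \<noteq> 0})"
  shows "(\<integral>x. f x *\<^sub>R \<psi> x \<partial>lborel) = - (\<integral>x. \<phi> x *\<^sub>R g x \<partial>lborel)"
  by (rule assms(1)[unfolded weak_gradient_def, THEN conjunct2, THEN spec, THEN spec, THEN mp])
     (intro conjI allI assms)

text \<open>The product of the cutoff with any \<open>C\<^sup>1\<close> function \<open>w\<close> is an admissible test function, and the
product rule moves the gradient of the cutoff to the other side. So the truncated function can be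
tested against \<open>C\<^sup>1\<close> functions without compact support, in particular against Gaussian kernels.\<close>

lemma weak_gradient_cutoff:
  fixes f :: "'a::euclidean_space \<Rightarrow> real" and g :: "'a \<Rightarrow> 'a"
  assumes wg: "weak_gradient f g" and [measurable]: "f \<in> borel_measurable borel" and R: "0 < R"
  defines "f0 \<equiv> \<lambda>x. cutoff R x * f x"
    and "g0 \<equiv> \<lambda>x. cutoff R x *\<^sub>R g x + f x *\<^sub>R cutoff_grad R x"
  shows "integrable lborel f0" "integrable lborel g0"
    "\<And>w W. (\<And>x. GDERIV w x :> W x) \<Longrightarrow> continuous_on UNIV W \<Longrightarrow>
       (\<integral>x. f0 x *\<^sub>R W x \<partial>lborel) = - (\<integral>x. w x *\<^sub>R g0 x \<partial>lborel)"
proof -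
  have [measurable]: "g \<in> borel_measurable borel" by (rule weak_gradient_measurable[OF wg])
  have loc: "set_integrable lborel (cball 0 R) f" "set_integrable lborel (cball 0 R) g"
    using wg unfolding weak_gradient_def by auto
  have c1: "\<bar>cutoff R x\<bar> \<le> 1" for x :: 'a using cutoff_bounds[of R x] by simp
  show "integrable lborel f0" unfolding f0_def
    by (rule integrable_if_dominated_on_cball[OF loc(1), where C = 1])
       (use c1 R in \<open>auto simp: cutoff_outside abs_mult intro!: mult_left_le_one_le\<close>)
  obtain C where C: "0 \<le> C" "\<And>x. norm (cutoff_grad R x :: 'a) \<le> C"
    using bounded_of_compact_support[OF cutoff_grad_continuous, of R R] cutoff_outside(2)[OF R] by metis
  have i1: "integrable lborel (\<lambda>x. cutoff R x *\<^sub>R g x)"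
    by (rule integrable_if_dominated_on_cball[OF loc(2), where C = 1])
       (use c1 R in \<open>auto simp: cutoff_outside mult_left_le_one_le\<close>)
  have i2: "integrable lborel (\<lambda>x. f x *\<^sub>R cutoff_grad R x)"
    by (rule integrable_if_dominated_on_cball[OF loc(1), where C = C])
       (use C R in \<open>auto simp: cutoff_outside mult.commute[of C] intro!: mult_left_mono\<close>)
  show "integrable lborel g0" unfolding g0_def using i1 i2 by simp
  fix w :: "'a \<Rightarrow> real" and W assume w: "\<And>x. GDERIV w x :> W x" and W: "continuous_on UNIV W"
  have w_cont: "continuous_on UNIV w" by (rule GDERIV_continuous_on[OF w])
  have [measurable]: "w \<in> borel_measurable borel" "W \<in> borel_measurable borel"
    using w_cont W by (auto intro: borel_measurable_continuous_onI)
  have e_cont: "continuous_on UNIV (cutoff R :: 'a \<Rightarrow> real)" by (rule GDERIV_continuous_on[OF GDERIV_cutoff])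
  have supp: "compact (closure {x. cutoff R x * w x \<noteq> 0})"
    unfolding compact_closure by (rule bounded_subset[OF bounded_cball[of 0 R]]) (use R cutoff_outside(1) in force)
  have der: "GDERIV (\<lambda>x. cutoff R x * w x) x :> cutoff R x *\<^sub>R W x + w x *\<^sub>R cutoff_grad R x" for x
    by (rule GDERIV_mult[OF GDERIV_cutoff w])
  have cont: "continuous_on UNIV (\<lambda>x. cutoff R x *\<^sub>R W x + w x *\<^sub>R cutoff_grad R x)"
    by (intro continuous_intros e_cont W w_cont cutoff_grad_continuous)
  have test: "(\<integral>x. f x *\<^sub>R (cutoff R x *\<^sub>R W x + w x *\<^sub>R cutoff_grad R x) \<partial>lborel)
      = - (\<integral>x. (cutoff R x * w x) *\<^sub>R g x \<partial>lborel)"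
    by (rule weak_gradientD[OF wg der cont supp])
  have k1: "continuous_on UNIV (\<lambda>x. cutoff R x *\<^sub>R W x)" by (intro continuous_intros e_cont W)
  obtain C1 where C1: "\<And>x. norm (cutoff R x *\<^sub>R W x) \<le> C1"
    by (rule bounded_of_compact_support[OF k1, of R], simp add: cutoff_outside R, blast)
  have k2: "continuous_on UNIV (\<lambda>x. w x *\<^sub>R cutoff_grad R x)" by (intro continuous_intros w_cont cutoff_grad_continuous)
  obtain C2 where C2: "\<And>x. norm (w x *\<^sub>R cutoff_grad R x) \<le> C2"
    by (rule bounded_of_compact_support[OF k2, of R], simp add: cutoff_outside R, blast)
  have k3: "continuous_on UNIV (\<lambda>x. cutoff R x * w x)" by (intro continuous_intros e_cont w_cont)
  obtain C3 where C3: "\<And>x. norm (cutoff R x * w x) \<le> C3"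
    by (rule bounded_of_compact_support[OF k3, of R], simp add: cutoff_outside R, blast)
  have j1: "integrable lborel (\<lambda>x. f x *\<^sub>R (cutoff R x *\<^sub>R W x))"
  proof (rule integrable_if_dominated_on_cball[OF loc(1), where C = C1])
    fix x
    show "norm (f x *\<^sub>R (cutoff R x *\<^sub>R W x)) \<le> C1 * norm (f x)"
      using mult_right_mono[OF C1[of x], of "\<bar>f x\<bar>"]
      by (simp only: norm_scaleR[of "f x"] real_norm_def mult.commute abs_ge_zero)
  qed (use R in \<open>auto simp: cutoff_outside\<close>)
  have j2: "integrable lborel (\<lambda>x. f x *\<^sub>R (w x *\<^sub>R cutoff_grad R x))"
  proof (rule integrable_if_dominated_on_cball[OF loc(1), where C = C2])
    fix x
    show "norm (f x *\<^sub>R (w x *\<^sub>R cutoff_grad R x)) \<le> C2 * norm (f x)"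
      using mult_right_mono[OF C2[of x], of "\<bar>f x\<bar>"]
      by (simp only: norm_scaleR[of "f x"] real_norm_def mult.commute abs_ge_zero)
  qed (use R in \<open>auto simp: cutoff_outside\<close>)
  have j3: "integrable lborel (\<lambda>x. (cutoff R x * w x) *\<^sub>R g x)"
    by (rule integrable_if_dominated_on_cball[OF loc(2), where C = C3])
       (use mult_right_mono[OF C3 norm_ge_zero] R in \<open>auto simp: cutoff_outside\<close>)
  have "(\<integral>x. w x *\<^sub>R g0 x \<partial>lborel) = (\<integral>x. (cutoff R x * w x) *\<^sub>R g x + f x *\<^sub>R (w x *\<^sub>R cutoff_grad R x) \<partial>lborel)"
    by (simp add: g0_def scaleR_add_right mult.commute)
  also have "\<dots> = (\<integral>x. (cutoff R x * w x) *\<^sub>R g x \<partial>lborel) + (\<integral>x. f x *\<^sub>R (w x *\<^sub>R cutoff_grad R x) \<partial>lborel)"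
    using j2 j3 by simp
  also have "(\<integral>x. (cutoff R x * w x) *\<^sub>R g x \<partial>lborel) = - ((\<integral>x. f x *\<^sub>R (cutoff R x *\<^sub>R W x) \<partial>lborel) + (\<integral>x. f x *\<^sub>R (w x *\<^sub>R cutoff_grad R x) \<partial>lborel))"
    using test j1 j2 by (simp only: scaleR_add_right) (simp add: equation_minus_iff)
  finally show "(\<integral>x. f0 x *\<^sub>R W x \<partial>lborel) = - (\<integral>x. w x *\<^sub>R g0 x \<partial>lborel)"
    by (simp add: f0_def mult.commute)
qed

text \<open>Differentiating the kernel and then testing the weak gradient against it shows that the gradient of
the mollified function is the mollified weak gradient.\<close>

lemma heat_weak_gradient:
  fixes f0 :: "'a::euclidean_space \<Rightarrow> real" and g0 :: "'a \<Rightarrow> 'a"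
  assumes f0: "integrable lborel f0" and g0: "integrable lborel g0" and s: "0 < s"
    and test: "\<And>w W. (\<And>x. GDERIV w x :> W x) \<Longrightarrow> continuous_on UNIV W \<Longrightarrow>
       (\<integral>x. f0 x *\<^sub>R W x \<partial>lborel) = - (\<integral>x. w x *\<^sub>R g0 x \<partial>lborel)"
  shows "GDERIV (heat s f0) x :> heat s g0 x" "\<exists>L. L-lipschitz_on UNIV (heat s g0)"
    "\<exists>B. \<forall>x. norm (heat s g0 x) \<le> B \<and> \<bar>heat s f0 x\<bar> \<le> B"
proof -
  have [measurable]: "f0 \<in> borel_measurable borel" "g0 \<in> borel_measurable borel" using f0 g0 by auto
  obtain L where L: "L-lipschitz_on UNIV (gauss_grad s :: 'a \<Rightarrow> 'a)" using gauss_grad_lipschitz[OF s] by blast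
  obtain C where C: "0 \<le> C" "\<And>v::'a. norm (gauss_grad s v) \<le> C" using gauss_grad_bounded[OF s, where 'a = 'a] by blast
  have gg_cont: "continuous_on UNIV (gauss_grad s :: 'a \<Rightarrow> 'a)" using L by (rule lipschitz_on_continuous_on)
  then have [measurable]: "gauss_grad s \<in> borel_measurable (borel :: 'a measure)" by (rule borel_measurable_continuous_onI)
  have gg_shift: "GDERIV (\<lambda>u. gauss s (u - x)) u :> gauss_grad s (u - x)" for u x :: 'a
  proof -
    have "((\<lambda>u. gauss s (u - x)) has_derivative (\<lambda>h. h \<bullet> gauss_grad s (u - x))) (at u)"
      by (rule has_derivative_compose[of "\<lambda>u. u - x" "\<lambda>h. h" _ _ "gauss s"])
         (use GDERIV_gauss[OF s, of "u - x"] in \<open>auto intro!: derivative_eq_intros simp: gderiv_def\<close>)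
    then show ?thesis by (simp add: gderiv_def)
  qed
  have i_g: "integrable lborel (\<lambda>u. gauss s (u - x) *\<^sub>R k u)"
    if k: "integrable lborel k" for k :: "'a \<Rightarrow> 'b::euclidean_space" and x
  proof (rule Bochner_Integration.integrable_bound)
    show "integrable lborel (\<lambda>u. (1 / sqrt (2 * pi * s)) ^ DIM('a) *\<^sub>R k u)" using k by simp
    show "AE u in lborel. norm (gauss s (u - x) *\<^sub>R k u) \<le> norm ((1 / sqrt (2 * pi * s)) ^ DIM('a) *\<^sub>R k u)"
      using gauss_le[OF s, where 'a = 'a] s by (intro AE_I2) (simp add: mult_right_mono)
  qed (use k in simp)
  have i_gg: "integrable lborel (\<lambda>u. f0 u *\<^sub>R gauss_grad s (u - x))" for x
  proof (rule Bochner_Integration.integrable_bound)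
    show "integrable lborel (\<lambda>u. C *\<^sub>R f0 u)" using f0 by simp
    show "AE u in lborel. norm (f0 u *\<^sub>R gauss_grad s (u - x)) \<le> norm (C *\<^sub>R f0 u)"
      using C by (intro AE_I2) (simp add: abs_mult mult.commute[of C] mult_left_mono)
  qed simp
  have G: "heat s g0 x = (\<integral>u. (- f0 u) *\<^sub>R gauss_grad s (u - x) \<partial>lborel)" for x
  proof -
    have "continuous_on UNIV (\<lambda>u. gauss_grad s (u - x))"
      by (rule continuous_on_compose2[OF gg_cont]) (auto intro!: continuous_intros)
    from test[OF gg_shift this] show ?thesis by (simp add: heat_eq_convolution)
  qed
  have "GDERIV (\<lambda>x. \<integral>u. gauss s (u - x) *\<^sub>R f0 u \<partial>lborel) x :> (\<integral>u. (- f0 u) *\<^sub>R gauss_grad s (u - x) \<partial>lborel)"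
  proof (rule GDERIV_integral_quadratic[where c = "\<lambda>u. L * \<bar>f0 u\<bar>"])
    fix u v
    have "\<bar>gauss s (u - (x + v)) *\<^sub>R f0 u - gauss s (u - x) *\<^sub>R f0 u - v \<bullet> ((- f0 u) *\<^sub>R gauss_grad s (u - x))\<bar>
       = \<bar>f0 u\<bar> * \<bar>gauss s ((u - x) + (- v)) - gauss s (u - x) - (- v) \<bullet> gauss_grad s (u - x)\<bar>"
      unfolding abs_mult[symmetric] by (rule arg_cong[of _ _ abs]) (simp add: algebra_simps)
    also have "\<dots> \<le> \<bar>f0 u\<bar> * (L * (norm (- v))\<^sup>2)"
      by (intro mult_left_mono gradient_taylor_bound GDERIV_gauss s L) auto
    finally show "\<bar>gauss s (u - (x + v)) *\<^sub>R f0 u - gauss s (u - x) *\<^sub>R f0 u - v \<bullet> ((- f0 u) *\<^sub>R gauss_grad s (u - x))\<bar>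
       \<le> L * \<bar>f0 u\<bar> * (norm v)\<^sup>2" by (simp add: ac_simps)
  qed (use f0 i_gg i_g[OF f0] in auto)
  then show "GDERIV (heat s f0) x :> heat s g0 x"
    unfolding G heat_eq_convolution[OF \<open>f0 \<in> borel_measurable borel\<close>, abs_def] by simp
  have "(L * (\<integral>u. \<bar>f0 u\<bar> \<partial>lborel))-lipschitz_on UNIV (heat s g0)"
  proof (rule lipschitz_onI)
    fix x y
    have "dist (heat s g0 x) (heat s g0 y) = norm (\<integral>u. f0 u *\<^sub>R gauss_grad s (u - y) - f0 u *\<^sub>R gauss_grad s (u - x) \<partial>lborel)"
      unfolding G dist_norm using i_gg by simp
    also have "\<dots> \<le> (\<integral>u. L * \<bar>f0 u\<bar> * dist x y \<partial>lborel)"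
    proof (rule norm_integral_le_integral)
      fix u
      have "norm (f0 u *\<^sub>R gauss_grad s (u - y) - f0 u *\<^sub>R gauss_grad s (u - x)) = \<bar>f0 u\<bar> * dist (gauss_grad s (u - y)) (gauss_grad s (u - x))"
        by (simp add: dist_norm scaleR_diff_right[symmetric])
      also have "\<dots> \<le> \<bar>f0 u\<bar> * (L * dist (u - y) (u - x))"
        by (intro mult_left_mono lipschitz_onD[OF L]) auto
      finally show "norm (f0 u *\<^sub>R gauss_grad s (u - y) - f0 u *\<^sub>R gauss_grad s (u - x)) \<le> L * \<bar>f0 u\<bar> * dist x y"
        by (simp add: dist_norm ac_simps)
    qed (use f0 in auto)
    finally show "dist (heat s g0 x) (heat s g0 y) \<le> L * (\<integral>u. \<bar>f0 u\<bar> \<partial>lborel) * dist x y" by simp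
  qed (use lipschitz_on_nonneg[OF L] in auto)
  then show "\<exists>L. L-lipschitz_on UNIV (heat s g0)" by blast
  define c where "c = (1 / sqrt (2 * pi * s)) ^ DIM('a)"
  have bd: "norm (heat s k x) \<le> c * (\<integral>u. norm (k u) \<partial>lborel)" if k: "integrable lborel k" for k :: "'a \<Rightarrow> 'b::euclidean_space" and x
  proof -
    have [measurable]: "k \<in> borel_measurable borel" using k by auto
    have "norm (heat s k x) \<le> (\<integral>u. c * norm (k u) \<partial>lborel)"
      unfolding heat_eq_convolution[OF \<open>k \<in> borel_measurable borel\<close>]
    proof (rule norm_integral_le_integral)
      fix u show "norm (gauss s (u - x) *\<^sub>R k u) \<le> c * norm (k u)"
        using gauss_le[OF s, of "u - x"] by (simp add: c_def mult_right_mono)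
    qed (use k in auto)
    then show ?thesis by simp
  qed
  show "\<exists>B. \<forall>x. norm (heat s g0 x) \<le> B \<and> \<bar>heat s f0 x\<bar> \<le> B"
    using bd[OF f0] bd[OF g0]
    by (intro exI[of _ "max (c * (\<integral>u. norm (g0 u) \<partial>lborel)) (c * (\<integral>u. norm (f0 u) \<partial>lborel))"])
       (auto simp: le_max_iff_disj)
qed


text \<open>With \<open>b t = e * t / (e + t)\<close>, which satisfies \<open>0 \<le> b \<le> e\<close> on the half line, integration by parts
bounds the integral of \<open>w * b' f * \<nabla>f\<close> by \<open>e\<close> times the integral of \<open>|\<nabla>w|\<close>. As \<open>e\<close> tends to 0,
\<open>b' t = e\<^sup>2 / (e + t)\<^sup>2\<close> tends to the indicator of \<open>t = 0\<close>, so that the integral of \<open>w * \<nabla>f\<close> over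
\<open>{f = 0}\<close> vanishes. The chain rule for \<open>b f\<close> is obtained by mollifying the truncated function.\<close>

lemma weak_gradient_zero_set_cutoff:
  fixes f :: "'a::euclidean_space \<Rightarrow> real" and g :: "'a \<Rightarrow> 'a"
  assumes wg: "weak_gradient f g" and [measurable]: "f \<in> borel_measurable borel"
    and nonneg: "\<And>x. 0 \<le> f x" and R: "0 < R"
    and w: "\<And>x. GDERIV w x :> W x" "continuous_on UNIV W" "\<And>x. norm x > r \<Longrightarrow> w x = 0"
  shows "(\<integral>x. (w x * cutoff R x) *\<^sub>R (if f x = 0 then g x else 0) \<partial>lborel) = 0"
proof -
  have [measurable]: "g \<in> borel_measurable borel" by (rule weak_gradient_measurable[OF wg])
  define f0 where "f0 x = cutoff R x * f x" for x
  define g0 where "g0 x = cutoff R x *\<^sub>R g x + f x *\<^sub>R cutoff_grad R x" for x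
  have f0: "integrable lborel f0" and g0: "integrable lborel g0"
    and test: "\<And>w W. (\<And>x. GDERIV w x :> W x) \<Longrightarrow> continuous_on UNIV W \<Longrightarrow>
       (\<integral>x. f0 x *\<^sub>R W x \<partial>lborel) = - (\<integral>x. w x *\<^sub>R g0 x \<partial>lborel)"
    using weak_gradient_cutoff[OF wg _ R] unfolding f0_def[abs_def] g0_def[abs_def] by auto
  have [measurable]: "f0 \<in> borel_measurable borel" "g0 \<in> borel_measurable borel" using f0 g0 by auto
  have f0_nonneg: "0 \<le> f0 x" for x using nonneg[of x] by (simp add: f0_def cutoff_bounds)
  have w_cont: "continuous_on UNIV w" by (rule GDERIV_continuous_on[OF w(1)])
  then have [measurable]: "w \<in> borel_measurable borel" by (rule borel_measurable_continuous_onI)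
  have [measurable]: "W \<in> borel_measurable borel" using w(2) by (rule borel_measurable_continuous_onI)
  obtain Mw where Mw: "0 \<le> Mw" "\<And>x. norm (w x) \<le> Mw"
    using bounded_of_compact_support[OF w_cont w(3)] by metis
  have W_int: "integrable lborel W" by (rule integral_gradient_eq_0(2)[OF w])
  define \<delta> where "\<delta> n = 1 / real (Suc n)" for n
  have \<delta>: "\<delta> \<longlonglongrightarrow> 0" "\<And>n. 0 < \<delta> n"
    unfolding \<delta>_def using LIMSEQ_Suc[OF lim_const_over_n[of 1]] by auto
  define F where "F n = heat (\<delta> n) f0" for n
  define G where "G n = heat (\<delta> n) g0" for n
  have F_int: "integrable lborel (F n)" and G_int: "integrable lborel (G n)" for n
    unfolding F_def G_def using heat_L1(1) f0 g0 \<delta>(2) by auto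
  have [measurable]: "F n \<in> borel_measurable borel" "G n \<in> borel_measurable borel" for n
    using F_int[of n] G_int[of n] by auto
  have F_grad: "GDERIV (F n) x :> G n x" for n x
    unfolding F_def G_def by (rule heat_weak_gradient(1)[OF f0 g0 \<delta>(2) test])
  have G_cont: "continuous_on UNIV (G n)" for n
    using heat_weak_gradient(2)[OF f0 g0 \<delta>(2)[of n] test] unfolding G_def by (auto intro: lipschitz_on_continuous_on)
  have F_nonneg: "0 \<le> F n x" for n x
    unfolding F_def heat_def by (intro Bochner_Integration.integral_nonneg) (simp add: f0_nonneg)
  have G_lim: "(\<lambda>n. \<integral>x. norm (G n x - g0 x) \<partial>lborel) \<longlonglongrightarrow> 0"
    unfolding G_def by (rule heat_tendsto_L1[OF g0 \<delta>])
  have "(\<lambda>n. \<integral>x. norm (F n x - f0 x) \<partial>lborel) \<longlonglongrightarrow> 0"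
    unfolding F_def by (rule heat_tendsto_L1[OF f0 \<delta>])
  from tendsto_L1_AE_subseq[OF _ this] f0 F_int obtain sub where sub: "strict_mono (sub :: nat \<Rightarrow> nat)"
    "AE x in lborel. (\<lambda>n. F (sub n) x - f0 x) \<longlonglongrightarrow> 0" by auto
  define b' where "b' e t = e\<^sup>2 / (e + t)\<^sup>2" for e t :: real
  have b'_bounds: "0 \<le> b' e t" "b' e t \<le> 1" if "0 < e" "0 \<le> t" for e t
  proof -
    have "e\<^sup>2 \<le> (e + t)\<^sup>2" using that by (intro power_mono) auto
    then show "b' e t \<le> 1" using that unfolding b'_def by (simp add: divide_le_eq_1)
  qed (simp add: b'_def)
  have [measurable]: "b' e \<in> borel_measurable borel" for e unfolding b'_def[abs_def] by measurable
  have main: "norm (\<integral>x. (w x * b' e (f0 x)) *\<^sub>R g0 x \<partial>lborel) \<le> e * (\<integral>x. norm (W x) \<partial>lborel)" if e: "0 < e" for e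
  proof -
    define b where "b t = e * t / (e + t)" for t
    have b_bounds: "\<bar>b t\<bar> \<le> e" if "0 \<le> t" for t using that e by (simp add: b_def field_simps)
    have b_der: "(b has_real_derivative b' e t) (at t)" if "0 \<le> t" for t
      unfolding b_def[abs_def] b'_def using that e
      by (auto intro!: derivative_eq_intros simp: field_simps power2_eq_square)
    have [measurable]: "b \<in> borel_measurable borel" unfolding b_def[abs_def] by measurable
    have bound_n: "norm (\<integral>x. (w x * b' e (F n x)) *\<^sub>R G n x \<partial>lborel) \<le> e * (\<integral>x. norm (W x) \<partial>lborel)" for n
    proof -
      have i1: "integrable lborel (\<lambda>x. b (F n x) *\<^sub>R W x)"
      proof (rule Bochner_Integration.integrable_bound)
        show "integrable lborel (\<lambda>x. e *\<^sub>R W x)" using W_int by simp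
        show "AE x in lborel. norm (b (F n x) *\<^sub>R W x) \<le> norm (e *\<^sub>R W x)"
          using b_bounds[OF F_nonneg] e by (intro AE_I2) (simp add: mult_right_mono)
      qed simp
      have i2: "integrable lborel (\<lambda>x. (w x * b' e (F n x)) *\<^sub>R G n x)"
      proof (rule Bochner_Integration.integrable_bound)
        show "integrable lborel (\<lambda>x. Mw *\<^sub>R G n x)" using G_int by simp
        show "AE x in lborel. norm ((w x * b' e (F n x)) *\<^sub>R G n x) \<le> norm (Mw *\<^sub>R G n x)"
        proof (rule AE_I2)
          fix x
          have "\<bar>w x * b' e (F n x)\<bar> \<le> Mw * 1" unfolding abs_mult
            using Mw b'_bounds[OF e F_nonneg] by (intro mult_mono) auto
          then show "norm ((w x * b' e (F n x)) *\<^sub>R G n x) \<le> norm (Mw *\<^sub>R G n x)"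
            using Mw(1) by (simp add: mult_right_mono)
        qed
      qed simp
      have U: "GDERIV (\<lambda>x. b (F n x) * w x) x :> b (F n x) *\<^sub>R W x + w x *\<^sub>R (b' e (F n x) *\<^sub>R G n x)" for x
        by (rule GDERIV_mult[OF GDERIV_DERIV_compose[OF F_grad b_der[OF F_nonneg]] w(1)])
      have F_cont: "continuous_on UNIV (F n)" by (rule GDERIV_continuous_on[OF F_grad])
      have ne: "e + F n x \<noteq> 0" for x using F_nonneg[of n x] e by linarith
      have "continuous_on UNIV (\<lambda>x. b (F n x) *\<^sub>R W x + w x *\<^sub>R (b' e (F n x) *\<^sub>R G n x))"
        unfolding b_def b'_def using ne by (intro continuous_intros F_cont w(2) w_cont G_cont) auto
      from integral_gradient_eq_0(1)[OF U this, of r] w(3)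
      have "(\<integral>x. b (F n x) *\<^sub>R W x + (w x * b' e (F n x)) *\<^sub>R G n x \<partial>lborel) = 0" by simp
      then have "(\<integral>x. (w x * b' e (F n x)) *\<^sub>R G n x \<partial>lborel) = - (\<integral>x. b (F n x) *\<^sub>R W x \<partial>lborel)"
        using i1 i2 by (simp add: eq_neg_iff_add_eq_0 add.commute)
      then have "norm (\<integral>x. (w x * b' e (F n x)) *\<^sub>R G n x \<partial>lborel) = norm (\<integral>x. b (F n x) *\<^sub>R W x \<partial>lborel)" by simp
      also have "\<dots> \<le> (\<integral>x. e * norm (W x) \<partial>lborel)"
        using b_bounds[OF F_nonneg] e W_int by (intro norm_integral_le_integral) (auto intro: mult_right_mono)
      finally show ?thesis by simp
    qed
    have wb: "\<bar>w x * b' e t\<bar> \<le> Mw" if "0 \<le> t" for x t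
    proof -
      have "\<bar>w x * b' e t\<bar> \<le> Mw * 1" unfolding abs_mult
        using Mw b'_bounds[OF e that] by (intro mult_mono) auto
      then show ?thesis by simp
    qed
    have i3: "integrable lborel (\<lambda>x. (w x * b' e (h x)) *\<^sub>R k x)" if [measurable]: "h \<in> borel_measurable borel" and "\<And>x. 0 \<le> h x" and k: "integrable lborel k"
      for h and k :: "'a \<Rightarrow> 'a"
    proof (rule Bochner_Integration.integrable_bound)
      show "integrable lborel (\<lambda>x. Mw *\<^sub>R k x)" using k by simp
      show "AE x in lborel. norm ((w x * b' e (h x)) *\<^sub>R k x) \<le> norm (Mw *\<^sub>R k x)"
        using wb that(2) Mw(1) by (intro AE_I2) (simp add: mult_right_mono)
      show "(\<lambda>x. (w x * b' e (h x)) *\<^sub>R k x) \<in> borel_measurable lborel" using k by simp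
    qed
    have l1: "(\<lambda>n. \<integral>x. (w x * b' e (F (sub n) x)) *\<^sub>R (G (sub n) x - g0 x) \<partial>lborel) \<longlonglongrightarrow> 0"
    proof (rule Lim_null_comparison)
      show "\<forall>\<^sub>F n in sequentially. norm (\<integral>x. (w x * b' e (F (sub n) x)) *\<^sub>R (G (sub n) x - g0 x) \<partial>lborel)
          \<le> Mw * (\<integral>x. norm (G (sub n) x - g0 x) \<partial>lborel)"
      proof (intro always_eventually allI)
        fix n
        have "norm (\<integral>x. (w x * b' e (F (sub n) x)) *\<^sub>R (G (sub n) x - g0 x) \<partial>lborel) \<le> (\<integral>x. Mw * norm (G (sub n) x - g0 x) \<partial>lborel)"
          using wb[OF F_nonneg] G_int g0 by (intro norm_integral_le_integral) (auto intro: mult_right_mono)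
        then show "norm (\<integral>x. (w x * b' e (F (sub n) x)) *\<^sub>R (G (sub n) x - g0 x) \<partial>lborel)
          \<le> Mw * (\<integral>x. norm (G (sub n) x - g0 x) \<partial>lborel)" by simp
      qed
      show "(\<lambda>n. Mw * (\<integral>x. norm (G (sub n) x - g0 x) \<partial>lborel)) \<longlonglongrightarrow> 0"
        using tendsto_mult_right_zero[OF LIMSEQ_subseq_LIMSEQ[OF G_lim sub(1)]] by (simp add: comp_def)
    qed
    have l2: "(\<lambda>n. \<integral>x. (w x * b' e (F (sub n) x)) *\<^sub>R g0 x \<partial>lborel) \<longlonglongrightarrow> (\<integral>x. (w x * b' e (f0 x)) *\<^sub>R g0 x \<partial>lborel)"
    proof (rule integral_dominated_convergence[where w = "\<lambda>x. Mw * norm (g0 x)"])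
      show "AE x in lborel. (\<lambda>n. (w x * b' e (F (sub n) x)) *\<^sub>R g0 x) \<longlonglongrightarrow> (w x * b' e (f0 x)) *\<^sub>R g0 x"
        using sub(2)
      proof eventually_elim
        case (elim x)
        then have "(\<lambda>n. F (sub n) x) \<longlonglongrightarrow> f0 x" by (rule LIM_zero_cancel)
        moreover have "e + f0 x \<noteq> 0" using f0_nonneg[of x] e by linarith
        ultimately show ?case unfolding b'_def by (intro tendsto_intros) auto
      qed
      show "AE x in lborel. norm ((w x * b' e (F (sub n) x)) *\<^sub>R g0 x) \<le> Mw * norm (g0 x)" for n
        using wb[OF F_nonneg] by (intro AE_I2) (simp add: mult_right_mono)
    qed (use g0 in auto)
    have "(\<lambda>n. \<integral>x. (w x * b' e (F (sub n) x)) *\<^sub>R G (sub n) x \<partial>lborel) \<longlonglongrightarrow> 0 + (\<integral>x. (w x * b' e (f0 x)) *\<^sub>R g0 x \<partial>lborel)"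
    proof (rule Lim_transform_eventually[OF tendsto_add[OF l1 l2]], intro always_eventually allI)
      fix n
      have "integrable lborel (\<lambda>x. (w x * b' e (F (sub n) x)) *\<^sub>R (G (sub n) x - g0 x))" "integrable lborel (\<lambda>x. (w x * b' e (F (sub n) x)) *\<^sub>R g0 x)"
        using F_nonneg G_int g0 by (auto intro!: i3)
      then show "(\<integral>x. (w x * b' e (F (sub n) x)) *\<^sub>R (G (sub n) x - g0 x) \<partial>lborel) + (\<integral>x. (w x * b' e (F (sub n) x)) *\<^sub>R g0 x \<partial>lborel)
        = (\<integral>x. (w x * b' e (F (sub n) x)) *\<^sub>R G (sub n) x \<partial>lborel)"
        by (subst Bochner_Integration.integral_add[symmetric]) (auto simp: scaleR_add_right[symmetric])
    qed
    then have "(\<lambda>n. norm (\<integral>x. (w x * b' e (F (sub n) x)) *\<^sub>R G (sub n) x \<partial>lborel)) \<longlonglongrightarrow> norm (\<integral>x. (w x * b' e (f0 x)) *\<^sub>R g0 x \<partial>lborel)"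
      by (intro tendsto_norm) simp
    then show ?thesis by (rule tendsto_upperbound) (use bound_n in auto)
  qed
  \<comment> \<open>Where the cutoff vanishes, its gradient vanishes as well; so the truncated gradient on the zero set is \<open>\<eta> g\<close> on \<open>{f = 0}\<close>.\<close>
  have z: "(if f0 x = 0 then w x *\<^sub>R g0 x else 0) = (w x * cutoff R x) *\<^sub>R (if f x = 0 then g x else 0)" for x
  proof (cases "cutoff R x = 0")
    case True
    then have "(norm (cutoff_grad R x))\<^sup>2 \<le> 0" using cutoff_grad_le[OF R, of x] by simp
    then have "cutoff_grad R x = 0" by simp
    with True show ?thesis by (simp add: f0_def g0_def)
  qed (simp add: f0_def g0_def)
  have "(\<lambda>n. \<integral>x. (w x * b' (\<delta> n) (f0 x)) *\<^sub>R g0 x \<partial>lborel) \<longlonglongrightarrow> (\<integral>x. (if f0 x = 0 then w x *\<^sub>R g0 x else 0) \<partial>lborel)"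
  proof (rule integral_dominated_convergence[where w = "\<lambda>x. Mw * norm (g0 x)"])
    show "AE x in lborel. (\<lambda>n. (w x * b' (\<delta> n) (f0 x)) *\<^sub>R g0 x) \<longlonglongrightarrow> (if f0 x = 0 then w x *\<^sub>R g0 x else 0)"
    proof (rule AE_I2)
      fix x
      show "(\<lambda>n. (w x * b' (\<delta> n) (f0 x)) *\<^sub>R g0 x) \<longlonglongrightarrow> (if f0 x = 0 then w x *\<^sub>R g0 x else 0)"
      proof (cases "f0 x = 0")
        case True
        then have "b' (\<delta> n) (f0 x) = 1" for n using \<delta>(2)[of n] by (simp add: b'_def)
        then show ?thesis using True by simp
      next
        case False
        have "(\<lambda>n. (w x * ((\<delta> n)\<^sup>2 / (\<delta> n + f0 x)\<^sup>2)) *\<^sub>R g0 x) \<longlonglongrightarrow> (w x * (0\<^sup>2 / (0 + f0 x)\<^sup>2)) *\<^sub>R g0 x"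
          using False by (intro tendsto_intros \<delta>(1)) auto
        then show ?thesis using False by (simp add: b'_def)
      qed
    qed
    show "AE x in lborel. norm ((w x * b' (\<delta> n) (f0 x)) *\<^sub>R g0 x) \<le> Mw * norm (g0 x)" for n
    proof (rule AE_I2)
      fix x
      have "\<bar>w x * b' (\<delta> n) (f0 x)\<bar> \<le> Mw * 1" unfolding abs_mult
        using Mw b'_bounds[OF \<delta>(2) f0_nonneg] by (intro mult_mono) auto
      then show "norm ((w x * b' (\<delta> n) (f0 x)) *\<^sub>R g0 x) \<le> Mw * norm (g0 x)" by (simp add: mult_right_mono)
    qed
  qed (use g0 in auto)
  then have "(\<lambda>n. norm (\<integral>x. (w x * b' (\<delta> n) (f0 x)) *\<^sub>R g0 x \<partial>lborel)) \<longlonglongrightarrow> norm (\<integral>x. (if f0 x = 0 then w x *\<^sub>R g0 x else 0) \<partial>lborel)"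
    by (rule tendsto_norm)
  moreover have "(\<lambda>n. norm (\<integral>x. (w x * b' (\<delta> n) (f0 x)) *\<^sub>R g0 x \<partial>lborel)) \<longlonglongrightarrow> 0"
  proof (rule tendsto_sandwich[OF _ _ tendsto_const])
    show "(\<lambda>n. \<delta> n * (\<integral>x. norm (W x) \<partial>lborel)) \<longlonglongrightarrow> 0"
      using tendsto_mult_left_zero[OF \<delta>(1)] .
  qed (use main[OF \<delta>(2)] in auto)
  ultimately have "norm (\<integral>x. (if f0 x = 0 then w x *\<^sub>R g0 x else 0) \<partial>lborel) = 0" by (rule LIMSEQ_unique)
  then show ?thesis unfolding z by simp
qed

text \<open>Stampacchia's lemma. It is what allows the Fisher information to ignore the zero set of a density. The
cutoff of the previous lemma is removed by letting its radius tend to infinity.\<close>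

lemma weak_gradient_zero_set:
  fixes f :: "'a::euclidean_space \<Rightarrow> real" and g :: "'a \<Rightarrow> 'a"
  assumes wg: "weak_gradient f g" and [measurable]: "f \<in> borel_measurable borel" and nonneg: "\<And>x. 0 \<le> f x"
  shows "weak_gradient f (\<lambda>x. if f x = 0 then 0 else g x)"
  unfolding weak_gradient_def
proof (intro conjI allI impI)
  have [measurable]: "g \<in> borel_measurable borel" by (rule weak_gradient_measurable[OF wg])
  fix C :: "'a set" assume "compact C"
  then have [measurable]: "C \<in> sets borel" and C: "set_integrable lborel C f" "set_integrable lborel C g"
    using wg by (auto simp: weak_gradient_def dest: compact_imp_closed)
  show "set_integrable lborel C f" by fact
  show "set_integrable lborel C (\<lambda>x. if f x = 0 then 0 else g x)"
    unfolding set_integrable_def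
    by (rule Bochner_Integration.integrable_bound[OF C(2)[unfolded set_integrable_def]]) (auto simp: indicator_def)
next
  have [measurable]: "g \<in> borel_measurable borel" by (rule weak_gradient_measurable[OF wg])
  fix w :: "'a \<Rightarrow> real" and W
  assume "(\<forall>x. GDERIV w x :> W x) \<and> continuous_on UNIV W \<and> compact (closure {x. w x \<noteq> 0})"
  then have w: "\<And>x. GDERIV w x :> W x" "continuous_on UNIV W" "compact (closure {x. w x \<noteq> 0})" by auto
  have "bounded {x. w x \<noteq> 0}" using w(3) by (simp add: compact_closure)
  then obtain r where "\<And>x. w x \<noteq> 0 \<Longrightarrow> norm x \<le> r" unfolding bounded_iff by blast
  then have r: "\<And>x. norm x > r \<Longrightarrow> w x = 0" by force
  have w_cont: "continuous_on UNIV w" by (rule GDERIV_continuous_on[OF w(1)])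
  then have [measurable]: "w \<in> borel_measurable borel" by (rule borel_measurable_continuous_onI)
  obtain Mw where Mw: "0 \<le> Mw" "\<And>x. norm (w x) \<le> Mw"
    using bounded_of_compact_support[OF w_cont r] by metis
  define z where "z x = (if f x = 0 then g x else 0)" for x
  have [measurable]: "z \<in> borel_measurable borel" unfolding z_def[abs_def] by measurable
  have loc: "set_integrable lborel (cball 0 r) g" using wg unfolding weak_gradient_def by auto
  have wz: "integrable lborel (\<lambda>x. w x *\<^sub>R z x)" and wg0: "integrable lborel (\<lambda>x. w x *\<^sub>R (if f x = 0 then 0 else g x))"
    by (rule integrable_if_dominated_on_cball[OF loc, where C = Mw],
        use Mw r in \<open>auto simp: z_def mult_right_mono\<close>)+
  have "(\<lambda>n. \<integral>x. (w x * cutoff (real (Suc n)) x) *\<^sub>R z x \<partial>lborel) \<longlonglongrightarrow> (\<integral>x. (w x * 1) *\<^sub>R z x \<partial>lborel)"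
  proof (rule integral_dominated_convergence[where w = "\<lambda>x. norm (w x *\<^sub>R z x)"])
    show "AE x in lborel. (\<lambda>n. (w x * cutoff (real (Suc n)) x) *\<^sub>R z x) \<longlonglongrightarrow> (w x * 1) *\<^sub>R z x"
      by (intro AE_I2 tendsto_intros cutoff_tendsto)
    show "AE x in lborel. norm ((w x * cutoff (real (Suc n)) x) *\<^sub>R z x) \<le> norm (w x *\<^sub>R z x)" for n
    proof (rule AE_I2)
      fix x :: 'a
      have "\<bar>w x * cutoff (real (Suc n)) x\<bar> \<le> \<bar>w x\<bar> * 1" unfolding abs_mult
        using cutoff_bounds[of "real (Suc n)" x] by (intro mult_left_mono) auto
      then show "norm ((w x * cutoff (real (Suc n)) x) *\<^sub>R z x) \<le> norm (w x *\<^sub>R z x)" by (simp add: mult_right_mono)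
    qed
  qed (use integrable_norm[OF wz] in auto)
  moreover have "(\<integral>x. (w x * cutoff (real (Suc n)) x) *\<^sub>R z x \<partial>lborel) = 0" for n
    unfolding z_def by (rule weak_gradient_zero_set_cutoff[OF wg _ nonneg _ w(1,2) r]) auto
  ultimately have z0: "(\<integral>x. w x *\<^sub>R z x \<partial>lborel) = 0" using LIMSEQ_unique[OF _ tendsto_const[of 0]] by auto
  have "(\<integral>x. f x *\<^sub>R W x \<partial>lborel) = - (\<integral>x. w x *\<^sub>R g x \<partial>lborel)"
    by (rule weak_gradientD[OF wg w])
  also have "(\<integral>x. w x *\<^sub>R g x \<partial>lborel) = (\<integral>x. w x *\<^sub>R z x + w x *\<^sub>R (if f x = 0 then 0 else g x) \<partial>lborel)"
    by (rule Bochner_Integration.integral_cong) (auto simp: z_def)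
  also have "\<dots> = (\<integral>x. w x *\<^sub>R (if f x = 0 then 0 else g x) \<partial>lborel)" using wz wg0 z0 by simp
  finally show "(\<integral>x. f x *\<^sub>R W x \<partial>lborel) = - (\<integral>x. w x *\<^sub>R (if f x = 0 then 0 else g x) \<partial>lborel)" .
qed

section \<open>Logarithmic Sobolev inequality for Gaussian measures\<close>

lemma entropy_gap_measurable [measurable]: "(\<lambda>t. entropy_gap t m) \<in> borel_measurable borel"
  unfolding entropy_gap_def by measurable

lemma entropy_gap_nonneg:
  assumes "0 \<le> t" "0 < m" shows "0 \<le> entropy_gap t m"
proof (cases "t = 0")
  case False
  then have t: "0 < t" using assms by simp
  have "ln (m / t) \<le> m / t - 1" using t assms by (intro ln_le_minus_one) auto
  then have "t * ln (m / t) \<le> t * (m / t - 1)" using t by (intro mult_left_mono) auto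
  then show ?thesis using t assms by (simp add: entropy_gap_def ln_div algebra_simps)
qed (use assms in \<open>simp add: entropy_gap_def\<close>)

text \<open>Quantifies that \<open>t ln t\<close> tends to 0 at 0, where the logarithm is not continuous.\<close>

lemma abs_mult_ln_le:
  assumes "0 \<le> t" shows "\<bar>t * ln t\<bar> \<le> 2 * sqrt t + t\<^sup>2"
proof (cases "t = 0")
  case False
  then have t: "0 < t" using assms by simp
  have "ln (1 / sqrt t) \<le> 1 / sqrt t - 1" using t by (intro ln_le_minus_one) auto
  then have "- (ln t / 2) \<le> 1 / sqrt t" using t by (simp add: ln_div ln_sqrt)
  then have "t * (- (ln t / 2)) \<le> t * (1 / sqrt t)" using t by (intro mult_left_mono) auto
  moreover have "t * (1 / sqrt t) = sqrt t" using t by (simp add: real_div_sqrt)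
  ultimately have 1: "- (t * ln t) \<le> 2 * sqrt t" by simp
  have "t * ln t \<le> t * (t - 1)" using t by (intro mult_left_mono ln_le_minus_one) auto
  then have "t * ln t \<le> t\<^sup>2" using t unfolding power2_eq_square right_diff_distrib by linarith
  moreover have "0 \<le> sqrt t" "0 \<le> t\<^sup>2" using t by auto
  ultimately show ?thesis using 1 by linarith
qed simp

lemma tendsto_mult_ln:
  fixes u :: "'b \<Rightarrow> real"
  assumes "(u \<longlongrightarrow> t) F" "\<And>n. 0 \<le> u n" "0 \<le> t"
  shows "((\<lambda>n. u n * ln (u n)) \<longlongrightarrow> t * ln t) F"
proof (cases "t = 0")
  case True
  have "((\<lambda>n. 2 * sqrt (u n) + (u n)\<^sup>2) \<longlongrightarrow> 2 * sqrt 0 + 0\<^sup>2) F"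
    using assms(1) True by (intro tendsto_intros) auto
  then have "((\<lambda>n. 2 * sqrt (u n) + (u n)\<^sup>2) \<longlongrightarrow> 0) F" by simp
  then have "((\<lambda>n. u n * ln (u n)) \<longlongrightarrow> 0) F"
    by (rule Lim_null_comparison[rotated]) (use abs_mult_ln_le[OF assms(2)] in auto)
  then show ?thesis using True by simp
next
  case False
  then show ?thesis using assms by (intro tendsto_intros) auto
qed

lemma tendsto_entropy_gap:
  fixes u :: "'b \<Rightarrow> real"
  assumes "(u \<longlongrightarrow> t) F" "\<And>n. 0 \<le> u n" "0 \<le> t" "(v \<longlongrightarrow> m) F" "0 < m"
  shows "((\<lambda>n. entropy_gap (u n) (v n)) \<longlongrightarrow> entropy_gap t m) F"
  unfolding entropy_gap_def using assms by (intro tendsto_intros tendsto_mult_ln) auto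

text \<open>Fatou's lemma, in the form in which lower semicontinuity is used.\<close>

lemma nn_integral_le_of_AE_tendsto:
  fixes u :: "nat \<Rightarrow> 'b \<Rightarrow> ennreal"
  assumes [measurable]: "\<And>n. u n \<in> borel_measurable M"
    and lim: "AE x in M. (\<lambda>n. u n x) \<longlonglongrightarrow> v x"
    and le: "\<And>n. (\<integral>\<^sup>+x. u n x \<partial>M) \<le> c n" and c: "c \<longlonglongrightarrow> C"
  shows "(\<integral>\<^sup>+x. v x \<partial>M) \<le> C"
proof -
  have "(\<integral>\<^sup>+x. v x \<partial>M) \<le> (\<integral>\<^sup>+x. liminf (\<lambda>n. u n x) \<partial>M)"
  proof (rule nn_integral_mono_AE, use lim in eventually_elim)
    fix x assume "(\<lambda>n. u n x) \<longlonglongrightarrow> v x"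
    then have "liminf (\<lambda>n. u n x) = v x" by (rule lim_imp_Liminf[OF sequentially_bot])
    then show "v x \<le> liminf (\<lambda>n. u n x)" by simp
  qed
  also have "\<dots> \<le> liminf (\<lambda>n. \<integral>\<^sup>+x. u n x \<partial>M)" by (rule nn_integral_liminf) measurable
  also have "\<dots> \<le> liminf c" using le by (intro Liminf_mono always_eventually) auto
  also have "liminf c = C" using c by (rule lim_imp_Liminf[OF sequentially_bot])
  finally show ?thesis .
qed

lemma nn_integral_gaussian_convolution:
  assumes "0 < s" "0 < t" and [measurable]: "h \<in> borel_measurable (borel :: 'a::euclidean_space measure)"
  shows "(\<integral>\<^sup>+x. h x \<partial>gaussian (s + t)) = (\<integral>\<^sup>+x. (\<integral>\<^sup>+y. h (x + y) \<partial>gaussian t) \<partial>gaussian s)"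
proof -
  interpret S: prob_space "gaussian s :: 'a measure" by (rule prob_space_gaussian) fact
  interpret T: prob_space "gaussian t :: 'a measure" by (rule prob_space_gaussian) fact
  have "(\<integral>\<^sup>+x. h x \<partial>gaussian (s + t)) = (\<integral>\<^sup>+p. h (fst p + snd p) \<partial>(gaussian s \<Otimes>\<^sub>M gaussian t))"
    unfolding gaussian_convolution[OF assms(1,2)] by (subst nn_integral_distr) (auto simp: split_beta)
  also have "\<dots> = (\<integral>\<^sup>+x. (\<integral>\<^sup>+y. h (x + y) \<partial>gaussian t) \<partial>gaussian s)"
    by (subst T.nn_integral_fst[symmetric]) auto
  finally show ?thesis .
qed

lemma integral_gaussian_convolution:
  fixes h :: "'a::euclidean_space \<Rightarrow> real"
  assumes "0 < s" "0 < t" and h: "integrable (gaussian (s + t)) h"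
  shows "(\<integral>x. (\<integral>y. h (x + y) \<partial>gaussian t) \<partial>gaussian s) = (\<integral>x. h x \<partial>gaussian (s + t))"
proof -
  interpret S: prob_space "gaussian s :: 'a measure" by (rule prob_space_gaussian) fact
  interpret T: prob_space "gaussian t :: 'a measure" by (rule prob_space_gaussian) fact
  interpret ST: pair_prob_space "gaussian s :: 'a measure" "gaussian t :: 'a measure" ..
  have [measurable]: "h \<in> borel_measurable borel" using h by (auto dest: borel_measurable_integrable)
  have "integrable (gaussian s \<Otimes>\<^sub>M gaussian t) (\<lambda>p. h (fst p + snd p))"
    using h unfolding gaussian_convolution[OF assms(1,2)] by (subst (asm) integrable_distr_eq) (auto simp: split_beta)
  then have "(\<integral>x. (\<integral>y. h (x + y) \<partial>gaussian t) \<partial>gaussian s) = (\<integral>p. h (fst p + snd p) \<partial>(gaussian s \<Otimes>\<^sub>M gaussian t))"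
    using ST.integral_fst'[of "\<lambda>p. h (fst p + snd p)"] by simp
  then show ?thesis
    unfolding gaussian_convolution[OF assms(1,2)] by (subst integral_distr) (auto simp: split_beta)
qed

text \<open>Jensen's inequality for \<open>|p|\<^sup>2 / m\<close> again, now including the case of an infinite right-hand side.\<close>

lemma norm_square_div_integral_le_nn_integral:
  fixes G :: "'z \<Rightarrow> 'a::euclidean_space"
  assumes G: "integrable M G" and F: "integrable M F" and pos: "\<And>z. 0 < F z" and m: "0 < (\<integral>z. F z \<partial>M)"
  shows "ennreal ((norm (\<integral>z. G z \<partial>M))\<^sup>2 / (\<integral>z. F z \<partial>M)) \<le> (\<integral>\<^sup>+z. ennreal ((norm (G z))\<^sup>2 / F z) \<partial>M)"
proof (cases "integrable M (\<lambda>z. (norm (G z))\<^sup>2 / F z)")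
  case True
  have "(norm (\<integral>z. G z \<partial>M))\<^sup>2 / (\<integral>z. F z \<partial>M) \<le> (\<integral>z. (norm (G z))\<^sup>2 / F z \<partial>M)"
    by (rule norm_square_div_integral_le) (use assms True in auto)
  then show ?thesis using True pos by (subst nn_integral_eq_integral) (auto simp: less_imp_le ennreal_leI)
next
  case False
  have [measurable]: "G \<in> borel_measurable M" "F \<in> borel_measurable M" using G F by auto
  have "(\<integral>\<^sup>+z. ennreal ((norm (G z))\<^sup>2 / F z) \<partial>M) = \<infinity>"
  proof (rule ccontr)
    assume "(\<integral>\<^sup>+z. ennreal ((norm (G z))\<^sup>2 / F z) \<partial>M) \<noteq> \<infinity>"
    then have "integrable M (\<lambda>z. (norm (G z))\<^sup>2 / F z)"
      using pos by (intro integrableI_nonneg) (auto simp: less_imp_le less_top)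
    then show False using False by simp
  qed
  then show ?thesis by simp
qed

text \<open>Run the heat semigroup for time \<open>\<delta>\<close> on the function and apply the smooth inequality for the
remaining time \<open>T = s - \<delta>\<close>. The mean \<open>m\<close> does not depend on \<open>\<delta>\<close> because \<open>T + \<delta> = s\<close>. The constant
\<open>\<epsilon>\<close> keeps the function away from 0, as the smooth inequality requires.\<close>

lemma gaussian_LSI_compact:
  fixes f0 :: "'a::euclidean_space \<Rightarrow> real" and g0 :: "'a \<Rightarrow> 'a"
  assumes f0: "integrable lborel f0" and g0: "integrable lborel g0" and s: "0 < s"
    and nonneg: "\<And>x. 0 \<le> f0 x" and \<epsilon>: "0 < \<epsilon>"
    and test: "\<And>w W. (\<And>x. GDERIV w x :> W x) \<Longrightarrow> continuous_on UNIV W \<Longrightarrow>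
       (\<integral>x. f0 x *\<^sub>R W x \<partial>lborel) = - (\<integral>x. w x *\<^sub>R g0 x \<partial>lborel)"
  shows "(\<integral>\<^sup>+x. ennreal (entropy_gap (\<epsilon> + f0 x) (\<epsilon> + (\<integral>x. f0 x \<partial>gaussian s))) \<partial>gaussian s)
     \<le> ennreal (s / 2) * (\<integral>\<^sup>+x. ennreal ((norm (g0 x))\<^sup>2 / (\<epsilon> + f0 x)) \<partial>gaussian s)"
proof -
  have [measurable]: "f0 \<in> borel_measurable borel" "g0 \<in> borel_measurable borel" using f0 g0 by auto
  have f0_s: "integrable (gaussian s) f0" using integrable_heat_L1[OF f0 s, of 0] by simp
  define m where "m = \<epsilon> + (\<integral>x. f0 x \<partial>gaussian s)"
  have m: "0 < m" unfolding m_def using \<epsilon> nonneg by (intro add_pos_nonneg Bochner_Integration.integral_nonneg) auto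
  define I where "I = (\<integral>\<^sup>+x. ennreal ((norm (g0 x))\<^sup>2 / (\<epsilon> + f0 x)) \<partial>gaussian s)"
  have step: "(\<integral>\<^sup>+x. ennreal (entropy_gap (\<epsilon> + heat \<delta> f0 x) m) \<partial>gaussian (s - \<delta>)) \<le> ennreal (s / 2) * I"
    if \<delta>: "0 < \<delta>" "\<delta> < s" for \<delta>
  proof -
    define T where "T = s - \<delta>"
    have T: "0 < T" "T + \<delta> = s" using \<delta> by (auto simp: T_def)
    interpret P: prob_space "gaussian T :: 'a measure" by (rule prob_space_gaussian) fact
    interpret D: prob_space "gaussian \<delta> :: 'a measure" by (rule prob_space_gaussian) fact
    define F where "F x = \<epsilon> + heat \<delta> f0 x" for x
    define G where "G = heat \<delta> g0"
    have F_ge: "\<epsilon> \<le> F x" for x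
      unfolding F_def heat_def using nonneg by (simp add: Bochner_Integration.integral_nonneg)
    have F_pos: "0 < F x" for x using F_ge[of x] \<epsilon> by simp
    obtain L where L: "L-lipschitz_on UNIV G" using heat_weak_gradient(2)[OF f0 g0 \<delta>(1) test] by (auto simp: G_def)
    obtain B where B: "\<And>x. norm (G x) \<le> B" "\<And>x. \<bar>heat \<delta> f0 x\<bar> \<le> B"
      using heat_weak_gradient(3)[OF f0 g0 \<delta>(1) test] by (auto simp: G_def)
    have "GDERIV F x :> G x" for x
      using GDERIV_add[OF GDERIV_const[of \<epsilon>] heat_weak_gradient(1)[OF f0 g0 \<delta>(1) test]]
      unfolding F_def G_def by simp
    moreover have "norm (G x) \<le> \<epsilon> + B" "F x \<le> \<epsilon> + B" for x
      using B[of x] \<epsilon> by (auto simp: F_def)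
    ultimately have tame: "tame \<epsilon> (\<epsilon> + B) L F G"
      unfolding tame_def using L F_ge \<epsilon> by auto
    note bb = tame_bounded_borel[OF tame]
    note int = bb[THEN integrable_heat, OF T(1), of 0, simplified]
    have [measurable]: "F \<in> borel_measurable borel" "G \<in> borel_measurable borel"
      using bb(1,2) by (auto simp: bounded_borel_def)
    have mean: "heat T F 0 = m"
    proof -
      have "integrable (gaussian T) (heat \<delta> f0)"
      proof -
        have "heat \<delta> f0 = (\<lambda>x. F x - \<epsilon>)" by (simp add: F_def fun_eq_iff)
        then show ?thesis using int(1) by simp
      qed
      then have "heat T F 0 = \<epsilon> + (\<integral>x. heat \<delta> f0 x \<partial>gaussian T)"
        by (simp add: heat_def[of T] F_def P.prob_space[unfolded space_gaussian])
      also have "(\<integral>x. heat \<delta> f0 x \<partial>gaussian T) = (\<integral>x. f0 x \<partial>gaussian s)"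
        unfolding heat_def using integral_gaussian_convolution[OF T(1) \<delta>(1), of f0] f0_s T(2) by simp
      finally show ?thesis by (simp add: m_def)
    qed
    have gap_int: "integrable (gaussian T) (\<lambda>x. entropy_gap (F x) m)"
      unfolding entropy_gap_def using int by simp
    have "(\<integral>x. entropy_gap (F x) m \<partial>gaussian T) = (\<integral>x. F x * ln (F x) \<partial>gaussian T) - (\<integral>x. F x \<partial>gaussian T) * ln m - (\<integral>x. F x \<partial>gaussian T) + m"
      unfolding entropy_gap_def using int by (simp add: P.prob_space[unfolded space_gaussian])
    also have "\<dots> = heat T (\<lambda>x. F x * ln (F x)) 0 - m * ln m"
      unfolding mean[symmetric] by (simp add: heat_def[of T])
    also have "\<dots> \<le> T / 2 * heat T (\<lambda>x. (norm (G x))\<^sup>2 / F x) 0"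
      using log_sobolev_tame[OF tame T(1), of 0] unfolding mean .
    finally have "(\<integral>x. entropy_gap (F x) m \<partial>gaussian T) \<le> T / 2 * (\<integral>x. (norm (G x))\<^sup>2 / F x \<partial>gaussian T)"
      by (simp add: heat_def)
    then have "ennreal (\<integral>x. entropy_gap (F x) m \<partial>gaussian T) \<le> ennreal (T / 2) * ennreal (\<integral>x. (norm (G x))\<^sup>2 / F x \<partial>gaussian T)"
      using T F_pos by (simp add: ennreal_mult'[symmetric] ennreal_leI)
    also have "ennreal (\<integral>x. (norm (G x))\<^sup>2 / F x \<partial>gaussian T) = (\<integral>\<^sup>+x. ennreal ((norm (G x))\<^sup>2 / F x) \<partial>gaussian T)"
      using int(4) F_pos by (intro nn_integral_eq_integral[symmetric]) (auto simp: less_imp_le)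
    also have "ennreal (T / 2) * (\<integral>\<^sup>+x. ennreal ((norm (G x))\<^sup>2 / F x) \<partial>gaussian T)
      \<le> ennreal (T / 2) * (\<integral>\<^sup>+x. (\<integral>\<^sup>+y. ennreal ((norm (g0 (x + y)))\<^sup>2 / (\<epsilon> + f0 (x + y))) \<partial>gaussian \<delta>) \<partial>gaussian T)"
    proof (intro mult_left_mono nn_integral_mono)
      fix x
      have "F x = (\<integral>y. \<epsilon> + f0 (x + y) \<partial>gaussian \<delta>)"
        using integrable_heat_L1[OF f0 \<delta>(1)] by (simp add: F_def heat_def D.prob_space[unfolded space_gaussian])
      then show "ennreal ((norm (G x))\<^sup>2 / F x) \<le> (\<integral>\<^sup>+y. ennreal ((norm (g0 (x + y)))\<^sup>2 / (\<epsilon> + f0 (x + y))) \<partial>gaussian \<delta>)"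
        using norm_square_div_integral_le_nn_integral[of "gaussian \<delta>" "\<lambda>y. g0 (x + y)" "\<lambda>y. \<epsilon> + f0 (x + y)"]
          integrable_heat_L1[OF f0 \<delta>(1)] integrable_heat_L1[OF g0 \<delta>(1)] add_pos_nonneg[OF \<epsilon> nonneg] F_pos[of x]
        by (simp add: G_def heat_def)
    qed simp
    also have "(\<integral>\<^sup>+x. (\<integral>\<^sup>+y. ennreal ((norm (g0 (x + y)))\<^sup>2 / (\<epsilon> + f0 (x + y))) \<partial>gaussian \<delta>) \<partial>gaussian T) = I"
      unfolding I_def T(2)[symmetric] by (rule nn_integral_gaussian_convolution[symmetric]) (use T \<delta> in auto)
    also have "ennreal (T / 2) * I \<le> ennreal (s / 2) * I"
      using T \<delta> by (intro mult_right_mono ennreal_leI) auto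
    also have "ennreal (\<integral>x. entropy_gap (F x) m \<partial>gaussian T) = (\<integral>\<^sup>+x. ennreal (entropy_gap (F x) m) \<partial>gaussian T)"
      using gap_int F_pos m by (intro nn_integral_eq_integral[symmetric]) (auto simp: less_imp_le entropy_gap_nonneg)
    finally show ?thesis by (simp add: F_def T_def)
  qed
  \<comment> \<open>The shift by two keeps \<open>\<delta> n\<close> strictly below \<open>s\<close>.\<close>
  define \<delta> where "\<delta> n = s / real (Suc (Suc n))" for n
  have \<delta>: "\<delta> \<longlonglongrightarrow> 0" "\<And>n. 0 < \<delta> n" "\<And>n. \<delta> n < s"
    unfolding \<delta>_def using LIMSEQ_Suc[OF LIMSEQ_Suc[OF lim_const_over_n[of s]]] s by (auto simp: field_simps add_pos_nonneg)
  have "integrable lborel (\<lambda>x. heat (\<delta> n) f0 x - f0 x)" for n using heat_L1(1)[OF f0 \<delta>(2)] f0 by simp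
  from tendsto_L1_AE_subseq[OF this heat_tendsto_L1[OF f0 \<delta>(1,2)]]
  obtain sub where sub: "strict_mono (sub :: nat \<Rightarrow> nat)" "AE x in lborel. (\<lambda>n. heat (\<delta> (sub n)) f0 x - f0 x) \<longlonglongrightarrow> 0" by auto
  have sub0: "(\<lambda>n. \<delta> (sub n)) \<longlonglongrightarrow> 0" using LIMSEQ_subseq_LIMSEQ[OF \<delta>(1) sub(1)] by (simp add: comp_def)
  have "(\<integral>\<^sup>+x. ennreal (gauss s x) * ennreal (entropy_gap (\<epsilon> + f0 x) m) \<partial>lborel) \<le> ennreal (s / 2) * I"
  proof (rule nn_integral_le_of_AE_tendsto[where u = "\<lambda>n x. ennreal (gauss (s - \<delta> (sub n)) x) * ennreal (entropy_gap (\<epsilon> + heat (\<delta> (sub n)) f0 x) m)"])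
    fix n
    have [measurable]: "heat (\<delta> (sub n)) f0 \<in> borel_measurable borel" by (rule heat_measurable) (use \<delta>(2) in auto)
    show "(\<lambda>x. ennreal (gauss (s - \<delta> (sub n)) x) * ennreal (entropy_gap (\<epsilon> + heat (\<delta> (sub n)) f0 x) m)) \<in> borel_measurable lborel"
      by measurable
    show "(\<integral>\<^sup>+x. ennreal (gauss (s - \<delta> (sub n)) x) * ennreal (entropy_gap (\<epsilon> + heat (\<delta> (sub n)) f0 x) m) \<partial>lborel) \<le> ennreal (s / 2) * I"
      using step[OF \<delta>(2,3), of "sub n"] by (subst (asm) nn_integral_gaussian) auto
  next
    show "AE x in lborel. (\<lambda>n. ennreal (gauss (s - \<delta> (sub n)) x) * ennreal (entropy_gap (\<epsilon> + heat (\<delta> (sub n)) f0 x) m))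
        \<longlonglongrightarrow> ennreal (gauss s x) * ennreal (entropy_gap (\<epsilon> + f0 x) m)"
      using sub(2)
    proof eventually_elim
      case (elim x)
      then have h: "(\<lambda>n. heat (\<delta> (sub n)) f0 x) \<longlonglongrightarrow> f0 x" by (rule LIM_zero_cancel)
      have hn: "0 \<le> heat (\<delta> (sub n)) f0 x" for n
        unfolding heat_def using nonneg by (simp add: Bochner_Integration.integral_nonneg)
      have gap: "(\<lambda>n. entropy_gap (\<epsilon> + heat (\<delta> (sub n)) f0 x) m) \<longlonglongrightarrow> entropy_gap (\<epsilon> + f0 x) m"
        by (rule tendsto_entropy_gap) (use \<epsilon> hn nonneg m in \<open>auto intro!: tendsto_intros h add_nonneg_nonneg\<close>)
      have "(\<lambda>n. (1 / sqrt (2 * pi * (s - \<delta> (sub n)))) ^ DIM('a) * exp (- (norm x)\<^sup>2 / (2 * (s - \<delta> (sub n)))))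
         \<longlonglongrightarrow> (1 / sqrt (2 * pi * (s - 0))) ^ DIM('a) * exp (- (norm x)\<^sup>2 / (2 * (s - 0)))"
        using s by (intro tendsto_intros sub0) auto
      then have g: "(\<lambda>n. gauss (s - \<delta> (sub n)) x) \<longlonglongrightarrow> gauss s x"
        using \<delta>(3) s by (simp add: gauss_eq)
      have "(\<lambda>n. ennreal (gauss (s - \<delta> (sub n)) x * entropy_gap (\<epsilon> + heat (\<delta> (sub n)) f0 x) m))
         \<longlonglongrightarrow> ennreal (gauss s x * entropy_gap (\<epsilon> + f0 x) m)"
        by (intro tendsto_ennrealI tendsto_mult g gap)
      then show ?case by (simp add: ennreal_mult')
    qed
  qed (rule tendsto_const)
  then show ?thesis unfolding m_def I_def by (subst nn_integral_gaussian) auto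
qed

text \<open>Apply the previous lemma to \<open>1 / R + \<eta> f\<close> with the cutoff \<open>\<eta>\<close> of radius \<open>R\<close> and let \<open>R\<close> tend to
infinity. Young's inequality \<open>|u + v|\<^sup>2 \<le> (1 + 1 / R) |u|\<^sup>2 + (1 + R) |v|\<^sup>2\<close> splits the gradient
\<open>\<eta> \<nabla>f + f \<nabla>\<eta>\<close>; the second part contributes at most \<open>(1 + R) * 16 / R\<^sup>2\<close> times the mean of \<open>f\<close>, which
tends to 0.\<close>

theorem gaussian_log_sobolev:
  fixes f :: "'a::euclidean_space \<Rightarrow> real" and g :: "'a \<Rightarrow> 'a"
  assumes s: "0 < s" and [measurable]: "f \<in> borel_measurable borel" and nonneg: "\<And>x. 0 \<le> f x"
    and wg: "weak_gradient f g" and f: "integrable (gaussian s) f"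
  defines "m \<equiv> \<integral>x. f x \<partial>gaussian s"
  assumes m: "0 < m"
  shows "(\<integral>\<^sup>+x. ennreal (entropy_gap (f x) m) \<partial>gaussian s)
     \<le> ennreal (s / 2) * (\<integral>\<^sup>+x. ennreal ((norm (g x))\<^sup>2 / f x) \<partial>gaussian s)"
proof (cases "(\<integral>\<^sup>+x. ennreal ((norm (g x))\<^sup>2 / f x) \<partial>gaussian s) = \<infinity>")
  case True
  then show ?thesis using s by (simp add: ennreal_mult_top)
next
  case False
  then obtain i where i: "(\<integral>\<^sup>+x. ennreal ((norm (g x))\<^sup>2 / f x) \<partial>gaussian s) = ennreal i" "0 \<le> i"
    by (cases "\<integral>\<^sup>+x. ennreal ((norm (g x))\<^sup>2 / f x) \<partial>gaussian s") auto
  have [measurable]: "g \<in> borel_measurable borel" by (rule weak_gradient_measurable[OF wg])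
  define h where "h x = (if f x = 0 then 0 else g x)" for x
  have [measurable]: "h \<in> borel_measurable borel" unfolding h_def[abs_def] by measurable
  have wh: "weak_gradient f h" unfolding h_def[abs_def] by (rule weak_gradient_zero_set[OF wg _ nonneg]) simp
  have h_eq: "(norm (h x))\<^sup>2 / f x = (norm (g x))\<^sup>2 / f x" for x by (simp add: h_def)
  define R where "R n = real (Suc n)" for n
  have R: "0 < R n" "1 \<le> R n" for n by (auto simp: R_def)
  define c where "c n = (1 + R n) * (16 / (R n)\<^sup>2)" for n
  have c_nonneg: "0 \<le> c n" for n using R by (simp add: c_def less_imp_le)
  define fn where "fn n x = cutoff (R n) x * f x" for n x
  define gn where "gn n x = cutoff (R n) x *\<^sub>R h x + f x *\<^sub>R cutoff_grad (R n) x" for n x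
  have [measurable]: "fn n \<in> borel_measurable borel" "gn n \<in> borel_measurable borel" for n
    unfolding fn_def[abs_def] gn_def[abs_def] by measurable
  have fn_nonneg: "0 \<le> fn n x" for n x using nonneg[of x] by (simp add: fn_def cutoff_bounds)
  define mn where "mn n = 1 / R n + (\<integral>x. fn n x \<partial>gaussian s)" for n
  have ptw: "(norm (gn n x))\<^sup>2 / (1 / R n + fn n x) \<le> (1 + 1 / R n) * ((norm (g x))\<^sup>2 / f x) + c n * f x" for n x
  proof (cases "fn n x = 0")
    case True
    have "gn n x = 0"
    proof (cases "f x = 0")
      case False
      then have e: "cutoff (R n) x = 0" using True by (simp add: fn_def)
      then have "(norm (cutoff_grad (R n) x))\<^sup>2 \<le> 0" using cutoff_grad_le[OF R(1)[of n], of x] by simp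
      then show ?thesis using e by (simp add: gn_def)
    qed (simp add: gn_def h_def)
    then show ?thesis using nonneg[of x] R(1)[of n] c_nonneg[of n]
      by (auto intro!: add_nonneg_nonneg mult_nonneg_nonneg divide_nonneg_nonneg)
  next
    case False
    define e where "e = cutoff (R n) x"
    define a where "a = cutoff_grad (R n) x"
    have e: "0 < e" "e \<le> 1" and fx: "0 < f x"
      using False nonneg[of x] cutoff_bounds[of "R n" x] by (auto simp: fn_def e_def less_le)
    have hx: "h x = g x" using fx by (simp add: h_def)
    have a: "(norm a)\<^sup>2 \<le> 16 / (R n)\<^sup>2 * e" unfolding a_def e_def by (rule cutoff_grad_le[OF R(1)])
    have young: "(norm (u + v))\<^sup>2 \<le> (1 + 1 / r) * (norm u)\<^sup>2 + (1 + r) * (norm v)\<^sup>2" if "0 < r" for u v :: 'a and r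
    proof -
      have "(norm (u + v))\<^sup>2 \<le> (norm u + norm v)\<^sup>2" by (intro power_mono norm_triangle_ineq) auto
      also have "\<dots> = (norm u)\<^sup>2 + (norm v)\<^sup>2 + 2 * norm u * norm v" by (simp add: power2_sum)
      also have "2 * norm u * norm v \<le> (norm u)\<^sup>2 / r + r * (norm v)\<^sup>2"
        using zero_le_power2[of "norm u / sqrt r - sqrt r * norm v"] that
        by (simp add: power2_diff power_divide power_mult_distrib)
      finally show ?thesis by (simp add: algebra_simps)
    qed
    have "(norm (gn n x))\<^sup>2 / (1 / R n + fn n x) \<le> (norm (gn n x))\<^sup>2 / (e * f x)"
      using e fx R(1)[of n] by (intro divide_left_mono) (auto simp: fn_def e_def[symmetric] add_pos_pos)
    also have "\<dots> \<le> ((1 + 1 / R n) * (norm (e *\<^sub>R g x))\<^sup>2 + (1 + R n) * (norm (f x *\<^sub>R a))\<^sup>2) / (e * f x)"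
      unfolding gn_def hx e_def[symmetric] a_def[symmetric] using e fx
      by (intro divide_right_mono young R) auto
    also have "\<dots> = (1 + 1 / R n) * (e * ((norm (g x))\<^sup>2 / f x)) + (1 + R n) * f x * ((norm a)\<^sup>2 / e)"
      using e fx R(1)[of n] by (simp add: power_mult_distrib add_divide_distrib power2_eq_square mult.commute mult.left_commute)
    also have "\<dots> \<le> (1 + 1 / R n) * (1 * ((norm (g x))\<^sup>2 / f x)) + (1 + R n) * f x * (16 / (R n)\<^sup>2)"
      using e fx R(1)[of n] a
      by (intro add_mono mult_left_mono mult_right_mono) (auto simp: divide_le_eq)
    finally show ?thesis by (simp add: c_def mult.commute mult.left_commute)
  qed
  have step: "(\<integral>\<^sup>+x. ennreal (entropy_gap (1 / R n + fn n x) (mn n)) \<partial>gaussian s)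
      \<le> ennreal (s / 2 * ((1 + 1 / R n) * i + c n * m))" for n
  proof -
    have "(\<integral>\<^sup>+x. ennreal (entropy_gap (1 / R n + fn n x) (mn n)) \<partial>gaussian s)
      \<le> ennreal (s / 2) * (\<integral>\<^sup>+x. ennreal ((norm (gn n x))\<^sup>2 / (1 / R n + fn n x)) \<partial>gaussian s)"
      unfolding mn_def
    proof (rule gaussian_LSI_compact)
      show "integrable lborel (fn n)" "integrable lborel (gn n)"
        using weak_gradient_cutoff(1,2)[OF wh _ R(1)[of n]] by (auto simp: fn_def[abs_def] gn_def[abs_def])
      fix w and W :: "'a \<Rightarrow> 'a" assume "\<And>x. GDERIV w x :> W x" "continuous_on UNIV W"
      then show "(\<integral>x. fn n x *\<^sub>R W x \<partial>lborel) = - (\<integral>x. w x *\<^sub>R gn n x \<partial>lborel)"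
        unfolding fn_def gn_def by (rule weak_gradient_cutoff(3)[OF wh _ R(1)[of n], rotated]) simp
    qed (use s R(1)[of n] fn_nonneg in auto)
    also have "\<dots> \<le> ennreal (s / 2) * (\<integral>\<^sup>+x. ennreal (1 + 1 / R n) * ennreal ((norm (g x))\<^sup>2 / f x) + ennreal (c n) * ennreal (f x) \<partial>gaussian s)"
    proof (intro mult_left_mono nn_integral_mono)
      fix x
      show "ennreal ((norm (gn n x))\<^sup>2 / (1 / R n + fn n x)) \<le> ennreal (1 + 1 / R n) * ennreal ((norm (g x))\<^sup>2 / f x) + ennreal (c n) * ennreal (f x)"
        using ptw[of n x] R(1)[of n] c_nonneg[of n] nonneg[of x]
        by (simp add: ennreal_mult'[symmetric] ennreal_mult''[symmetric] ennreal_plus[symmetric] ennreal_leI del: ennreal_plus)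
    qed simp
    also have "(\<integral>\<^sup>+x. ennreal (1 + 1 / R n) * ennreal ((norm (g x))\<^sup>2 / f x) + ennreal (c n) * ennreal (f x) \<partial>gaussian s)
       = ennreal (1 + 1 / R n) * ennreal i + ennreal (c n) * ennreal m"
    proof -
      have "(\<integral>\<^sup>+x. ennreal (f x) \<partial>gaussian s) = ennreal m"
        unfolding m_def using f nonneg by (intro nn_integral_eq_integral) auto
      then show ?thesis by (subst nn_integral_add) (simp_all add: nn_integral_cmult i)
    qed
    also have "ennreal (s / 2) * \<dots> = ennreal (s / 2 * ((1 + 1 / R n) * i + c n * m))"
      using s i m c_nonneg[of n] R(1)[of n] by (simp add: ennreal_mult'[symmetric] ennreal_plus[symmetric] del: ennreal_plus)
    finally show ?thesis .
  qed
  have R_lim: "(\<lambda>n. 1 / R n) \<longlonglongrightarrow> 0" unfolding R_def using LIMSEQ_Suc[OF lim_const_over_n[of 1]] by simp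
  have "(\<lambda>n. 16 * (1 / R n) * (1 / R n) + 16 * (1 / R n)) \<longlonglongrightarrow> 16 * 0 * 0 + 16 * 0"
    by (intro tendsto_intros R_lim)
  moreover have "c n = 16 * (1 / R n) * (1 / R n) + 16 * (1 / R n)" for n
    using R(1)[of n] by (simp add: c_def field_simps power2_eq_square)
  then have "c = (\<lambda>n. 16 * (1 / R n) * (1 / R n) + 16 * (1 / R n))" by (rule ext)
  ultimately have c_lim: "c \<longlonglongrightarrow> 0" by (simp only:) simp
  have "mn \<longlonglongrightarrow> 0 + m"
    unfolding mn_def m_def
  proof (intro tendsto_add R_lim integral_dominated_convergence[where w = f])
    show "AE x in gaussian s. (\<lambda>n. fn n x) \<longlonglongrightarrow> f x"
    proof (rule AE_I2)
      fix x
      have "(\<lambda>n. cutoff (R n) x * f x) \<longlonglongrightarrow> 1 * f x" unfolding R_def by (intro tendsto_intros cutoff_tendsto)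
      then show "(\<lambda>n. fn n x) \<longlonglongrightarrow> f x" by (simp add: fn_def)
    qed
    show "AE x in gaussian s. norm (fn n x) \<le> f x" for n
      using nonneg fn_nonneg by (intro AE_I2) (auto simp: fn_def cutoff_bounds mult_left_le_one_le)
  qed (use f in auto)
  then have mn_lim: "mn \<longlonglongrightarrow> m" by simp
  have "(\<integral>\<^sup>+x. ennreal (entropy_gap (f x) m) \<partial>gaussian s) \<le> ennreal (s / 2 * ((1 + 0) * i + 0 * m))"
  proof (rule nn_integral_le_of_AE_tendsto[OF _ _ step])
    show "AE x in gaussian s. (\<lambda>n. ennreal (entropy_gap (1 / R n + fn n x) (mn n))) \<longlonglongrightarrow> ennreal (entropy_gap (f x) m)"
    proof (rule AE_I2)
      fix x
      have "(\<lambda>n. 1 / R n + cutoff (R n) x * f x) \<longlonglongrightarrow> 0 + 1 * f x"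
        by (intro tendsto_intros R_lim cutoff_tendsto[folded R_def])
      then show "(\<lambda>n. ennreal (entropy_gap (1 / R n + fn n x) (mn n))) \<longlonglongrightarrow> ennreal (entropy_gap (f x) m)"
        using R fn_nonneg nonneg mn_lim m unfolding fn_def[symmetric]
        by (intro tendsto_ennrealI tendsto_entropy_gap) (auto simp: less_imp_le)
    qed
    show "(\<lambda>n. ennreal (s / 2 * ((1 + 1 / R n) * i + c n * m))) \<longlonglongrightarrow> ennreal (s / 2 * ((1 + 0) * i + 0 * m))"
      by (intro tendsto_ennrealI tendsto_intros R_lim c_lim)
  qed measurable
  also have "\<dots> = ennreal (s / 2) * (\<integral>\<^sup>+x. ennreal ((norm (g x))\<^sup>2 / f x) \<partial>gaussian s)"
    unfolding i using s i(2) by (simp add: ennreal_mult'[symmetric])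
  finally show ?thesis .
qed

section \<open>Bounded perturbations of the quadratic potential\<close>

lemma nn_integral_neg_ln_density_le_1:
  fixes f :: "'b \<Rightarrow> real"
  assumes "prob_space \<nu>" "\<And>x. 0 \<le> f x"
  shows "(\<integral>\<^sup>+x. ennreal (f x) * ennreal (- ln (f x)) \<partial>\<nu>) \<le> 1"
proof -
  interpret prob_space \<nu> by fact
  have "(\<integral>\<^sup>+x. ennreal (f x) * ennreal (- ln (f x)) \<partial>\<nu>) \<le> (\<integral>\<^sup>+x. 1 \<partial>\<nu>)"
  proof (rule nn_integral_mono)
    fix x
    have "f x * (- ln (f x)) \<le> 1"
      using entropy_gap_nonneg[OF assms(2)[of x], of 1] assms(2)[of x] by (simp add: entropy_gap_def)
    then show "ennreal (f x) * ennreal (- ln (f x)) \<le> 1"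
      using assms(2)[of x] by (simp add: ennreal_mult'[symmetric] ennreal_le_1)
  qed
  then show ?thesis by (simp add: emeasure_space_1)
qed

text \<open>Since \<open>f\<close> has integral one, \<open>f ln f\<close> and \<open>f ln f - f + 1\<close> have the same integral. The identity is
proved for positive and negative parts separately, because the positive part may be infinite.\<close>

lemma ext_integral_ln_density:
  fixes f :: "'b \<Rightarrow> real"
  assumes [measurable]: "f \<in> borel_measurable \<nu>" and nonneg: "\<And>x. 0 \<le> f x"
    and \<nu>: "prob_space \<nu>" and \<mu>: "prob_space (density \<nu> (\<lambda>x. ennreal (f x)))"
  shows "ext_integral (density \<nu> (\<lambda>x. ennreal (f x))) (\<lambda>x. ln (f x))
    = enn2ereal (\<integral>\<^sup>+x. ennreal (entropy_gap (f x) 1) \<partial>\<nu>)"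
proof -
  interpret prob_space \<nu> by fact
  define P where "P = (\<integral>\<^sup>+x. ennreal (f x) * ennreal (ln (f x)) \<partial>\<nu>)"
  define N where "N = (\<integral>\<^sup>+x. ennreal (f x) * ennreal (- ln (f x)) \<partial>\<nu>)"
  define X where "X = (\<integral>\<^sup>+x. ennreal (entropy_gap (f x) 1) \<partial>\<nu>)"
  have one: "(\<integral>\<^sup>+x. ennreal (f x) \<partial>\<nu>) = 1"
    using prob_space.emeasure_space_1[OF \<mu>] by (simp add: emeasure_density cong: nn_integral_cong)
  have "N < \<infinity>"
    using nn_integral_neg_ln_density_le_1[OF \<nu> nonneg] unfolding N_def
    by (auto simp: less_top intro: le_less_trans[OF _ ennreal_one_less_top])
  have "X + N + 1 = (\<integral>\<^sup>+x. ennreal (entropy_gap (f x) 1) + ennreal (f x) * ennreal (- ln (f x)) + ennreal (f x) \<partial>\<nu>)"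
    unfolding X_def N_def one[symmetric] by (simp add: nn_integral_add)
  also have "\<dots> = (\<integral>\<^sup>+x. ennreal (f x) * ennreal (ln (f x)) + 1 \<partial>\<nu>)"
  proof (rule nn_integral_cong)
    fix x
    have gap: "0 \<le> entropy_gap (f x) 1" by (rule entropy_gap_nonneg) (use nonneg in auto)
    show "ennreal (entropy_gap (f x) 1) + ennreal (f x) * ennreal (- ln (f x)) + ennreal (f x)
      = ennreal (f x) * ennreal (ln (f x)) + 1"
    proof (cases "0 \<le> ln (f x)")
      case True
      then have "ennreal (- ln (f x)) = 0" by (simp add: ennreal_neg)
      then show ?thesis using gap nonneg[of x] True
        by (simp add: ennreal_mult'[symmetric] ennreal_plus[symmetric] ennreal_1[symmetric] entropy_gap_def del: ennreal_plus ennreal_1)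
    next
      case False
      then have "ennreal (ln (f x)) = 0" "f x \<le> 1" using ln_ge_zero[of "f x"] by (auto simp: ennreal_neg)
      then show ?thesis using gap nonneg[of x] False
        by (simp add: ennreal_mult'[symmetric] ennreal_plus[symmetric] ennreal_1[symmetric] entropy_gap_def mult_nonneg_nonpos del: ennreal_plus ennreal_1)
    qed
  qed
  also have "\<dots> = P + 1" unfolding P_def by (simp add: nn_integral_add emeasure_space_1)
  finally have "X + N = P" by (simp add: add.commute[of _ 1] ennreal_add_left_cancel)
  then have "enn2ereal P - enn2ereal N = enn2ereal X"
    using \<open>N < \<infinity>\<close> by (cases N; cases X) (auto simp: plus_ennreal.rep_eq)
  moreover have "(\<integral>\<^sup>+x. ennreal (ln (f x)) \<partial>density \<nu> (\<lambda>x. ennreal (f x))) = P"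
    "(\<integral>\<^sup>+x. ennreal (- ln (f x)) \<partial>density \<nu> (\<lambda>x. ennreal (f x))) = N"
    unfolding P_def N_def by (subst nn_integral_density; simp)+
  ultimately show ?thesis by (simp add: ext_integral_def X_def)
qed

lemma relative_entropy_density:
  fixes f :: "'b \<Rightarrow> real"
  assumes [measurable]: "f \<in> borel_measurable \<nu>" and nonneg: "\<And>x. 0 \<le> f x"
    and \<nu>: "prob_space \<nu>" and \<mu>: "prob_space (density \<nu> (\<lambda>x. ennreal (f x)))"
  shows "relative_entropy (density \<nu> (\<lambda>x. ennreal (f x))) \<nu> = enn2ereal (\<integral>\<^sup>+x. ennreal (entropy_gap (f x) 1) \<partial>\<nu>)"
proof -
  interpret prob_space \<nu> by fact
  let ?\<mu> = "density \<nu> (\<lambda>x. ennreal (f x))"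
  have "AE x in \<nu>. ennreal (f x) = RN_deriv \<nu> ?\<mu> x" by (rule RN_deriv_unique) auto
  then have "AE x in ?\<mu>. f x = enn2real (RN_deriv \<nu> ?\<mu> x)"
    by (subst AE_density) (auto elim!: eventually_mono simp: nonneg dest: arg_cong[of _ _ enn2real])
  then have "ext_integral ?\<mu> (\<lambda>x. ln (enn2real (RN_deriv \<nu> ?\<mu> x))) = ext_integral ?\<mu> (\<lambda>x. ln (f x))"
    unfolding ext_integral_def
    by (intro arg_cong2[of _ _ _ _ minus] arg_cong[of _ _ enn2ereal] nn_integral_cong_AE) (auto elim!: eventually_mono)
  then show ?thesis
    unfolding relative_entropy_def using ext_integral_ln_density[OF _ nonneg \<nu> \<mu>] by simp
qed

text \<open>The mean is the optimal second argument: the difference of both sides is \<open>t - 1 - ln t\<close>. Terms are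
moved to the side where they are nonnegative, since both integrals may be infinite.\<close>

lemma nn_integral_entropy_gap_mean_le:
  fixes f :: "'b \<Rightarrow> real"
  assumes [measurable]: "f \<in> borel_measurable \<nu>" and nonneg: "\<And>x. 0 \<le> f x"
    and \<nu>: "prob_space \<nu>" and one: "(\<integral>\<^sup>+x. ennreal (f x) \<partial>\<nu>) = 1" and t: "0 < t"
  shows "(\<integral>\<^sup>+x. ennreal (entropy_gap (f x) 1) \<partial>\<nu>) \<le> (\<integral>\<^sup>+x. ennreal (entropy_gap (f x) t) \<partial>\<nu>)"
proof -
  interpret prob_space \<nu> by fact
  define p q where "p = max 0 (- ln t)" and "q = max 0 (ln t)"
  have pq: "0 \<le> p" "0 \<le> q" "q - p = ln t" by (auto simp: p_def q_def)
  define X where "X = (\<integral>\<^sup>+x. ennreal (entropy_gap (f x) 1) \<partial>\<nu>)"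
  define Y where "Y = (\<integral>\<^sup>+x. ennreal (entropy_gap (f x) t) \<partial>\<nu>)"
  have "X + ennreal p + ennreal t = (\<integral>\<^sup>+x. ennreal (entropy_gap (f x) 1) + ennreal p * ennreal (f x) + ennreal t \<partial>\<nu>)"
    by (simp add: nn_integral_add nn_integral_cmult one emeasure_space_1 X_def)
  also have "\<dots> = (\<integral>\<^sup>+x. ennreal (entropy_gap (f x) t) + ennreal q * ennreal (f x) + ennreal 1 \<partial>\<nu>)"
  proof (rule nn_integral_cong)
    fix x
    have "0 \<le> entropy_gap (f x) 1" "0 \<le> entropy_gap (f x) t" using nonneg t by (auto intro: entropy_gap_nonneg)
    moreover have "entropy_gap (f x) 1 + p * f x + t = entropy_gap (f x) t + q * f x + 1"
      using arg_cong[OF pq(3), of "\<lambda>u. u * f x"] by (simp add: entropy_gap_def algebra_simps)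
    ultimately show "ennreal (entropy_gap (f x) 1) + ennreal p * ennreal (f x) + ennreal t = ennreal (entropy_gap (f x) t) + ennreal q * ennreal (f x) + ennreal 1"
      using pq(1,2) nonneg[of x] t by (simp only: ennreal_mult'[symmetric] ennreal_plus[symmetric] mult_nonneg_nonneg add_nonneg_nonneg less_imp_le zero_le_one)
  qed
  also have "\<dots> = Y + ennreal q + ennreal 1"
    by (simp add: nn_integral_add nn_integral_cmult one emeasure_space_1 Y_def del: ennreal_1) 
  finally have eq: "X + ennreal (p + t) = Y + ennreal (q + 1)" using pq t by (simp add: add.assoc)
  have "q + 1 \<le> p + t" using ln_le_minus_one[OF t] pq(3) by linarith
  then have "Y + ennreal (q + 1) \<le> Y + ennreal (p + t)" by (intro add_left_mono ennreal_leI)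
  then have "X + ennreal (p + t) \<le> Y + ennreal (p + t)" unfolding eq .
  then show ?thesis unfolding X_def[symmetric] Y_def[symmetric] by (simp add: add.commute[of _ "ennreal (p + t)"] ennreal_add_left_cancel_le)
qed

lemma integrable_gaussian_norm_square:
  assumes s: "0 < s" shows "integrable (gaussian s) (\<lambda>x::'a::euclidean_space. (norm x)\<^sup>2)"
proof (rule Bochner_Integration.integrable_bound)
  show "integrable (gaussian s) (\<lambda>x::'a. (4 * s) * exp (1 / (4 * s) * (norm x)\<^sup>2))"
    using s by (intro integrable_mult_right integrable_gaussian_exp_square) (auto simp: divide_strict_left_mono)
  show "AE x::'a in gaussian s. norm ((norm x)\<^sup>2) \<le> norm ((4 * s) * exp (1 / (4 * s) * (norm x)\<^sup>2))"
  proof (rule AE_I2)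
    fix x :: 'a
    have "(norm x)\<^sup>2 = (4 * s) * (1 / (4 * s) * (norm x)\<^sup>2)" using s by simp
    also have "\<dots> \<le> (4 * s) * exp (1 / (4 * s) * (norm x)\<^sup>2)"
      using s exp_ge_add_one_self[of "1 / (4 * s) * (norm x)\<^sup>2"] by (intro mult_left_mono) linarith+
    finally show "norm ((norm x)\<^sup>2) \<le> norm ((4 * s) * exp (1 / (4 * s) * (norm x)\<^sup>2))" using s by simp
  qed
qed simp

text \<open>The Holley--Stroock argument. The Gibbs measure \<open>\<nu>\<close> has a density \<open>r\<close> with respect to the Gaussian
measure, with \<open>A * exp (- k) \<le> r \<le> A * exp k\<close>. Bound the entropy for \<open>\<nu>\<close> by the integral of
\<open>entropy_gap f m\<close> with the Gaussian mean \<open>m\<close> of \<open>f\<close>, pass to the Gaussian measure at the cost of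
\<open>A * exp k\<close>, apply the Gaussian inequality, and return to \<open>\<nu>\<close> at the cost of \<open>exp k / A\<close>.\<close>

theorem LSI_gibbs_bounded_perturbation:
  fixes w :: "'a::euclidean_space \<Rightarrow> real"
  assumes [measurable]: "w \<in> borel_measurable borel" and w: "\<And>x. \<bar>w x\<bar> \<le> k" and s: "0 < s"
  defines "U \<equiv> \<lambda>x. w x + (norm x)\<^sup>2 / (2 * s)"
  shows "integrable lborel (\<lambda>x. exp (- U x))" "LSI (exp (- 2 * k) / s) (gibbs U)"
proof -
  interpret N: prob_space "gaussian s :: 'a measure" by (rule prob_space_gaussian) fact
  define c where "c = (1 / sqrt (2 * pi * s)) ^ DIM('a)"
  have c: "0 < c" using s by (simp add: c_def)
  have U_eq: "exp (- U x) = gauss s x *\<^sub>R (exp (- w x) / c)" for x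
  proof -
    have "exp (- U x) = exp (- (norm x)\<^sup>2 / (2 * s)) * exp (- w x)"
      unfolding exp_add[symmetric] U_def by simp
    moreover have "gauss s x = c * exp (- (norm x)\<^sup>2 / (2 * s))" using s by (simp add: gauss_eq c_def)
    ultimately show ?thesis using c by simp
  qed
  have ew: "exp (- k) \<le> exp (- w x)" "exp (- w x) \<le> exp k" for x using w[of x] by auto
  have int_w: "integrable (gaussian s) (\<lambda>x::'a. exp (- w x) / c)"
    by (rule N.integrable_const_bound[where B = "exp k / c"])
       (use divide_right_mono[OF ew(2) less_imp_le[OF c]] c in \<open>auto intro!: AE_I2\<close>)
  have U_meas [measurable]: "U \<in> borel_measurable borel" unfolding U_def by measurable
  show int_U: "integrable lborel (\<lambda>x. exp (- U x))"
    using int_w unfolding U_eq by (subst (asm) integrable_gaussian) auto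
  define Z where "Z = (\<integral>x. exp (- U x) \<partial>lborel)"
  have "Z = (\<integral>x. exp (- w x) / c \<partial>gaussian s)" unfolding Z_def U_eq by (subst integral_gaussian) auto
  also have "\<dots> \<ge> (\<integral>x. exp (- k) / c \<partial>(gaussian s :: 'a measure))"
    using int_w ew c by (intro integral_mono) (auto intro: divide_right_mono)
  finally have "exp (- k) / c \<le> Z" by (simp add: N.prob_space[unfolded space_gaussian])
  moreover have "0 < exp (- k) / c" using c by simp
  ultimately have Z: "0 < Z" by linarith
  define A where "A = 1 / (c * Z)"
  have A: "0 < A" using c Z by (simp add: A_def)
  define r where "r x = A * exp (- w x)" for x
  have r: "A * exp (- k) \<le> r x" "r x \<le> A * exp k" "0 < r x" for x
    using ew[of x] A by (auto simp: r_def)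
  have [measurable]: "r \<in> borel_measurable borel" unfolding r_def[abs_def] by measurable
  define \<nu> where "\<nu> = gibbs U"
  have \<nu>_lborel: "\<nu> = density lborel (\<lambda>x. ennreal (exp (- U x) / Z))" by (simp add: \<nu>_def gibbs_def Z_def)
  have \<nu>_eq: "\<nu> = density (gaussian s) (\<lambda>x. ennreal (r x))"
    unfolding \<nu>_lborel gaussian_def
    by (subst density_density_eq) (use c Z in \<open>auto intro!: arg_cong[of _ _ "density lborel"] simp: U_eq r_def A_def ennreal_mult'[symmetric] mult.commute\<close>)
  have sets_\<nu> [simp, measurable_cong]: "sets \<nu> = sets borel" and space_\<nu> [simp]: "space \<nu> = UNIV" by (simp_all add: \<nu>_lborel)
  have nn_\<nu>: "(\<integral>\<^sup>+x. h x \<partial>\<nu>) = (\<integral>\<^sup>+x. ennreal (r x) * h x \<partial>gaussian s)" if "h \<in> borel_measurable borel" for h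
    unfolding \<nu>_eq using that by (subst nn_integral_density) auto
  interpret \<nu>: prob_space \<nu>
  proof
    have "emeasure \<nu> (space \<nu>) = (\<integral>\<^sup>+x. ennreal (exp (- U x) / Z) \<partial>lborel)"
      by (simp add: \<nu>_lborel emeasure_density)
    also have "\<dots> = ennreal (\<integral>x. exp (- U x) / Z \<partial>lborel)" using int_U Z by (intro nn_integral_eq_integral) auto
    also have "\<dots> = 1" using int_U Z by (simp add: Z_def[symmetric])
    finally show "emeasure \<nu> (space \<nu>) = 1" .
  qed
  note int2 = integrable_gaussian_norm_square[OF s]
  have "integrable \<nu> (\<lambda>x. (norm x)\<^sup>2)"
    unfolding \<nu>_eq
  proof (subst integrable_density)
    show "integrable (gaussian s) (\<lambda>x. r x *\<^sub>R (norm x)\<^sup>2)"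
      by (rule Bochner_Integration.integrable_bound[OF integrable_mult_right[OF int2, of "A * exp k"]])
         (use r A in \<open>auto intro!: AE_I2 mult_right_mono simp: less_imp_le abs_mult\<close>)
  qed (use r(3) in \<open>auto intro: less_imp_le\<close>)
  moreover have "absolutely_continuous lborel \<nu>"
    unfolding \<nu>_lborel by (rule absolutely_continuousI_density) measurable
  ultimately have P2a: "\<nu> \<in> P2a" by (simp add: P2a_def P2_def \<nu>.prob_space_axioms)
  define \<rho> where "\<rho> = exp (- 2 * k) / s"
  have \<rho>: "0 < \<rho>" using s by (simp add: \<rho>_def)
  have "relative_entropy \<mu> \<nu> \<le> ereal (1 / (2 * \<rho>)) * enn2ereal (relative_fisher \<mu> \<nu>)" if \<mu>: "\<mu> \<in> P2a" for \<mu>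
  proof -
    have \<mu>_prob: "prob_space \<mu>" using \<mu> by (simp add: P2a_def P2_def)
    have key: "relative_entropy \<mu> \<nu> \<le> ereal (1 / (2 * \<rho>)) * enn2ereal (\<integral>\<^sup>+ x. ennreal ((norm (g x /\<^sub>R f x))\<^sup>2) \<partial>\<mu>)"
      if f [measurable]: "f \<in> borel_measurable borel" and nonneg: "\<And>x. 0 \<le> f x" and \<mu>_eq: "\<mu> = density \<nu> (\<lambda>x. ennreal (f x))"
        and wg: "weak_gradient f g" for f :: "'a \<Rightarrow> real" and g :: "'a \<Rightarrow> 'a"
    proof -
      have [measurable]: "g \<in> borel_measurable borel" by (rule weak_gradient_measurable[OF wg])
      have one: "(\<integral>\<^sup>+x. ennreal (f x) \<partial>\<nu>) = 1"
        using prob_space.emeasure_space_1[OF \<mu>_prob] unfolding \<mu>_eq by (simp add: emeasure_density cong: nn_integral_cong)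
      define B where "B = exp k / A"
      have B: "0 < B" using A by (simp add: B_def)
      have le_B: "(\<integral>\<^sup>+x. h x \<partial>gaussian s) \<le> ennreal B * (\<integral>\<^sup>+x. h x \<partial>\<nu>)" if [measurable]: "h \<in> borel_measurable borel" for h
      proof -
        have "ennreal B * (\<integral>\<^sup>+x. h x \<partial>\<nu>) = (\<integral>\<^sup>+x. ennreal (B * r x) * h x \<partial>gaussian s)"
          using B by (simp add: nn_\<nu> nn_integral_cmult[symmetric] ennreal_mult' mult.assoc)
        also have "\<dots> \<ge> (\<integral>\<^sup>+x. 1 * h x \<partial>gaussian s)"
        proof (intro nn_integral_mono mult_right_mono)
          fix x
          have "1 = B * (A * exp (- k))" using A by (simp add: B_def exp_minus)
          also have "\<dots> \<le> B * r x" using r(1) B by (intro mult_left_mono) auto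
          finally show "1 \<le> ennreal (B * r x)" by (metis ennreal_1 ennreal_leI)
        qed simp
        finally show ?thesis by simp
      qed
      have fin: "(\<integral>\<^sup>+x. ennreal (f x) \<partial>gaussian s) \<le> ennreal B"
        using le_B[of "\<lambda>x. ennreal (f x)"] by (simp add: one)
      have int_f: "integrable (gaussian s) f"
        using fin nonneg by (intro integrableI_nonneg) (auto intro: le_less_trans)
      define m where "m = (\<integral>x. f x \<partial>gaussian s)"
      have nn_m: "(\<integral>\<^sup>+x. ennreal (f x) \<partial>gaussian s) = ennreal m"
        unfolding m_def using int_f nonneg by (intro nn_integral_eq_integral) auto
      have m: "0 < m"
      proof -
        have "(1::ennreal) \<le> (\<integral>\<^sup>+x. ennreal (A * exp k) * ennreal (f x) \<partial>gaussian s)"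
          unfolding one[symmetric] using r(2) by (subst nn_\<nu>) (auto intro!: nn_integral_mono mult_right_mono ennreal_leI)
        also have "\<dots> = ennreal (A * exp k) * ennreal m" by (simp add: nn_integral_cmult nn_m)
        finally have "ennreal m \<noteq> 0" by auto
        then show ?thesis by (simp add: ennreal_eq_0_iff)
      qed
      define I where "I = (\<integral>\<^sup>+ x. ennreal ((norm (g x /\<^sub>R f x))\<^sup>2) \<partial>\<mu>)"
      have fisher: "(\<integral>\<^sup>+x. ennreal ((norm (g x))\<^sup>2 / f x) \<partial>\<nu>) = I"
        unfolding I_def \<mu>_eq
      proof (subst nn_integral_density)
        have "ennreal ((norm (g x))\<^sup>2 / f x) = ennreal (f x) * ennreal ((norm (g x /\<^sub>R f x))\<^sup>2)" for x
          using nonneg[of x] by (cases "f x = 0")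
            (simp_all add: ennreal_mult'[symmetric] power_mult_distrib divide_inverse power2_eq_square)
        then show "(\<integral>\<^sup>+x. ennreal ((norm (g x))\<^sup>2 / f x) \<partial>\<nu>) = (\<integral>\<^sup>+x. ennreal (f x) * ennreal ((norm (g x /\<^sub>R f x))\<^sup>2) \<partial>\<nu>)"
          by simp
      qed auto
      have "(\<integral>\<^sup>+x. ennreal (entropy_gap (f x) 1) \<partial>\<nu>) \<le> (\<integral>\<^sup>+x. ennreal (entropy_gap (f x) m) \<partial>\<nu>)"
        by (rule nn_integral_entropy_gap_mean_le[OF _ nonneg \<nu>.prob_space_axioms one m]) measurable
      also have "\<dots> = (\<integral>\<^sup>+x. ennreal (r x) * ennreal (entropy_gap (f x) m) \<partial>gaussian s)" by (rule nn_\<nu>) measurable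
      also have "\<dots> \<le> (\<integral>\<^sup>+x. ennreal (A * exp k) * ennreal (entropy_gap (f x) m) \<partial>gaussian s)"
        using r(2) by (intro nn_integral_mono mult_right_mono ennreal_leI) auto
      also have "\<dots> = ennreal (A * exp k) * (\<integral>\<^sup>+x. ennreal (entropy_gap (f x) m) \<partial>gaussian s)"
        by (rule nn_integral_cmult) measurable
      also have "\<dots> \<le> ennreal (A * exp k) * (ennreal (s / 2) * (\<integral>\<^sup>+x. ennreal ((norm (g x))\<^sup>2 / f x) \<partial>gaussian s))"
        using gaussian_log_sobolev[OF s _ nonneg wg int_f] m unfolding m_def[symmetric]
        by (intro mult_left_mono) auto
      also have "\<dots> \<le> ennreal (A * exp k) * (ennreal (s / 2) * (ennreal B * I))"
        unfolding fisher[symmetric] by (intro mult_left_mono le_B) auto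
      also have "\<dots> = ennreal (A * exp k * (s / 2) * B) * I"
      proof -
        have "ennreal (a * b * c) * I = ennreal a * (ennreal b * (ennreal c * I))"
          if "0 \<le> a" "0 \<le> b" "0 \<le> c" for a b c
          using that by (simp add: ennreal_mult mult.assoc)
        from this[of "A * exp k" "s / 2" B] A s B show ?thesis by simp
      qed
      also have "A * exp k * (s / 2) * B = 1 / (2 * \<rho>)"
      proof -
        have "A * exp k * (s / 2) * B = s / 2 * (exp k * exp k)" using A by (simp add: B_def)
        also have "exp k * exp k = exp (2 * k)" unfolding exp_add[symmetric] by simp
        also have "s / 2 * exp (2 * k) = 1 / (2 * \<rho>)" using s by (simp add: \<rho>_def exp_minus field_simps)
        finally show ?thesis .
      qed
      finally have "enn2ereal (\<integral>\<^sup>+x. ennreal (entropy_gap (f x) 1) \<partial>\<nu>) \<le> enn2ereal (ennreal (1 / (2 * \<rho>)) * I)"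
        by (simp add: less_eq_ennreal.rep_eq)
      moreover have "relative_entropy \<mu> \<nu> = enn2ereal (\<integral>\<^sup>+x. ennreal (entropy_gap (f x) 1) \<partial>\<nu>)"
        using relative_entropy_density[OF _ nonneg \<nu>.prob_space_axioms] \<mu>_prob unfolding \<mu>_eq by simp
      ultimately show ?thesis
        using \<rho> unfolding I_def[symmetric] by (simp add: times_ennreal.rep_eq)
    qed
    define S where "S = {\<integral>\<^sup>+ x. ennreal ((norm (g x /\<^sub>R f x))\<^sup>2) \<partial>\<mu> | f g.
       f \<in> borel_measurable borel \<and> (\<forall>x. 0 \<le> f x) \<and> \<mu> = density \<nu> (\<lambda>x. ennreal (f x)) \<and> weak_gradient f g}"
    \<comment> \<open>The constant is moved to the left, so that the right-hand side is the infimum itself. A negative relative entropy would become 0, which is harmless in a lower bound for a nonnegative infimum.\<close>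
    have "ennreal (2 * \<rho>) * e2ennreal (relative_entropy \<mu> \<nu>) \<le> Inf S"
    proof (rule Inf_greatest)
      fix v assume "v \<in> S"
      then have "relative_entropy \<mu> \<nu> \<le> ereal (1 / (2 * \<rho>)) * enn2ereal v"
        unfolding S_def using key by auto
      also have "\<dots> = enn2ereal (ennreal (1 / (2 * \<rho>)) * v)" using \<rho> by (simp add: times_ennreal.rep_eq)
      finally have "e2ennreal (relative_entropy \<mu> \<nu>) \<le> ennreal (1 / (2 * \<rho>)) * v"
        using e2ennreal_mono by fastforce
      then have "ennreal (2 * \<rho>) * e2ennreal (relative_entropy \<mu> \<nu>) \<le> ennreal (2 * \<rho>) * (ennreal (1 / (2 * \<rho>)) * v)"
        by (intro mult_left_mono) auto
      also have "\<dots> = v" using \<rho> by (simp add: mult.assoc[symmetric] ennreal_mult'[symmetric])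
      finally show "ennreal (2 * \<rho>) * e2ennreal (relative_entropy \<mu> \<nu>) \<le> v" .
    qed
    then have "ennreal (1 / (2 * \<rho>)) * (ennreal (2 * \<rho>) * e2ennreal (relative_entropy \<mu> \<nu>)) \<le> ennreal (1 / (2 * \<rho>)) * Inf S"
      by (intro mult_left_mono) auto
    then have "e2ennreal (relative_entropy \<mu> \<nu>) \<le> ennreal (1 / (2 * \<rho>)) * Inf S"
      using \<rho> by (simp add: mult.assoc[symmetric] ennreal_mult'[symmetric])
    then have "enn2ereal (e2ennreal (relative_entropy \<mu> \<nu>)) \<le> ereal (1 / (2 * \<rho>)) * enn2ereal (Inf S)"
      using \<rho> by (simp add: less_eq_ennreal.rep_eq times_ennreal.rep_eq)
    moreover have "relative_entropy \<mu> \<nu> \<le> enn2ereal (e2ennreal (relative_entropy \<mu> \<nu>))"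
      by (cases "0 \<le> relative_entropy \<mu> \<nu>") (auto simp: enn2ereal_e2ennreal intro: order_trans[of _ 0])
    ultimately show ?thesis unfolding relative_fisher_def S_def by simp
  qed
  then show "LSI (exp (- 2 * k) / s) (gibbs U)"
    unfolding LSI_def \<nu>_def[symmetric] \<rho>_def[symmetric] using \<rho> P2a by auto
qed

section \<open>Convex combinations of measures\<close>

lemma sets_lin_comb [simp, measurable_cong]: "sets (lin_comb a \<mu> b \<nu>) = sets borel"
  unfolding lin_comb_def by (subst sets_measure_of) (auto simp: sets.sigma_sets_eq[of borel, simplified])

lemma space_lin_comb [simp]: "space (lin_comb a \<mu> b \<nu>) = UNIV"
  by (simp add: lin_comb_def space_measure_of_conv)

lemma emeasure_lin_comb:
  fixes \<mu> \<nu> :: "'a::euclidean_space measure"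
  assumes s: "sets \<mu> = sets borel" "sets \<nu> = sets borel" and A: "A \<in> sets borel"
  shows "emeasure (lin_comb a \<mu> b \<nu>) A = ennreal a * emeasure \<mu> A + ennreal b * emeasure \<nu> A"
  unfolding lin_comb_def
proof (rule emeasure_measure_of_sigma)
  show "sigma_algebra UNIV (sets (borel :: 'a measure))" using sets.sigma_algebra_axioms[of "borel :: 'a measure"] by simp
  show "positive (sets borel) (\<lambda>A. ennreal a * emeasure \<mu> A + ennreal b * emeasure \<nu> A)" by (simp add: positive_def)
  show "countably_additive (sets borel) (\<lambda>A. ennreal a * emeasure \<mu> A + ennreal b * emeasure \<nu> A)"
  proof (rule countably_additiveI)
    fix F :: "nat \<Rightarrow> 'a set" assume "range F \<subseteq> sets borel" "disjoint_family F"
    then show "(\<Sum>i. ennreal a * emeasure \<mu> (F i) + ennreal b * emeasure \<nu> (F i))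
      = ennreal a * emeasure \<mu> (\<Union>i. F i) + ennreal b * emeasure \<nu> (\<Union>i. F i)"
      using s by (simp add: suminf_add[symmetric] ennreal_suminf_cmult suminf_emeasure)
  qed
qed (rule A)

lemma nn_integral_lin_comb:
  fixes \<mu> \<nu> :: "'a::euclidean_space measure"
  assumes s: "sets \<mu> = sets borel" "sets \<nu> = sets borel" and f: "f \<in> borel_measurable borel"
  shows "(\<integral>\<^sup>+x. f x \<partial>lin_comb a \<mu> b \<nu>) = ennreal a * (\<integral>\<^sup>+x. f x \<partial>\<mu>) + ennreal b * (\<integral>\<^sup>+x. f x \<partial>\<nu>)"
  using f
proof (induction rule: borel_measurable_induct)
  case (cong f g)
  then have "f = g" by (auto simp: fun_eq_iff)
  then show ?case using cong by simp
next
  case (set A)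
  then show ?case using s by (simp add: emeasure_lin_comb)
next
  case (mult u c)
  note [measurable_cong] = s
  have [measurable]: "u \<in> borel_measurable borel" by fact
  from mult show ?case by (simp add: nn_integral_cmult distrib_left mult.left_commute)
next
  case (add u v)
  note [measurable_cong] = s
  have [measurable]: "u \<in> borel_measurable borel" "v \<in> borel_measurable borel" by fact+
  from add show ?case by (simp add: nn_integral_add distrib_left ac_simps)
next
  case (seq U)
  note [measurable_cong] = s
  have [measurable]: "U i \<in> borel_measurable borel" for i by fact
  have m: "(\<integral>\<^sup>+x. (SUP i. U i) x \<partial>M) = (SUP i. \<integral>\<^sup>+x. U i x \<partial>M)" "incseq (\<lambda>i. \<integral>\<^sup>+x. U i x \<partial>M)"
    if [measurable_cong]: "sets M = sets borel" for M
    using seq(3) nn_integral_monotone_convergence_SUP[of U M]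
    by (auto simp: image_comp incseq_def le_fun_def intro!: nn_integral_mono)
  have "(SUP i. ennreal a * (\<integral>\<^sup>+x. U i x \<partial>\<mu>) + ennreal b * (\<integral>\<^sup>+x. U i x \<partial>\<nu>))
     = (SUP i. ennreal a * (\<integral>\<^sup>+x. U i x \<partial>\<mu>)) + (SUP i. ennreal b * (\<integral>\<^sup>+x. U i x \<partial>\<nu>))"
    using m(2)[OF s(1)] m(2)[OF s(2)] by (intro ennreal_SUP_add) (auto simp: incseq_def intro: mult_left_mono)
  then show ?case
    using m(1)[OF sets_lin_comb, of a \<mu> b \<nu>] m(1)[OF s(1)] m(1)[OF s(2)] seq
    by (simp add: SUP_mult_left_ennreal)
qed

lemma integral_lin_comb:
  fixes \<mu> \<nu> :: "'a::euclidean_space measure" and f :: "'a \<Rightarrow> real"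
  assumes s: "sets \<mu> = sets borel" "sets \<nu> = sets borel" and ab: "0 \<le> a" "0 \<le> b"
    and f: "integrable \<mu> f" "integrable \<nu> f"
  shows "integrable (lin_comb a \<mu> b \<nu>) f"
    "(\<integral>x. f x \<partial>lin_comb a \<mu> b \<nu>) = a * (\<integral>x. f x \<partial>\<mu>) + b * (\<integral>x. f x \<partial>\<nu>)"
proof -
  have [measurable]: "f \<in> borel_measurable borel"
    using borel_measurable_integrable[OF f(1)] by (simp cong: measurable_cong_sets[OF s(1) refl])
  have fin: "\<exists>r\<ge>0. (\<integral>\<^sup>+x. ennreal (h x) \<partial>M) = ennreal r"
    if "integrable M f" "h = (\<lambda>x. f x) \<or> h = (\<lambda>x. - f x)" for M h
  proof -
    have "(\<integral>\<^sup>+x. ennreal (h x) \<partial>M) \<le> (\<integral>\<^sup>+x. ennreal (norm (f x)) \<partial>M)"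
      using that(2) by (intro nn_integral_mono ennreal_leI) auto
    also have "\<dots> < \<infinity>" using that(1) by (simp add: integrable_iff_bounded)
    finally show ?thesis by (cases "\<integral>\<^sup>+x. ennreal (h x) \<partial>M") auto
  qed
  show i: "integrable (lin_comb a \<mu> b \<nu>) f"
    using f by (auto simp: integrable_iff_bounded nn_integral_lin_comb[OF s] ennreal_mult_less_top)
  obtain p1 p2 q1 q2 where e: "0 \<le> p1" "(\<integral>\<^sup>+x. ennreal (f x) \<partial>\<mu>) = ennreal p1" "0 \<le> p2" "(\<integral>\<^sup>+x. ennreal (f x) \<partial>\<nu>) = ennreal p2"
     "0 \<le> q1" "(\<integral>\<^sup>+x. ennreal (- f x) \<partial>\<mu>) = ennreal q1" "0 \<le> q2" "(\<integral>\<^sup>+x. ennreal (- f x) \<partial>\<nu>) = ennreal q2"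
    using fin[OF f(1), of f] fin[OF f(2), of f] fin[OF f(1), of "\<lambda>x. - f x"] fin[OF f(2), of "\<lambda>x. - f x"] by auto
  show "(\<integral>x. f x \<partial>lin_comb a \<mu> b \<nu>) = a * (\<integral>x. f x \<partial>\<mu>) + b * (\<integral>x. f x \<partial>\<nu>)"
    unfolding real_lebesgue_integral_def[OF f(1)] real_lebesgue_integral_def[OF f(2)] real_lebesgue_integral_def[OF i]
    using ab e by (simp add: nn_integral_lin_comb[OF s] ennreal_mult'[symmetric] ennreal_plus[symmetric] algebra_simps del: ennreal_plus)
qed

lemma lin_comb_P2:
  assumes "\<mu> \<in> P2" "\<nu> \<in> P2" "0 \<le> a" "0 \<le> b" "a + b = 1"
  shows "lin_comb a \<mu> b \<nu> \<in> P2"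
proof -
  have s: "sets \<mu> = sets borel" "sets \<nu> = sets borel" and p: "prob_space \<mu>" "prob_space \<nu>"
    using assms by (auto simp: P2_def)
  have sp: "space \<mu> = UNIV" "space \<nu> = UNIV" using s[THEN sets_eq_imp_space_eq] by auto
  have "prob_space (lin_comb a \<mu> b \<nu>)"
  proof
    show "emeasure (lin_comb a \<mu> b \<nu>) (space (lin_comb a \<mu> b \<nu>)) = 1"
      using assms(3-5) p[THEN prob_space.emeasure_space_1] sp
      by (simp add: emeasure_lin_comb[OF s] ennreal_plus[symmetric] del: ennreal_plus)
  qed
  then show ?thesis using assms by (auto simp: P2_def integral_lin_comb(1)[OF s])
qed

section \<open>The two loss functions\<close>

lemma square_loss_DERIV: "(square_loss y has_real_derivative a - y) (at a)"
  unfolding square_loss_def[abs_def] power2_abs by (auto intro!: derivative_eq_intros)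

lemma logistic_loss_DERIV: "(logistic_loss y has_real_derivative - y / (1 + exp (y * a))) (at a)"
proof -
  have "(logistic_loss y has_real_derivative (exp (- y * a) * (- y)) / (1 + exp (- y * a))) (at a)"
    unfolding logistic_loss_def[abs_def] by (auto intro!: derivative_eq_intros simp: add_pos_pos)
  moreover have "(exp (- y * a) * (- y)) / (1 + exp (- y * a)) = - y / (1 + exp (y * a))"
    by (simp add: exp_minus divide_simps add_pos_pos)
  ultimately show ?thesis by simp
qed

text \<open>The features that both losses share. The derivative in the second argument is \<open>a - y\<close> for the square
loss, with Lipschitz constant 1, and \<open>- y / (1 + exp (y * a))\<close> for the logistic loss, with Lipschitz
constant at most \<open>y\<^sup>2\<close>; the bounds below cover both.\<close>

lemma loss_properties:
  assumes "loss = square_loss \<or> loss = logistic_loss"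
  shows loss_DERIV: "(loss y has_real_derivative deriv (loss y) a) (at a)"
    and loss_nonneg: "0 \<le> loss y a"
    and abs_deriv_loss_le: "\<bar>deriv (loss y) a\<bar> \<le> \<bar>y\<bar> + \<bar>a\<bar>"
    and deriv_loss_lipschitz: "\<bar>deriv (loss y) a - deriv (loss y) b\<bar> \<le> (1 + y\<^sup>2) * \<bar>a - b\<bar>"
    and loss_convex: "convex_on UNIV (loss y)"
    and loss_measurable: "(\<lambda>(y, a). loss y a) \<in> borel_measurable borel"
    and deriv_loss_measurable: "(\<lambda>(y, a). deriv (loss y) a) \<in> borel_measurable borel"
proof -
  have sq: "deriv (square_loss y) a = a - y" for y a by (rule DERIV_imp_deriv[OF square_loss_DERIV])
  have lo: "deriv (logistic_loss y) a = - y / (1 + exp (y * a))" for y a by (rule DERIV_imp_deriv[OF logistic_loss_DERIV])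
  show der: "(loss y has_real_derivative deriv (loss y) a) (at a)" for a
    using assms square_loss_DERIV logistic_loss_DERIV sq lo by metis
  show "0 \<le> loss y a" using assms by (auto simp: square_loss_def logistic_loss_def)
  have "\<bar>y\<bar> / (1 + exp (y * a)) \<le> \<bar>y\<bar> / 1" by (intro divide_left_mono) (auto simp: add_pos_pos)
  then show "\<bar>deriv (loss y) a\<bar> \<le> \<bar>y\<bar> + \<bar>a\<bar>"
    using assms by (auto simp: sq lo abs_divide)
  have "\<bar>- y / (1 + exp (y * a)) - (- y / (1 + exp (y * b)))\<bar> \<le> y\<^sup>2 * \<bar>a - b\<bar>"
    unfolding real_norm_def[symmetric]
  proof (rule field_differentiable_bound[where S = UNIV and f' = "\<lambda>a. y\<^sup>2 * (exp (y * a) / (1 + exp (y * a))\<^sup>2)"])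
    fix z
    have ne: "1 + exp (y * z) \<noteq> 0" using exp_gt_zero[of "y * z"] by linarith
    show "((\<lambda>a. - y / (1 + exp (y * a))) has_real_derivative y\<^sup>2 * (exp (y * z) / (1 + exp (y * z))\<^sup>2)) (at z within UNIV)"
      using ne by (auto intro!: derivative_eq_intros simp: power2_eq_square)
    have "exp (y * z) \<le> (1 + exp (y * z))\<^sup>2" by (simp add: power2_eq_square algebra_simps add_nonneg_nonneg)
    then have "exp (y * z) / (1 + exp (y * z))\<^sup>2 \<le> 1" using ne by (simp add: divide_le_eq)
    then have "y\<^sup>2 * (exp (y * z) / (1 + exp (y * z))\<^sup>2) \<le> y\<^sup>2 * 1"
      by (rule mult_left_mono) simp
    then show "norm (y\<^sup>2 * (exp (y * z) / (1 + exp (y * z))\<^sup>2)) \<le> y\<^sup>2"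
      by simp
  qed auto
  also have "\<dots> \<le> (1 + y\<^sup>2) * \<bar>a - b\<bar>" by (intro mult_right_mono) auto
  finally have 1: "\<bar>- y / (1 + exp (y * a)) - (- y / (1 + exp (y * b)))\<bar> \<le> (1 + y\<^sup>2) * \<bar>a - b\<bar>" .
  have "1 * \<bar>a - b\<bar> \<le> (1 + y\<^sup>2) * \<bar>a - b\<bar>" by (intro mult_right_mono) auto
  with 1 show "\<bar>deriv (loss y) a - deriv (loss y) b\<bar> \<le> (1 + y\<^sup>2) * \<bar>a - b\<bar>"
    using assms by (auto simp: sq lo)
  show "convex_on UNIV (loss y)"
  proof (rule convex_on_realI)
    fix u v :: real assume "u \<le> v"
    have "- y / (1 + exp (y * u)) \<le> - y / (1 + exp (y * v))"
    proof (cases "0 \<le> y")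
      case True
      then have "y / (1 + exp (y * v)) \<le> y / (1 + exp (y * u))"
        using \<open>u \<le> v\<close> by (intro divide_left_mono) (auto simp: mult_left_mono add_pos_pos)
      then show ?thesis by simp
    next
      case False
      then show ?thesis
        using \<open>u \<le> v\<close> by (intro divide_left_mono) (auto simp: mult_left_mono_neg add_pos_pos)
    qed
    then show "deriv (loss y) u \<le> deriv (loss y) v" using assms \<open>u \<le> v\<close> by (auto simp: sq lo)
  qed (use der in auto)
  have "(\<lambda>(y, a). square_loss y a) \<in> borel_measurable (borel \<Otimes>\<^sub>M borel)" "(\<lambda>(y, a). logistic_loss y a) \<in> borel_measurable (borel \<Otimes>\<^sub>M borel)"
    "(\<lambda>(y, a::real). a - y) \<in> borel_measurable (borel \<Otimes>\<^sub>M borel)" "(\<lambda>(y, a::real). - y / (1 + exp (y * a))) \<in> borel_measurable (borel \<Otimes>\<^sub>M borel)"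
    unfolding square_loss_def logistic_loss_def by measurable
  then show "(\<lambda>(y, a). loss y a) \<in> borel_measurable borel" "(\<lambda>(y, a). deriv (loss y) a) \<in> borel_measurable borel"
    using assms unfolding borel_prod[symmetric] by (auto simp: sq[abs_def] lo[abs_def])
qed

lemma abs_deriv_logistic_loss_le: "\<bar>deriv (logistic_loss y) a\<bar> \<le> \<bar>y\<bar>"
proof -
  have "deriv (logistic_loss y) a = - y / (1 + exp (y * a))" by (rule DERIV_imp_deriv[OF logistic_loss_DERIV])
  moreover have "\<bar>y\<bar> / (1 + exp (y * a)) \<le> \<bar>y\<bar> / 1" by (intro divide_left_mono) (auto simp: add_pos_pos)
  ultimately show ?thesis by (simp add: abs_divide)
qed

section \<open>Couplings\<close>

lemma integral_norm_le_sqrt: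
  assumes "prob_space M" and h: "integrable M h" and h2: "integrable M (\<lambda>x. (h x)\<^sup>2)"
  shows "(\<integral>x. h x \<partial>M) \<le> sqrt (\<integral>x. (h x)\<^sup>2 \<partial>M)"
proof -
  interpret prob_space M by fact
  have "(\<integral>x. h x \<partial>M)\<^sup>2 \<le> (\<integral>x. (h x)\<^sup>2 \<partial>M)"
    using variance_positive[of h] variance_eq[OF h h2] by simp
  then show ?thesis by (rule real_le_rsqrt)
qed

text \<open>Every coupling compares the two integrals by \<open>M\<close> times the mean distance, which the Cauchy--Schwarz
inequality bounds by the root mean square distance. The infimum of the costs is finite, as the product
coupling shows, so that its conversion to a real number does not degenerate to 0.\<close>

lemma integral_diff_le_W2:
  fixes \<mu> \<nu> :: "'a::euclidean_space measure" and f :: "'a \<Rightarrow> real"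
  assumes \<mu>: "\<mu> \<in> P2" and \<nu>: "\<nu> \<in> P2" and f: "integrable \<mu> f" "integrable \<nu> f"
    and lip: "\<And>x y. \<bar>f x - f y\<bar> \<le> M * norm (x - y)" and M: "0 < M"
  shows "\<bar>(\<integral>x. f x \<partial>\<mu>) - (\<integral>x. f x \<partial>\<nu>)\<bar> \<le> M * W2 \<mu> \<nu>"
proof -
  have s: "sets \<mu> = sets borel" "sets \<nu> = sets borel" and p: "prob_space \<mu>" "prob_space \<nu>"
    and i2: "integrable \<mu> (\<lambda>x. (norm x)\<^sup>2)" "integrable \<nu> (\<lambda>x. (norm x)\<^sup>2)"
    using \<mu> \<nu> by (auto simp: P2_def)
  note [measurable_cong] = s
  have [measurable]: "f \<in> borel_measurable borel"
    using borel_measurable_integrable[OF f(1)] by (simp cong: measurable_cong_sets[OF s(1) refl])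
  define d where "d = \<bar>(\<integral>x. f x \<partial>\<mu>) - (\<integral>x. f x \<partial>\<nu>)\<bar>"
  define J where "J = (INF \<gamma> \<in> couplings \<mu> \<nu>. \<integral>\<^sup>+ p. ennreal ((norm (snd p - fst p))\<^sup>2) \<partial>\<gamma>)"
  have "ennreal ((d / M)\<^sup>2) \<le> J"
    unfolding J_def
  proof (rule INF_greatest)
    fix \<gamma> assume "\<gamma> \<in> couplings \<mu> \<nu>"
    then have g: "prob_space \<gamma>" "sets \<gamma> = sets borel" "distr \<gamma> borel fst = \<mu>" "distr \<gamma> borel snd = \<nu>"
      by (auto simp: couplings_def)
    have sg [measurable_cong]: "sets \<gamma> = sets (borel \<Otimes>\<^sub>M borel)" unfolding borel_prod by (rule g(2))
    show "ennreal ((d / M)\<^sup>2) \<le> (\<integral>\<^sup>+ p. ennreal ((norm (snd p - fst p))\<^sup>2) \<partial>\<gamma>)"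
    proof (cases "(\<integral>\<^sup>+ p. ennreal ((norm (snd p - fst p))\<^sup>2) \<partial>\<gamma>) = \<infinity>")
      case False
      interpret prob_space \<gamma> by fact
      have h2: "integrable \<gamma> (\<lambda>p. (norm (snd p - fst p))\<^sup>2)"
        using False by (intro integrableI_nonneg) (auto simp: less_top)
      have h: "integrable \<gamma> (\<lambda>p. norm (snd p - fst p))"
      proof (rule Bochner_Integration.integrable_bound)
        show "integrable \<gamma> (\<lambda>p. 1 + (norm (snd p - fst p))\<^sup>2)" using h2 by simp
        show "AE p in \<gamma>. norm (norm (snd p - fst p)) \<le> norm (1 + (norm (snd p - fst p))\<^sup>2)"
        proof (rule AE_I2)
          fix p :: "'a \<times> 'a"
          have "2 * norm (snd p - fst p) \<le> 1 + (norm (snd p - fst p))\<^sup>2"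
            using zero_le_power2[of "norm (snd p - fst p) - 1"] by (simp add: power2_diff)
          then show "norm (norm (snd p - fst p)) \<le> norm (1 + (norm (snd p - fst p))\<^sup>2)"
            using norm_ge_zero[of "snd p - fst p"] by (simp del: norm_ge_zero)
        qed
      qed simp
      have fst_int: "integrable \<gamma> (\<lambda>p. f (fst p))" "(\<integral>x. f x \<partial>\<mu>) = (\<integral>p. f (fst p) \<partial>\<gamma>)"
        using f(1) unfolding g(3)[symmetric] by (auto simp: integrable_distr_eq integral_distr)
      have snd_int: "integrable \<gamma> (\<lambda>p. f (snd p))" "(\<integral>x. f x \<partial>\<nu>) = (\<integral>p. f (snd p) \<partial>\<gamma>)"
        using f(2) unfolding g(4)[symmetric] by (auto simp: integrable_distr_eq integral_distr)
      have "d = norm (\<integral>p. f (fst p) - f (snd p) \<partial>\<gamma>)"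
        unfolding d_def fst_int(2) snd_int(2) using fst_int(1) snd_int(1) by simp
      also have "\<dots> \<le> (\<integral>p. M * norm (snd p - fst p) \<partial>\<gamma>)"
        by (rule norm_integral_le_integral) (use h lip in \<open>auto simp: norm_minus_commute\<close>)
      also have "\<dots> = M * (\<integral>p. norm (snd p - fst p) \<partial>\<gamma>)" by simp
      finally have "d / M \<le> (\<integral>p. norm (snd p - fst p) \<partial>\<gamma>)" using M by (simp add: divide_le_eq mult.commute)
      also have "\<dots> \<le> sqrt (\<integral>p. (norm (snd p - fst p))\<^sup>2 \<partial>\<gamma>)"
        by (rule integral_norm_le_sqrt[OF g(1) h h2])
      finally have "(d / M)\<^sup>2 \<le> (\<integral>p. (norm (snd p - fst p))\<^sup>2 \<partial>\<gamma>)"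
        using M by (intro sqrt_ge_absD) (simp add: d_def)
      then have "ennreal ((d / M)\<^sup>2) \<le> ennreal (\<integral>p. (norm (snd p - fst p))\<^sup>2 \<partial>\<gamma>)" by (rule ennreal_leI)
      then show ?thesis using h2 by (subst nn_integral_eq_integral) auto
    qed simp
  qed
  moreover have "J < \<infinity>"
  proof -
    interpret \<mu>: prob_space \<mu> by fact
    interpret \<nu>: prob_space \<nu> by fact
    interpret pair_prob_space \<mu> \<nu> ..
    have sp: "sets (\<mu> \<Otimes>\<^sub>M \<nu>) = sets borel"
      using sets_pair_measure_cong[OF s] unfolding borel_prod .
    have 1: "distr (\<mu> \<Otimes>\<^sub>M \<nu>) borel fst = \<mu>"
      using \<nu>.distr_pair_fst[of \<mu>] distr_cong[of "\<mu> \<Otimes>\<^sub>M \<nu>" "\<mu> \<Otimes>\<^sub>M \<nu>" borel \<mu> fst fst] s by simp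
    have 2: "distr (\<mu> \<Otimes>\<^sub>M \<nu>) borel snd = \<nu>"
    proof (rule measure_eqI)
      fix A assume "A \<in> sets (distr (\<mu> \<Otimes>\<^sub>M \<nu>) borel snd)"
      then have A: "A \<in> sets \<nu>" using s by simp
      have "emeasure (distr (\<mu> \<Otimes>\<^sub>M \<nu>) borel snd) A = emeasure (\<mu> \<Otimes>\<^sub>M \<nu>) (space \<mu> \<times> A)"
        using A s sets.sets_into_space[OF A]
        by (subst emeasure_distr) (auto simp: space_pair_measure intro!: arg_cong2[where f = emeasure])
      then show "emeasure (distr (\<mu> \<Otimes>\<^sub>M \<nu>) borel snd) A = emeasure \<nu> A"
        using A by (simp add: \<nu>.emeasure_pair_measure_Times \<mu>.emeasure_space_1)
    qed (simp add: s)
    have "\<mu> \<Otimes>\<^sub>M \<nu> \<in> couplings \<mu> \<nu>"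
      unfolding couplings_def using 1 2 sp prob_space_axioms by simp
    then have "J \<le> (\<integral>\<^sup>+ p. ennreal ((norm (snd p - fst p))\<^sup>2) \<partial>(\<mu> \<Otimes>\<^sub>M \<nu>))"
      unfolding J_def by (rule INF_lower)
    also have "\<dots> \<le> (\<integral>\<^sup>+ p. ennreal (2 * (norm (fst p))\<^sup>2) + ennreal (2 * (norm (snd p))\<^sup>2) \<partial>(\<mu> \<Otimes>\<^sub>M \<nu>))"
    proof (rule nn_integral_mono)
      fix p :: "'a \<times> 'a"
      have "(norm (snd p - fst p))\<^sup>2 \<le> (norm (snd p) + norm (fst p))\<^sup>2"
        by (intro power_mono norm_triangle_ineq4) auto
      also have "\<dots> \<le> 2 * (norm (fst p))\<^sup>2 + 2 * (norm (snd p))\<^sup>2"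
        using zero_le_power2[of "norm (snd p) - norm (fst p)"] by (simp add: power2_diff power2_sum)
      finally show "ennreal ((norm (snd p - fst p))\<^sup>2) \<le> ennreal (2 * (norm (fst p))\<^sup>2) + ennreal (2 * (norm (snd p))\<^sup>2)"
        by (simp add: ennreal_plus[symmetric] ennreal_leI del: ennreal_plus)
    qed
    also have "\<dots> = (\<integral>\<^sup>+ p. ennreal (2 * (norm (fst p))\<^sup>2) \<partial>(\<mu> \<Otimes>\<^sub>M \<nu>)) + (\<integral>\<^sup>+ p. ennreal (2 * (norm (snd p))\<^sup>2) \<partial>(\<mu> \<Otimes>\<^sub>M \<nu>))"
      by (rule nn_integral_add) auto
    also have "(\<integral>\<^sup>+ p. ennreal (2 * (norm (fst p))\<^sup>2) \<partial>(\<mu> \<Otimes>\<^sub>M \<nu>)) = (\<integral>\<^sup>+ x. ennreal (2 * (norm x)\<^sup>2) \<partial>\<mu>)"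
      by (subst (2) 1[symmetric], subst nn_integral_distr) auto
    also have "(\<integral>\<^sup>+ p. ennreal (2 * (norm (snd p))\<^sup>2) \<partial>(\<mu> \<Otimes>\<^sub>M \<nu>)) = (\<integral>\<^sup>+ x. ennreal (2 * (norm x)\<^sup>2) \<partial>\<nu>)"
      by (subst (2) 2[symmetric], subst nn_integral_distr) auto
    also have "(\<integral>\<^sup>+ x. ennreal (2 * (norm x)\<^sup>2) \<partial>\<mu>) + (\<integral>\<^sup>+ x. ennreal (2 * (norm x)\<^sup>2) \<partial>\<nu>) < \<infinity>"
      using i2 by (simp add: nn_integral_eq_integral)
    finally show ?thesis .
  qed
  ultimately have "(d / M)\<^sup>2 \<le> enn2real J"
    by (cases J) (auto simp: ennreal_le_iff2 split: if_splits)
  then have "d / M \<le> sqrt (enn2real J)" by (rule real_le_rsqrt)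
  then show ?thesis using M unfolding W2_def J_def[symmetric] d_def[symmetric] by (simp add: divide_le_eq mult.commute)
qed

section \<open>The regularised risk: convexity and first variation\<close>

locale mean_field_risk = prob_space D
  for D :: "('z::euclidean_space \<times> real) measure" +
  fixes \<Phi> :: "'z \<Rightarrow> 'a::euclidean_space \<Rightarrow> real" and loss :: "real \<Rightarrow> real \<Rightarrow> real"
    and lam K C :: real and grad :: "'z \<Rightarrow> 'a \<Rightarrow> 'a"
  assumes sets_D: "sets D = sets borel"
    and lam_pos: "0 < lam"
    and \<Phi>_continuous: "continuous_on UNIV (\<lambda>(z, x). \<Phi> z x)"
    and loss: "loss = square_loss \<or> loss = logistic_loss"
    and K_pos: "0 < K" and \<Phi>_bounded: "\<And>z x. \<bar>\<Phi> z x\<bar> \<le> K"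
    and \<Phi>_grad: "\<And>z x. GDERIV (\<Phi> z) x :> grad z x"
    and grad_lipschitz: "\<And>z. C-lipschitz_on UNIV (grad z)"
    and risk_finite: "\<And>\<mu>. \<mu> \<in> P2 \<Longrightarrow> integrable D (\<lambda>(z, y). loss y (\<integral>x. \<Phi> z x \<partial>\<mu>))"
begin

definition predict :: "'a measure \<Rightarrow> 'z \<Rightarrow> real" where
  "predict \<mu> z = (\<integral>x. \<Phi> z x \<partial>\<mu>)"

lemma sets_D_pair [measurable_cong]: "sets D = sets (borel \<Otimes>\<^sub>M borel)"
  unfolding borel_prod by (rule sets_D)

lemma \<Phi>_measurable [measurable]: "(\<lambda>(z, x). \<Phi> z x) \<in> borel_measurable (borel \<Otimes>\<^sub>M borel)"
  unfolding borel_prod by (rule borel_measurable_continuous_onI[OF \<Phi>_continuous])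

lemma \<Phi>_measurable_x [measurable]: "\<Phi> z \<in> borel_measurable borel"
proof -
  have "(\<lambda>x. (\<lambda>(z, x). \<Phi> z x) (z, x)) \<in> borel_measurable borel" by measurable
  then show ?thesis by simp
qed

lemma \<Phi>_measurable_z [measurable]: "(\<lambda>z. \<Phi> z x) \<in> borel_measurable borel"
proof -
  have "(\<lambda>z. (\<lambda>(z, x). \<Phi> z x) (z, x)) \<in> borel_measurable borel" by measurable
  then show ?thesis by simp
qed

lemma integrable_\<Phi>:
  assumes "prob_space \<mu>" "sets \<mu> = sets borel" shows "integrable \<mu> (\<Phi> z)"
proof -
  interpret \<mu>: prob_space \<mu> by fact
  note [measurable_cong] = assms(2)
  show ?thesis using \<Phi>_bounded by (intro \<mu>.integrable_const_bound[where B = K]) auto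
qed

lemma predict_measurable:
  assumes "prob_space \<mu>" "sets \<mu> = sets borel" shows "predict \<mu> \<in> borel_measurable borel"
proof -
  interpret \<mu>: prob_space \<mu> by fact
  note [measurable_cong] = assms(2)
  have "(\<lambda>(z, x). \<Phi> z x) \<in> borel_measurable (borel \<Otimes>\<^sub>M \<mu>)"
    using \<Phi>_measurable by (simp cong: measurable_cong_sets sets_pair_measure_cong add: assms(2))
  then show ?thesis unfolding predict_def[abs_def] by (intro \<mu>.borel_measurable_lebesgue_integral) (simp add: split_beta')
qed

lemma abs_predict_le:
  assumes "prob_space \<mu>" shows "\<bar>predict \<mu> z\<bar> \<le> K"
proof -
  interpret \<mu>: prob_space \<mu> by fact
  have "norm (predict \<mu> z) \<le> (\<integral>x. K \<partial>\<mu>)"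
    unfolding predict_def using \<Phi>_bounded by (intro norm_integral_le_integral) auto
  then show ?thesis by (simp add: \<mu>.prob_space)
qed

lemma P2D:
  assumes "\<mu> \<in> P2" shows "prob_space \<mu>" "sets \<mu> = sets borel" "integrable \<mu> (\<lambda>x. (norm x)\<^sup>2)"
  using assms by (auto simp: P2_def)

lemma predict_lin_comb:
  assumes "\<mu> \<in> P2" "\<nu> \<in> P2" "0 \<le> a" "0 \<le> b"
  shows "predict (lin_comb a \<mu> b \<nu>) z = a * predict \<mu> z + b * predict \<nu> z"
  unfolding predict_def using assms by (intro integral_lin_comb(2)) (auto intro: integrable_\<Phi> dest: P2D)

text \<open>The factor with which \<open>\<Phi>\<close> is averaged in the first variation.\<close>

definition weight :: "'a measure \<Rightarrow> 'z \<times> real \<Rightarrow> real" where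
  "weight \<mu> p = deriv (loss (snd p)) (predict \<mu> (fst p))"

lemma risk_eq: "risk D loss lam \<Phi> \<mu> = (\<integral>p. loss (snd p) (predict \<mu> (fst p)) \<partial>D) + lam / 2 * (\<integral>x. (norm x)\<^sup>2 \<partial>\<mu>)"
  by (simp add: risk_def predict_def split_beta')

text \<open>The first variation without its quadratic part. It is bounded as soon as the weight is integrable.\<close>

definition potential_fit :: "'a measure \<Rightarrow> 'a \<Rightarrow> real" where
  "potential_fit \<mu> x = (\<integral>p. weight \<mu> p * \<Phi> (fst p) x \<partial>D)"

lemma potential_eq: "potential D loss lam \<Phi> \<mu> x = potential_fit \<mu> x + lam / 2 * (norm x)\<^sup>2"
  by (simp add: potential_def potential_fit_def weight_def predict_def split_beta')

lemma weight_measurable: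
  assumes "\<mu> \<in> P2" shows "weight \<mu> \<in> borel_measurable D"
proof -
  have [measurable]: "predict \<mu> \<in> borel_measurable borel" using assms by (intro predict_measurable P2D)
  have [measurable]: "(\<lambda>(y, a). deriv (loss y) a) \<in> borel_measurable (borel \<Otimes>\<^sub>M borel)"
    using deriv_loss_measurable[OF loss] by (simp add: borel_prod)
  have "(\<lambda>p. (\<lambda>(y, a). deriv (loss y) a) (snd p, predict \<mu> (fst p))) \<in> borel_measurable D" by measurable
  then show ?thesis by (simp add: weight_def[abs_def])
qed

lemma loss_predict_measurable:
  assumes "\<mu> \<in> P2" shows "(\<lambda>p. loss (snd p) (predict \<mu> (fst p))) \<in> borel_measurable D"
  using risk_finite[OF assms] by (auto simp: predict_def split_beta' dest: borel_measurable_integrable)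

lemma risk_finite': "\<mu> \<in> P2 \<Longrightarrow> integrable D (\<lambda>p. loss (snd p) (predict \<mu> (fst p)))"
  using risk_finite by (simp add: predict_def split_beta')

lemma return_0_P2: "return borel (0::'a) \<in> P2"
proof -
  have "integrable (return borel (0::'a)) (\<lambda>x. (norm x)\<^sup>2)"
    by (rule integrableI_bounded) (auto simp: nn_integral_return)
  then show ?thesis by (simp add: P2_def prob_space_return)
qed

text \<open>Finiteness of the risk at the Dirac measure at 0 bounds the second moment of \<open>y\<close> minus a bounded
function.\<close>

lemma square_loss_label_square_integrable:
  assumes "loss = square_loss" shows "integrable D (\<lambda>p. (snd p)\<^sup>2)"
proof (rule Bochner_Integration.integrable_bound)
  let ?\<mu> = "return borel (0::'a)"
  show "integrable D (\<lambda>p. 4 * loss (snd p) (predict ?\<mu> (fst p)) + 2 * K\<^sup>2)"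
    using risk_finite'[OF return_0_P2] by auto
  show "AE p in D. norm ((snd p)\<^sup>2) \<le> norm (4 * loss (snd p) (predict ?\<mu> (fst p)) + 2 * K\<^sup>2)"
  proof (rule AE_I2)
    fix p :: "'z \<times> real"
    define m where "m = predict ?\<mu> (fst p)"
    have m: "m\<^sup>2 \<le> K\<^sup>2"
      using abs_predict_le[OF P2D(1)[OF return_0_P2], of "fst p"] unfolding m_def
      by (metis abs_ge_zero power2_abs power_mono)
    have "(snd p)\<^sup>2 \<le> 2 * (snd p - m)\<^sup>2 + 2 * m\<^sup>2"
      using zero_le_power2[of "snd p - 2 * m"] by (simp add: power2_eq_square algebra_simps)
    also have "\<dots> \<le> 4 * square_loss (snd p) m + 2 * K\<^sup>2" using m by (simp add: square_loss_def)
    finally show "norm ((snd p)\<^sup>2) \<le> norm (4 * loss (snd p) (predict ?\<mu> (fst p)) + 2 * K\<^sup>2)"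
      unfolding assms m_def by simp
  qed
qed measurable

text \<open>A step of length one in the direction of the gradient changes a function bounded by \<open>K\<close> by at most
\<open>2 * K\<close>, and the Taylor remainder is at most \<open>C\<close>.\<close>

lemma grad_bounded: "norm (grad z x) \<le> 2 * K + C"
proof (cases "grad z x = 0")
  case True
  then show ?thesis using K_pos lipschitz_on_nonneg[OF grad_lipschitz[of z]] by simp
next
  case False
  define v where "v = grad z x /\<^sub>R norm (grad z x)"
  have v: "norm v = 1" "v \<bullet> grad z x = norm (grad z x)"
    using False by (auto simp: v_def power2_norm_eq_inner[symmetric] power2_eq_square)
  have "\<bar>\<Phi> z (x + v) - \<Phi> z x - v \<bullet> grad z x\<bar> \<le> C * (norm v)\<^sup>2"
    by (rule gradient_taylor_bound[OF \<Phi>_grad grad_lipschitz])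
  then have "norm (grad z x) \<le> \<bar>\<Phi> z (x + v)\<bar> + \<bar>\<Phi> z x\<bar> + C" using v by simp
  then show ?thesis using \<Phi>_bounded[of z "x + v"] \<Phi>_bounded[of z x] by linarith
qed

text \<open>Each coordinate is a limit of difference quotients, which are measurable in \<open>z\<close>.\<close>

lemma grad_measurable [measurable]: "(\<lambda>z. grad z x) \<in> borel_measurable borel"
  unfolding borel_measurable_euclidean_space[of "\<lambda>z. grad z x"]
proof
  fix b :: 'a assume "b \<in> Basis"
  show "(\<lambda>z. grad z x \<bullet> b) \<in> borel_measurable borel"
  proof (rule borel_measurable_LIMSEQ_metric[where f = "\<lambda>n z. real (Suc n) * (\<Phi> z (x + (1 / real (Suc n)) *\<^sub>R b) - \<Phi> z x)"])
    fix z
    show "(\<lambda>n. real (Suc n) * (\<Phi> z (x + (1 / real (Suc n)) *\<^sub>R b) - \<Phi> z x)) \<longlonglongrightarrow> grad z x \<bullet> b"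
    proof (rule LIM_zero_cancel, rule Lim_null_comparison)
      show "(\<lambda>n. C * (norm b)\<^sup>2 * (1 / real (Suc n))) \<longlonglongrightarrow> 0"
        using tendsto_mult_right_zero[OF LIMSEQ_Suc[OF lim_const_over_n[of 1]]] by simp
      show "\<forall>\<^sub>F n in sequentially. norm (real (Suc n) * (\<Phi> z (x + (1 / real (Suc n)) *\<^sub>R b) - \<Phi> z x) - grad z x \<bullet> b) \<le> C * (norm b)\<^sup>2 * (1 / real (Suc n))"
      proof (intro always_eventually allI)
        fix n
        define r where "r = real (Suc n)"
        have r: "0 < r" by (simp add: r_def)
        have "norm (r * (\<Phi> z (x + (1 / r) *\<^sub>R b) - \<Phi> z x) - grad z x \<bullet> b)
          = r * \<bar>\<Phi> z (x + (1 / r) *\<^sub>R b) - \<Phi> z x - ((1 / r) *\<^sub>R b) \<bullet> grad z x\<bar>"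
        proof -
          have "r * (\<Phi> z (x + (1 / r) *\<^sub>R b) - \<Phi> z x) - grad z x \<bullet> b
            = r * (\<Phi> z (x + (1 / r) *\<^sub>R b) - \<Phi> z x - ((1 / r) *\<^sub>R b) \<bullet> grad z x)"
            using r by (simp add: right_diff_distrib inner_commute)
          then show ?thesis using r by (simp only: real_norm_def abs_mult abs_of_pos)
        qed
        also have "\<dots> \<le> r * (C * (norm ((1 / r) *\<^sub>R b))\<^sup>2)"
          using r by (intro mult_left_mono gradient_taylor_bound[OF \<Phi>_grad grad_lipschitz]) auto
        also have "\<dots> = C * (norm b)\<^sup>2 * (1 / r)" using r by (simp add: power_mult_distrib power2_eq_square)
        finally show "norm (real (Suc n) * (\<Phi> z (x + (1 / real (Suc n)) *\<^sub>R b) - \<Phi> z x) - grad z x \<bullet> b) \<le> C * (norm b)\<^sup>2 * (1 / real (Suc n))"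
          unfolding r_def .
      qed
    qed
  qed measurable
qed

lemma predict_diff_le_W2:
  assumes "\<mu> \<in> P2" "\<nu> \<in> P2" shows "\<bar>predict \<mu> z - predict \<nu> z\<bar> \<le> (2 * K + C) * W2 \<mu> \<nu>"
  unfolding predict_def
proof (rule integral_diff_le_W2[OF assms])
  show "integrable \<mu> (\<Phi> z)" "integrable \<nu> (\<Phi> z)" using assms by (auto intro: integrable_\<Phi> dest: P2D)
  show "0 < 2 * K + C" using K_pos lipschitz_on_nonneg[OF grad_lipschitz] by (simp add: add_pos_nonneg)
  fix x y
  have "norm (\<Phi> z x - \<Phi> z y) \<le> (2 * K + C) * norm (x - y)"
  proof (rule differentiable_bound[where f' = "\<lambda>x h. h \<bullet> grad z x" and S = UNIV])
    fix x :: 'a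
    show "(\<Phi> z has_derivative (\<lambda>h. h \<bullet> grad z x)) (at x within UNIV)" using \<Phi>_grad[of z x] by (simp add: gderiv_def)
    show "onorm (\<lambda>h. h \<bullet> grad z x) \<le> 2 * K + C"
    proof (rule onorm_le)
      fix h show "norm (h \<bullet> grad z x) \<le> (2 * K + C) * norm h"
        using Cauchy_Schwarz_ineq2[of h "grad z x"] mult_left_mono[OF grad_bounded[of z x], of "norm h"] by (simp add: mult.commute)
    qed
  qed auto
  then show "\<bar>\<Phi> z x - \<Phi> z y\<bar> \<le> (2 * K + C) * norm (x - y)" by simp
qed

definition fit :: "'a measure \<Rightarrow> real" where
  "fit \<mu> = (\<integral>p. loss (snd p) (predict \<mu> (fst p)) \<partial>D)"

lemma risk_eq_fit: "risk D loss lam \<Phi> \<mu> = fit \<mu> + lam / 2 * (\<integral>x. (norm x)\<^sup>2 \<partial>\<mu>)"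
  by (simp add: risk_eq fit_def)

lemma fit_convex:
  assumes \<mu>: "\<mu> \<in> P2" and \<nu>: "\<nu> \<in> P2" and \<alpha>: "\<alpha> \<in> {0..1}"
  shows "fit (lin_comb \<alpha> \<mu> (1 - \<alpha>) \<nu>) \<le> \<alpha> * fit \<mu> + (1 - \<alpha>) * fit \<nu>"
proof -
  have comb: "lin_comb \<alpha> \<mu> (1 - \<alpha>) \<nu> \<in> P2" using assms by (intro lin_comb_P2) auto
  have "fit (lin_comb \<alpha> \<mu> (1 - \<alpha>) \<nu>)
     \<le> (\<integral>p. \<alpha> * loss (snd p) (predict \<mu> (fst p)) + (1 - \<alpha>) * loss (snd p) (predict \<nu> (fst p)) \<partial>D)"
    unfolding fit_def
  proof (rule integral_mono)
    fix p
    show "loss (snd p) (predict (lin_comb \<alpha> \<mu> (1 - \<alpha>) \<nu>) (fst p)) \<le> \<alpha> * loss (snd p) (predict \<mu> (fst p)) + (1 - \<alpha>) * loss (snd p) (predict \<nu> (fst p))"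
      using convex_onD[OF loss_convex[OF loss], of "1 - \<alpha>" "predict \<mu> (fst p)" "predict \<nu> (fst p)" "snd p"] assms
      by (simp add: predict_lin_comb)
  qed (use risk_finite' \<mu> \<nu> comb in auto)
  also have "\<dots> = \<alpha> * fit \<mu> + (1 - \<alpha>) * fit \<nu>" unfolding fit_def using risk_finite' \<mu> \<nu> by simp
  finally show ?thesis .
qed

lemma risk_convex:
  assumes \<mu>: "\<mu> \<in> P2" and \<nu>: "\<nu> \<in> P2" and \<alpha>: "\<alpha> \<in> {0..1}"
  shows "risk D loss lam \<Phi> (lin_comb \<alpha> \<mu> (1 - \<alpha>) \<nu>) \<le> \<alpha> * risk D loss lam \<Phi> \<mu> + (1 - \<alpha>) * risk D loss lam \<Phi> \<nu>"
proof -
  have "(\<integral>x. (norm x)\<^sup>2 \<partial>lin_comb \<alpha> \<mu> (1 - \<alpha>) \<nu>) = \<alpha> * (\<integral>x. (norm x)\<^sup>2 \<partial>\<mu>) + (1 - \<alpha>) * (\<integral>x. (norm x)\<^sup>2 \<partial>\<nu>)"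
    using P2D[OF \<mu>] P2D[OF \<nu>] \<alpha> by (intro integral_lin_comb(2)) auto
  moreover have "\<alpha> * (A + lam / 2 * a) + (1 - \<alpha>) * (B + lam / 2 * b)
      = (\<alpha> * A + (1 - \<alpha>) * B) + lam / 2 * (\<alpha> * a + (1 - \<alpha>) * b)" for A B a b
    by (simp add: field_simps)
  ultimately show ?thesis using fit_convex[OF assms] by (simp add: risk_eq_fit)
qed

end

text \<open>A square integrable label makes the Lipschitz constants \<open>1 + y\<^sup>2\<close> of the derivatives of the losses
integrable. For the square loss this is a consequence of the finiteness of the risk.\<close>

locale mean_field_risk_L2 = mean_field_risk D \<Phi> loss lam K C grad
  for D :: "('z::euclidean_space \<times> real) measure" and \<Phi> :: "'z \<Rightarrow> 'a::euclidean_space \<Rightarrow> real"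
    and loss lam K C grad +
  assumes label_square_integrable: "integrable D (\<lambda>p. (snd p)\<^sup>2)"
begin

lemma label_integrable: "integrable D (\<lambda>p. \<bar>snd p\<bar>)"
proof (rule Bochner_Integration.integrable_bound)
  show "integrable D (\<lambda>p. 1 + (snd p)\<^sup>2)" using label_square_integrable by simp
  show "AE p in D. norm \<bar>snd p\<bar> \<le> norm (1 + (snd p)\<^sup>2)"
  proof (rule AE_I2)
    fix p :: "'z \<times> real"
    have "2 * \<bar>snd p\<bar> \<le> 1 + (snd p)\<^sup>2" using zero_le_power2[of "\<bar>snd p\<bar> - 1"] by (simp add: power2_diff)
    then show "norm \<bar>snd p\<bar> \<le> norm (1 + (snd p)\<^sup>2)" using abs_ge_zero[of "snd p"] by (simp del: abs_ge_zero)
  qed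
qed measurable

lemma abs_weight_le:
  assumes "\<mu> \<in> P2" shows "\<bar>weight \<mu> p\<bar> \<le> \<bar>snd p\<bar> + K"
  using abs_deriv_loss_le[OF loss, of "snd p" "predict \<mu> (fst p)"] abs_predict_le[OF P2D(1)[OF assms], of "fst p"]
  by (simp add: weight_def)

lemma weight_integrable:
  assumes "\<mu> \<in> P2" shows "integrable D (weight \<mu>)"
proof (rule Bochner_Integration.integrable_bound)
  show "integrable D (\<lambda>p. \<bar>snd p\<bar> + K)" using label_integrable by simp
  show "AE p in D. norm (weight \<mu> p) \<le> norm (\<bar>snd p\<bar> + K)"
    using abs_weight_le[OF assms] K_pos by (auto intro!: AE_I2)
qed (rule weight_measurable[OF assms])

lemma weight_mult_integrable:
  fixes h :: "'z \<times> real \<Rightarrow> 'e::euclidean_space"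
  assumes \<mu>: "\<mu> \<in> P2" and [measurable]: "h \<in> borel_measurable D" and h: "\<And>p. norm (h p) \<le> B"
  shows "integrable D (\<lambda>p. weight \<mu> p *\<^sub>R h p)"
proof (rule Bochner_Integration.integrable_bound)
  show "integrable D (\<lambda>p. B * \<bar>weight \<mu> p\<bar>)" using weight_integrable[OF \<mu>] by simp
  show "(\<lambda>p. weight \<mu> p *\<^sub>R h p) \<in> borel_measurable D" using weight_measurable[OF \<mu>] by measurable
  show "AE p in D. norm (weight \<mu> p *\<^sub>R h p) \<le> norm (B * \<bar>weight \<mu> p\<bar>)"
  proof (rule AE_I2)
    fix p
    have "norm (weight \<mu> p *\<^sub>R h p) \<le> \<bar>weight \<mu> p\<bar> * B"
      using h[of p] by (simp add: mult_left_mono)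
    then show "norm (weight \<mu> p *\<^sub>R h p) \<le> norm (B * \<bar>weight \<mu> p\<bar>)" by (simp add: mult.commute)
  qed
qed

lemma weight_\<Phi>_integrable:
  assumes "\<mu> \<in> P2" shows "integrable D (\<lambda>p. weight \<mu> p * \<Phi> (fst p) x)"
  using weight_mult_integrable[OF assms, of "\<lambda>p. \<Phi> (fst p) x" K] \<Phi>_bounded by simp

lemma weight_grad_integrable:
  assumes "\<mu> \<in> P2" shows "integrable D (\<lambda>p. weight \<mu> p *\<^sub>R grad (fst p) x)"
  using weight_mult_integrable[OF assms, of "\<lambda>p. grad (fst p) x" "2 * K + C"] grad_bounded by simp

definition potential_grad :: "'a measure \<Rightarrow> 'a \<Rightarrow> 'a" where
  "potential_grad \<mu> x = (\<integral>p. weight \<mu> p *\<^sub>R grad (fst p) x \<partial>D) + lam *\<^sub>R x"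

lemma GDERIV_potential:
  assumes \<mu>: "\<mu> \<in> P2"
  shows "GDERIV (potential D loss lam \<Phi> \<mu>) x :> potential_grad \<mu> x"
proof -
  have "GDERIV (\<lambda>x. \<integral>p. weight \<mu> p * \<Phi> (fst p) x \<partial>D) x :> (\<integral>p. weight \<mu> p *\<^sub>R grad (fst p) x \<partial>D)"
  proof (rule GDERIV_integral_quadratic[where c = "\<lambda>p. C * \<bar>weight \<mu> p\<bar>"])
    fix p v
    have "\<bar>weight \<mu> p * \<Phi> (fst p) (x + v) - weight \<mu> p * \<Phi> (fst p) x - v \<bullet> weight \<mu> p *\<^sub>R grad (fst p) x\<bar>
      = \<bar>weight \<mu> p\<bar> * \<bar>\<Phi> (fst p) (x + v) - \<Phi> (fst p) x - v \<bullet> grad (fst p) x\<bar>"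
      unfolding abs_mult[symmetric] by (simp add: algebra_simps)
    also have "\<dots> \<le> \<bar>weight \<mu> p\<bar> * (C * (norm v)\<^sup>2)"
      by (intro mult_left_mono gradient_taylor_bound[OF \<Phi>_grad grad_lipschitz]) auto
    finally show "\<bar>weight \<mu> p * \<Phi> (fst p) (x + v) - weight \<mu> p * \<Phi> (fst p) x - v \<bullet> weight \<mu> p *\<^sub>R grad (fst p) x\<bar>
      \<le> C * \<bar>weight \<mu> p\<bar> * (norm v)\<^sup>2" by (simp add: ac_simps)
  qed (use weight_integrable[OF \<mu>] weight_grad_integrable[OF \<mu>] weight_\<Phi>_integrable[OF \<mu>] in auto)
  moreover have "GDERIV (\<lambda>x::'a. lam / 2 * (norm x)\<^sup>2) x :> (lam / 2) *\<^sub>R (2 *\<^sub>R x)"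
    by (rule GDERIV_DERIV_compose[of "\<lambda>x. (norm x)\<^sup>2" x _ "\<lambda>t. lam / 2 * t", OF GDERIV_norm_square])
       (auto intro!: derivative_eq_intros)
  ultimately have "GDERIV (\<lambda>x. potential_fit \<mu> x + lam / 2 * (norm x)\<^sup>2) x :> (\<integral>p. weight \<mu> p *\<^sub>R grad (fst p) x \<partial>D) + (lam / 2) *\<^sub>R (2 *\<^sub>R x)"
    unfolding potential_fit_def by (rule GDERIV_add)
  then show ?thesis by (simp add: potential_eq[abs_def] potential_grad_def)
qed

text \<open>A change of \<open>\<mu>\<close> changes the weights by at most \<open>(1 + y\<^sup>2) * (2 * K + C) * W2\<close>, and a change of \<open>x\<close>
changes the gradient of \<open>\<Phi>\<close> by at most \<open>C * |x - y|\<close>.\<close>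

lemma potential_grad_lipschitz:
  "\<exists>L>0. \<forall>\<mu>\<in>P2. \<forall>\<nu>\<in>P2. \<forall>x y. norm (potential_grad \<mu> x - potential_grad \<nu> y) \<le> L * (norm (x - y) + W2 \<mu> \<nu>)"
proof -
  define M where "M = 2 * K + C"
  have M: "0 \<le> M" using K_pos lipschitz_on_nonneg[OF grad_lipschitz] by (simp add: M_def)
  have C: "0 \<le> C" by (rule lipschitz_on_nonneg[OF grad_lipschitz])
  define A where "A = M * M * (\<integral>p. 1 + (snd p)\<^sup>2 \<partial>D)"
  define B where "B = C * (\<integral>p. \<bar>snd p\<bar> + K \<partial>D)"
  have A: "0 \<le> A" unfolding A_def using M by (intro mult_nonneg_nonneg Bochner_Integration.integral_nonneg) auto
  have B: "0 \<le> B" unfolding B_def using C K_pos by (intro mult_nonneg_nonneg Bochner_Integration.integral_nonneg) auto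
  show ?thesis
  proof (intro exI[of _ "A + B + lam"] conjI ballI allI)
    show "0 < A + B + lam" using A B lam_pos by simp
    fix \<mu> \<nu> :: "'a measure" and x y :: 'a assume \<mu>: "\<mu> \<in> P2" and \<nu>: "\<nu> \<in> P2"
    define w where "w = W2 \<mu> \<nu>"
    have w: "0 \<le> w" by (simp add: w_def W2_def)
    have "norm (\<integral>p. weight \<mu> p *\<^sub>R grad (fst p) x - weight \<nu> p *\<^sub>R grad (fst p) y \<partial>D)
       \<le> (\<integral>p. (1 + (snd p)\<^sup>2) * (M * w * M) + (\<bar>snd p\<bar> + K) * (C * norm (x - y)) \<partial>D)"
    proof (rule norm_integral_le_integral)
      fix p
      have "\<bar>weight \<mu> p - weight \<nu> p\<bar> \<le> (1 + (snd p)\<^sup>2) * \<bar>predict \<mu> (fst p) - predict \<nu> (fst p)\<bar>"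
        unfolding weight_def by (rule deriv_loss_lipschitz[OF loss])
      also have "\<dots> \<le> (1 + (snd p)\<^sup>2) * (M * w)"
        unfolding M_def w_def by (intro mult_left_mono predict_diff_le_W2 \<mu> \<nu>) auto
      finally have 1: "\<bar>weight \<mu> p - weight \<nu> p\<bar> \<le> (1 + (snd p)\<^sup>2) * (M * w)" .
      have "weight \<mu> p *\<^sub>R grad (fst p) x - weight \<nu> p *\<^sub>R grad (fst p) y
        = (weight \<mu> p - weight \<nu> p) *\<^sub>R grad (fst p) x + weight \<nu> p *\<^sub>R (grad (fst p) x - grad (fst p) y)"
        by (simp add: algebra_simps)
      also have "norm \<dots> \<le> \<bar>weight \<mu> p - weight \<nu> p\<bar> * norm (grad (fst p) x) + \<bar>weight \<nu> p\<bar> * norm (grad (fst p) x - grad (fst p) y)"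
        by (rule order_trans[OF norm_triangle_ineq]) simp
      also have "\<dots> \<le> ((1 + (snd p)\<^sup>2) * (M * w)) * M + (\<bar>snd p\<bar> + K) * (C * norm (x - y))"
        using 1 abs_weight_le[OF \<nu>, of p] grad_bounded[of "fst p" x] lipschitz_onD[OF grad_lipschitz, of x y "fst p"] M C w K_pos
        by (intro add_mono mult_mono) (auto simp: M_def dist_norm intro!: mult_nonneg_nonneg add_nonneg_nonneg)
      finally show "norm (weight \<mu> p *\<^sub>R grad (fst p) x - weight \<nu> p *\<^sub>R grad (fst p) y)
        \<le> (1 + (snd p)\<^sup>2) * (M * w * M) + (\<bar>snd p\<bar> + K) * (C * norm (x - y))" by (simp add: mult.assoc)
    qed (use label_square_integrable label_integrable in auto)
    also have "\<dots> = A * w + B * norm (x - y)"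
      using label_square_integrable label_integrable by (simp add: A_def B_def mult.commute mult.left_commute)
    finally have fit: "norm (\<integral>p. weight \<mu> p *\<^sub>R grad (fst p) x - weight \<nu> p *\<^sub>R grad (fst p) y \<partial>D) \<le> A * w + B * norm (x - y)" .
    have "potential_grad \<mu> x - potential_grad \<nu> y = (\<integral>p. weight \<mu> p *\<^sub>R grad (fst p) x - weight \<nu> p *\<^sub>R grad (fst p) y \<partial>D) + lam *\<^sub>R (x - y)"
      using weight_grad_integrable \<mu> \<nu> by (simp add: potential_grad_def algebra_simps)
    also have "norm \<dots> \<le> (A * w + B * norm (x - y)) + lam * norm (x - y)"
      using lam_pos by (intro order_trans[OF norm_triangle_ineq] add_mono fit) simp
    also have "\<dots> \<le> (A + B + lam) * (norm (x - y) + w)"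
      using A B lam_pos w by (simp add: algebra_simps add_nonneg_nonneg)
    finally show "norm (potential_grad \<mu> x - potential_grad \<nu> y) \<le> (A + B + lam) * (norm (x - y) + W2 \<mu> \<nu>)"
      by (simp add: w_def)
  qed
qed

text \<open>The Lipschitz estimate for equal measures, whose distance is 0 by the diagonal coupling.\<close>

lemma potential_grad_continuous:
  assumes "\<mu> \<in> P2" shows "continuous_on UNIV (potential_grad \<mu>)"
proof -
  obtain L where L: "0 < L" "\<And>\<mu> \<nu> x y. \<mu> \<in> P2 \<Longrightarrow> \<nu> \<in> P2 \<Longrightarrow> norm (potential_grad \<mu> x - potential_grad \<nu> y) \<le> L * (norm (x - y) + W2 \<mu> \<nu>)"
    using potential_grad_lipschitz by metis
  have W: "W2 \<mu> \<mu> = 0"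
  proof -
    have s: "sets \<mu> = sets borel" and p: "prob_space \<mu>" using assms by (auto simp: P2_def)
    note [measurable_cong] = s
    let ?\<gamma> = "distr \<mu> borel (\<lambda>x. (x, x))"
    have [measurable]: "(\<lambda>x::'a. (x, x)) \<in> borel_measurable borel"
      unfolding borel_prod[symmetric] by measurable
    have [measurable]: "fst \<in> borel_measurable (borel :: ('a \<times> 'a) measure)" "snd \<in> borel_measurable (borel :: ('a \<times> 'a) measure)"
      unfolding borel_prod[symmetric] by measurable
    have "distr \<mu> borel (\<lambda>x. x) = \<mu>" using s by (intro measure_eqI) (auto simp: emeasure_distr)
    then have "?\<gamma> \<in> couplings \<mu> \<mu>"
      using p by (auto simp: couplings_def distr_distr comp_def intro!: prob_space.prob_space_distr)
    then have "(INF \<gamma> \<in> couplings \<mu> \<mu>. \<integral>\<^sup>+ p. ennreal ((norm (snd p - fst p))\<^sup>2) \<partial>\<gamma>) \<le> (\<integral>\<^sup>+ p. ennreal ((norm (snd p - fst p))\<^sup>2) \<partial>?\<gamma>)"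
      by (rule INF_lower)
    also have "\<dots> = 0" by (subst nn_integral_distr) auto
    finally show ?thesis by (simp add: W2_def)
  qed
  have "L-lipschitz_on UNIV (potential_grad \<mu>)"
    using L(2)[OF assms assms] L(1) W by (intro lipschitz_onI) (auto simp: dist_norm)
  then show ?thesis by (rule lipschitz_on_continuous_on)
qed

lemma potential_fit_bounded:
  assumes "\<mu> \<in> P2" shows "\<exists>B. \<forall>x. \<bar>potential_fit \<mu> x\<bar> \<le> B"
proof (intro exI allI)
  fix x
  have "norm (potential_fit \<mu> x) \<le> (\<integral>p. \<bar>weight \<mu> p\<bar> * K \<partial>D)"
    unfolding potential_fit_def
    by (rule norm_integral_le_integral) (use weight_integrable[OF assms] \<Phi>_bounded in \<open>auto simp: abs_mult intro!: mult_left_mono\<close>)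
  then show "\<bar>potential_fit \<mu> x\<bar> \<le> (\<integral>p. \<bar>weight \<mu> p\<bar> * K \<partial>D)" by simp
qed

lemma potential_continuous:
  assumes "\<mu> \<in> P2" shows "continuous_on UNIV (potential D loss lam \<Phi> \<mu>)"
  using GDERIV_continuous_on GDERIV_potential[OF assms] by blast

lemma potential_fit_measurable:
  assumes "\<mu> \<in> P2" shows "potential_fit \<mu> \<in> borel_measurable borel"
proof -
  have [measurable]: "potential D loss lam \<Phi> \<mu> \<in> borel_measurable borel"
    using potential_continuous[OF assms] by (rule borel_measurable_continuous_onI)
  have "(\<lambda>x. potential D loss lam \<Phi> \<mu> x - lam / 2 * (norm x)\<^sup>2) \<in> borel_measurable borel" by measurable
  then show ?thesis by (simp add: potential_eq)
qed

lemma potential_fit_integrable: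
  assumes \<mu>: "\<mu> \<in> P2" and \<nu>: "\<nu> \<in> P2" shows "integrable \<nu> (potential_fit \<mu>)"
proof -
  interpret \<nu>: prob_space \<nu> using \<nu> by (rule P2D)
  note [measurable_cong] = P2D(2)[OF \<nu>]
  have [measurable]: "potential_fit \<mu> \<in> borel_measurable borel" by (rule potential_fit_measurable[OF \<mu>])
  obtain B where "\<And>x. \<bar>potential_fit \<mu> x\<bar> \<le> B" using potential_fit_bounded[OF \<mu>] by blast
  then show ?thesis by (intro \<nu>.integrable_const_bound[where B = B]) auto
qed

lemma integral_potential_fit:
  assumes \<mu>: "\<mu> \<in> P2" and \<nu>: "\<nu> \<in> P2"
  shows "(\<integral>x. potential_fit \<mu> x \<partial>\<nu>) = (\<integral>p. weight \<mu> p * predict \<nu> (fst p) \<partial>D)"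
proof -
  interpret \<nu>: prob_space \<nu> using \<nu> by (rule P2D)
  interpret P: pair_sigma_finite D \<nu> ..
  note [measurable_cong] = P2D(2)[OF \<nu>]
  have [measurable]: "weight \<mu> \<in> borel_measurable D" by (rule weight_measurable[OF \<mu>])
  have [measurable]: "(\<lambda>(p, x). \<Phi> (fst p) x) \<in> borel_measurable (D \<Otimes>\<^sub>M \<nu>)"
  proof -
    have "(\<lambda>q. (\<lambda>(z, x). \<Phi> z x) (fst (fst q), snd q)) \<in> borel_measurable (D \<Otimes>\<^sub>M \<nu>)" by measurable
    then show ?thesis by (simp add: split_beta')
  qed
  have \<Phi>i: "integrable \<nu> (\<Phi> z)" for z by (rule integrable_\<Phi>[OF P2D(1,2)[OF \<nu>]])
  have "integrable (D \<Otimes>\<^sub>M \<nu>) (\<lambda>(p, x). weight \<mu> p * \<Phi> (fst p) x)"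
  proof (rule P.Fubini_integrable)
    show "integrable D (\<lambda>p. \<integral>x. norm (case (p, x) of (p, x) \<Rightarrow> weight \<mu> p * \<Phi> (fst p) x) \<partial>\<nu>)"
    proof (rule Bochner_Integration.integrable_bound)
      show "integrable D (\<lambda>p. K * \<bar>weight \<mu> p\<bar>)" using weight_integrable[OF \<mu>] by simp
      show "AE p in D. norm (\<integral>x. norm (case (p, x) of (p, x) \<Rightarrow> weight \<mu> p * \<Phi> (fst p) x) \<partial>\<nu>) \<le> norm (K * \<bar>weight \<mu> p\<bar>)"
      proof (rule AE_I2)
        fix p
        have "norm (\<integral>x. \<bar>weight \<mu> p\<bar> * \<bar>\<Phi> (fst p) x\<bar> \<partial>\<nu>) \<le> (\<integral>x. \<bar>weight \<mu> p\<bar> * K \<partial>\<nu>)"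
          by (rule norm_integral_le_integral) (auto intro!: mult_left_mono \<Phi>_bounded)
        then show "norm (\<integral>x. norm (case (p, x) of (p, x) \<Rightarrow> weight \<mu> p * \<Phi> (fst p) x) \<partial>\<nu>) \<le> norm (K * \<bar>weight \<mu> p\<bar>)"
          using K_pos by (simp add: abs_mult \<nu>.prob_space mult.commute)
      qed
    qed measurable
    show "AE p in D. integrable \<nu> (\<lambda>x. case (p, x) of (p, x) \<Rightarrow> weight \<mu> p * \<Phi> (fst p) x)"
      using \<Phi>i by simp
  qed measurable
  then have "(\<integral>x. (\<integral>p. weight \<mu> p * \<Phi> (fst p) x \<partial>D) \<partial>\<nu>) = (\<integral>p. (\<integral>x. weight \<mu> p * \<Phi> (fst p) x \<partial>\<nu>) \<partial>D)"
    by (rule P.Fubini_integral)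
  then show ?thesis by (simp add: potential_fit_def predict_def)
qed

lemma loss_second_order:
  "\<bar>loss y (a + h) - loss y a - h * deriv (loss y) a\<bar> \<le> (1 + y\<^sup>2) * h\<^sup>2"
proof -
  have "\<bar>loss y (a + h) - loss y a - h \<bullet> deriv (loss y) a\<bar> \<le> (1 + y\<^sup>2) * (norm h)\<^sup>2"
  proof (rule gradient_taylor_bound)
    show "GDERIV (loss y) x :> deriv (loss y) x" for x using loss_DERIV[OF loss] by simp
    show "(1 + y\<^sup>2)-lipschitz_on UNIV (deriv (loss y))"
      using deriv_loss_lipschitz[OF loss] by (intro lipschitz_onI) (auto simp: dist_real_def)
  qed
  then show ?thesis by simp
qed

text \<open>The prediction depends affinely on \<open>\<epsilon>\<close>, so \<open>loss_second_order\<close> bounds the difference between the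
difference quotient and the derivative by \<open>E * \<epsilon>\<close> with a finite constant \<open>E\<close>. The derivative is
identified with the integral of the potential by Fubini's theorem (\<open>integral_potential_fit\<close>).\<close>

lemma first_variation_risk:
  assumes \<mu>: "\<mu> \<in> P2"
  shows "first_variation_at (risk D loss lam \<Phi>) \<mu> (potential D loss lam \<Phi> \<mu>)"
  unfolding first_variation_at_def
proof (intro conjI ballI)
  show "continuous_on UNIV (potential D loss lam \<Phi> \<mu>)" by (rule potential_continuous[OF \<mu>])
  have pot_int: "integrable \<nu> (potential D loss lam \<Phi> \<mu>)"
    "(\<integral>x. potential D loss lam \<Phi> \<mu> x \<partial>\<nu>) = (\<integral>p. weight \<mu> p * predict \<nu> (fst p) \<partial>D) + lam / 2 * (\<integral>x. (norm x)\<^sup>2 \<partial>\<nu>)"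
    if "\<nu> \<in> P2" for \<nu>
    using potential_fit_integrable[OF \<mu> that] integral_potential_fit[OF \<mu> that] P2D(3)[OF that]
    unfolding potential_eq[abs_def] by simp_all
  fix \<nu> :: "'a measure" assume \<nu>: "\<nu> \<in> P2"
  show "integrable \<mu> (potential D loss lam \<Phi> \<mu>)" "integrable \<nu> (potential D loss lam \<Phi> \<mu>)"
    using pot_int(1) \<mu> \<nu> by auto
  define h where "h p = predict \<nu> (fst p) - predict \<mu> (fst p)" for p :: "'z \<times> real"
  have [measurable]: "predict \<mu> \<in> borel_measurable borel" "predict \<nu> \<in> borel_measurable borel"
    using \<mu> \<nu> by (auto intro: predict_measurable dest: P2D)
  have h_bound: "\<bar>h p\<bar> \<le> 2 * K" for p
    using abs_predict_le[OF P2D(1)[OF \<mu>], of "fst p"] abs_predict_le[OF P2D(1)[OF \<nu>], of "fst p"] by (simp add: h_def)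
  have wi: "integrable D (\<lambda>p. weight \<mu> p * predict \<mu> (fst p))" "integrable D (\<lambda>p. weight \<mu> p * predict \<nu> (fst p))"
    using weight_mult_integrable[OF \<mu>, of "\<lambda>p. predict \<mu> (fst p)" K] weight_mult_integrable[OF \<mu>, of "\<lambda>p. predict \<nu> (fst p)" K]
      abs_predict_le[OF P2D(1)[OF \<mu>]] abs_predict_le[OF P2D(1)[OF \<nu>]] by auto
  then have whi: "integrable D (\<lambda>p. weight \<mu> p * h p)" by (simp add: h_def right_diff_distrib)
  define E where "E = (\<integral>p. (1 + (snd p)\<^sup>2) * (2 * K)\<^sup>2 \<partial>D)"
  define V where "V = (\<integral>p. weight \<mu> p * h p \<partial>D) + lam / 2 * ((\<integral>x. (norm x)\<^sup>2 \<partial>\<nu>) - (\<integral>x. (norm x)\<^sup>2 \<partial>\<mu>))"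
  have V_eq: "V = (\<integral>x. potential D loss lam \<Phi> \<mu> x \<partial>\<nu>) - (\<integral>x. potential D loss lam \<Phi> \<mu> x \<partial>\<mu>)"
    unfolding V_def pot_int(2)[OF \<mu>] pot_int(2)[OF \<nu>] h_def using wi by (simp add: right_diff_distrib)
  have bound: "\<bar>(risk D loss lam \<Phi> (lin_comb (1 - \<epsilon>) \<mu> \<epsilon> \<nu>) - risk D loss lam \<Phi> \<mu>) / \<epsilon> - V\<bar> \<le> E * \<epsilon>"
    if \<epsilon>: "0 < \<epsilon>" "\<epsilon> < 1" for \<epsilon>
  proof -
    define \<mu>\<epsilon> where "\<mu>\<epsilon> = lin_comb (1 - \<epsilon>) \<mu> \<epsilon> \<nu>"
    have \<mu>\<epsilon>: "\<mu>\<epsilon> \<in> P2" unfolding \<mu>\<epsilon>_def using \<epsilon> \<mu> \<nu> by (intro lin_comb_P2) auto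
    have pred: "predict \<mu>\<epsilon> (fst p) = predict \<mu> (fst p) + \<epsilon> * h p" for p
      unfolding \<mu>\<epsilon>_def h_def using \<epsilon> \<mu> \<nu> by (simp add: predict_lin_comb algebra_simps)
    have norm2: "(\<integral>x. (norm x)\<^sup>2 \<partial>\<mu>\<epsilon>) = (1 - \<epsilon>) * (\<integral>x. (norm x)\<^sup>2 \<partial>\<mu>) + \<epsilon> * (\<integral>x. (norm x)\<^sup>2 \<partial>\<nu>)"
      unfolding \<mu>\<epsilon>_def using \<epsilon> P2D[OF \<mu>] P2D[OF \<nu>] by (intro integral_lin_comb(2)) auto
    have li: "integrable D (\<lambda>p. loss (snd p) (predict \<mu> (fst p) + \<epsilon> * h p))" "integrable D (\<lambda>p. loss (snd p) (predict \<mu> (fst p)))"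
      using risk_finite'[OF \<mu>\<epsilon>] risk_finite'[OF \<mu>] by (simp_all add: pred)
    have "risk D loss lam \<Phi> \<mu>\<epsilon> - risk D loss lam \<Phi> \<mu> - \<epsilon> * V
       = (\<integral>p. loss (snd p) (predict \<mu> (fst p) + \<epsilon> * h p) - loss (snd p) (predict \<mu> (fst p)) - (\<epsilon> * h p) * weight \<mu> p \<partial>D)"
    proof -
      have "(\<integral>p. loss (snd p) (predict \<mu> (fst p) + \<epsilon> * h p) - loss (snd p) (predict \<mu> (fst p)) - \<epsilon> * (weight \<mu> p * h p) \<partial>D)
        = (\<integral>p. loss (snd p) (predict \<mu> (fst p) + \<epsilon> * h p) \<partial>D) - (\<integral>p. loss (snd p) (predict \<mu> (fst p)) \<partial>D) - \<epsilon> * (\<integral>p. weight \<mu> p * h p \<partial>D)"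
        using li whi by simp
      then show ?thesis
        unfolding risk_eq V_def pred norm2 by (simp add: algebra_simps add_divide_distrib diff_divide_distrib)
    qed
    also have "\<bar>\<dots>\<bar> \<le> (\<integral>p. \<epsilon>\<^sup>2 * ((1 + (snd p)\<^sup>2) * (2 * K)\<^sup>2) \<partial>D)"
      unfolding real_norm_def[symmetric]
    proof (rule norm_integral_le_integral)
      fix p
      have "norm (loss (snd p) (predict \<mu> (fst p) + \<epsilon> * h p) - loss (snd p) (predict \<mu> (fst p)) - (\<epsilon> * h p) * weight \<mu> p) \<le> (1 + (snd p)\<^sup>2) * (\<epsilon> * h p)\<^sup>2"
        unfolding weight_def real_norm_def by (rule loss_second_order)
      also have "\<dots> \<le> (1 + (snd p)\<^sup>2) * (\<epsilon>\<^sup>2 * (2 * K)\<^sup>2)"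
        using power_mono[OF h_bound[of p], of 2] by (intro mult_left_mono) (auto simp: power_mult_distrib intro!: mult_left_mono)
      finally show "norm (loss (snd p) (predict \<mu> (fst p) + \<epsilon> * h p) - loss (snd p) (predict \<mu> (fst p)) - (\<epsilon> * h p) * weight \<mu> p)
         \<le> \<epsilon>\<^sup>2 * ((1 + (snd p)\<^sup>2) * (2 * K)\<^sup>2)" by (simp add: ac_simps)
    qed (use label_square_integrable in auto)
    also have "\<dots> = \<epsilon> * (E * \<epsilon>)" by (simp add: E_def power2_eq_square)
    finally have "\<bar>risk D loss lam \<Phi> \<mu>\<epsilon> - risk D loss lam \<Phi> \<mu> - \<epsilon> * V\<bar> / \<epsilon> \<le> E * \<epsilon>"
      using \<epsilon> by (simp add: divide_le_eq mult.commute)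
    moreover have "(risk D loss lam \<Phi> \<mu>\<epsilon> - risk D loss lam \<Phi> \<mu>) / \<epsilon> - V = (risk D loss lam \<Phi> \<mu>\<epsilon> - risk D loss lam \<Phi> \<mu> - \<epsilon> * V) / \<epsilon>"
      using \<epsilon> by (simp add: diff_divide_distrib)
    ultimately show ?thesis using \<epsilon> by (simp add: \<mu>\<epsilon>_def abs_divide)
  qed
  have "((\<lambda>\<epsilon>. (risk D loss lam \<Phi> (lin_comb (1 - \<epsilon>) \<mu> \<epsilon> \<nu>) - risk D loss lam \<Phi> \<mu>) / \<epsilon> - V) \<longlongrightarrow> 0) (at_right 0)"
  proof (rule Lim_null_comparison)
    have "\<forall>\<^sub>F \<epsilon> in at_right 0. \<epsilon> \<in> {0<..<1::real}" by (rule eventually_at_right_real) simp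
    then show "\<forall>\<^sub>F \<epsilon> in at_right 0. norm ((risk D loss lam \<Phi> (lin_comb (1 - \<epsilon>) \<mu> \<epsilon> \<nu>) - risk D loss lam \<Phi> \<mu>) / \<epsilon> - V) \<le> E * \<epsilon>"
      by eventually_elim (use bound in auto)
    have "((\<lambda>\<epsilon>. E * \<epsilon>) \<longlongrightarrow> E * 0) (at_right 0)" by (intro tendsto_intros)
    then show "((\<lambda>\<epsilon>. E * \<epsilon>) \<longlongrightarrow> 0) (at_right 0)" by simp
  qed
  then show "((\<lambda>\<epsilon>. (risk D loss lam \<Phi> (lin_comb (1 - \<epsilon>) \<mu> \<epsilon> \<nu>) - risk D loss lam \<Phi> \<mu>) / \<epsilon>)
     \<longlongrightarrow> (\<integral>x. potential D loss lam \<Phi> \<mu> x \<partial>\<nu>) - (\<integral>x. potential D loss lam \<Phi> \<mu> x \<partial>\<mu>)) (at_right 0)"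
    unfolding V_eq[symmetric] by (rule LIM_zero_cancel)
qed

subsection \<open>Logarithmic Sobolev inequality for the Gibbs measures\<close>

text \<open>Divided by \<open>\<tau>\<close>, the quadratic part of the potential is that of the Gaussian measure of variance
\<open>\<tau> / lam\<close>.\<close>

lemma LSI_gibbs_potential:
  assumes \<mu>: "\<mu> \<in> P2" and \<tau>: "0 < \<tau>" and k: "\<And>x. \<bar>potential_fit \<mu> x\<bar> \<le> k"
  shows "integrable lborel (\<lambda>x. exp (- potential D loss lam \<Phi> \<mu> x / \<tau>))"
    "LSI (lam / \<tau> * exp (- 2 * k / \<tau>)) (gibbs (\<lambda>x. potential D loss lam \<Phi> \<mu> x / \<tau>))"
proof -
  have [measurable]: "potential_fit \<mu> \<in> borel_measurable borel" by (rule potential_fit_measurable[OF \<mu>])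
  have U: "(\<lambda>x. potential_fit \<mu> x / \<tau> + (norm x)\<^sup>2 / (2 * (\<tau> / lam))) = (\<lambda>x. potential D loss lam \<Phi> \<mu> x / \<tau>)"
    using \<tau> lam_pos by (auto simp: potential_eq add_divide_distrib fun_eq_iff)
  have w: "\<bar>potential_fit \<mu> x / \<tau>\<bar> \<le> k / \<tau>" for x using k[of x] \<tau> by (simp add: abs_divide divide_right_mono)
  have "0 < \<tau> / lam" using \<tau> lam_pos by simp
  note LSI = LSI_gibbs_bounded_perturbation[of "\<lambda>x. potential_fit \<mu> x / \<tau>", OF _ w this]
  have "(\<lambda>x. potential_fit \<mu> x / \<tau>) \<in> borel_measurable borel" by measurable
  from LSI[OF this] show "integrable lborel (\<lambda>x. exp (- potential D loss lam \<Phi> \<mu> x / \<tau>))"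
    "LSI (lam / \<tau> * exp (- 2 * k / \<tau>)) (gibbs (\<lambda>x. potential D loss lam \<Phi> \<mu> x / \<tau>))"
    unfolding fun_cong[OF U] U by (simp_all add: mult.commute)
qed

lemma potential_fit_le_of_weight:
  assumes \<mu>: "\<mu> \<in> P2" and le: "AE p in D. \<bar>weight \<mu> p\<bar> \<le> 1" shows "\<bar>potential_fit \<mu> x\<bar> \<le> K"
proof -
  have "norm (potential_fit \<mu> x) \<le> (\<integral>p. norm (weight \<mu> p * \<Phi> (fst p) x) \<partial>D)"
    unfolding potential_fit_def by (rule integral_norm_bound)
  also have "\<dots> \<le> (\<integral>p. K \<partial>D)"
  proof (rule integral_mono_AE)
    show "AE p in D. norm (weight \<mu> p * \<Phi> (fst p) x) \<le> K"
      using le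
    proof eventually_elim
      case (elim p)
      then have "\<bar>weight \<mu> p\<bar> * \<bar>\<Phi> (fst p) x\<bar> \<le> 1 * K" by (intro mult_mono \<Phi>_bounded) auto
      then show ?case by (simp add: abs_mult)
    qed
  qed (use weight_\<Phi>_integrable[OF \<mu>] in auto)
  finally show ?thesis by (simp add: prob_space)
qed

text \<open>Since \<open>\<Phi> z x\<close> and the prediction depend on \<open>z\<close> only, the label \<open>y\<close> in the weight
\<open>predict \<mu> z - y\<close> can be replaced by its conditional expectation given \<open>z\<close>.\<close>

lemma potential_fit_square_le:
  assumes \<mu>: "\<mu> \<in> P2" and sq: "loss = square_loss" and le: "AE p in D. \<bar>cond_exp_label D p\<bar> \<le> K'"
  shows "\<bar>potential_fit \<mu> x\<bar> \<le> K * (K + K')"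
proof -
  define F where "F = vimage_algebra (space D) fst (borel :: 'z measure)"
  have space_D: "space D = UNIV" using sets_eq_imp_space_eq[OF sets_D] by simp
  have fst_F: "fst \<in> measurable F borel" unfolding F_def by (rule measurable_vimage_algebra1) simp
  have sub: "subalgebra D F"
    unfolding subalgebra_def
  proof
    show "space F = space D" by (simp add: F_def)
    have "fst \<in> measurable D (borel :: 'z measure)" by measurable
    then show "sets F \<subseteq> sets D"
      unfolding F_def sets_vimage_algebra by (auto intro!: sets.sigma_sets_subset dest: measurable_sets)
  qed
  interpret F: finite_measure_subalgebra D F by unfold_locales (rule sub)
  have lab: "integrable D (\<lambda>p. snd p)" using label_integrable by (subst (asm) integrable_abs_iff) auto
  have [measurable]: "predict \<mu> \<in> borel_measurable borel" using \<mu> by (intro predict_measurable P2D)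
  have f_F: "(\<lambda>p. \<Phi> (fst p) x) \<in> borel_measurable F"
    by (rule measurable_compose[OF fst_F]) measurable
  have m: "\<bar>predict \<mu> (fst p)\<bar> \<le> K" for p :: "'z \<times> real" by (rule abs_predict_le[OF P2D(1)[OF \<mu>]])
  have i1: "integrable D (\<lambda>p. \<Phi> (fst p) x * snd p)"
    by (rule Bochner_Integration.integrable_bound[OF integrable_mult_right[OF label_integrable, of K]])
       (use \<Phi>_bounded K_pos in \<open>auto intro!: AE_I2 mult_right_mono simp: abs_mult\<close>)
  have i2: "integrable D (\<lambda>p. \<Phi> (fst p) x * predict \<mu> (fst p))"
  proof (rule integrable_const_bound[where B = "K * K"])
    show "AE p in D. norm (\<Phi> (fst p) x * predict \<mu> (fst p)) \<le> K * K"
      using \<Phi>_bounded m K_pos by (auto intro!: AE_I2 mult_mono simp: abs_mult)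
  qed measurable
  note ce = F.real_cond_exp_intg[OF i1 f_F borel_measurable_integrable[OF lab], folded cond_exp_label_def[of D, folded F_def]]
  have ce_eq: "cond_exp_label D = real_cond_exp D F snd" by (simp add: cond_exp_label_def F_def)
  have w: "weight \<mu> p = predict \<mu> (fst p) - snd p" for p
  proof -
    have "weight \<mu> p = deriv (loss (snd p)) (predict \<mu> (fst p))" by (rule weight_def)
    also have "\<dots> = predict \<mu> (fst p) - snd p"
      unfolding sq by (rule DERIV_imp_deriv[OF square_loss_DERIV])
    finally show ?thesis .
  qed
  have "potential_fit \<mu> x = (\<integral>p. \<Phi> (fst p) x * predict \<mu> (fst p) \<partial>D) - (\<integral>p. \<Phi> (fst p) x * snd p \<partial>D)"
    unfolding potential_fit_def w using i1 i2 by (simp add: algebra_simps)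
  also have "\<dots> = (\<integral>p. \<Phi> (fst p) x * predict \<mu> (fst p) - \<Phi> (fst p) x * cond_exp_label D p \<partial>D)"
    using i2 ce unfolding ce_eq by simp
  also have "norm \<dots> \<le> (\<integral>p. norm (\<Phi> (fst p) x * predict \<mu> (fst p) - \<Phi> (fst p) x * cond_exp_label D p) \<partial>D)"
    by (rule integral_norm_bound)
  also have "\<dots> \<le> (\<integral>p. K * (K + K') \<partial>D)"
  proof (rule integral_mono_AE)
    show "AE p in D. norm (\<Phi> (fst p) x * predict \<mu> (fst p) - \<Phi> (fst p) x * cond_exp_label D p) \<le> K * (K + K')"
      using le
    proof eventually_elim
      case (elim p)
      have "\<bar>\<Phi> (fst p) x\<bar> * \<bar>predict \<mu> (fst p) - cond_exp_label D p\<bar> \<le> K * (K + K')"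
        using \<Phi>_bounded m[of p] elim K_pos by (intro mult_mono) auto
      then show ?case by (simp add: abs_mult[symmetric] right_diff_distrib)
    qed
  qed (use i2 ce in \<open>auto simp: ce_eq\<close>)
  finally show ?thesis by (simp add: prob_space)
qed

end

section \<open>Entropy relative to a Gaussian\<close>

text \<open>Compare \<open>(f + b)\<^sup>+ + f\<^sup>- + b\<^sup>-\<close> with \<open>(f + b)\<^sup>- + f\<^sup>+ + b\<^sup>+\<close>; the only integrals that may be infinite
are those of \<open>f\<^sup>+\<close> and \<open>(f + b)\<^sup>+\<close>.\<close>

lemma ext_integral_add_integrable:
  fixes f b :: "'b \<Rightarrow> real"
  assumes [measurable]: "f \<in> borel_measurable M" and b: "integrable M b"
    and neg: "(\<integral>\<^sup>+x. ennreal (- f x) \<partial>M) < \<infinity>"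
  shows "ext_integral M (\<lambda>x. f x + b x) = ext_integral M f + ereal (\<integral>x. b x \<partial>M)"
proof -
  have [measurable]: "b \<in> borel_measurable M" using b by auto
  define P where "P h = (\<integral>\<^sup>+x. ennreal (h x) \<partial>M)" for h
  define S where "S x = f x + b x" for x
  have [measurable]: "S \<in> borel_measurable M" unfolding S_def[abs_def] by measurable
  have Pb: "P b < \<infinity>" "P (\<lambda>x. - b x) < \<infinity>"
  proof -
    have "P b \<le> (\<integral>\<^sup>+x. ennreal (norm (b x)) \<partial>M)" "P (\<lambda>x. - b x) \<le> (\<integral>\<^sup>+x. ennreal (norm (b x)) \<partial>M)"
      unfolding P_def by (auto intro!: nn_integral_mono ennreal_leI)
    moreover have "(\<integral>\<^sup>+x. ennreal (norm (b x)) \<partial>M) < \<infinity>" using b by (simp add: integrable_iff_bounded)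
    ultimately show "P b < \<infinity>" "P (\<lambda>x. - b x) < \<infinity>" by (auto intro: le_less_trans)
  qed
  have Pf: "P (\<lambda>x. - f x) < \<infinity>" using neg by (simp add: P_def)
  have PS: "P (\<lambda>x. - S x) < \<infinity>"
  proof -
    have "P (\<lambda>x. - S x) \<le> (\<integral>\<^sup>+x. ennreal (- f x) + ennreal (- b x) \<partial>M)"
      unfolding P_def
    proof (rule nn_integral_mono)
      fix x
      have "ennreal (- S x) \<le> ennreal (max 0 (- f x) + max 0 (- b x))" by (intro ennreal_leI) (simp add: S_def)
      also have "\<dots> = ennreal (- f x) + ennreal (- b x)" by (simp add: ennreal_plus max_def ennreal_neg)
      finally show "ennreal (- S x) \<le> ennreal (- f x) + ennreal (- b x)" .
    qed
    also have "\<dots> = P (\<lambda>x. - f x) + P (\<lambda>x. - b x)" unfolding P_def by (rule nn_integral_add) auto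
    also have "\<dots> < \<infinity>" using Pf Pb by simp
    finally show ?thesis .
  qed
  have "P S + P (\<lambda>x. - f x) + P (\<lambda>x. - b x) = (\<integral>\<^sup>+x. ennreal (S x) + ennreal (- f x) + ennreal (- b x) \<partial>M)"
    unfolding P_def by (simp add: nn_integral_add)
  also have "\<dots> = (\<integral>\<^sup>+x. ennreal (f x) + ennreal (b x) + ennreal (- S x) \<partial>M)"
  proof (rule nn_integral_cong)
    fix x
    have e: "ennreal (max 0 u) = ennreal u" for u by (simp add: max_def ennreal_neg)
    have sum3: "ennreal (max 0 u + max 0 v + max 0 w) = ennreal u + ennreal v + ennreal w" for u v w
      by (simp only: ennreal_plus max.cobounded1 add_nonneg_nonneg e)
    have "max 0 (S x) + max 0 (- f x) + max 0 (- b x) = max 0 (f x) + max 0 (b x) + max 0 (- S x)"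
      by (simp add: S_def max_def)
    then show "ennreal (S x) + ennreal (- f x) + ennreal (- b x) = ennreal (f x) + ennreal (b x) + ennreal (- S x)"
      unfolding sum3[symmetric] by simp
  qed
  also have "\<dots> = P f + P b + P (\<lambda>x. - S x)" unfolding P_def by (simp add: nn_integral_add)
  finally have eq: "P S + P (\<lambda>x. - f x) + P (\<lambda>x. - b x) = P f + P b + P (\<lambda>x. - S x)" .
  have Ib: "(\<integral>x. b x \<partial>M) = enn2real (P b) - enn2real (P (\<lambda>x. - b x))"
    unfolding P_def by (rule real_lebesgue_integral_def[OF b])
  obtain r1 where r1: "P (\<lambda>x. - f x) = ennreal r1" "0 \<le> r1" using Pf by (cases "P (\<lambda>x. - f x)") auto
  obtain r2 where r2: "P (\<lambda>x. - b x) = ennreal r2" "0 \<le> r2" using Pb by (cases "P (\<lambda>x. - b x)") auto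
  obtain r3 where r3: "P b = ennreal r3" "0 \<le> r3" using Pb by (cases "P b") auto
  obtain r4 where r4: "P (\<lambda>x. - S x) = ennreal r4" "0 \<le> r4" using PS by (cases "P (\<lambda>x. - S x)") auto
  have "enn2ereal (P S) - enn2ereal (P (\<lambda>x. - S x)) = enn2ereal (P f) - enn2ereal (P (\<lambda>x. - f x)) + ereal (\<integral>x. b x \<partial>M)"
  proof (cases "P f")
    case (real a)
    then have eq': "P S + ennreal r1 + ennreal r2 = ennreal (a + r3 + r4)" using eq r1 r2 r3 r4 by simp
    then have "P S \<noteq> \<infinity>" by (metis ennreal_neq_top ennreal_add_eq_top infinity_ennreal_def)
    then obtain c where c: "P S = ennreal c" "0 \<le> c" by (cases "P S") auto
    then have "ennreal (c + r1 + r2) = ennreal (a + r3 + r4)" using eq' r1 r2 by simp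
    then have "c + r1 + r2 = a + r3 + r4" using c r1 r2 r3 r4 real by (subst (asm) ennreal_inj) auto
    then show ?thesis using real c r1 r2 r3 r4 by (simp add: Ib)
  next
    case top
    then have "P S + ennreal r1 + ennreal r2 = \<infinity>" using eq r1 r2 by simp
    then have "P S = \<infinity>" by (simp add: ennreal_add_eq_top)
    then show ?thesis using top r1 r4 by simp
  qed
  then show ?thesis unfolding ext_integral_def P_def S_def by simp
qed

lemma P2a_gaussian_density:
  assumes \<mu>: "\<mu> \<in> (P2a :: 'a::euclidean_space measure set)" and s: "0 < s"
  obtains f where "f \<in> borel_measurable borel" "\<And>x. 0 \<le> f x" "\<mu> = density (gaussian s) (\<lambda>x. ennreal (f x))"
proof -
  let ?\<gamma> = "gaussian s :: 'a measure"
  interpret \<gamma>: prob_space ?\<gamma> by (rule prob_space_gaussian[OF s])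
  have p: "prob_space \<mu>" "sets \<mu> = sets borel" "absolutely_continuous lborel \<mu>" using \<mu> by (auto simp: P2a_def P2_def)
  interpret \<mu>: prob_space \<mu> by fact
  have "absolutely_continuous ?\<gamma> \<mu>"
    unfolding absolutely_continuous_def
  proof
    fix A assume A: "A \<in> null_sets ?\<gamma>"
    then have "A \<in> null_sets (lborel :: 'a measure)"
      using AE_gaussian_iff[OF s, of "\<lambda>x. x \<notin> A"] by (subst (asm) AE_iff_null_sets[symmetric]) (auto simp: null_setsD2 AE_iff_null_sets)
    then show "A \<in> null_sets \<mu>" using p(3) by (auto simp: absolutely_continuous_def)
  qed
  then have d: "density ?\<gamma> (RN_deriv ?\<gamma> \<mu>) = \<mu>" by (rule \<gamma>.density_RN_deriv) (simp add: p(2))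
  have fin: "AE x in ?\<gamma>. RN_deriv ?\<gamma> \<mu> x \<noteq> \<infinity>"
    by (rule \<gamma>.RN_deriv_finite) (use \<open>absolutely_continuous ?\<gamma> \<mu>\<close> p(2) \<mu>.sigma_finite_measure_axioms in auto)
  have [measurable]: "RN_deriv ?\<gamma> \<mu> \<in> borel_measurable borel"
    using borel_measurable_RN_deriv[of ?\<gamma> \<mu>] by simp
  have "density ?\<gamma> (\<lambda>x. ennreal (enn2real (RN_deriv ?\<gamma> \<mu> x))) = density ?\<gamma> (RN_deriv ?\<gamma> \<mu>)"
    by (rule density_cong) (use fin in \<open>auto elim!: eventually_mono simp: less_top\<close>)
  then show ?thesis using d by (intro that[of "\<lambda>x. enn2real (RN_deriv ?\<gamma> \<mu> x)"]) auto
qed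

text \<open>The logarithm of the Lebesgue density is \<open>ln f\<close> plus the logarithm of the Gaussian density, which is
integrable because the second moment is finite.\<close>

lemma entropy_functional_gaussian_density:
  fixes f :: "'a::euclidean_space \<Rightarrow> real"
  assumes f [measurable]: "f \<in> borel_measurable borel" and nonneg: "\<And>x. 0 \<le> f x" and s: "0 < s"
    and P2: "density (gaussian s) (\<lambda>x. ennreal (f x)) \<in> P2"
  defines "\<mu> \<equiv> density (gaussian s) (\<lambda>x. ennreal (f x))"
  shows "entropy_functional \<mu> = enn2ereal (\<integral>\<^sup>+x. ennreal (entropy_gap (f x) 1) \<partial>gaussian s)
    + ereal (ln ((1 / sqrt (2 * pi * s)) ^ DIM('a)) - (\<integral>x. (norm x)\<^sup>2 \<partial>\<mu>) / (2 * s))"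
proof -
  let ?\<gamma> = "gaussian s :: 'a measure"
  define c where "c = (1 / sqrt (2 * pi * s)) ^ DIM('a)"
  have c: "0 < c" using s by (simp add: c_def)
  interpret \<gamma>: prob_space ?\<gamma> by (rule prob_space_gaussian[OF s])
  have \<mu>: "prob_space \<mu>" "sets \<mu> = sets borel" "integrable \<mu> (\<lambda>x. (norm x)\<^sup>2)"
    using P2 unfolding \<mu>_def by (auto simp: P2_def)
  interpret \<mu>: prob_space \<mu> by fact
  note [measurable_cong] = \<mu>(2)
  have \<mu>_lborel: "\<mu> = density lborel (\<lambda>x. ennreal (gauss s x * f x))"
    unfolding \<mu>_def gaussian_def by (subst density_density_eq) (auto simp: ennreal_mult')
  have AE_\<mu>: "(AE x in \<mu>. Q x)" if "AE x in lborel. 0 < f x \<longrightarrow> Q x" for Q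
    unfolding \<mu>_lborel using that
    by (subst AE_density) (auto elim!: eventually_mono dest: zero_less_mult_pos[OF _ gauss_pos[OF s]])
  have "AE x in lborel. ennreal (gauss s x * f x) = RN_deriv lborel \<mu> x"
    by (rule sigma_finite_measure.RN_deriv_unique[OF sigma_finite_lborel]) (auto simp: \<mu>_lborel)
  then have "AE x in lborel. gauss s x * f x = enn2real (RN_deriv lborel \<mu> x)"
    by (auto elim!: eventually_mono simp: nonneg dest: arg_cong[of _ _ enn2real])
  then have "AE x in lborel. 0 < f x \<longrightarrow> ln (enn2real (RN_deriv lborel \<mu> x)) = ln (f x) + (ln c - (norm x)\<^sup>2 / (2 * s))"
  proof eventually_elim
    case (elim x)
    show ?case
    proof
      assume fx: "0 < f x"
      have "ln (gauss s x * f x) = ln (gauss s x) + ln (f x)" using gauss_pos[OF s, of x] fx by (intro ln_mult_pos)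
      also have "ln (gauss s x) = ln c + - (norm x)\<^sup>2 / (2 * s)"
        using c by (simp add: gauss_eq[OF s] c_def[symmetric] ln_mult_pos)
      finally show "ln (enn2real (RN_deriv lborel \<mu> x)) = ln (f x) + (ln c - (norm x)\<^sup>2 / (2 * s))"
        using elim by simp
    qed
  qed
  then have ae: "AE x in \<mu>. ln (enn2real (RN_deriv lborel \<mu> x)) = ln (f x) + (ln c - (norm x)\<^sup>2 / (2 * s))"
    by (rule AE_\<mu>)
  have "entropy_functional \<mu> = ext_integral \<mu> (\<lambda>x. ln (f x) + (ln c - (norm x)\<^sup>2 / (2 * s)))"
    unfolding entropy_functional_def relative_entropy_def ext_integral_def
    by (intro arg_cong2[of _ _ _ _ minus] arg_cong[of _ _ enn2ereal] nn_integral_cong_AE) (use ae in \<open>auto elim!: eventually_mono\<close>)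
  also have "\<dots> = ext_integral \<mu> (\<lambda>x. ln (f x)) + ereal (\<integral>x. ln c - (norm x)\<^sup>2 / (2 * s) \<partial>\<mu>)"
  proof (rule ext_integral_add_integrable)
    have "(\<integral>\<^sup>+x. ennreal (- ln (f x)) \<partial>\<mu>) = (\<integral>\<^sup>+x. ennreal (f x) * ennreal (- ln (f x)) \<partial>?\<gamma>)"
      unfolding \<mu>_def by (subst nn_integral_density) auto
    also have "\<dots> \<le> 1" by (rule nn_integral_neg_ln_density_le_1[OF \<gamma>.prob_space_axioms nonneg])
    finally show "(\<integral>\<^sup>+x. ennreal (- ln (f x)) \<partial>\<mu>) < \<infinity>"
      by (auto intro: le_less_trans[OF _ ennreal_one_less_top])
  qed (use \<mu>(3) in auto)
  also have "ext_integral \<mu> (\<lambda>x. ln (f x)) = enn2ereal (\<integral>\<^sup>+x. ennreal (entropy_gap (f x) 1) \<partial>?\<gamma>)"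
    using ext_integral_ln_density[OF _ nonneg \<gamma>.prob_space_axioms] \<mu>(1) unfolding \<mu>_def by simp
  also have "(\<integral>x. ln c - (norm x)\<^sup>2 / (2 * s) \<partial>\<mu>) = ln c - (\<integral>x. (norm x)\<^sup>2 \<partial>\<mu>) / (2 * s)"
    using \<mu>(3) by (simp add: \<mu>.prob_space)
  finally show ?thesis by (simp add: c_def)
qed

text \<open>This is \<open>ln u \<le> u - 1\<close> for \<open>u = sqrt (m / t)\<close>.\<close>

lemma entropy_gap_ge_hellinger:
  assumes "0 \<le> t" "0 < m" shows "(sqrt t - sqrt m)\<^sup>2 \<le> entropy_gap t m"
proof (cases "t = 0")
  case True
  then show ?thesis using assms by (simp add: entropy_gap_def)
next
  case False
  then have t: "0 < t" using assms by simp
  define u where "u = sqrt m / sqrt t"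
  have u: "0 < u" using t assms by (simp add: u_def)
  have "ln u \<le> u - 1" using u by (rule ln_le_minus_one)
  moreover have "ln u = (ln m - ln t) / 2" using t assms by (simp add: u_def ln_div ln_sqrt)
  ultimately have "t * (ln m - ln t) \<le> t * (2 * (u - 1))" using t by (intro mult_left_mono) auto
  moreover have "t * u = sqrt t * sqrt m"
  proof -
    define w where "w = sqrt t"
    have w: "0 < w" "t = w * w" using t by (simp_all add: w_def)
    show ?thesis unfolding u_def w_def[symmetric] w(2) using w(1) by simp
  qed
  moreover have "(sqrt t - sqrt m)\<^sup>2 = t + m - 2 * (sqrt t * sqrt m)" using t assms by (simp add: power2_diff)
  ultimately show ?thesis by (simp add: entropy_gap_def algebra_simps)
qed

text \<open>Uniform convexity. With \<open>m = (a + b) / 2\<close>, the sum of the values at \<open>a\<close> and \<open>b\<close> exceeds twice the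
value at \<open>m\<close> by \<open>entropy_gap a m + entropy_gap b m\<close>, which bounds Hellinger distances.\<close>

lemma entropy_gap_midpoint:
  assumes "0 \<le> a" "0 \<le> b"
  shows "entropy_gap ((a + b) / 2) 1 + (sqrt a - sqrt b)\<^sup>2 / 4 \<le> (entropy_gap a 1 + entropy_gap b 1) / 2"
proof (cases "a + b = 0")
  case True
  then have "a = 0" "b = 0" using assms by auto
  then show ?thesis by (simp add: entropy_gap_def)
next
  case False
  define m where "m = (a + b) / 2"
  have m: "0 < m" using False assms by (simp add: m_def)
  have 1: "(sqrt a - sqrt m)\<^sup>2 \<le> entropy_gap a m" "(sqrt b - sqrt m)\<^sup>2 \<le> entropy_gap b m"
    using assms m by (auto intro: entropy_gap_ge_hellinger)
  have ab: "a + b = 2 * m" by (simp add: m_def)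
  have b: "b = 2 * m - a" using ab by simp
  have 2: "entropy_gap a m + entropy_gap b m = entropy_gap a 1 + entropy_gap b 1 - 2 * entropy_gap m 1"
    unfolding entropy_gap_def b by (simp add: algebra_simps)
  have "(sqrt a - sqrt b)\<^sup>2 \<le> 2 * (sqrt a - sqrt m)\<^sup>2 + 2 * (sqrt b - sqrt m)\<^sup>2"
  proof -
    have "(x - y)\<^sup>2 \<le> 2 * (x - z)\<^sup>2 + 2 * (y - z)\<^sup>2" for x y z :: real
      using zero_le_power2[of "x + y - 2 * z"] by (simp add: power2_eq_square algebra_simps)
    then show ?thesis .
  qed
  moreover have "r + d / 4 \<le> (p + q) / 2"
    if "d \<le> 2 * x + 2 * y" "x \<le> x'" "y \<le> y'" "x' + y' = p + q - 2 * r" for d p q r x y x' y' :: real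
    using that by (simp add: field_simps)
  ultimately show ?thesis using 1 2 unfolding m_def[symmetric] by blast
qed

section \<open>Existence of a minimiser of the free energy\<close>

context mean_field_risk
begin

lemma fit_nonneg: "0 \<le> fit \<mu>"
  unfolding fit_def by (intro Bochner_Integration.integral_nonneg loss_nonneg[OF loss])

lemma nn_integral_fit:
  assumes "\<mu> \<in> P2" shows "(\<integral>\<^sup>+p. ennreal (loss (snd p) (predict \<mu> (fst p))) \<partial>D) = ennreal (fit \<mu>)"
  unfolding fit_def using risk_finite'[OF assms] by (intro nn_integral_eq_integral) (auto simp: loss_nonneg[OF loss])

context
  fixes \<tau> :: real
  assumes \<tau>: "0 < \<tau>"
begin

text \<open>The reference measure absorbs the quadratic penalty and the entropy: \<open>\<tau> ln\<close> of its density is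
\<open>- lam / 2 * |x|\<^sup>2\<close> up to a constant.\<close>

definition ref_gaussian :: "'a measure" where "ref_gaussian = gaussian (\<tau> / lam)"

definition ref_measure :: "('a \<Rightarrow> real) \<Rightarrow> 'a measure" where
  "ref_measure f = density ref_gaussian (\<lambda>x. ennreal (f x))"

definition ref_entropy :: "('a \<Rightarrow> real) \<Rightarrow> ennreal" where
  "ref_entropy f = (\<integral>\<^sup>+x. ennreal (entropy_gap (f x) 1) \<partial>ref_gaussian)"

definition admissible :: "('a \<Rightarrow> real) \<Rightarrow> bool" where
  "admissible f \<longleftrightarrow> f \<in> borel_measurable borel \<and> (\<forall>x. 0 \<le> f x) \<and> ref_measure f \<in> P2"

text \<open>The free energy up to an additive constant, see \<open>free_energy_ref_measure\<close>. It takes values in the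
extended nonnegative numbers, so infinite entropy needs no special treatment.\<close>

definition ref_energy :: "('a \<Rightarrow> real) \<Rightarrow> ennreal" where
  "ref_energy f = ennreal (fit (ref_measure f)) + ennreal \<tau> * ref_entropy f"

lemma s_pos: "0 < \<tau> / lam" using \<tau> lam_pos by simp

lemma prob_space_ref: "prob_space ref_gaussian"
  unfolding ref_gaussian_def by (rule prob_space_gaussian[OF s_pos])

lemma sets_ref [simp, measurable_cong]: "sets ref_gaussian = sets borel"
  by (simp add: ref_gaussian_def)

lemma space_ref [simp]: "space ref_gaussian = UNIV" by (simp add: ref_gaussian_def)

lemma sets_ref_measure [simp, measurable_cong]: "sets (ref_measure f) = sets borel"
  by (simp add: ref_measure_def)

lemma free_energy_ref_measure:
  assumes "admissible f"
  shows "free_energy \<tau> (risk D loss lam \<Phi>) (ref_measure f)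
    = enn2ereal (ref_energy f) + ereal (\<tau> * ln ((1 / sqrt (2 * pi * (\<tau> / lam))) ^ DIM('a)))"
proof -
  have f: "f \<in> borel_measurable borel" "\<And>x. 0 \<le> f x" "density (gaussian (\<tau> / lam)) (\<lambda>x. ennreal (f x)) \<in> P2"
    using assms by (auto simp: admissible_def ref_measure_def ref_gaussian_def)
  define c where "c = ln ((1 / sqrt (2 * pi * (\<tau> / lam))) ^ DIM('a))"
  define q where "q = (\<integral>x. (norm x)\<^sup>2 \<partial>ref_measure f)"
  have H: "entropy_functional (ref_measure f) = enn2ereal (ref_entropy f) + ereal (c - q / (2 * (\<tau> / lam)))"
    using entropy_functional_gaussian_density[OF f(1,2) s_pos f(3)]
    by (simp add: ref_measure_def ref_gaussian_def ref_entropy_def c_def q_def)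
  have E: "enn2ereal (ref_energy f) = ereal (fit (ref_measure f)) + ereal \<tau> * enn2ereal (ref_entropy f)"
    using \<tau> fit_nonneg by (simp add: ref_energy_def plus_ennreal.rep_eq times_ennreal.rep_eq)
  show ?thesis
  proof (cases "ref_entropy f")
    case (real x)
    have "\<tau> * (q / (2 * (\<tau> / lam))) = lam / 2 * q" using \<tau> lam_pos by simp
    then have "fit (ref_measure f) + lam / 2 * q + \<tau> * (x + (c - q / (2 * (\<tau> / lam)))) = fit (ref_measure f) + \<tau> * x + \<tau> * c"
      by (simp add: algebra_simps)
    then show ?thesis unfolding free_energy_def H E risk_eq_fit q_def[symmetric] c_def[symmetric]
      using real by simp
  next
    case top
    then show ?thesis unfolding free_energy_def H E risk_eq_fit using \<tau> by simp
  qed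
qed

lemma admissible_1: "admissible (\<lambda>_. 1)"
proof -
  have "integrable ref_gaussian (\<lambda>x::'a. (norm x)\<^sup>2)"
    using integrable_gaussian_norm_square[OF s_pos] by (simp add: ref_gaussian_def)
  then show ?thesis
    using prob_space_ref by (simp add: admissible_def ref_measure_def density_1 P2_def)
qed

lemma admissible_nn_integral:
  assumes "admissible f" shows "(\<integral>\<^sup>+x. ennreal (f x) \<partial>ref_gaussian) = 1" "integrable ref_gaussian f"
    "(\<integral>x. f x \<partial>ref_gaussian) = 1"
proof -
  have [measurable]: "f \<in> borel_measurable borel" and nonneg: "\<And>x. 0 \<le> f x" and p: "prob_space (ref_measure f)"
    using assms by (auto simp: admissible_def P2_def)
  show 1: "(\<integral>\<^sup>+x. ennreal (f x) \<partial>ref_gaussian) = 1"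
    using prob_space.emeasure_space_1[OF p] by (simp add: ref_measure_def emeasure_density cong: nn_integral_cong)
  then show i: "integrable ref_gaussian f" using nonneg by (intro integrableI_nonneg) auto
  show "(\<integral>x. f x \<partial>ref_gaussian) = 1"
    using nn_integral_eq_integral[OF i] nonneg 1 by (simp add: Bochner_Integration.integral_nonneg)
qed

text \<open>Young's inequality \<open>f * a \<le> (f ln f - f + 1) + exp a\<close> with a small multiple \<open>a\<close> of \<open>|x|\<^sup>2\<close>: a finite
entropy relative to a Gaussian measure implies a finite second moment.\<close>

lemma admissibleI:
  assumes [measurable]: "f \<in> borel_measurable borel" and nonneg: "\<And>x. 0 \<le> f x"
    and one: "(\<integral>\<^sup>+x. ennreal (f x) \<partial>ref_gaussian) = 1" and fin: "ref_entropy f < \<infinity>"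
  shows "admissible f"
proof -
  \<comment> \<open>Half of the critical factor \<open>lam / (2 * \<tau>)\<close>, so that \<open>exp (a x)\<close> is integrable.\<close>
  define a where "a x = lam / (4 * \<tau>) * (norm x)\<^sup>2" for x :: 'a
  have a_meas [measurable]: "a \<in> borel_measurable borel" unfolding a_def[abs_def] by measurable
  have a_nonneg: "0 \<le> a x" for x using lam_pos \<tau> by (simp add: a_def)
  have "lam / (4 * \<tau>) < 1 / (2 * (\<tau> / lam))" using lam_pos \<tau> by (simp add: field_simps)
  then have exp_int: "integrable ref_gaussian (\<lambda>x. exp (a x))"
    unfolding a_def ref_gaussian_def by (rule integrable_gaussian_exp_square[OF s_pos])
  have "(\<integral>\<^sup>+x. ennreal (f x) * ennreal (a x) \<partial>ref_gaussian) \<le> (\<integral>\<^sup>+x. ennreal (entropy_gap (f x) 1) + ennreal (exp (a x)) \<partial>ref_gaussian)"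
  proof (rule nn_integral_mono)
    fix x
    have g: "0 \<le> entropy_gap (f x) (exp (a x))" "0 \<le> entropy_gap (f x) 1" using nonneg by (auto intro: entropy_gap_nonneg)
    have "f x * a x \<le> entropy_gap (f x) 1 + exp (a x)" using g(1) by (simp add: entropy_gap_def)
    then show "ennreal (f x) * ennreal (a x) \<le> ennreal (entropy_gap (f x) 1) + ennreal (exp (a x))"
      using g(2) nonneg a_nonneg by (simp add: ennreal_mult'[symmetric] ennreal_plus[symmetric] ennreal_leI del: ennreal_plus)
  qed
  also have "\<dots> = ref_entropy f + (\<integral>\<^sup>+x. ennreal (exp (a x)) \<partial>ref_gaussian)"
    unfolding ref_entropy_def by (rule nn_integral_add) auto
  also have "\<dots> < \<infinity>" using fin exp_int by (simp add: nn_integral_eq_integral)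
  finally have "(\<integral>\<^sup>+x. ennreal (a x) \<partial>ref_measure f) < \<infinity>"
    unfolding ref_measure_def by (subst nn_integral_density) auto
  then have "integrable (ref_measure f) a" using a_nonneg by (intro integrableI_nonneg) auto
  from integrable_mult_right[OF this, of "4 * \<tau> / lam"]
  have "integrable (ref_measure f) (\<lambda>x. (norm x)\<^sup>2)" using lam_pos \<tau> by (simp add: a_def)
  moreover have "prob_space (ref_measure f)"
    by standard (use one in \<open>simp add: ref_measure_def emeasure_density cong: nn_integral_cong\<close>)
  ultimately show ?thesis using nonneg by (simp add: admissible_def P2_def)
qed

lemma predict_ref_measure:
  assumes "admissible f" shows "predict (ref_measure f) z = (\<integral>x. \<Phi> z x * f x \<partial>ref_gaussian)"
proof -
  have [measurable]: "f \<in> borel_measurable borel" and nonneg: "\<And>x. 0 \<le> f x" using assms by (auto simp: admissible_def)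
  show ?thesis unfolding predict_def ref_measure_def
    by (subst integral_density) (auto simp: nonneg mult.commute)
qed

text \<open>The average of two densities is the density of a convex combination of measures, on which the
expected loss is convex and the entropy uniformly convex.\<close>

lemma ref_energy_midpoint:
  assumes f: "admissible f" and g: "admissible g" and fin: "ref_energy f < \<infinity>" "ref_energy g < \<infinity>"
  shows "admissible (\<lambda>x. (f x + g x) / 2)"
    "2 * ref_energy (\<lambda>x. (f x + g x) / 2) + ennreal (\<tau> / 2) * (\<integral>\<^sup>+x. ennreal ((sqrt (f x) - sqrt (g x))\<^sup>2) \<partial>ref_gaussian) \<le> ref_energy f + ref_energy g"
proof -
  have m [measurable]: "f \<in> borel_measurable borel" "g \<in> borel_measurable borel" and nonneg: "\<And>x. 0 \<le> f x" "\<And>x. 0 \<le> g x"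
    and P2: "ref_measure f \<in> P2" "ref_measure g \<in> P2"
    using f g by (auto simp: admissible_def)
  define h where "h x = (f x + g x) / 2" for x
  have [measurable]: "h \<in> borel_measurable borel" unfolding h_def[abs_def] by measurable
  have half_sum: "ennreal (h x) = ennreal (1/2) * ennreal (f x) + ennreal (1/2) * ennreal (g x)" for x
  proof -
    have "ennreal (h x) = ennreal (1/2 * f x + 1/2 * g x)" by (simp add: h_def add_divide_distrib)
    also have "\<dots> = ennreal (1/2 * f x) + ennreal (1/2 * g x)" using nonneg by (intro ennreal_plus) auto
    also have "\<dots> = ennreal (1/2) * ennreal (f x) + ennreal (1/2) * ennreal (g x)"
      by (subst (1 2) ennreal_mult') auto
    finally show ?thesis .
  qed
  have comb: "ref_measure h = lin_comb (1/2) (ref_measure f) (1 - 1/2) (ref_measure g)"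
  proof (rule measure_eqI)
    fix A assume "A \<in> sets (ref_measure h)"
    then have [measurable]: "A \<in> sets borel" by simp
    have "emeasure (ref_measure h) A = (\<integral>\<^sup>+x. ennreal (1/2) * (ennreal (f x) * indicator A x) + ennreal (1/2) * (ennreal (g x) * indicator A x) \<partial>ref_gaussian)"
      unfolding ref_measure_def
      by (subst emeasure_density) (simp_all only: half_sum distrib_right mult.assoc, measurable)
    also have "\<dots> = emeasure (lin_comb (1/2) (ref_measure f) (1 - 1/2) (ref_measure g)) A"
      by (simp add: emeasure_lin_comb nn_integral_add nn_integral_cmult ref_measure_def emeasure_density)
    finally show "emeasure (ref_measure h) A = emeasure (lin_comb (1/2) (ref_measure f) (1 - 1/2) (ref_measure g)) A" .
  qed simp
  have adm: "admissible h"
    unfolding admissible_def comb using nonneg P2 by (auto simp: h_def intro!: lin_comb_P2)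
  then show "admissible (\<lambda>x. (f x + g x) / 2)" by (simp add: h_def[abs_def])
  have "fit (ref_measure h) \<le> 1/2 * fit (ref_measure f) + (1 - 1/2) * fit (ref_measure g)"
    unfolding comb by (rule fit_convex[OF P2]) auto
  then have fit: "2 * ennreal (fit (ref_measure h)) \<le> ennreal (fit (ref_measure f)) + ennreal (fit (ref_measure g))"
    using fit_nonneg by (simp add: ennreal_plus[symmetric] ennreal_numeral[symmetric] ennreal_mult'[symmetric] ennreal_leI del: ennreal_plus ennreal_numeral)
  have "2 * ref_entropy h + ennreal (1/2) * (\<integral>\<^sup>+x. ennreal ((sqrt (f x) - sqrt (g x))\<^sup>2) \<partial>ref_gaussian)
    = (\<integral>\<^sup>+x. 2 * ennreal (entropy_gap (h x) 1) + ennreal (1/2) * ennreal ((sqrt (f x) - sqrt (g x))\<^sup>2) \<partial>ref_gaussian)"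
    unfolding ref_entropy_def by (simp add: nn_integral_add nn_integral_cmult)
  also have "\<dots> \<le> (\<integral>\<^sup>+x. ennreal (entropy_gap (f x) 1) + ennreal (entropy_gap (g x) 1) \<partial>ref_gaussian)"
  proof (rule nn_integral_mono)
    fix x
    have "0 \<le> entropy_gap (f x) 1" "0 \<le> entropy_gap (g x) 1" "0 \<le> entropy_gap (h x) 1"
      using nonneg by (auto intro!: entropy_gap_nonneg simp: h_def)
    moreover have "2 * entropy_gap (h x) 1 + 1/2 * (sqrt (f x) - sqrt (g x))\<^sup>2 \<le> entropy_gap (f x) 1 + entropy_gap (g x) 1"
      using entropy_gap_midpoint[OF nonneg(1)[of x] nonneg(2)[of x]] by (simp add: h_def)
    moreover have "ennreal (1/2) * ennreal ((sqrt (f x) - sqrt (g x))\<^sup>2) = ennreal ((sqrt (f x) - sqrt (g x))\<^sup>2 / 2)"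
      by (subst ennreal_mult'[symmetric]) auto
    ultimately show "2 * ennreal (entropy_gap (h x) 1) + ennreal (1/2) * ennreal ((sqrt (f x) - sqrt (g x))\<^sup>2)
      \<le> ennreal (entropy_gap (f x) 1) + ennreal (entropy_gap (g x) 1)"
      by (simp add: ennreal_plus[symmetric] ennreal_numeral[symmetric] ennreal_mult'[symmetric] ennreal_leI del: ennreal_plus ennreal_numeral)
  qed
  also have "\<dots> = ref_entropy f + ref_entropy g"
    unfolding ref_entropy_def by (rule nn_integral_add) auto
  finally have ent: "2 * ref_entropy h + ennreal (1/2) * (\<integral>\<^sup>+x. ennreal ((sqrt (f x) - sqrt (g x))\<^sup>2) \<partial>ref_gaussian) \<le> ref_entropy f + ref_entropy g" .
  have half: "ennreal (\<tau> / 2) = ennreal \<tau> * ennreal (1/2)"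
  proof -
    have "\<tau> / 2 = \<tau> * (1/2)" by simp
    then show ?thesis using \<tau> by (simp only: ennreal_mult' less_imp_le)
  qed
  have "2 * ref_energy h + ennreal (\<tau> / 2) * (\<integral>\<^sup>+x. ennreal ((sqrt (f x) - sqrt (g x))\<^sup>2) \<partial>ref_gaussian)
     = 2 * ennreal (fit (ref_measure h)) + ennreal \<tau> * (2 * ref_entropy h + ennreal (1/2) * (\<integral>\<^sup>+x. ennreal ((sqrt (f x) - sqrt (g x))\<^sup>2) \<partial>ref_gaussian))"
    unfolding ref_energy_def half by (simp add: distrib_left ac_simps)
  also have "\<dots> \<le> (ennreal (fit (ref_measure f)) + ennreal (fit (ref_measure g))) + ennreal \<tau> * (ref_entropy f + ref_entropy g)"
    by (intro add_mono fit mult_left_mono ent) auto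
  also have "\<dots> = ref_energy f + ref_energy g" unfolding ref_energy_def by (simp add: distrib_left ac_simps)
  finally show "2 * ref_energy (\<lambda>x. (f x + g x) / 2) + ennreal (\<tau> / 2) * (\<integral>\<^sup>+x. ennreal ((sqrt (f x) - sqrt (g x))\<^sup>2) \<partial>ref_gaussian) \<le> ref_energy f + ref_energy g"
    by (simp add: h_def[abs_def])
qed

text \<open>Young's inequality with parameter \<open>t\<close> for \<open>|f - g| = |sqrt f - sqrt g| * (sqrt f + sqrt g)\<close>, where the
second factor has a squared integral of at most 4.\<close>

lemma integral_abs_diff_le_hellinger:
  assumes f: "admissible f" and g: "admissible g" and t: "0 < t"
    and H: "(\<integral>\<^sup>+x. ennreal ((sqrt (f x) - sqrt (g x))\<^sup>2) \<partial>ref_gaussian) \<le> ennreal \<eta>" and \<eta>: "0 \<le> \<eta>"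
  shows "(\<integral>x. \<bar>f x - g x\<bar> \<partial>ref_gaussian) \<le> t / 2 * \<eta> + 2 / t"
proof -
  have [measurable]: "f \<in> borel_measurable borel" "g \<in> borel_measurable borel" and nonneg: "\<And>x. 0 \<le> f x" "\<And>x. 0 \<le> g x"
    using f g by (auto simp: admissible_def)
  note i = admissible_nn_integral[OF f] admissible_nn_integral[OF g]
  have Hi: "integrable ref_gaussian (\<lambda>x. (sqrt (f x) - sqrt (g x))\<^sup>2)"
    using H by (intro integrableI_nonneg) (auto intro: le_less_trans)
  have "ennreal (\<integral>x. (sqrt (f x) - sqrt (g x))\<^sup>2 \<partial>ref_gaussian) \<le> ennreal \<eta>"
    using H Hi by (simp add: nn_integral_eq_integral)
  then have H': "(\<integral>x. (sqrt (f x) - sqrt (g x))\<^sup>2 \<partial>ref_gaussian) \<le> \<eta>" using \<eta> by simp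
  have "(\<integral>x. \<bar>f x - g x\<bar> \<partial>ref_gaussian) \<le> (\<integral>x. t / 2 * (sqrt (f x) - sqrt (g x))\<^sup>2 + 1 / t * (f x + g x) \<partial>ref_gaussian)"
  proof (rule integral_mono)
    fix x
    define a b where "a = sqrt (f x)" and "b = sqrt (g x)"
    have ab: "0 \<le> a" "0 \<le> b" "f x = a\<^sup>2" "g x = b\<^sup>2" using nonneg by (auto simp: a_def b_def)
    have "\<bar>f x - g x\<bar> = \<bar>a - b\<bar> * (a + b)"
    proof -
      have "a\<^sup>2 - b\<^sup>2 = (a - b) * (a + b)" by (simp add: power2_eq_square algebra_simps)
      then show ?thesis using ab by (simp add: abs_mult)
    qed
    also have "\<dots> \<le> t / 2 * \<bar>a - b\<bar>\<^sup>2 + 1 / (2 * t) * (a + b)\<^sup>2"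
    proof -
      have "0 \<le> (sqrt t * \<bar>a - b\<bar> - (a + b) / sqrt t)\<^sup>2" by simp
      also have "\<dots> = t * \<bar>a - b\<bar>\<^sup>2 - 2 * (\<bar>a - b\<bar> * (a + b)) + (a + b)\<^sup>2 / t"
        using t by (simp add: power2_diff power_mult_distrib power_divide)
      finally show ?thesis by simp
    qed
    also have "1 / (2 * t) * (a + b)\<^sup>2 \<le> 1 / (2 * t) * (2 * (f x + g x))"
    proof (rule mult_left_mono)
      show "(a + b)\<^sup>2 \<le> 2 * (f x + g x)"
        using zero_le_power2[of "a - b"] unfolding ab by (simp add: power2_diff power2_sum)
    qed (use t in simp)
    also have "1 / (2 * t) * (2 * (f x + g x)) = 1 / t * (f x + g x)" using t by (simp add: field_simps)
    finally show "\<bar>f x - g x\<bar> \<le> t / 2 * (sqrt (f x) - sqrt (g x))\<^sup>2 + 1 / t * (f x + g x)"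
      using t by (simp add: a_def b_def)
  qed (use i Hi in auto)
  also have "\<dots> = t / 2 * (\<integral>x. (sqrt (f x) - sqrt (g x))\<^sup>2 \<partial>ref_gaussian) + 2 / t"
    using i Hi by simp
  also have "\<dots> \<le> t / 2 * \<eta> + 2 / t" using H' t by simp
  finally show ?thesis .
qed

text \<open>By uniform convexity, applied to the average of two members, a minimising sequence is Cauchy for the
Hellinger distance and hence in \<open>L\<^sup>1\<close>. Its limit \<open>f\<close> has mass one, and predictions converge because
\<open>\<Phi>\<close> is bounded. Fatou's lemma bounds the entropy of \<open>f\<close> and, a second time, its expected loss.\<close>

theorem ref_energy_minimizer:
  "\<exists>f. admissible f \<and> (\<forall>g. admissible g \<longrightarrow> ref_energy f \<le> ref_energy g)"
proof -
  interpret R: prob_space ref_gaussian by (rule prob_space_ref)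
  define j where "j = (INF f \<in> {f. admissible f}. ref_energy f)"
  have j_le: "j \<le> ref_energy f" if "admissible f" for f unfolding j_def using that by (intro INF_lower) auto
  have "ref_energy (\<lambda>_. 1) < \<infinity>"
    by (simp add: ref_energy_def ref_entropy_def entropy_gap_def)
  then have "j < \<infinity>" using j_le[OF admissible_1] by (rule le_less_trans[rotated])
  then obtain jr where jr: "j = ennreal jr" "0 \<le> jr" by (cases j) auto
  have "\<exists>f. admissible f \<and> ref_energy f < ennreal (jr + 1 / real (Suc n))" for n
  proof -
    have "j < ennreal (jr + 1 / real (Suc n))" unfolding jr using jr(2) by (intro ennreal_lessI) (auto simp: add_nonneg_pos)
    then show ?thesis unfolding j_def by (auto simp: INF_less_iff)
  qed
  then obtain u where u: "\<And>n. admissible (u n)" "\<And>n. ref_energy (u n) < ennreal (jr + 1 / real (Suc n))" by metis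
  have u_meas [measurable]: "u n \<in> borel_measurable borel" and u_nonneg: "0 \<le> u n x" and u_P2: "ref_measure (u n) \<in> P2" for n x
    using u(1)[of n] by (auto simp: admissible_def)
  note u_int = admissible_nn_integral[OF u(1)]
  \<comment> \<open>The energy of the average of \<open>u n\<close> and \<open>u m\<close> is at least \<open>j\<close>, while their own energies exceed \<open>j\<close> by at most \<open>1 / Suc N\<close>.\<close>
  have hell: "(\<integral>\<^sup>+x. ennreal ((sqrt (u n x) - sqrt (u m x))\<^sup>2) \<partial>ref_gaussian) \<le> ennreal (4 / (\<tau> * real (Suc N)))"
    if "N \<le> n" "N \<le> m" for n m N
  proof -
    define X where "X = (\<integral>\<^sup>+x. ennreal ((sqrt (u n x) - sqrt (u m x))\<^sup>2) \<partial>ref_gaussian)"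
    have fin: "ref_energy (u k) < \<infinity>" for k using u(2)[of k] by (rule less_trans) simp
    note mid = ref_energy_midpoint[OF u(1) u(1) fin fin, of n m]
    have up: "ref_energy (u k) \<le> ennreal (jr + 1 / real (Suc N))" if "N \<le> k" for k
      by (rule order_trans[OF less_imp_le[OF u(2)]]) (use that in \<open>auto intro!: ennreal_leI divide_left_mono\<close>)
    have "2 * j + ennreal (\<tau> / 2) * X \<le> 2 * ref_energy (\<lambda>x. (u n x + u m x) / 2) + ennreal (\<tau> / 2) * X"
      by (intro add_right_mono mult_left_mono j_le mid(1)) simp
    also have "\<dots> \<le> ref_energy (u n) + ref_energy (u m)" using mid(2) by (simp add: X_def)
    also have "\<dots> \<le> ennreal (jr + 1 / real (Suc N)) + ennreal (jr + 1 / real (Suc N))" using that by (intro add_mono up)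
    also have "\<dots> = 2 * j + ennreal (2 / real (Suc N))"
      unfolding jr using jr(2)
      by (simp add: ennreal_plus[symmetric] ennreal_numeral[symmetric] ennreal_mult'[symmetric] del: ennreal_plus ennreal_numeral)
    finally have "ennreal (\<tau> / 2) * X \<le> ennreal (2 / real (Suc N))"
      using jr by (simp add: ennreal_add_left_cancel_le ennreal_mult_eq_top_iff)
    then have "ennreal (2 / \<tau>) * (ennreal (\<tau> / 2) * X) \<le> ennreal (2 / \<tau>) * ennreal (2 / real (Suc N))"
      by (rule mult_left_mono) simp
    then show ?thesis unfolding X_def[symmetric] using \<tau> by (simp add: mult.assoc[symmetric] ennreal_mult'[symmetric])
  qed
  have cauchy: "\<exists>N. \<forall>i\<ge>N. \<forall>k\<ge>N. (\<integral>x. norm (u i x - u k x) \<partial>ref_gaussian) < e" if e: "0 < e" for e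
  proof -
    \<comment> \<open>The parameter makes the mass term \<open>2 / t\<close> equal to \<open>e / 4\<close>; the Hellinger term is small for large \<open>N\<close>.\<close>
    define t where "t = 8 / e"
    have t: "0 < t" "2 / t = e / 4" using e by (auto simp: t_def)
    define A where "A = t / 2 * (4 / \<tau>)"
    obtain N where "A / (e / 4) < real N" using reals_Archimedean2 by blast
    then have "A / (e / 4) < real (Suc N)" by simp
    then have "A < real (Suc N) * (e / 4)" using e by (subst (asm) pos_divide_less_eq) auto
    then have "A / real (Suc N) < e / 4" by (subst pos_divide_less_eq) (auto simp: mult.commute)
    then have lt: "t / 2 * (4 / (\<tau> * real (Suc N))) < e / 4" by (simp add: A_def)
    show ?thesis
    proof (intro exI[of _ N] allI impI)
      fix i k assume "N \<le> i" "N \<le> k"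
      have "(\<integral>x. \<bar>u i x - u k x\<bar> \<partial>ref_gaussian) \<le> t / 2 * (4 / (\<tau> * real (Suc N))) + 2 / t"
        by (rule integral_abs_diff_le_hellinger[OF u(1) u(1) t(1) hell]) (use \<open>N \<le> i\<close> \<open>N \<le> k\<close> \<tau> in auto)
      then show "(\<integral>x. norm (u i x - u k x) \<partial>ref_gaussian) < e" using lt t e by simp
    qed
  qed
  obtain r where r: "strict_mono r" "AE x in ref_gaussian. Cauchy (\<lambda>i. u (r i) x)"
    using cauchy_L1_AE_cauchy_subseq[of ref_gaussian u] u_int(2) cauchy by blast
  \<comment> \<open>The maximum makes \<open>f\<close> nonnegative also on the null set where the subsequence does not converge.\<close>
  define f where "f x = max 0 (lim (\<lambda>i. u (r i) x))" for x
  have f_meas [measurable]: "f \<in> borel_measurable borel"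
    unfolding f_def[abs_def] by (intro borel_measurable_max borel_measurable_const borel_measurable_lim_metric) measurable
  have f_nonneg: "0 \<le> f x" for x by (simp add: f_def)
  have ae_lim: "AE x in ref_gaussian. (\<lambda>i. u (r i) x) \<longlonglongrightarrow> f x"
    using r(2)
  proof eventually_elim
    case (elim x)
    then have l: "(\<lambda>i. u (r i) x) \<longlonglongrightarrow> lim (\<lambda>i. u (r i) x)" by (simp add: Cauchy_convergent_iff convergent_LIMSEQ_iff)
    then have "0 \<le> lim (\<lambda>i. u (r i) x)" by (rule LIMSEQ_le_const) (use u_nonneg in auto)
    then show ?case using l by (simp add: f_def)
  qed
  have r_ge: "i \<le> r i" for i using r(1) by (rule seq_suble)
  have l1: "\<exists>N. \<forall>i\<ge>N. (\<integral>\<^sup>+x. ennreal \<bar>u (r i) x - f x\<bar> \<partial>ref_gaussian) \<le> ennreal e" if e: "0 < e" for e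
  proof -
    obtain N where N: "\<And>i k. N \<le> i \<Longrightarrow> N \<le> k \<Longrightarrow> (\<integral>x. norm (u i x - u k x) \<partial>ref_gaussian) < e" using cauchy[OF e] by blast
    show ?thesis
    proof (intro exI[of _ N] allI impI)
      fix i assume i: "N \<le> i"
      show "(\<integral>\<^sup>+x. ennreal \<bar>u (r i) x - f x\<bar> \<partial>ref_gaussian) \<le> ennreal e"
      proof (rule nn_integral_le_of_AE_tendsto[where u = "\<lambda>k x. ennreal \<bar>u (r i) x - u (r (k + N)) x\<bar>" and c = "\<lambda>_. ennreal e"])
        show "AE x in ref_gaussian. (\<lambda>k. ennreal \<bar>u (r i) x - u (r (k + N)) x\<bar>) \<longlonglongrightarrow> ennreal \<bar>u (r i) x - f x\<bar>"
          using ae_lim by eventually_elim (intro tendsto_ennrealI tendsto_intros LIMSEQ_ignore_initial_segment)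
        fix k
        have "(\<integral>\<^sup>+x. ennreal \<bar>u (r i) x - u (r (k + N)) x\<bar> \<partial>ref_gaussian) = ennreal (\<integral>x. \<bar>u (r i) x - u (r (k + N)) x\<bar> \<partial>ref_gaussian)"
          using u_int(2) by (intro nn_integral_eq_integral) auto
        also have "\<dots> \<le> ennreal e"
          using N[of "r i" "r (k + N)"] i r_ge[of i] r_ge[of "k + N"] by (intro ennreal_leI) auto
        finally show "(\<integral>\<^sup>+x. ennreal \<bar>u (r i) x - u (r (k + N)) x\<bar> \<partial>ref_gaussian) \<le> ennreal e" .
      qed auto
    qed
  qed
  have f_int: "integrable ref_gaussian f"
  proof -
    obtain N where "(\<integral>\<^sup>+x. ennreal \<bar>u (r N) x - f x\<bar> \<partial>ref_gaussian) \<le> ennreal 1" using l1[of 1] by auto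
    then have "integrable ref_gaussian (\<lambda>x. u (r N) x - f x)"
      by (intro integrableI_bounded) (auto intro: le_less_trans)
    then have "integrable ref_gaussian (\<lambda>x. u (r N) x - (u (r N) x - f x))" by (rule Bochner_Integration.integrable_diff[OF u_int(2)])
    then show ?thesis by simp
  qed
  have l1_real: "(\<lambda>i. \<integral>x. \<bar>u (r i) x - f x\<bar> \<partial>ref_gaussian) \<longlonglongrightarrow> 0"
  proof (rule LIMSEQ_I)
    fix e :: real assume "0 < e"
    then have e: "0 < e / 2" by simp
    obtain N where N: "\<And>i. N \<le> i \<Longrightarrow> (\<integral>\<^sup>+x. ennreal \<bar>u (r i) x - f x\<bar> \<partial>ref_gaussian) \<le> ennreal (e / 2)" using l1[OF e] by blast
    show "\<exists>N. \<forall>i\<ge>N. norm ((\<integral>x. \<bar>u (r i) x - f x\<bar> \<partial>ref_gaussian) - 0) < e"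
    proof (intro exI[of _ N] allI impI)
      fix i assume "N \<le> i"
      from N[OF this] have "ennreal (\<integral>x. \<bar>u (r i) x - f x\<bar> \<partial>ref_gaussian) \<le> ennreal (e / 2)"
        using u_int(2) f_int by (subst (asm) nn_integral_eq_integral) auto
      then have "(\<integral>x. \<bar>u (r i) x - f x\<bar> \<partial>ref_gaussian) \<le> e / 2" using e by (subst (asm) ennreal_le_iff) auto
      then show "norm ((\<integral>x. \<bar>u (r i) x - f x\<bar> \<partial>ref_gaussian) - 0) < e" using \<open>0 < e\<close> by simp
    qed
  qed
  have f_one: "(\<integral>\<^sup>+x. ennreal (f x) \<partial>ref_gaussian) = 1"
  proof -
    have "(\<lambda>i. (\<integral>x. f x \<partial>ref_gaussian) - 1) \<longlonglongrightarrow> 0"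
    proof (rule Lim_null_comparison[OF _ l1_real], intro always_eventually allI)
      fix i
      have "(\<integral>x. f x \<partial>ref_gaussian) - 1 = (\<integral>x. f x - u (r i) x \<partial>ref_gaussian)"
        using f_int u_int(2,3) by simp
      also have "norm \<dots> \<le> (\<integral>x. \<bar>u (r i) x - f x\<bar> \<partial>ref_gaussian)"
        using f_int u_int(2) by (intro norm_integral_le_integral) auto
      finally show "norm ((\<integral>x. f x \<partial>ref_gaussian) - 1) \<le> (\<integral>x. \<bar>u (r i) x - f x\<bar> \<partial>ref_gaussian)" .
    qed
    then have "(\<integral>x. f x \<partial>ref_gaussian) - 1 = 0" by (rule LIMSEQ_unique[OF tendsto_const])
    then show ?thesis using f_int f_nonneg by (simp add: nn_integral_eq_integral)
  qed
  \<comment> \<open>A further subsequence along which the entropies converge, so that one application of Fatou's lemma handles the sum of the loss and the entropy.\<close>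
  define y where "y i = ref_entropy (u (r i))" for i
  obtain q where q: "strict_mono (q :: nat \<Rightarrow> nat)" "(y \<circ> q) \<longlonglongrightarrow> liminf y" using liminf_subseq_lim by blast
  define \<xi> where "\<xi> = liminf y"
  have y_lim: "(\<lambda>i. y (q i)) \<longlonglongrightarrow> \<xi>" using q(2) by (simp add: comp_def \<xi>_def)
  have aq: "AE x in ref_gaussian. (\<lambda>i. u (r (q i)) x) \<longlonglongrightarrow> f x"
    using ae_lim by eventually_elim (use LIMSEQ_subseq_LIMSEQ[OF _ q(1)] in \<open>simp add: comp_def\<close>)
  have ent_f: "ref_entropy f \<le> \<xi>"
    unfolding ref_entropy_def
  proof (rule nn_integral_le_of_AE_tendsto[OF _ _ _ y_lim, where u = "\<lambda>i x. ennreal (entropy_gap (u (r (q i)) x) 1)"])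
    show "AE x in ref_gaussian. (\<lambda>i. ennreal (entropy_gap (u (r (q i)) x) 1)) \<longlonglongrightarrow> ennreal (entropy_gap (f x) 1)"
      using aq by eventually_elim (intro tendsto_ennrealI tendsto_entropy_gap, auto simp: u_nonneg f_nonneg)
  qed (auto simp: y_def ref_entropy_def)
  have en_le: "ref_energy (u (r (q i))) \<le> ennreal (jr + 1 / real (Suc i))" for i
  proof (rule order_trans[OF less_imp_le[OF u(2)]], rule ennreal_leI)
    have "i \<le> r (q i)" using r_ge[of "q i"] seq_suble[OF q(1), of i] by linarith
    then show "jr + 1 / real (Suc (r (q i))) \<le> jr + 1 / real (Suc i)" by (intro add_left_mono divide_left_mono) auto
  qed
  have c_lim: "(\<lambda>i. ennreal (jr + 1 / real (Suc i))) \<longlonglongrightarrow> ennreal (jr + 0)"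
    by (intro tendsto_ennrealI tendsto_add tendsto_const LIMSEQ_Suc[OF lim_const_over_n])
  have \<tau>y_lim: "(\<lambda>i. ennreal \<tau> * y (q i)) \<longlonglongrightarrow> ennreal \<tau> * \<xi>"
    using y_lim by (intro ennreal_tendsto_cmult) auto
  have "ennreal \<tau> * \<xi> \<le> ennreal (jr + 0)"
  proof (rule LIMSEQ_le[OF \<tau>y_lim c_lim], intro exI allI impI)
    fix i
    have "ennreal \<tau> * y (q i) \<le> ref_energy (u (r (q i)))" unfolding ref_energy_def y_def by simp
    then show "ennreal \<tau> * y (q i) \<le> ennreal (jr + 1 / real (Suc i))" using en_le[of i] by (rule order_trans)
  qed
  then have "\<xi> < \<infinity>" using \<tau> by (auto simp: less_top[symmetric] ennreal_mult_eq_top_iff top_unique)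
  then have "ref_entropy f < \<infinity>" using ent_f by (rule le_less_trans[rotated])
  then have adm: "admissible f" by (rule admissibleI[OF f_meas f_nonneg f_one])
  have pred: "(\<lambda>i. predict (ref_measure (u (r (q i)))) z) \<longlonglongrightarrow> predict (ref_measure f) z" for z
  proof (rule LIM_zero_cancel, rule Lim_null_comparison)
    have mi: "integrable ref_gaussian (\<lambda>x. \<Phi> z x * h x)" if h: "integrable ref_gaussian h" for h
    proof (rule Bochner_Integration.integrable_bound)
      show "integrable ref_gaussian (\<lambda>x. K * \<bar>h x\<bar>)" using h by simp
      show "AE x in ref_gaussian. norm (\<Phi> z x * h x) \<le> norm (K * \<bar>h x\<bar>)"
        using \<Phi>_bounded K_pos by (intro AE_I2) (simp add: abs_mult mult_right_mono)
    qed (use h in measurable)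
    show "\<forall>\<^sub>F i in sequentially. norm (predict (ref_measure (u (r (q i)))) z - predict (ref_measure f) z) \<le> K * (\<integral>x. \<bar>u (r (q i)) x - f x\<bar> \<partial>ref_gaussian)"
    proof (intro always_eventually allI)
      fix i
      have "predict (ref_measure (u (r (q i)))) z - predict (ref_measure f) z = (\<integral>x. \<Phi> z x * (u (r (q i)) x - f x) \<partial>ref_gaussian)"
        unfolding predict_ref_measure[OF u(1)] predict_ref_measure[OF adm]
        using mi[OF u_int(2)] mi[OF f_int] by (simp add: right_diff_distrib)
      also have "norm \<dots> \<le> (\<integral>x. K * \<bar>u (r (q i)) x - f x\<bar> \<partial>ref_gaussian)"
        using u_int(2) f_int \<Phi>_bounded by (intro norm_integral_le_integral) (auto simp: abs_mult intro!: mult_right_mono)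
      finally show "norm (predict (ref_measure (u (r (q i)))) z - predict (ref_measure f) z) \<le> K * (\<integral>x. \<bar>u (r (q i)) x - f x\<bar> \<partial>ref_gaussian)" by simp
    qed
    show "(\<lambda>i. K * (\<integral>x. \<bar>u (r (q i)) x - f x\<bar> \<partial>ref_gaussian)) \<longlonglongrightarrow> 0"
      using tendsto_mult_right_zero[OF LIMSEQ_subseq_LIMSEQ[OF l1_real q(1)]] by (simp add: comp_def)
  qed
  have fP2: "ref_measure f \<in> P2" using adm by (simp add: admissible_def)
  have [measurable]: "(\<lambda>p. loss (snd p) (predict (ref_measure (u n)) (fst p))) \<in> borel_measurable D" for n by (rule loss_predict_measurable[OF u_P2])
  have [measurable]: "(\<lambda>p. loss (snd p) (predict (ref_measure f) (fst p))) \<in> borel_measurable D" by (rule loss_predict_measurable[OF fP2])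
  have "(\<integral>\<^sup>+p. ennreal (loss (snd p) (predict (ref_measure f) (fst p))) + ennreal \<tau> * \<xi> \<partial>D) \<le> ennreal (jr + 0)"
  proof (rule nn_integral_le_of_AE_tendsto[OF _ _ _ c_lim, where u = "\<lambda>i p. ennreal (loss (snd p) (predict (ref_measure (u (r (q i)))) (fst p))) + ennreal \<tau> * y (q i)"])
    show "AE p in D. (\<lambda>i. ennreal (loss (snd p) (predict (ref_measure (u (r (q i)))) (fst p))) + ennreal \<tau> * y (q i))
      \<longlonglongrightarrow> ennreal (loss (snd p) (predict (ref_measure f) (fst p))) + ennreal \<tau> * \<xi>"
    proof (intro AE_I2 tendsto_add \<tau>y_lim tendsto_ennrealI)
      fix p
      show "(\<lambda>i. loss (snd p) (predict (ref_measure (u (r (q i)))) (fst p))) \<longlonglongrightarrow> loss (snd p) (predict (ref_measure f) (fst p))"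
        by (rule isCont_tendsto_compose[OF DERIV_isCont[OF loss_DERIV[OF loss]] pred])
    qed
    fix i
    have "(\<integral>\<^sup>+p. ennreal (loss (snd p) (predict (ref_measure (u (r (q i)))) (fst p))) + ennreal \<tau> * y (q i) \<partial>D)
      = ref_energy (u (r (q i)))"
      unfolding ref_energy_def y_def nn_integral_fit[OF u_P2, symmetric] by (simp add: nn_integral_add emeasure_space_1)
    then show "(\<integral>\<^sup>+p. ennreal (loss (snd p) (predict (ref_measure (u (r (q i)))) (fst p))) + ennreal \<tau> * y (q i) \<partial>D) \<le> ennreal (jr + 1 / real (Suc i))"
      using en_le by simp
  qed measurable
  then have "ennreal (fit (ref_measure f)) + ennreal \<tau> * \<xi> \<le> j"
    unfolding jr nn_integral_fit[OF fP2, symmetric] by (simp add: nn_integral_add emeasure_space_1)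
  moreover have "ref_energy f \<le> ennreal (fit (ref_measure f)) + ennreal \<tau> * \<xi>"
    unfolding ref_energy_def by (intro add_left_mono mult_left_mono ent_f) simp
  ultimately have "ref_energy f \<le> j" by (rule order_trans[rotated])
  then show ?thesis using adm j_le order_trans by blast
qed

lemma free_energy_minimizer:
  "\<exists>\<mu>\<in>P2a. \<forall>\<nu>\<in>P2a. free_energy \<tau> (risk D loss lam \<Phi>) \<mu> \<le> free_energy \<tau> (risk D loss lam \<Phi>) \<nu>"
proof -
  obtain f where f: "admissible f" "\<And>g. admissible g \<Longrightarrow> ref_energy f \<le> ref_energy g"
    using ref_energy_minimizer by blast
  have [measurable]: "f \<in> borel_measurable borel" using f by (simp add: admissible_def)
  have "ref_measure f = density lborel (\<lambda>x. ennreal (gauss (\<tau> / lam) x) * ennreal (f x))"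
    unfolding ref_measure_def ref_gaussian_def gaussian_def by (subst density_density_eq) auto
  then have "absolutely_continuous lborel (ref_measure f)"
    by (simp add: absolutely_continuousI_density)
  then have "ref_measure f \<in> P2a" using f(1) by (simp add: P2a_def admissible_def)
  moreover have "free_energy \<tau> (risk D loss lam \<Phi>) (ref_measure f) \<le> free_energy \<tau> (risk D loss lam \<Phi>) \<nu>" if \<nu>: "\<nu> \<in> P2a" for \<nu>
  proof -
    obtain g where g: "g \<in> borel_measurable borel" "\<And>x. 0 \<le> g x" "\<nu> = density (gaussian (\<tau> / lam)) (\<lambda>x. ennreal (g x))"
      using P2a_gaussian_density[OF \<nu> s_pos] by metis
    then have eq: "\<nu> = ref_measure g" by (simp add: ref_measure_def ref_gaussian_def)
    have adm: "admissible g" using g \<nu> unfolding admissible_def eq[symmetric] by (auto simp: P2a_def)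
    show ?thesis unfolding eq free_energy_ref_measure[OF f(1)] free_energy_ref_measure[OF adm]
      using f(2)[OF adm] by (intro add_right_mono) (simp add: less_eq_ennreal.rep_eq)
  qed
  ultimately show ?thesis by blast
qed

end

end

theorem proposition5p1:
  fixes D :: "((real ^ 'n) \<times> real) measure"
    and \<Phi> :: "real ^ 'n \<Rightarrow> real ^ 'd \<Rightarrow> real"
    and loss :: "real \<Rightarrow> real \<Rightarrow> real"
    and lam K :: real
  assumes "prob_space D" and "sets D = sets borel"
    and "lam > 0"
    and "continuous_on UNIV (\<lambda>(z, x). \<Phi> z x)"
    and "loss = square_loss \<or> loss = logistic_loss"
    and "K > 0" and bounded: "\<And>z x. \<bar>\<Phi> z x\<bar> \<le> K"
    and smooth: "\<exists>grad_\<Phi> C. \<forall>z. (\<forall>x. GDERIV (\<Phi> z) x :> grad_\<Phi> z x) \<and> C-lipschitz_on UNIV (grad_\<Phi> z)"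
    and real_valued: "\<And>\<mu>. \<mu> \<in> P2 \<Longrightarrow> integrable D (\<lambda>(z, y). loss y (\<integral>x. \<Phi> z x \<partial>\<mu>))"
  shows
    "((loss = logistic_loss \<longrightarrow> integrable D (\<lambda>(z, y). y\<^sup>2)) \<longrightarrow>
       (\<forall>\<mu>\<in>P2.
          (\<forall>x. integrable D (\<lambda>(z, y). deriv (loss y) (\<integral>x'. \<Phi> z x' \<partial>\<mu>) * \<Phi> z x)) \<and>
          first_variation_at (risk D loss lam \<Phi>) \<mu> (potential D loss lam \<Phi> \<mu>)) \<and>
       (\<exists>grad_V.
          (\<forall>\<mu>\<in>P2. (\<forall>x. GDERIV (potential D loss lam \<Phi> \<mu>) x :> grad_V \<mu> x) \<and>
             continuous_on UNIV (grad_V \<mu>)) \<and>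
          (\<exists>L>0. \<forall>\<mu>\<in>P2. \<forall>\<nu>\<in>P2. \<forall>x y.
             norm (grad_V \<mu> x - grad_V \<nu> y) \<le> L * (norm (x - y) + W2 \<mu> \<nu>))))
     \<and>
     ((\<forall>\<mu>\<in>P2. \<forall>\<nu>\<in>P2. \<forall>\<alpha>\<in>{0..1}.
          risk D loss lam \<Phi> (lin_comb \<alpha> \<mu> (1 - \<alpha>) \<nu>)
            \<le> \<alpha> * risk D loss lam \<Phi> \<mu> + (1 - \<alpha>) * risk D loss lam \<Phi> \<nu>) \<and>
      (\<forall>\<tau>>0. \<exists>\<mu>\<in>P2a. \<forall>\<nu>\<in>P2a.
          free_energy \<tau> (risk D loss lam \<Phi>) \<mu> \<le> free_energy \<tau> (risk D loss lam \<Phi>) \<nu>))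
     \<and>
     (\<forall>\<tau>>0.
       (loss = logistic_loss \<and> (AE (z, y) in D. \<bar>y\<bar> \<le> 1) \<longrightarrow>
          (\<exists>\<rho>>0. \<rho> \<ge> lam / \<tau> * exp (- 2 * K / \<tau>) \<and>
             (\<forall>\<mu>\<in>P2. integrable lborel (\<lambda>x. exp (- potential D loss lam \<Phi> \<mu> x / \<tau>)) \<and>
                LSI \<rho> (gibbs (\<lambda>x. potential D loss lam \<Phi> \<mu> x / \<tau>))))) \<and>
       (\<forall>K'. loss = square_loss \<and> (AE p in D. \<bar>cond_exp_label D p\<bar> \<le> K') \<longrightarrow>
          (\<exists>\<rho>>0. \<rho> \<ge> lam / \<tau> * exp (- 2 * K * (K + K') / \<tau>) \<and>
             (\<forall>\<mu>\<in>P2. integrable lborel (\<lambda>x. exp (- potential D loss lam \<Phi> \<mu> x / \<tau>)) \<and>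
                LSI \<rho> (gibbs (\<lambda>x. potential D loss lam \<Phi> \<mu> x / \<tau>))))))"
proof -
  obtain grad C where grad: "\<And>z x. GDERIV (\<Phi> z) x :> grad z x" "\<And>z. C-lipschitz_on UNIV (grad z)"
    using smooth by auto
  interpret mean_field_risk D \<Phi> loss lam K C grad
    by (intro mean_field_risk.intro mean_field_risk_axioms.intro) (fact assms grad)+
  have L2: "mean_field_risk_L2 D \<Phi> loss lam K C grad" if "integrable D (\<lambda>p. (snd p)\<^sup>2)"
    by (intro mean_field_risk_L2.intro mean_field_risk_L2_axioms.intro mean_field_risk_axioms that)
  have first: "(\<forall>\<mu>\<in>P2.
          (\<forall>x. integrable D (\<lambda>(z, y). deriv (loss y) (\<integral>x'. \<Phi> z x' \<partial>\<mu>) * \<Phi> z x)) \<and>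
          first_variation_at (risk D loss lam \<Phi>) \<mu> (potential D loss lam \<Phi> \<mu>)) \<and>
       (\<exists>grad_V.
          (\<forall>\<mu>\<in>P2. (\<forall>x. GDERIV (potential D loss lam \<Phi> \<mu>) x :> grad_V \<mu> x) \<and>
             continuous_on UNIV (grad_V \<mu>)) \<and>
          (\<exists>L>0. \<forall>\<mu>\<in>P2. \<forall>\<nu>\<in>P2. \<forall>x y.
             norm (grad_V \<mu> x - grad_V \<nu> y) \<le> L * (norm (x - y) + W2 \<mu> \<nu>)))"
    if sq: "loss = logistic_loss \<longrightarrow> integrable D (\<lambda>(z, y). y\<^sup>2)"
  proof -
    have "integrable D (\<lambda>p. (snd p)\<^sup>2)"
      using sq square_loss_label_square_integrable assms(5) by (auto simp: split_beta')
    then interpret mean_field_risk_L2 D \<Phi> loss lam K C grad by (rule L2)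
    have "integrable D (\<lambda>(z, y). deriv (loss y) (\<integral>x'. \<Phi> z x' \<partial>\<mu>) * \<Phi> z x)" if "\<mu> \<in> P2" for \<mu> x
      using weight_\<Phi>_integrable[OF that, of x] by (simp add: weight_def predict_def split_beta')
    then show ?thesis
      using first_variation_risk GDERIV_potential potential_grad_continuous potential_grad_lipschitz
      by (intro conjI exI[of _ potential_grad]) auto
  qed
  have logistic: "\<exists>\<rho>>0. \<rho> \<ge> lam / \<tau> * exp (- 2 * K / \<tau>) \<and>
             (\<forall>\<mu>\<in>P2. integrable lborel (\<lambda>x. exp (- potential D loss lam \<Phi> \<mu> x / \<tau>)) \<and>
                LSI \<rho> (gibbs (\<lambda>x. potential D loss lam \<Phi> \<mu> x / \<tau>)))"
    if \<tau>: "0 < \<tau>" and l: "loss = logistic_loss" and y: "AE (z, y) in D. \<bar>y\<bar> \<le> 1" for \<tau>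
  proof -
    have y': "AE p in D. \<bar>snd p\<bar> \<le> 1" using y by (simp add: split_beta')
    have "integrable D (\<lambda>p. (snd p)\<^sup>2)"
    proof (rule integrable_const_bound[where B = 1])
      show "AE p in D. norm ((snd p)\<^sup>2) \<le> 1"
        using y' by eventually_elim (simp add: abs_square_le_1)
    qed measurable
    then interpret mean_field_risk_L2 D \<Phi> loss lam K C grad by (rule L2)
    have "AE p in D. \<bar>weight \<mu> p\<bar> \<le> 1" for \<mu>
      using y'
    proof eventually_elim
      case (elim p)
      have "\<bar>weight \<mu> p\<bar> \<le> \<bar>snd p\<bar>"
        unfolding weight_def by (subst l) (rule abs_deriv_logistic_loss_le)
      then show ?case using elim by simp
    qed
    then show ?thesis
      using lam_pos \<tau> potential_fit_le_of_weight LSI_gibbs_potential[OF _ \<tau>, of _ K]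
      by (intro exI[of _ "lam / \<tau> * exp (- 2 * K / \<tau>)"]) auto
  qed
  have square: "\<exists>\<rho>>0. \<rho> \<ge> lam / \<tau> * exp (- 2 * K * (K + K') / \<tau>) \<and>
             (\<forall>\<mu>\<in>P2. integrable lborel (\<lambda>x. exp (- potential D loss lam \<Phi> \<mu> x / \<tau>)) \<and>
                LSI \<rho> (gibbs (\<lambda>x. potential D loss lam \<Phi> \<mu> x / \<tau>)))"
    if \<tau>: "0 < \<tau>" and l: "loss = square_loss" and y: "AE p in D. \<bar>cond_exp_label D p\<bar> \<le> K'" for \<tau> K'
  proof -
    interpret mean_field_risk_L2 D \<Phi> loss lam K C grad
      using square_loss_label_square_integrable[OF l] by (rule L2)
    have "- 2 * K * (K + K') / \<tau> = - 2 * (K * (K + K')) / \<tau>" by simp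
    then show ?thesis
      using lam_pos \<tau> potential_fit_square_le[OF _ l y] LSI_gibbs_potential[OF _ \<tau>, of _ "K * (K + K')"]
      by (intro exI[of _ "lam / \<tau> * exp (- 2 * K * (K + K') / \<tau>)"]) (auto simp only: mult_pos_pos divide_pos_pos exp_gt_zero order_refl)
  qed
  show ?thesis
    using first risk_convex free_energy_minimizer logistic square
    by (intro conjI allI impI ballI) auto
qed

end
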